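(* Let $G$ be an abelian group, let $k$ be a commutative $G$-ring, let $\delta\in k$, and let $n$ be an odd positive integer. Let $G\mathcal{TL}_n(\delta)$ be the $G$-Temperley-Lieb algebra over $k$. There is an isomorphism of graded $k$-modules $$\mathrm{Tor}_{\star}^{G\mathcal{TL}_n(\delta)}(\mathbf{1},\mathbf{1})\cong \mathrm{Tor}_{\star}^{k[G^n]}(\mathbf{1},\mathbf{1}).$$
   Context: A commutative $G$-ring is a unital commutative ring $k$ together with a group homomorphism $G\to\mathrm{Aut}(k)$ to the group of ring automorphisms; the action of $g\in G$ on $\lambda\in k$ is written $g\lambda$. A $G$-Temperley-Lieb $n$-diagram is a graph on two columns (left and right) of $n$ nodes in which each node is connected to exactly one other node by an edge (left-to-left, right-to-right and left-to-right edges are all allowed), which is planar (edges can be drawn between the two columns without crossings), and in which each edge is labelled by an element of $G$. The $G$-Temperley-Lieb algebra $G\mathcal{TL}_n(\delta)$ consists of formal $k$-linear combinations of $G$-Temperley-Lieb $n$-diagrams. The product $x\cdot y$ of two diagrams is the $k$-bilinear extension of: identify the right-hand nodes of $x$ with the left-hand nodes of $y$, forget the middle nodes, label each edge formed by concatenation with the product of the group elements along it, and replace each closed loop formed in the middle by a factor $g\delta\in k$, where $g\in G$ is the product of all the labels on the loop. The trivial module $\mathbf{1}$ of $G\mathcal{TL}_n(\delta)$ is a copy of $k$ (as a left and as a right module) on which diagrams with no left-to-left and no right-to-right connections act as $1$ and all other diagrams act as $0$. For the (untwisted) group algebra $k[G^n]$, $\mathbf{1}$ is $k$ with every group element acting as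 $1$. *)

theory Defs
  imports "HOL-Algebra.Module" "HOL-Algebra.QuotRing" "HOL-Algebra.Product_Groups"
begin

section \<open>Modules\<close>

text \<open>Modules over a ring that need not be commutative, as records of type
  \<^typ>\<open>('a, 'm) module\<close>; the fields \<^const>\<open>monoid.mult\<close> and \<^const>\<open>one\<close> of the module record play no role.
  For a right module \<open>M\<close> the term \<open>a \<odot>\<^bsub>M\<^esub> x\<close> stands for the product of \<open>x\<close> by \<open>a\<close> on the right.\<close>

definition free_module :: "('k, 'r) ring_scheme \<Rightarrow> 'x set \<Rightarrow> ('k, 'x \<Rightarrow> 'k) module" where
  "free_module R B = \<lparr>
     carrier = {f. finite {x. f x \<noteq> \<zero>\<^bsub>R\<^esub>} \<and> (\<forall>x. f x \<in> carrier R) \<and> (\<forall>x. x \<notin> B \<longrightarrow> f x = \<zero>\<^bsub>R\<^esub>)},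
     monoid.mult = undefined, one = undefined,
     ring.zero = (\<lambda>_. \<zero>\<^bsub>R\<^esub>),
     add = (\<lambda>f g x. f x \<oplus>\<^bsub>R\<^esub> g x),
     smult = (\<lambda>a f x. a \<otimes>\<^bsub>R\<^esub> f x)\<rparr>"

definition free_right_module :: "('a, 'r) ring_scheme \<Rightarrow> 'x set \<Rightarrow> ('a, 'x \<Rightarrow> 'a) module" where
  "free_right_module R B = (free_module R B)\<lparr>smult := (\<lambda>a f x. f x \<otimes>\<^bsub>R\<^esub> a)\<rparr>"

definition basis_vec :: "('k, 'r) ring_scheme \<Rightarrow> 'x \<Rightarrow> 'x \<Rightarrow> 'k" where
  "basis_vec R x = (\<lambda>y. if y = x then \<one>\<^bsub>R\<^esub> else \<zero>\<^bsub>R\<^esub>)"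

definition generated_submodule ::
  "('k, 'r) ring_scheme \<Rightarrow> ('k, 'm) module \<Rightarrow> 'm set \<Rightarrow> 'm set" where
  "generated_submodule k M S = \<Inter>{H. submodule H k M \<and> S \<subseteq> H}"

definition quotient_module :: "('k, 'm) module \<Rightarrow> 'm set \<Rightarrow> ('k, 'm set) module" where
  "quotient_module M H = \<lparr>
     carrier = a_rcosets\<^bsub>M\<^esub> H,
     monoid.mult = undefined, one = undefined,
     ring.zero = H,
     add = set_add M,
     smult = (\<lambda>a C. \<Union>x\<in>C. H +>\<^bsub>M\<^esub> (a \<odot>\<^bsub>M\<^esub> x))\<rparr>"

definition module_iso ::
  "('k, 'r) ring_scheme \<Rightarrow> ('k, 'm) module \<Rightarrow> ('k, 'n) module \<Rightarrow> ('m \<Rightarrow> 'n) set" where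
  "module_iso k M N = {h. bij_betw h (carrier M) (carrier N)
     \<and> (\<forall>x\<in>carrier M. \<forall>y\<in>carrier M. h (x \<oplus>\<^bsub>M\<^esub> y) = h x \<oplus>\<^bsub>N\<^esub> h y)
     \<and> (\<forall>a\<in>carrier k. \<forall>x\<in>carrier M. h (a \<odot>\<^bsub>M\<^esub> x) = a \<odot>\<^bsub>N\<^esub> h x)}"


section \<open>Tensor products over an algebra\<close>

text \<open>A \<open>k\<close>-algebra \<open>A\<close> is also a record of type \<^typ>\<open>('k, 'a) module\<close>, now with \<^const>\<open>monoid.mult\<close> and
  \<^const>\<open>one\<close>.  A right \<open>A\<close>-module \<open>M\<close> is a \<open>k\<close>-module through \<open>c \<mapsto> c \<odot>\<^bsub>A\<^esub> \<one>\<^bsub>A\<^esub>\<close>, and the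
  tensor product over \<open>A\<close> of \<open>M\<close> with a left \<open>A\<close>-module \<open>N\<close> is the \<open>k\<close>-module with a
  generator for each pair \<open>(x, y)\<close> and the following relations.\<close>

definition tensor_relations ::
  "('k, 'r) ring_scheme \<Rightarrow> ('k, 'a) module \<Rightarrow> ('a, 'm) module \<Rightarrow> ('a, 'n) module \<Rightarrow>
   ('m \<times> 'n \<Rightarrow> 'k) set" where
  "tensor_relations k A M N =
     (let F = free_module k (carrier M \<times> carrier N); e = basis_vec k in
       {e (x \<oplus>\<^bsub>M\<^esub> x', y) \<ominus>\<^bsub>F\<^esub> (e (x, y) \<oplus>\<^bsub>F\<^esub> e (x', y)) | x x' y.
          x \<in> carrier M \<and> x' \<in> carrier M \<and> y \<in> carrier N}
     \<union> {e (x, y \<oplus>\<^bsub>N\<^esub> y') \<ominus>\<^bsub>F\<^esub> (e (x, y) \<oplus>\<^bsub>F\<^esub> e (x, y')) | x y y'.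
          x \<in> carrier M \<and> y \<in> carrier N \<and> y' \<in> carrier N}
     \<union> {e (a \<odot>\<^bsub>M\<^esub> x, y) \<ominus>\<^bsub>F\<^esub> e (x, a \<odot>\<^bsub>N\<^esub> y) | a x y.
          a \<in> carrier A \<and> x \<in> carrier M \<and> y \<in> carrier N}
     \<union> {e ((c \<odot>\<^bsub>A\<^esub> \<one>\<^bsub>A\<^esub>) \<odot>\<^bsub>M\<^esub> x, y) \<ominus>\<^bsub>F\<^esub> (c \<odot>\<^bsub>F\<^esub> e (x, y)) | c x y.
          c \<in> carrier k \<and> x \<in> carrier M \<and> y \<in> carrier N})"

definition tensor_kernel ::
  "('k, 'r) ring_scheme \<Rightarrow> ('k, 'a) module \<Rightarrow> ('a, 'm) module \<Rightarrow> ('a, 'n) module \<Rightarrow>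
   ('m \<times> 'n \<Rightarrow> 'k) set" where
  "tensor_kernel k A M N =
     generated_submodule k (free_module k (carrier M \<times> carrier N)) (tensor_relations k A M N)"

definition tensor_product ::
  "('k, 'r) ring_scheme \<Rightarrow> ('k, 'a) module \<Rightarrow> ('a, 'm) module \<Rightarrow> ('a, 'n) module \<Rightarrow>
   ('k, ('m \<times> 'n \<Rightarrow> 'k) set) module" where
  "tensor_product k A M N =
     quotient_module (free_module k (carrier M \<times> carrier N)) (tensor_kernel k A M N)"

text \<open>For \<open>h : M \<rightarrow> M'\<close> the induced map \<open>h \<otimes> id\<close> on tensor products with \<open>N\<close>: it sends the coset
  of \<open>f = \<Sum> f(x,y) (x,y)\<close> to that of \<open>\<Sum> f(x,y) (h x,y)\<close>.\<close>

definition tensor_map ::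
  "('k, 'r) ring_scheme \<Rightarrow> ('k, 'a) module \<Rightarrow> ('a, 'm') module \<Rightarrow> ('a, 'n) module \<Rightarrow>
   ('m \<Rightarrow> 'm') \<Rightarrow> ('m \<times> 'n \<Rightarrow> 'k) set \<Rightarrow> ('m' \<times> 'n \<Rightarrow> 'k) set" where
  "tensor_map k A M' N h C =
     (\<Union>f\<in>C. tensor_kernel k A M' N +>\<^bsub>free_module k (carrier M' \<times> carrier N)\<^esub>
       (\<lambda>(x', y). \<Oplus>\<^bsub>k\<^esub>x\<in>{x. f (x, y) \<noteq> \<zero>\<^bsub>k\<^esub> \<and> h x = x'}. f (x, y)))"


section \<open>Homology and Tor\<close>

text \<open>Homology of a chain complex \<open>C\<close> with differentials \<open>d i : C (i + 1) \<rightarrow> C i\<close>.\<close>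

fun homology ::
  "(nat \<Rightarrow> ('k, 'm) module) \<Rightarrow> (nat \<Rightarrow> 'm \<Rightarrow> 'm) \<Rightarrow> nat \<Rightarrow> ('k, 'm set) module" where
  "homology C d 0 = quotient_module (C 0) (d 0 ` carrier (C 1))"
| "homology C d (Suc i) =
     quotient_module ((C (Suc i))\<lparr>carrier := a_kernel (C (Suc i)) (C i) (d i)\<rparr>)
       (d (Suc i) ` carrier (C (Suc (Suc i))))"

text \<open>The standard resolution of a right \<open>A\<close>-module \<open>M\<close> by free modules:
  the module in degree \<open>0\<close> is free on the elements of \<open>M\<close>, and the module in degree \<open>i + 1\<close> is
  free on names for the elements of the kernel of the map leaving degree \<open>i\<close>.
  Here \<open>Elt x\<close> names the element \<open>x\<close> of \<open>M\<close>, and \<open>Syz l\<close> names the finitely supported function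
  with association list \<open>l\<close>, so that generators of all degrees have the same type.\<close>

datatype ('a, 'm) gen = Elt (elt: 'm) | Syz (syz: "(('a, 'm) gen \<times> 'a) list")

definition syz_fun :: "('a, 'r) ring_scheme \<Rightarrow> ('a, 'm) gen \<Rightarrow> ('a, 'm) gen \<Rightarrow> 'a" where
  "syz_fun A x = (\<lambda>y. case map_of (syz x) y of None \<Rightarrow> \<zero>\<^bsub>A\<^esub> | Some a \<Rightarrow> a)"

definition std_aug ::
  "('a, 'r) ring_scheme \<Rightarrow> ('a, 'm) module \<Rightarrow> (('a, 'm) gen \<Rightarrow> 'a) \<Rightarrow> 'm" where
  "std_aug A M f = (\<Oplus>\<^bsub>M\<^esub>x\<in>{x. f x \<noteq> \<zero>\<^bsub>A\<^esub>}. f x \<odot>\<^bsub>M\<^esub> elt x)"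

definition std_diff ::
  "('a, 'r) ring_scheme \<Rightarrow> (('a, 'm) gen \<Rightarrow> 'a) \<Rightarrow> (('a, 'm) gen \<Rightarrow> 'a)" where
  "std_diff A f = (\<lambda>y. \<Oplus>\<^bsub>A\<^esub>x\<in>{x. f x \<noteq> \<zero>\<^bsub>A\<^esub>}. syz_fun A x y \<otimes>\<^bsub>A\<^esub> f x)"

primrec std_gens ::
  "('a, 'r) ring_scheme \<Rightarrow> ('a, 'm) module \<Rightarrow> nat \<Rightarrow> ('a, 'm) gen set" where
  "std_gens A M 0 = Elt ` carrier M"
| "std_gens A M (Suc i) = {Syz l | l.
     syz_fun A (Syz l) \<in> carrier (free_right_module A (std_gens A M i)) \<and>
     (case i of
        0 \<Rightarrow> std_aug A M (syz_fun A (Syz l)) = \<zero>\<^bsub>M\<^esub>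
      | Suc _ \<Rightarrow> std_diff A (syz_fun A (Syz l)) = (\<lambda>_. \<zero>\<^bsub>A\<^esub>))}"

definition std_res ::
  "('a, 'r) ring_scheme \<Rightarrow> ('a, 'm) module \<Rightarrow> nat \<Rightarrow> ('a, ('a, 'm) gen \<Rightarrow> 'a) module" where
  "std_res A M i = free_right_module A (std_gens A M i)"

definition Tor ::
  "('k, 'r) ring_scheme \<Rightarrow> ('k, 'a) module \<Rightarrow> ('a, 'm) module \<Rightarrow> ('a, 'n) module \<Rightarrow> nat \<Rightarrow>
   ('k, ((('a, 'm) gen \<Rightarrow> 'a) \<times> 'n \<Rightarrow> 'k) set set) module" where
  "Tor k A M N =
     homology (\<lambda>i. tensor_product k A (std_res A M i) N)
       (\<lambda>i. tensor_map k A (std_res A M i) N (std_diff A))"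


section \<open>Algebras with a basis\<close>

text \<open>The \<open>k\<close>-algebra with basis \<open>B\<close>, unit \<open>u \<in> B\<close> and product \<open>b \<cdot> b' = c(b,b') (b * b')\<close>
  for \<open>b, b' \<in> B\<close>.\<close>

definition based_algebra ::
  "('k, 'r) ring_scheme \<Rightarrow> 'b set \<Rightarrow> ('b \<Rightarrow> 'b \<Rightarrow> 'b) \<Rightarrow> ('b \<Rightarrow> 'b \<Rightarrow> 'k) \<Rightarrow> 'b \<Rightarrow>
   ('k, 'b \<Rightarrow> 'k) module" where
  "based_algebra k B mul c u = (free_module k B)\<lparr>
     monoid.mult := (\<lambda>f g b. \<Oplus>\<^bsub>k\<^esub>p\<in>{p. f (fst p) \<noteq> \<zero>\<^bsub>k\<^esub> \<and> g (snd p) \<noteq> \<zero>\<^bsub>k\<^esub> \<and> mul (fst p) (snd p) = b}.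
                f (fst p) \<otimes>\<^bsub>k\<^esub> g (snd p) \<otimes>\<^bsub>k\<^esub> c (fst p) (snd p)),
     one := basis_vec k u\<rparr>"

text \<open>The module \<open>k\<close> on which the basis elements in \<open>S\<close> act as \<open>1\<close> and all others as \<open>0\<close>; as \<open>k\<close> is
  commutative, the record serves as a left and as a right module.\<close>

definition trivial_module :: "('k, 'r) ring_scheme \<Rightarrow> 'b set \<Rightarrow> ('b \<Rightarrow> 'k, 'k) module" where
  "trivial_module k S = \<lparr>
     carrier = carrier k, monoid.mult = monoid.mult k, one = \<one>\<^bsub>k\<^esub>, ring.zero = \<zero>\<^bsub>k\<^esub>, add = add k,
     smult = (\<lambda>f x. (\<Oplus>\<^bsub>k\<^esub>b\<in>{b\<in>S. f b \<noteq> \<zero>\<^bsub>k\<^esub>}. f b) \<otimes>\<^bsub>k\<^esub> x)\<rparr>"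

definition group_algebra ::
  "('k, 'r) ring_scheme \<Rightarrow> ('h, 's) monoid_scheme \<Rightarrow> ('k, 'h \<Rightarrow> 'k) module" where
  "group_algebra k H = based_algebra k (carrier H) (monoid.mult H) (\<lambda>_ _. \<one>\<^bsub>k\<^esub>) \<one>\<^bsub>H\<^esub>"

definition group_power :: "('g, 's) monoid_scheme \<Rightarrow> nat \<Rightarrow> (nat \<Rightarrow> 'g) monoid" where
  "group_power G n = product_group {..<n} (\<lambda>_. G)"


section \<open>Temperley-Lieb diagrams with labels in a group\<close>

definition commutative_G_ring ::
  "('g, 's) monoid_scheme \<Rightarrow> ('k, 'r) ring_scheme \<Rightarrow> ('g \<Rightarrow> 'k \<Rightarrow> 'k) \<Rightarrow> bool" where
  "commutative_G_ring G k act \<longleftrightarrow>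
     cring k \<and> (\<forall>g\<in>carrier G. act g \<in> ring_iso k k) \<and>
     (\<forall>x\<in>carrier k. act \<one>\<^bsub>G\<^esub> x = x) \<and>
     (\<forall>g\<in>carrier G. \<forall>h\<in>carrier G. \<forall>x\<in>carrier k. act (g \<otimes>\<^bsub>G\<^esub> h) x = act g (act h x))"

text \<open>The node \<open>(c, i)\<close> is the one at height \<open>i\<close> in column \<open>c\<close>.  A diagram has columns \<open>0\<close> (left) and
  \<open>1\<close> (right), and is given by its set of labelled edges \<open>({u, v}, g)\<close>.\<close>

type_synonym node = "nat \<times> nat"
type_synonym 'g diagram = "(node set \<times> 'g) set"

definition nodes :: "nat \<Rightarrow> node set" where
  "nodes n = {0, 1} \<times> {..<n}"

text \<open>All edges lie between the two columns, so planarity means that no two edges have interleaved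
  end points in the order in which the nodes occur on the boundary of this strip: along the left
  column and back along the right one.\<close>

definition boundary_pos :: "nat \<Rightarrow> node \<Rightarrow> nat" where
  "boundary_pos n v = (if fst v = 0 then snd v else 2 * n - 1 - snd v)"

definition planar :: "nat \<Rightarrow> node set set \<Rightarrow> bool" where
  "planar n E \<longleftrightarrow> \<not> (\<exists>a b c d. {a, b} \<in> E \<and> {c, d} \<in> E \<and>
     boundary_pos n a < boundary_pos n c \<and> boundary_pos n c < boundary_pos n b \<and>
     boundary_pos n b < boundary_pos n d)"

definition diagrams :: "('g, 's) monoid_scheme \<Rightarrow> nat \<Rightarrow> 'g diagram set" where
  "diagrams G n = {x.
     (\<forall>(e, g)\<in>x. e \<subseteq> nodes n \<and> card e = 2 \<and> g \<in> carrier G) \<and>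
     (\<forall>v\<in>nodes n. \<exists>!p. p \<in> x \<and> v \<in> fst p) \<and>
     planar n (fst ` x)}"

text \<open>To multiply \<open>x\<close> and \<open>y\<close>, place \<open>y\<close> in columns \<open>1\<close> and \<open>2\<close>.  The connected components of the
  resulting graph on three columns are paths between nodes of the outer columns, and closed loops
  in column \<open>1\<close>.\<close>

definition shift :: "node \<Rightarrow> node" where
  "shift v = (fst v + 1, snd v)"

definition glued_edges :: "'g diagram \<Rightarrow> 'g diagram \<Rightarrow> node set set" where
  "glued_edges x y = fst ` x \<union> (\<lambda>p. shift ` fst p) ` y"

definition components :: "nat \<Rightarrow> 'g diagram \<Rightarrow> 'g diagram \<Rightarrow> node set set" where
  "components n x y = ({0, 1, 2} \<times> {..<n}) // {(u, v). \<exists>e\<in>glued_edges x y. u \<in> e \<and> v \<in> e}\<^sup>*"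

text \<open>The product of all labels in the component \<open>C\<close>; the order is irrelevant as \<open>G\<close> is abelian.\<close>

definition component_label ::
  "('g, 's) monoid_scheme \<Rightarrow> 'g diagram \<Rightarrow> 'g diagram \<Rightarrow> node set \<Rightarrow> 'g" where
  "component_label G x y C =
     (\<Otimes>\<^bsub>G\<^esub>p\<in>{p\<in>x. fst p \<subseteq> C}. snd p) \<otimes>\<^bsub>G\<^esub> (\<Otimes>\<^bsub>G\<^esub>p\<in>{p\<in>y. shift ` fst p \<subseteq> C}. snd p)"

definition loops :: "nat \<Rightarrow> 'g diagram \<Rightarrow> 'g diagram \<Rightarrow> node set set" where
  "loops n x y = {C \<in> components n x y. C \<subseteq> {1} \<times> {..<n}}"

definition outer_nodes :: "node set \<Rightarrow> node set" where
  "outer_nodes C = {(0, i) | i. (0, i) \<in> C} \<union> {(1, i) | i. (2, i) \<in> C}"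

definition compose_diagrams ::
  "('g, 's) monoid_scheme \<Rightarrow> nat \<Rightarrow> 'g diagram \<Rightarrow> 'g diagram \<Rightarrow> 'g diagram" where
  "compose_diagrams G n x y =
     (\<lambda>C. (outer_nodes C, component_label G x y C)) ` (components n x y - loops n x y)"

definition loop_factor ::
  "('g, 's) monoid_scheme \<Rightarrow> ('k, 'r) ring_scheme \<Rightarrow> ('g \<Rightarrow> 'k \<Rightarrow> 'k) \<Rightarrow> 'k \<Rightarrow> nat \<Rightarrow>
   'g diagram \<Rightarrow> 'g diagram \<Rightarrow> 'k" where
  "loop_factor G k act \<delta> n x y = (\<Otimes>\<^bsub>k\<^esub>C\<in>loops n x y. act (component_label G x y C) \<delta>)"

definition identity_diagram :: "('g, 's) monoid_scheme \<Rightarrow> nat \<Rightarrow> 'g diagram" where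
  "identity_diagram G n = (\<lambda>i. ({(0, i), (1, i)}, \<one>\<^bsub>G\<^esub>)) ` {..<n}"

definition TL_algebra ::
  "('g, 's) monoid_scheme \<Rightarrow> ('k, 'r) ring_scheme \<Rightarrow> ('g \<Rightarrow> 'k \<Rightarrow> 'k) \<Rightarrow> 'k \<Rightarrow> nat \<Rightarrow>
   ('k, 'g diagram \<Rightarrow> 'k) module" where
  "TL_algebra G k act \<delta> n =
     based_algebra k (diagrams G n) (compose_diagrams G n) (loop_factor G k act \<delta> n)
       (identity_diagram G n)"

definition through_diagrams :: "('g, 's) monoid_scheme \<Rightarrow> nat \<Rightarrow> 'g diagram set" where
  "through_diagrams G n = {x \<in> diagrams G n. \<forall>p\<in>x. fst ` fst p = {0, 1}}"

definition TL_trivial ::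
  "('g, 's) monoid_scheme \<Rightarrow> ('k, 'r) ring_scheme \<Rightarrow> nat \<Rightarrow> ('g diagram \<Rightarrow> 'k, 'k) module" where
  "TL_trivial G k n = trivial_module k (through_diagrams G n)"

definition group_trivial ::
  "('k, 'r) ring_scheme \<Rightarrow> ('h, 's) monoid_scheme \<Rightarrow> ('h \<Rightarrow> 'k, 'k) module" where
  "group_trivial k H = trivial_module k (carrier H)"


section \<open>Exactness of the standard resolution\<close>

locale right_module = R?: ring A + M?: abelian_group M
  for A :: "('a, 'r) ring_scheme" (structure) and M :: "('a, 'm) module" (structure) +
  assumes smult_closed [simp, intro]:
      "\<lbrakk>a \<in> carrier A; x \<in> carrier M\<rbrakk> \<Longrightarrow> a \<odot>\<^bsub>M\<^esub> x \<in> carrier M"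
    and smult_l_distr:
      "\<lbrakk>a \<in> carrier A; b \<in> carrier A; x \<in> carrier M\<rbrakk> \<Longrightarrow>
       (a \<oplus>\<^bsub>A\<^esub> b) \<odot>\<^bsub>M\<^esub> x = a \<odot>\<^bsub>M\<^esub> x \<oplus>\<^bsub>M\<^esub> b \<odot>\<^bsub>M\<^esub> x"
    and smult_r_distr:
      "\<lbrakk>a \<in> carrier A; x \<in> carrier M; y \<in> carrier M\<rbrakk> \<Longrightarrow>
       a \<odot>\<^bsub>M\<^esub> (x \<oplus>\<^bsub>M\<^esub> y) = a \<odot>\<^bsub>M\<^esub> x \<oplus>\<^bsub>M\<^esub> a \<odot>\<^bsub>M\<^esub> y"
    and smult_assoc:
      "\<lbrakk>a \<in> carrier A; b \<in> carrier A; x \<in> carrier M\<rbrakk> \<Longrightarrow>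
       (a \<otimes>\<^bsub>A\<^esub> b) \<odot>\<^bsub>M\<^esub> x = b \<odot>\<^bsub>M\<^esub> (a \<odot>\<^bsub>M\<^esub> x)"
    and smult_one [simp]: "x \<in> carrier M \<Longrightarrow> \<one>\<^bsub>A\<^esub> \<odot>\<^bsub>M\<^esub> x = x"
begin

lemma smult_l_null [simp]:
  assumes "x \<in> carrier M" shows "\<zero>\<^bsub>A\<^esub> \<odot>\<^bsub>M\<^esub> x = \<zero>\<^bsub>M\<^esub>"
proof -
  have "\<zero>\<^bsub>A\<^esub> \<odot>\<^bsub>M\<^esub> x \<oplus>\<^bsub>M\<^esub> \<zero>\<^bsub>A\<^esub> \<odot>\<^bsub>M\<^esub> x = \<zero>\<^bsub>A\<^esub> \<odot>\<^bsub>M\<^esub> x"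
    using smult_l_distr[of "\<zero>\<^bsub>A\<^esub>" "\<zero>\<^bsub>A\<^esub>" x] assms by simp
  thus ?thesis using assms by (metis M.add.r_cancel_one' R.zero_closed smult_closed)
qed

lemma smult_r_null [simp]:
  assumes "a \<in> carrier A" shows "a \<odot>\<^bsub>M\<^esub> \<zero>\<^bsub>M\<^esub> = \<zero>\<^bsub>M\<^esub>"
proof -
  have "a \<odot>\<^bsub>M\<^esub> \<zero>\<^bsub>M\<^esub> \<oplus>\<^bsub>M\<^esub> a \<odot>\<^bsub>M\<^esub> \<zero>\<^bsub>M\<^esub> = a \<odot>\<^bsub>M\<^esub> \<zero>\<^bsub>M\<^esub>"
    using smult_r_distr[of a "\<zero>\<^bsub>M\<^esub>" "\<zero>\<^bsub>M\<^esub>"] assms by simp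
  thus ?thesis using assms by (metis M.add.r_cancel_one' M.zero_closed smult_closed)
qed

lemma smult_finsum_right:
  assumes "finite S" "\<And>i. i \<in> S \<Longrightarrow> e i \<in> carrier M" "a \<in> carrier A"
  shows "a \<odot>\<^bsub>M\<^esub> (\<Oplus>\<^bsub>M\<^esub>i\<in>S. e i) = (\<Oplus>\<^bsub>M\<^esub>i\<in>S. a \<odot>\<^bsub>M\<^esub> e i)"
  using assms
proof (induction S rule: finite_induct)
  case empty thus ?case by simp
next
  case (insert i S)
  thus ?case by (simp add: smult_r_distr Pi_def)
qed

lemma smult_finsum_left:
  assumes "finite S" "\<And>i. i \<in> S \<Longrightarrow> c i \<in> carrier A" "x \<in> carrier M"
  shows "(\<Oplus>\<^bsub>A\<^esub>i\<in>S. c i) \<odot>\<^bsub>M\<^esub> x = (\<Oplus>\<^bsub>M\<^esub>i\<in>S. c i \<odot>\<^bsub>M\<^esub> x)"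
  using assms
proof (induction S rule: finite_induct)
  case empty thus ?case by simp
next
  case (insert i S)
  thus ?case by (simp add: smult_l_distr Pi_def)
qed

lemma finsum_eval_superset:
  assumes "finite T" "{x. f x \<noteq> \<zero>\<^bsub>A\<^esub>} \<subseteq> T" "\<And>x. f x \<in> carrier A"
    "\<And>x. x \<in> T \<Longrightarrow> e x \<in> carrier M"
  shows "(\<Oplus>\<^bsub>M\<^esub>x\<in>{x. f x \<noteq> \<zero>\<^bsub>A\<^esub>}. f x \<odot>\<^bsub>M\<^esub> e x) = (\<Oplus>\<^bsub>M\<^esub>x\<in>T. f x \<odot>\<^bsub>M\<^esub> e x)"
  using assms by (intro M.add.finprod_mono_neutral_cong_left) (auto simp: Pi_def)

lemma finsum_swap:
  assumes "finite S" "finite T" "\<And>x y. \<lbrakk>x \<in> S; y \<in> T\<rbrakk> \<Longrightarrow> g x y \<in> carrier M"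
  shows "(\<Oplus>\<^bsub>M\<^esub>y\<in>T. \<Oplus>\<^bsub>M\<^esub>x\<in>S. g x y) = (\<Oplus>\<^bsub>M\<^esub>x\<in>S. \<Oplus>\<^bsub>M\<^esub>y\<in>T. g x y)"
  using assms(1,3)
proof (induction S rule: finite_induct)
  case empty thus ?case by simp
next
  case (insert x S)
  have "(\<Oplus>\<^bsub>M\<^esub>y\<in>T. \<Oplus>\<^bsub>M\<^esub>x\<in>insert x S. g x y) = (\<Oplus>\<^bsub>M\<^esub>y\<in>T. g x y \<oplus>\<^bsub>M\<^esub> (\<Oplus>\<^bsub>M\<^esub>x\<in>S. g x y))"
    using insert by (intro M.add.finprod_cong') (auto simp: Pi_def intro!: M.finsum_closed)
  also have "\<dots> = (\<Oplus>\<^bsub>M\<^esub>y\<in>T. g x y) \<oplus>\<^bsub>M\<^esub> (\<Oplus>\<^bsub>M\<^esub>y\<in>T. \<Oplus>\<^bsub>M\<^esub>x\<in>S. g x y)"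
    using insert by (intro M.finsum_addf) (auto intro!: M.finsum_closed)
  finally show ?case using insert assms(2) by (simp add: Pi_def)
qed

end

definition regular_module :: "('a, 'r) ring_scheme \<Rightarrow> ('a, 'a) module" where
  "regular_module R = \<lparr>carrier = carrier R, monoid.mult = monoid.mult R, one = \<one>\<^bsub>R\<^esub>,
     ring.zero = \<zero>\<^bsub>R\<^esub>, add = add R, smult = (\<lambda>a x. x \<otimes>\<^bsub>R\<^esub> a)\<rparr>"

lemma regular_module_simps [simp]:
  "carrier (regular_module R) = carrier R" "\<zero>\<^bsub>regular_module R\<^esub> = \<zero>\<^bsub>R\<^esub>"
  "a \<odot>\<^bsub>regular_module R\<^esub> x = x \<otimes>\<^bsub>R\<^esub> a" "add (regular_module R) = add R"
  by (simp_all add: regular_module_def)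

lemma (in ring) regular_right_module: "right_module R (regular_module R)"
proof -
  have "abelian_group (regular_module R)"
  proof (rule abelian_groupI)
    fix x assume "x \<in> carrier (regular_module R)"
    thus "\<exists>y\<in>carrier (regular_module R). y \<oplus>\<^bsub>regular_module R\<^esub> x = \<zero>\<^bsub>regular_module R\<^esub>"
      using l_neg[of x] a_inv_closed[of x] unfolding regular_module_simps by blast
  qed (auto simp: a_ac)
  thus ?thesis
    by (intro right_module.intro right_module_axioms.intro)
       (auto simp: ring_axioms l_distr r_distr m_assoc)
qed

context right_module
begin

lemma mem_free:
  "f \<in> carrier (free_right_module A B) \<longleftrightarrow>
     finite {x. f x \<noteq> \<zero>\<^bsub>A\<^esub>} \<and> (\<forall>x. f x \<in> carrier A) \<and> (\<forall>x. x \<notin> B \<longrightarrow> f x = \<zero>\<^bsub>A\<^esub>)"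
  by (simp add: free_right_module_def free_module_def)

lemma syz_fun_mem:
  "x \<in> std_gens A M (Suc i) \<Longrightarrow> syz_fun A x \<in> carrier (free_right_module A (std_gens A M i))"
  by auto

lemma syz_fun_closed: "x \<in> std_gens A M (Suc i) \<Longrightarrow> syz_fun A x y \<in> carrier A"
  using syz_fun_mem[of x i] unfolding mem_free by simp

lemma ex_syz:
  assumes "finite {x. f x \<noteq> \<zero>\<^bsub>A\<^esub>}"
  shows "\<exists>l. syz_fun A (Syz l) = f"
proof -
  obtain xs where xs: "set xs = {x. f x \<noteq> \<zero>\<^bsub>A\<^esub>}" using finite_list assms by blast
  have "syz_fun A (Syz (map (\<lambda>x. (x, f x)) xs)) = f"
    using xs by (auto simp: syz_fun_def map_of_map_restrict restrict_map_def fun_eq_iff)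
  thus ?thesis by blast
qed

text \<open>A homomorphism that vanishes on the cycles named by the generators vanishes on boundaries.\<close>

lemma eval_std_diff:
  assumes f: "f \<in> carrier (free_right_module A (std_gens A M (Suc i)))"
    and e: "\<And>y. y \<in> std_gens A M i \<Longrightarrow> e y \<in> carrier N" and N: "right_module A N"
    and z: "\<And>x. x \<in> std_gens A M (Suc i) \<Longrightarrow>
      (\<Oplus>\<^bsub>N\<^esub>y\<in>{y. syz_fun A x y \<noteq> \<zero>\<^bsub>A\<^esub>}. syz_fun A x y \<odot>\<^bsub>N\<^esub> e y) = \<zero>\<^bsub>N\<^esub>"
  shows "std_diff A f \<in> carrier (free_right_module A (std_gens A M i))"
    and "(\<Oplus>\<^bsub>N\<^esub>y\<in>{y. std_diff A f y \<noteq> \<zero>\<^bsub>A\<^esub>}. std_diff A f y \<odot>\<^bsub>N\<^esub> e y) = \<zero>\<^bsub>N\<^esub>"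
proof -
  interpret N: right_module A N by (rule N)
  define S where "S = {x. f x \<noteq> \<zero>\<^bsub>A\<^esub>}"
  define T where "T = (\<Union>x\<in>S. {y. syz_fun A x y \<noteq> \<zero>\<^bsub>A\<^esub>})"
  have S: "finite S" "S \<subseteq> std_gens A M (Suc i)" using f unfolding mem_free S_def by blast+
  have fc: "f x \<in> carrier A" for x using f unfolding mem_free by simp
  have c: "syz_fun A x y \<in> carrier A" if "x \<in> S" for x y using that S(2) syz_fun_closed by blast
  have T: "finite T" "T \<subseteq> std_gens A M i"
    proof -
    have "finite {y. syz_fun A x y \<noteq> \<zero>\<^bsub>A\<^esub>} \<and> {y. syz_fun A x y \<noteq> \<zero>\<^bsub>A\<^esub>} \<subseteq> std_gens A M i"
      if "x \<in> S" for x
      using that S(2) syz_fun_mem[of x i] unfolding mem_free by blast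
    thus "finite T" and "T \<subseteq> std_gens A M i" using S(1) unfolding T_def by auto
  qed
  have dT: "std_diff A f y = (\<Oplus>\<^bsub>A\<^esub>x\<in>S. syz_fun A x y \<otimes>\<^bsub>A\<^esub> f x)" for y
    by (simp add: std_diff_def S_def)
  have d0: "std_diff A f y = \<zero>\<^bsub>A\<^esub>" if "y \<notin> T" for y
  proof -
    have "std_diff A f y = (\<Oplus>\<^bsub>A\<^esub>x\<in>S. \<zero>\<^bsub>A\<^esub>)" unfolding dT
      using that fc by (intro R.add.finprod_cong') (auto simp: T_def)
    thus ?thesis by simp
  qed
  have dc: "std_diff A f y \<in> carrier A" for y unfolding dT
    using c fc by (intro R.finsum_closed) auto
  show "std_diff A f \<in> carrier (free_right_module A (std_gens A M i))"
    unfolding mem_free using d0 dc T finite_subset[of "{y. std_diff A f y \<noteq> \<zero>\<^bsub>A\<^esub>}" T] by blast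
  have eT: "e y \<in> carrier N" if "y \<in> T" for y using that T e by blast
  have "(\<Oplus>\<^bsub>N\<^esub>y\<in>{y. std_diff A f y \<noteq> \<zero>\<^bsub>A\<^esub>}. std_diff A f y \<odot>\<^bsub>N\<^esub> e y)
      = (\<Oplus>\<^bsub>N\<^esub>y\<in>T. std_diff A f y \<odot>\<^bsub>N\<^esub> e y)"
    using T(1) d0 dc eT by (intro N.finsum_eval_superset) auto
  also have "\<dots> = (\<Oplus>\<^bsub>N\<^esub>y\<in>T. \<Oplus>\<^bsub>N\<^esub>x\<in>S. f x \<odot>\<^bsub>N\<^esub> (syz_fun A x y \<odot>\<^bsub>N\<^esub> e y))"
  proof (intro N.M.add.finprod_cong' refl)
    show "(\<lambda>y. \<Oplus>\<^bsub>N\<^esub>x\<in>S. f x \<odot>\<^bsub>N\<^esub> (syz_fun A x y \<odot>\<^bsub>N\<^esub> e y)) \<in> T \<rightarrow> carrier N"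
      using c fc eT by (auto intro!: N.M.finsum_closed)
    fix y assume y: "y \<in> T"
    show "std_diff A f y \<odot>\<^bsub>N\<^esub> e y = (\<Oplus>\<^bsub>N\<^esub>x\<in>S. f x \<odot>\<^bsub>N\<^esub> (syz_fun A x y \<odot>\<^bsub>N\<^esub> e y))"
      unfolding dT using S c fc eT[OF y]
      by (subst N.smult_finsum_left) (auto simp: N.smult_assoc intro!: N.M.add.finprod_cong')
  qed
  also have "\<dots> = (\<Oplus>\<^bsub>N\<^esub>x\<in>S. \<Oplus>\<^bsub>N\<^esub>y\<in>T. f x \<odot>\<^bsub>N\<^esub> (syz_fun A x y \<odot>\<^bsub>N\<^esub> e y))"
    using S T c fc eT by (intro N.finsum_swap) auto
  also have "\<dots> = (\<Oplus>\<^bsub>N\<^esub>x\<in>S. \<zero>\<^bsub>N\<^esub>)"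
  proof (intro N.M.add.finprod_cong' refl)
    fix x assume x: "x \<in> S"
    have "(\<Oplus>\<^bsub>N\<^esub>y\<in>T. f x \<odot>\<^bsub>N\<^esub> (syz_fun A x y \<odot>\<^bsub>N\<^esub> e y))
        = f x \<odot>\<^bsub>N\<^esub> (\<Oplus>\<^bsub>N\<^esub>y\<in>T. syz_fun A x y \<odot>\<^bsub>N\<^esub> e y)"
      using T fc c[OF x] eT by (subst N.smult_finsum_right) auto
    also have "(\<Oplus>\<^bsub>N\<^esub>y\<in>T. syz_fun A x y \<odot>\<^bsub>N\<^esub> e y)
        = (\<Oplus>\<^bsub>N\<^esub>y\<in>{y. syz_fun A x y \<noteq> \<zero>\<^bsub>A\<^esub>}. syz_fun A x y \<odot>\<^bsub>N\<^esub> e y)"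
      using T c x eT by (intro N.finsum_eval_superset[symmetric]) (auto simp: T_def)
    also have "\<dots> = \<zero>\<^bsub>N\<^esub>" using z S x by blast
    finally show "(\<Oplus>\<^bsub>N\<^esub>y\<in>T. f x \<odot>\<^bsub>N\<^esub> (syz_fun A x y \<odot>\<^bsub>N\<^esub> e y)) = \<zero>\<^bsub>N\<^esub>"
      using fc by simp
  qed auto
  also have "\<dots> = \<zero>\<^bsub>N\<^esub>" by simp
  finally show "(\<Oplus>\<^bsub>N\<^esub>y\<in>{y. std_diff A f y \<noteq> \<zero>\<^bsub>A\<^esub>}. std_diff A f y \<odot>\<^bsub>N\<^esub> e y) = \<zero>\<^bsub>N\<^esub>" .
qed

lemma basis_vec_mem: "x \<in> B \<Longrightarrow> basis_vec A x \<in> carrier (free_right_module A B)"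
  by (auto simp: mem_free basis_vec_def)

lemma eval_basis_vec:
  assumes "right_module A N" "e x \<in> carrier N"
  shows "(\<Oplus>\<^bsub>N\<^esub>y\<in>{y. basis_vec A x y \<noteq> \<zero>\<^bsub>A\<^esub>}. basis_vec A x y \<odot>\<^bsub>N\<^esub> e y) = e x"
proof -
  interpret N: right_module A N by (rule assms(1))
  have "(\<Oplus>\<^bsub>N\<^esub>y\<in>{y. basis_vec A x y \<noteq> \<zero>\<^bsub>A\<^esub>}. basis_vec A x y \<odot>\<^bsub>N\<^esub> e y)
      = (\<Oplus>\<^bsub>N\<^esub>y\<in>{x}. basis_vec A x y \<odot>\<^bsub>N\<^esub> e y)"
    using assms(2) by (intro N.finsum_eval_superset) (auto simp: basis_vec_def)
  also have "\<dots> = e x" using assms(2) by (simp add: basis_vec_def)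
  finally show ?thesis .
qed

lemma std_diff_eval:
  "std_diff A f z = (\<Oplus>\<^bsub>regular_module A\<^esub>y\<in>{y. f y \<noteq> \<zero>\<^bsub>A\<^esub>}. f y \<odot>\<^bsub>regular_module A\<^esub> syz_fun A y z)"
  by (simp add: std_diff_def finsum_def finprod_def)

lemma std_diff_basis_vec:
  assumes "x \<in> std_gens A M (Suc i)"
  shows "std_diff A (basis_vec A x) = syz_fun A x"
proof
  fix z show "std_diff A (basis_vec A x) z = syz_fun A x z"
    unfolding std_diff_eval using syz_fun_closed[OF assms, of z]
    by (subst eval_basis_vec[OF R.regular_right_module, of "\<lambda>y. syz_fun A y z"]) auto
qed

lemma std_aug_surj: "std_aug A M ` carrier (std_res A M 0) = carrier M"
proof -
  have "std_aug A M f \<in> carrier M" if "f \<in> carrier (std_res A M 0)" for f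
  proof -
    have "f x \<odot>\<^bsub>M\<^esub> elt x \<in> carrier M" if "f x \<noteq> \<zero>\<^bsub>A\<^esub>" for x
    proof (rule smult_closed)
      show "f x \<in> carrier A"
        using \<open>f \<in> carrier (std_res A M 0)\<close> unfolding std_res_def mem_free by simp
      have "x \<in> std_gens A M 0"
        using \<open>f \<in> carrier (std_res A M 0)\<close> that unfolding std_res_def mem_free by blast
      thus "elt x \<in> carrier M" by auto
    qed
    thus ?thesis unfolding std_aug_def by (intro M.finsum_closed) auto
  qed
  moreover have "m \<in> std_aug A M ` carrier (std_res A M 0)" if "m \<in> carrier M" for m
  proof -
    have "std_aug A M (basis_vec A (Elt m)) = m"
      unfolding std_aug_def using eval_basis_vec[of M elt "Elt m"] that right_module_axioms by simp
    thus ?thesis using basis_vec_mem[of "Elt m" "std_gens A M 0"] that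
      by (force simp: std_res_def)
  qed
  ultimately show ?thesis by blast
qed

lemma std_res_exact_0:
  "std_diff A ` carrier (std_res A M 1) =
     {f \<in> carrier (std_res A M 0). std_aug A M f = \<zero>\<^bsub>M\<^esub>}" (is "_ = ?K")
proof (intro equalityI subsetI)
  fix g assume "g \<in> std_diff A ` carrier (std_res A M 1)"
  then obtain f where f: "f \<in> carrier (free_right_module A (std_gens A M (Suc 0)))"
    "g = std_diff A f" by (auto simp: std_res_def)
  have z: "std_aug A M (syz_fun A x) = \<zero>\<^bsub>M\<^esub>" if "x \<in> std_gens A M (Suc 0)" for x
    using that by auto
  have e: "elt y \<in> carrier M" if "y \<in> std_gens A M 0" for y
    using that by auto
  note E = eval_std_diff[OF f(1) e right_module_axioms z[unfolded std_aug_def]]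
  show "g \<in> ?K" using E unfolding f(2) std_res_def std_aug_def by blast
next
  fix g assume g: "g \<in> ?K"
  then obtain l where l: "syz_fun A (Syz l) = g"
    using ex_syz unfolding std_res_def mem_free by blast
  have m: "Syz l \<in> std_gens A M (Suc 0)" using g l by (auto simp: std_res_def)
  have "g = std_diff A (basis_vec A (Syz l))" using std_diff_basis_vec[OF m] l by simp
  moreover have "basis_vec A (Syz l) \<in> carrier (std_res A M 1)"
    using basis_vec_mem[OF m] by (simp add: std_res_def)
  ultimately show "g \<in> std_diff A ` carrier (std_res A M 1)" by blast
qed

lemma std_res_exact_Suc:
  "std_diff A ` carrier (std_res A M (Suc (Suc i))) =
     {f \<in> carrier (std_res A M (Suc i)). std_diff A f = \<zero>\<^bsub>std_res A M i\<^esub>}" (is "_ = ?K")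
proof (intro equalityI subsetI)
  have zero: "\<zero>\<^bsub>std_res A M i\<^esub> = (\<lambda>_. \<zero>\<^bsub>A\<^esub>)"
    by (simp add: std_res_def free_right_module_def free_module_def)
  {
    fix g assume "g \<in> std_diff A ` carrier (std_res A M (Suc (Suc i)))"
    then obtain f where f: "f \<in> carrier (free_right_module A (std_gens A M (Suc (Suc i))))"
      "g = std_diff A f" by (auto simp: std_res_def)
    have s: "std_diff A (syz_fun A x) z = \<zero>\<^bsub>A\<^esub>" if "x \<in> std_gens A M (Suc (Suc i))" for x z
      using that by auto
    have e: "syz_fun A y z \<in> carrier (regular_module A)" if "y \<in> std_gens A M (Suc i)" for y z
      using that syz_fun_closed unfolding regular_module_simps by blast
    have E: "std_diff A f \<in> carrier (free_right_module A (std_gens A M (Suc i)))"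
      "std_diff A (std_diff A f) z = \<zero>\<^bsub>A\<^esub>" for z
      using eval_std_diff[where e = "\<lambda>y. syz_fun A y z" and N = "regular_module A",
          OF f(1) e R.regular_right_module] s[of _ z]
      unfolding std_diff_eval[of "std_diff A f"] std_diff_eval[of "syz_fun A x" for x]
        regular_module_simps(2) by blast+
    have "std_diff A g z = \<zero>\<^bsub>A\<^esub>" for z unfolding f(2) by (rule E(2))
    moreover have "g \<in> carrier (std_res A M (Suc i))" unfolding f(2) std_res_def by (rule E(1))
    ultimately show "g \<in> ?K" using zero by auto
  }
  fix g assume g: "g \<in> ?K"
  then obtain l where l: "syz_fun A (Syz l) = g"
    using ex_syz unfolding std_res_def mem_free by blast
  have m: "Syz l \<in> std_gens A M (Suc (Suc i))"
    using g l zero by (auto simp: std_res_def)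
  have "g = std_diff A (basis_vec A (Syz l))" using std_diff_basis_vec[OF m] l by simp
  moreover have "basis_vec A (Syz l) \<in> carrier (std_res A M (Suc (Suc i)))"
    using basis_vec_mem[OF m] by (simp add: std_res_def)
  ultimately show "g \<in> std_diff A ` carrier (std_res A M (Suc (Suc i)))" by blast
qed

end

end

theory Submission
  imports Defs
begin

text \<open>The diagrams that are not through diagrams span an ideal \<open>I\<close> of the Temperley-Lieb algebra \<open>A\<close>
  with quotient \<open>A/I = k[G^n]\<close>, and both trivial modules factor through this quotient.  Hence the two
  Tor groups agree as soon as \<open>A/I \<otimes> F\<close> is still a resolution for a free resolution \<open>F\<close> of the
  trivial module, that is, as soon as every cycle of \<open>F\<close> with coefficients in \<open>I\<close> bounds a chain with
  coefficients in \<open>I\<close>.  A diagram lies in \<open>I\<close> if and only if it joins two adjacent nodes of the right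
  column by an edge, a cup.  So \<open>I\<close> is the union of the left ideals spanned by the diagrams containing
  a given nonempty set of cups; these are closed under intersection, and by Mayer-Vietoris it
  suffices to treat each of them.  Such a left ideal is zero or, as \<open>n\<close> is odd, the cups leave a node
  free; using the free space next to it, one inserts the cups one after the other by multiplying with
  suitable diagrams from the right, and the product of these diagrams is a right identity \<open>e\<close> of the
  left ideal, which is therefore the direct summand \<open>A e\<close> of \<open>A\<close>.\<close>

section \<open>Maps between free modules\<close>

text \<open>The right identity \<open>e\<close> has to exist for every \<open>\<delta>\<close>,
  invertible or not. Capping a cup off with its mirror image would close a loop and produce such a
  factor. The hook avoids this: the old cup is swallowed by a neighbouring strand while a new copy
  of it is attached, so no loop arises and no scalar appears. The neighbouring strand is the reason
  for asking for a free node. For even \<open>n\<close> the cups can cover the whole column, and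
  then there is no room for a hook. The labels run through \<open>G\<close>, so there may be
  infinitely many of these left ideals; a single chain has finite support and meets only finitely
  many. All of them are spanned by sets of diagrams, so their sums and intersections correspond to
  unions and intersections of these sets, and Mayer-Vietoris becomes a matter of splitting supports.
  The two Tor modules come from different standard resolutions. Changing coefficients in the one
  over \<open>A\<close> gives a resolution over \<open>A/I\<close>, but not the standard one, hence
  the comparison of resolutions up to homotopy.\<close>

definition mat_map :: "('a, 'r) ring_scheme \<Rightarrow> ('x \<Rightarrow> 'y \<Rightarrow> 'a) \<Rightarrow> ('x \<Rightarrow> 'a) \<Rightarrow> 'y \<Rightarrow> 'a" where
  "mat_map R \<phi> f = (\<lambda>y. \<Oplus>\<^bsub>R\<^esub>x\<in>{x. f x \<noteq> \<zero>\<^bsub>R\<^esub>}. \<phi> x y \<otimes>\<^bsub>R\<^esub> f x)"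

definition single_vec :: "('a, 'r) ring_scheme \<Rightarrow> 'x \<Rightarrow> 'a \<Rightarrow> 'x \<Rightarrow> 'a" where
  "single_vec R x a = (\<lambda>y. if y = x then a else \<zero>\<^bsub>R\<^esub>)"

lemma basis_vec_single: "basis_vec R x = single_vec R x \<one>\<^bsub>R\<^esub>"
  by (simp add: basis_vec_def single_vec_def)

text \<open>The entry stands to the left of the coefficient in \<open>mat_map\<close>, so these maps
  commute with multiplication from the right, as maps of free right modules must. Over the
  commutative ring \<open>k\<close> the same formula serves for left modules.\<close>

lemma std_diff_mat_map: "std_diff A = mat_map A (syz_fun A)"
  by (simp add: std_diff_def mat_map_def fun_eq_iff)

lemma free_module_mem:
  "f \<in> carrier (free_module R X) \<longleftrightarrow>
     finite {x. f x \<noteq> \<zero>\<^bsub>R\<^esub>} \<and> (\<forall>x. f x \<in> carrier R) \<and> (\<forall>x. x \<notin> X \<longrightarrow> f x = \<zero>\<^bsub>R\<^esub>)"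
  by (simp add: free_module_def)

lemma free_module_simps [simp]:
  "\<zero>\<^bsub>free_module R X\<^esub> = (\<lambda>_. \<zero>\<^bsub>R\<^esub>)"
  "f \<oplus>\<^bsub>free_module R X\<^esub> g = (\<lambda>x. f x \<oplus>\<^bsub>R\<^esub> g x)"
  "a \<odot>\<^bsub>free_module R X\<^esub> f = (\<lambda>x. a \<otimes>\<^bsub>R\<^esub> f x)"
  by (simp_all add: free_module_def)

lemma free_right_module_simps [simp]:
  "carrier (free_right_module R X) = carrier (free_module R X)"
  "\<zero>\<^bsub>free_right_module R X\<^esub> = (\<lambda>_. \<zero>\<^bsub>R\<^esub>)"
  "f \<oplus>\<^bsub>free_right_module R X\<^esub> g = (\<lambda>x. f x \<oplus>\<^bsub>R\<^esub> g x)"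
  "a \<odot>\<^bsub>free_right_module R X\<^esub> f = (\<lambda>x. f x \<otimes>\<^bsub>R\<^esub> a)"
  by (simp_all add: free_right_module_def free_module_def)

context ring
begin

lemma free_closed: "f \<in> carrier (free_module R X) \<Longrightarrow> f x \<in> carrier R"
  by (simp add: free_module_mem)

lemma free_finite: "f \<in> carrier (free_module R X) \<Longrightarrow> finite {x. f x \<noteq> \<zero>}"
  by (simp add: free_module_mem)

lemma free_outside: "f \<in> carrier (free_module R X) \<Longrightarrow> x \<notin> X \<Longrightarrow> f x = \<zero>"
  by (simp add: free_module_mem)

lemma free_supp: "f \<in> carrier (free_module R X) \<Longrightarrow> {x. f x \<noteq> \<zero>} \<subseteq> X"
  by (auto simp: free_module_mem)

lemma free_zero [simp]: "(\<lambda>_. \<zero>) \<in> carrier (free_module R X)"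
  by (simp add: free_module_mem)

text \<open>An operation that fixes zero keeps the support inside the union of the two supports.
  Closure under sums, negatives and multiples are instances.\<close>

lemma free_combine:
  assumes "f \<in> carrier (free_module R X)" "g \<in> carrier (free_module R X)"
    "\<And>a b. a \<in> carrier R \<Longrightarrow> b \<in> carrier R \<Longrightarrow> h a b \<in> carrier R" "h \<zero> \<zero> = \<zero>"
  shows "(\<lambda>x. h (f x) (g x)) \<in> carrier (free_module R X)"
proof -
  note [simp] = free_closed[OF assms(1)] free_closed[OF assms(2)]
  have "{x. h (f x) (g x) \<noteq> \<zero>} \<subseteq> {x. f x \<noteq> \<zero>} \<union> {x. g x \<noteq> \<zero>}" using assms(4) by force
  hence "finite {x. h (f x) (g x) \<noteq> \<zero>}"
    by (rule finite_subset) (use free_finite[OF assms(1)] free_finite[OF assms(2)] in simp)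
  thus ?thesis using assms unfolding free_module_mem by simp
qed

lemma free_add [simp]:
  assumes "f \<in> carrier (free_module R X)" "g \<in> carrier (free_module R X)"
  shows "(\<lambda>x. f x \<oplus> g x) \<in> carrier (free_module R X)"
  using free_combine[OF assms, of "(\<oplus>)"] by simp

lemma free_minus [simp]:
  assumes "f \<in> carrier (free_module R X)" "g \<in> carrier (free_module R X)"
  shows "(\<lambda>x. f x \<ominus> g x) \<in> carrier (free_module R X)"
  using free_combine[OF assms, of "(\<lambda>x y. x \<ominus> y)"] by (simp add: a_minus_def)

lemma free_uminus [simp]:
  assumes "f \<in> carrier (free_module R X)"
  shows "(\<lambda>x. \<ominus> f x) \<in> carrier (free_module R X)"
  using free_combine[OF assms assms, of "(\<lambda>x y. \<ominus> x)"] by simp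

lemma free_smult_right [simp]:
  assumes "f \<in> carrier (free_module R X)" "a \<in> carrier R"
  shows "(\<lambda>x. f x \<otimes> a) \<in> carrier (free_module R X)"
  using free_combine[OF assms(1) assms(1), of "(\<lambda>x y. x \<otimes> a)"] assms by simp

lemma free_smult_left [simp]:
  assumes "f \<in> carrier (free_module R X)" "a \<in> carrier R"
  shows "(\<lambda>x. a \<otimes> f x) \<in> carrier (free_module R X)"
  using free_combine[OF assms(1) assms(1), of "(\<lambda>x y. a \<otimes> x)"] assms by simp

lemma free_restrict [simp]:
  assumes "f \<in> carrier (free_module R X)"
  shows "(\<lambda>x. if P x then f x else \<zero>) \<in> carrier (free_module R X)"
  by (rule finite_subset[OF _ free_finite[OF assms], THEN free_module_mem[THEN iffD2, OF conjI]])
     (use assms in \<open>auto simp: free_outside free_closed\<close>)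

lemma free_mono: "X \<subseteq> Y \<Longrightarrow> carrier (free_module R X) \<subseteq> carrier (free_module R Y)"
  unfolding free_module_mem subset_iff by blast

lemma mat_closed: "\<phi> \<in> X \<rightarrow> carrier (free_module R Y) \<Longrightarrow> x \<in> X \<Longrightarrow> \<phi> x y \<in> carrier R"
  using free_closed funcset_mem by metis

lemma single_mem [simp]:
  "x \<in> X \<Longrightarrow> a \<in> carrier R \<Longrightarrow> single_vec R x a \<in> carrier (free_module R X)"
  by (auto simp: free_module_mem single_vec_def)

lemma basis_vec_free [simp]: "x \<in> X \<Longrightarrow> basis_vec R x \<in> carrier (free_module R X)"
  by (simp add: basis_vec_single)

text \<open>The support is peeled off one point at a time. Identities between additive maps are
  thereby reduced to vectors with a single entry, and most computations below never touch a finite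
  sum.\<close>

lemma free_induct [consumes 1, case_names zero add single]:
  assumes f: "f \<in> carrier (free_module R X)"
    and "P (\<lambda>_. \<zero>)"
    and "\<And>f g. \<lbrakk>f \<in> carrier (free_module R X); g \<in> carrier (free_module R X); P f; P g\<rbrakk> \<Longrightarrow> P (\<lambda>x. f x \<oplus> g x)"
    and "\<And>x a. \<lbrakk>x \<in> X; a \<in> carrier R\<rbrakk> \<Longrightarrow> P (single_vec R x a)"
  shows "P f"
proof -
  have "\<forall>f. f \<in> carrier (free_module R X) \<longrightarrow> {x. f x \<noteq> \<zero>} \<subseteq> S \<longrightarrow> P f" if "finite S" for S
    using that
  proof (induction S rule: finite_induct)
    case empty
    show ?case
    proof (intro allI impI)
      fix f :: "'c \<Rightarrow> 'a" assume "{x. f x \<noteq> \<zero>} \<subseteq> {}"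
      hence "f = (\<lambda>_. \<zero>)" by auto
      thus "P f" using assms(2) by (simp only:)
    qed
  next
    case (insert s S)
    show ?case
    proof (intro allI impI)
      fix f assume f: "f \<in> carrier (free_module R X)" "{x. f x \<noteq> \<zero>} \<subseteq> insert s S"
      let ?g = "\<lambda>x. if x \<noteq> s then f x else \<zero>"
      have g: "?g \<in> carrier (free_module R X)" using f by (rule_tac free_restrict)
      have "{x. ?g x \<noteq> \<zero>} \<subseteq> S" using f(2) by auto
      hence Pg: "P ?g" using insert(3) g by blast
      show "P f"
      \<comment> \<open>The set that bounds the support is arbitrary, so the new point may lie
        outside \<open>X\<close>; there \<open>f\<close> vanishes anyway.\<close>
      proof (cases "s \<in> X")
        case True
        note [simp] = free_closed[OF f(1)]
        have "f = (\<lambda>x. ?g x \<oplus> single_vec R s (f s) x)"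
          using f by (auto simp: single_vec_def fun_eq_iff)
        moreover have "P (\<lambda>x. ?g x \<oplus> single_vec R s (f s) x)"
          by (intro assms(3)[OF g] single_mem assms(4) Pg True) simp_all
        ultimately show ?thesis by simp
      next
        case False
        hence "f = ?g" using f by (auto simp: fun_eq_iff free_outside)
        thus ?thesis using Pg by simp
      qed
    qed
  qed
  thus ?thesis using f free_finite by blast
qed

text \<open>Sums over the supports of different vectors can only be combined once they run over a
  common finite index set.\<close>

lemma mat_map_superset:
  assumes "finite T" "{x. f x \<noteq> \<zero>} \<subseteq> T" "\<And>x. x \<in> T \<Longrightarrow> f x \<in> carrier R"
    "\<And>x. x \<in> T \<Longrightarrow> \<phi> x y \<in> carrier R"
  shows "mat_map R \<phi> f y = (\<Oplus>x\<in>T. \<phi> x y \<otimes> f x)"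
  unfolding mat_map_def using assms
  by (intro add.finprod_mono_neutral_cong_left) auto

lemma mat_map_cong:
  assumes "f \<in> carrier (free_module R X)" "\<And>x. x \<in> X \<Longrightarrow> \<phi> x = \<psi> x" "\<psi> \<in> X \<rightarrow> carrier (free_module R Y)"
  shows "mat_map R \<phi> f = mat_map R \<psi> f"
proof
  note [simp] = free_closed[OF assms(1)]
  fix y
  have s: "{x. f x \<noteq> \<zero>} \<subseteq> X" using free_supp[OF assms(1)] .
  show "mat_map R \<phi> f y = mat_map R \<psi> f y"
    unfolding mat_map_def using s assms mat_closed[OF assms(3)] by (intro add.finprod_cong') auto
qed

lemma mat_map_closed:
  assumes f: "f \<in> carrier (free_module R X)" and \<phi>: "\<phi> \<in> X \<rightarrow> carrier (free_module R Y)"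
  shows "mat_map R \<phi> f \<in> carrier (free_module R Y)"
proof -
  note [simp] = free_closed[OF f]
  let ?S = "{x. f x \<noteq> \<zero>}"
  have s: "?S \<subseteq> X" "finite ?S" using f free_supp free_finite by auto
  have z: "mat_map R \<phi> f y = \<zero>" if "\<And>x. x \<in> ?S \<Longrightarrow> \<phi> x y = \<zero>" for y
    unfolding mat_map_def using f that by (intro add.finprod_one_eqI) auto
  have c: "mat_map R \<phi> f y \<in> carrier R" for y
    unfolding mat_map_def using f s mat_closed[OF \<phi>] by (intro finsum_closed) auto
  have "{y. mat_map R \<phi> f y \<noteq> \<zero>} \<subseteq> (\<Union>x\<in>?S. {y. \<phi> x y \<noteq> \<zero>})" using z by blast
  moreover have "finite (\<Union>x\<in>?S. {y. \<phi> x y \<noteq> \<zero>})" using s free_finite[OF funcset_mem[OF \<phi>]] by blast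
  moreover have "mat_map R \<phi> f y = \<zero>" if "y \<notin> Y" for y
    using s by (intro z free_outside[OF funcset_mem[OF \<phi>] that]) auto
  ultimately show ?thesis using c unfolding free_module_mem by (meson finite_subset)
qed

lemma mat_map_zero [simp]: "mat_map R \<phi> (\<lambda>_. \<zero>) = (\<lambda>_. \<zero>)"
  by (simp add: mat_map_def)

lemma mat_map_add:
  assumes f: "f \<in> carrier (free_module R X)" and g: "g \<in> carrier (free_module R X)"
    and \<phi>: "\<phi> \<in> X \<rightarrow> carrier (free_module R Y)"
  shows "mat_map R \<phi> (\<lambda>x. f x \<oplus> g x) = (\<lambda>y. mat_map R \<phi> f y \<oplus> mat_map R \<phi> g y)"
proof
  note [simp] = free_closed[OF f] free_closed[OF g]
  fix y
  let ?S = "{x. f x \<noteq> \<zero>} \<union> {x. g x \<noteq> \<zero>}"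
  have S: "finite ?S" "?S \<subseteq> X" using f g free_supp free_finite by auto
  have c: "\<phi> x y \<in> carrier R" if "x \<in> ?S" for x using that S mat_closed[OF \<phi>] by blast
  have 1: "mat_map R \<phi> f y = (\<Oplus>x\<in>?S. \<phi> x y \<otimes> f x)" "mat_map R \<phi> g y = (\<Oplus>x\<in>?S. \<phi> x y \<otimes> g x)"
    using S f g c by (auto intro!: mat_map_superset)
  have "mat_map R \<phi> (\<lambda>x. f x \<oplus> g x) y = (\<Oplus>x\<in>?S. \<phi> x y \<otimes> (f x \<oplus> g x))"
    using S f g c by (intro mat_map_superset) auto
  also have "\<dots> = (\<Oplus>x\<in>?S. \<phi> x y \<otimes> f x \<oplus> \<phi> x y \<otimes> g x)"
    using f g c by (intro add.finprod_cong') (auto simp: r_distr)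
  also have "\<dots> = (\<Oplus>x\<in>?S. \<phi> x y \<otimes> f x) \<oplus> (\<Oplus>x\<in>?S. \<phi> x y \<otimes> g x)"
    using f g c by (intro finsum_addf) (simp_all add: Pi_def)
  finally show "mat_map R \<phi> (\<lambda>x. f x \<oplus> g x) y = mat_map R \<phi> f y \<oplus> mat_map R \<phi> g y"
    using 1 by simp
qed

lemma mat_map_smult:
  assumes f: "f \<in> carrier (free_module R X)" and a: "a \<in> carrier R"
    and \<phi>: "\<phi> \<in> X \<rightarrow> carrier (free_module R Y)"
  shows "mat_map R \<phi> (\<lambda>x. f x \<otimes> a) = (\<lambda>y. mat_map R \<phi> f y \<otimes> a)"
proof
  note [simp] = free_closed[OF f]
  fix y
  let ?S = "{x. f x \<noteq> \<zero>}"
  have S: "finite ?S" "?S \<subseteq> X" using f free_supp free_finite by auto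
  have c: "\<phi> x y \<in> carrier R" if "x \<in> ?S" for x using that S mat_closed[OF \<phi>] by blast
  have "mat_map R \<phi> (\<lambda>x. f x \<otimes> a) y = (\<Oplus>x\<in>?S. \<phi> x y \<otimes> (f x \<otimes> a))"
    using S f a c by (intro mat_map_superset) auto
  also have "\<dots> = (\<Oplus>x\<in>?S. \<phi> x y \<otimes> f x \<otimes> a)"
    using f a c by (intro add.finprod_cong') (auto simp: m_assoc)
  also have "\<dots> = (\<Oplus>x\<in>?S. \<phi> x y \<otimes> f x) \<otimes> a"
    using f a c S by (intro finsum_ldistr[symmetric]) auto
  finally show "mat_map R \<phi> (\<lambda>x. f x \<otimes> a) y = mat_map R \<phi> f y \<otimes> a" by (simp add: mat_map_def)
qed

lemma mat_map_single:
  assumes "a \<in> carrier R" "\<phi> x \<in> carrier (free_module R Y)"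
  shows "mat_map R \<phi> (single_vec R x a) = (\<lambda>y. \<phi> x y \<otimes> a)"
proof
  fix y
  have "mat_map R \<phi> (single_vec R x a) y = (\<Oplus>z\<in>{x}. \<phi> z y \<otimes> single_vec R x a z)"
    using assms free_closed[OF assms(2)] by (intro mat_map_superset) (auto simp: single_vec_def)
  thus "mat_map R \<phi> (single_vec R x a) y = \<phi> x y \<otimes> a" using free_closed[OF assms(2)] assms(1) by (simp add: single_vec_def)
qed

lemma mat_map_basis [simp]:
  assumes "\<phi> x \<in> carrier (free_module R Y)"
  shows "mat_map R \<phi> (basis_vec R x) = \<phi> x"
  using mat_map_single[where \<phi> = \<phi>, OF one_closed assms] free_closed[OF assms] by (auto simp: basis_vec_single)

lemma mat_map_basis_id:
  assumes "f \<in> carrier (free_module R X)" shows "mat_map R (basis_vec R) f = f"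
  using assms
proof (induction rule: free_induct)
  case zero show ?case by (rule mat_map_zero)
next
  case (add f g)
  have "basis_vec R \<in> X \<rightarrow> carrier (free_module R X)" by simp
  from mat_map_add[OF add(1,2) this] show ?case by (simp only: add(3,4))
next
  case (single x a)
  have "mat_map R (basis_vec R) (single_vec R x a) = (\<lambda>y. basis_vec R x y \<otimes> a)"
    by (rule mat_map_single[where \<phi> = "basis_vec R", OF single(2) basis_vec_free[OF single(1)]])
  also have "\<dots> = single_vec R x a" using single by (simp add: fun_eq_iff basis_vec_def single_vec_def)
  finally show ?case .
qed

text \<open>The matrix product, written by columns: column \<open>x\<close> of the composite is the
  image of \<open>\<phi> x\<close> under the second map.\<close>

lemma mat_map_comp:
  assumes f: "f \<in> carrier (free_module R X)"
    and \<phi>: "\<phi> \<in> X \<rightarrow> carrier (free_module R Y)"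
    and \<psi>: "\<psi> \<in> Y \<rightarrow> carrier (free_module R Z)"
  shows "mat_map R \<psi> (mat_map R \<phi> f) = mat_map R (\<lambda>x. mat_map R \<psi> (\<phi> x)) f"
  using f
proof (induction rule: free_induct)
  case zero show ?case by (simp only: mat_map_zero)
next
  case (add f g)
  have c: "(\<lambda>x. mat_map R \<psi> (\<phi> x)) \<in> X \<rightarrow> carrier (free_module R Z)"
    by (intro Pi_I mat_map_closed[OF funcset_mem[OF \<phi>] \<psi>])
  show ?case
    by (simp only: add(3,4) mat_map_add[OF add(1,2) \<phi>] mat_map_add[OF add(1,2) c]
      mat_map_add[OF mat_map_closed[OF add(1) \<phi>] mat_map_closed[OF add(2) \<phi>] \<psi>])
next
  case (single x a)
  note c = funcset_mem[OF \<phi> single(1)]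
  have "mat_map R \<psi> (mat_map R \<phi> (single_vec R x a)) = (\<lambda>y. mat_map R \<psi> (\<phi> x) y \<otimes> a)"
    by (simp only: mat_map_single[where \<phi> = \<phi>, OF single(2) c] mat_map_smult[OF c single(2) \<psi>])
  thus ?case
    by (simp only: mat_map_single[where \<phi> = "\<lambda>x. mat_map R \<psi> (\<phi> x)", OF single(2) mat_map_closed[OF c \<psi>]])
qed

lemma mat_map_uminus:
  assumes f: "f \<in> carrier (free_module R X)"
    and \<phi>: "\<phi> \<in> X \<rightarrow> carrier (free_module R Y)"
  shows "mat_map R \<phi> (\<lambda>x. \<ominus> f x) = (\<lambda>y. \<ominus> mat_map R \<phi> f y)"
proof -
  note [simp] = free_closed[OF f]
  \<comment> \<open>Negation is right multiplication by \<open>\<ominus> \<one>\<close>, so right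
    linearity applies.\<close>
  have "(\<lambda>x. \<ominus> f x) = (\<lambda>x. f x \<otimes> \<ominus> \<one>)" using f by (auto simp: r_minus)
  thus ?thesis using mat_map_smult[OF f a_inv_closed[OF one_closed] \<phi>] free_closed[OF mat_map_closed[OF f \<phi>]]
    by (simp add: r_minus)
qed

lemma mat_map_minus:
  assumes f: "f \<in> carrier (free_module R X)" and g: "g \<in> carrier (free_module R X)"
    and \<phi>: "\<phi> \<in> X \<rightarrow> carrier (free_module R Y)"
  shows "mat_map R \<phi> (\<lambda>x. f x \<ominus> g x) = (\<lambda>y. mat_map R \<phi> f y \<ominus> mat_map R \<phi> g y)"
  unfolding a_minus_def
  using mat_map_add[OF f free_uminus[OF g] \<phi>] mat_map_uminus[OF g \<phi>] by simp

lemma mat_map_add_left: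
  assumes f: "f \<in> carrier (free_module R X)"
    and \<phi>: "\<phi> \<in> X \<rightarrow> carrier (free_module R Y)"
    and \<psi>: "\<psi> \<in> X \<rightarrow> carrier (free_module R Y)"
  shows "mat_map R (\<lambda>x y. \<phi> x y \<oplus> \<psi> x y) f = (\<lambda>y. mat_map R \<phi> f y \<oplus> mat_map R \<psi> f y)"
proof
  note [simp] = free_closed[OF f]
  fix y
  have S: "{x. f x \<noteq> \<zero>} \<subseteq> X" using free_supp[OF f] .
  have c: "\<phi> x y \<in> carrier R" "\<psi> x y \<in> carrier R" if "f x \<noteq> \<zero>" for x
    using that S mat_closed[OF \<phi>] mat_closed[OF \<psi>] by blast+
  have "mat_map R (\<lambda>x y. \<phi> x y \<oplus> \<psi> x y) f y = (\<Oplus>x\<in>{x. f x \<noteq> \<zero>}. \<phi> x y \<otimes> f x \<oplus> \<psi> x y \<otimes> f x)"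
    unfolding mat_map_def using f c by (intro add.finprod_cong') (auto simp: l_distr)
  also have "\<dots> = mat_map R \<phi> f y \<oplus> mat_map R \<psi> f y"
    unfolding mat_map_def using f c by (intro finsum_addf) auto
  finally show "mat_map R (\<lambda>x y. \<phi> x y \<oplus> \<psi> x y) f y = mat_map R \<phi> f y \<oplus> mat_map R \<psi> f y" .
qed

end

section \<open>Base change of vectors and matrices along a ring homomorphism\<close>

lemma hom_free:
  assumes "ring R" "ring S" "h \<in> ring_hom R S" "f \<in> carrier (free_module R X)"
  shows "(\<lambda>x. h (f x)) \<in> carrier (free_module S X)"
proof -
  interpret ring_hom_ring R S h using assms by (simp add: ring_hom_ring.intro ring_hom_ring_axioms.intro)
  have "{x. h (f x) \<noteq> \<zero>\<^bsub>S\<^esub>} \<subseteq> {x. f x \<noteq> \<zero>\<^bsub>R\<^esub>}" using hom_zero by force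
  thus ?thesis using assms(4) unfolding free_module_mem by (auto intro: finite_subset)
qed

text \<open>This is applied both to the augmentation, which reduces a differential to a matrix over
  \<open>k\<close>, and to the projection of an algebra onto a quotient.\<close>

lemma mat_map_hom:
  assumes R: "ring R" and S: "ring S" and h: "h \<in> ring_hom R S" and f: "f \<in> carrier (free_module R X)"
    and \<phi>: "\<phi> \<in> X \<rightarrow> carrier (free_module R Y)"
  shows "mat_map S (\<lambda>x y. h (\<phi> x y)) (\<lambda>x. h (f x)) = (\<lambda>y. h (mat_map R \<phi> f y))"
proof -
  interpret ring_hom_ring R S h using assms by (simp add: ring_hom_ring.intro ring_hom_ring_axioms.intro)
  have c: "(\<lambda>x y. h (\<phi> x y)) \<in> X \<rightarrow> carrier (free_module S Y)"
    by (intro Pi_I hom_free[OF R S h funcset_mem[OF \<phi>]])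
  show ?thesis using f
  proof (induction rule: R.free_induct)
    case zero show ?case by (simp only: R.mat_map_zero S.mat_map_zero hom_zero)
  next
    case (add f g)
    note cl = R.free_closed[OF add(1)] R.free_closed[OF add(2)]
      R.free_closed[OF R.mat_map_closed[OF add(1) \<phi>]] R.free_closed[OF R.mat_map_closed[OF add(2) \<phi>]]
    show ?case
      by (simp only: hom_add[OF cl(1,2)] hom_add[OF cl(3,4)] add(3,4) R.mat_map_add[OF add(1,2) \<phi>]
          S.mat_map_add[OF hom_free[OF R S h add(1)] hom_free[OF R S h add(2)] c])
  next
    case (single x a)
    have "(\<lambda>y. h (single_vec R x a y)) = single_vec S x (h a)" by (auto simp: single_vec_def)
    thus ?case
      by (simp only: S.mat_map_single[where \<phi> = "\<lambda>x y. h (\<phi> x y)",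
            OF hom_closed[OF single(2)] funcset_mem[OF c single(1)]]
          R.mat_map_single[where \<phi> = \<phi>, OF single(2) funcset_mem[OF \<phi> single(1)]]
          hom_mult[OF R.free_closed[OF funcset_mem[OF \<phi> single(1)]] single(2)])
  qed
qed

section \<open>Homology of complexes of modules\<close>

definition linear_maps ::
  "('k, 'r) ring_scheme \<Rightarrow> ('k, 'm) module \<Rightarrow> ('k, 'n) module \<Rightarrow> ('m \<Rightarrow> 'n) set" where
  "linear_maps k M N = {h \<in> carrier M \<rightarrow> carrier N.
     (\<forall>x\<in>carrier M. \<forall>y\<in>carrier M. h (x \<oplus>\<^bsub>M\<^esub> y) = h x \<oplus>\<^bsub>N\<^esub> h y) \<and>
     (\<forall>a\<in>carrier k. \<forall>x\<in>carrier M. h (a \<odot>\<^bsub>M\<^esub> x) = a \<odot>\<^bsub>N\<^esub> h x)}"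

lemma linear_mapsI:
  assumes "\<And>x. x \<in> carrier M \<Longrightarrow> h x \<in> carrier N"
    "\<And>x y. \<lbrakk>x \<in> carrier M; y \<in> carrier M\<rbrakk> \<Longrightarrow> h (x \<oplus>\<^bsub>M\<^esub> y) = h x \<oplus>\<^bsub>N\<^esub> h y"
    "\<And>a x. \<lbrakk>a \<in> carrier k; x \<in> carrier M\<rbrakk> \<Longrightarrow> h (a \<odot>\<^bsub>M\<^esub> x) = a \<odot>\<^bsub>N\<^esub> h x"
  shows "h \<in> linear_maps k M N"
  using assms by (simp add: linear_maps_def)

lemma linear_mapsD:
  assumes "h \<in> linear_maps k M N"
  shows "x \<in> carrier M \<Longrightarrow> h x \<in> carrier N"
    "\<lbrakk>x \<in> carrier M; y \<in> carrier M\<rbrakk> \<Longrightarrow> h (x \<oplus>\<^bsub>M\<^esub> y) = h x \<oplus>\<^bsub>N\<^esub> h y"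
    "\<lbrakk>a \<in> carrier k; x \<in> carrier M\<rbrakk> \<Longrightarrow> h (a \<odot>\<^bsub>M\<^esub> x) = a \<odot>\<^bsub>N\<^esub> h x"
  using assms by (auto simp: linear_maps_def)

lemma module_iso_alt: "module_iso k M N = {h \<in> linear_maps k M N. bij_betw h (carrier M) (carrier N)}"
  by (auto simp: module_iso_def linear_maps_def bij_betw_def)

locale linear_map = M: module k M + N: module k N
  for k :: "('k, 'r) ring_scheme" and M :: "('k, 'm) module" and N :: "('k, 'n) module" +
  fixes h assumes lin: "h \<in> linear_maps k M N"
begin

lemmas map_closed = linear_mapsD(1)[OF lin]
lemmas map_add = linear_mapsD(2)[OF lin]
lemmas map_smult = linear_mapsD(3)[OF lin]

lemma map_zero: "h \<zero>\<^bsub>M\<^esub> = \<zero>\<^bsub>N\<^esub>"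
  using map_add[of "\<zero>\<^bsub>M\<^esub>" "\<zero>\<^bsub>M\<^esub>"] map_closed[of "\<zero>\<^bsub>M\<^esub>"] N.M.add.r_cancel_one'[of "h \<zero>\<^bsub>M\<^esub>"] by auto

lemma map_uminus: "x \<in> carrier M \<Longrightarrow> h (\<ominus>\<^bsub>M\<^esub> x) = \<ominus>\<^bsub>N\<^esub> h x"
  using map_add[of "\<ominus>\<^bsub>M\<^esub> x" x] map_zero map_closed
  by (simp add: N.M.minus_equality M.M.l_neg)

lemma map_minus: "x \<in> carrier M \<Longrightarrow> y \<in> carrier M \<Longrightarrow> h (x \<ominus>\<^bsub>M\<^esub> y) = h x \<ominus>\<^bsub>N\<^esub> h y"
  by (simp add: a_minus_def map_add map_uminus)

lemma image_submodule:
  assumes H: "submodule H k M" shows "submodule (h ` H) k N"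
proof (rule N.submoduleI)
  have c: "x \<in> H \<Longrightarrow> x \<in> carrier M" for x using M.submoduleE(1)[OF H] by blast
  note S = M.submoduleE[OF H]
  show "h ` H \<subseteq> carrier N" using c map_closed by blast
  have "\<zero>\<^bsub>M\<^esub> \<in> H" using subgroup.one_closed[OF submodule.axioms(1)[OF H]] by simp
  thus "\<zero>\<^bsub>N\<^esub> \<in> h ` H" unfolding map_zero[symmetric] by (rule imageI)
  show "\<ominus>\<^bsub>N\<^esub> a \<in> h ` H" if "a \<in> h ` H" for a
    using that by (rule imageE) (simp add: map_uminus[symmetric] c S(3))
  show "a \<odot>\<^bsub>N\<^esub> b \<in> h ` H" if "a \<in> carrier k" "b \<in> h ` H" for a b
    using that(2) by (rule imageE) (simp add: map_smult[symmetric] c S(4) that(1))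
  show "a \<oplus>\<^bsub>N\<^esub> b \<in> h ` H" if ab: "a \<in> h ` H" "b \<in> h ` H" for a b
  proof -
    obtain x y where "x \<in> H" "y \<in> H" "a = h x" "b = h y" using ab by blast
    thus ?thesis by (simp add: map_add[symmetric] c S(5))
  qed
qed

lemma kernel_submodule: "submodule {x \<in> carrier M. h x = \<zero>\<^bsub>N\<^esub>} k M"
  by (rule M.submoduleI) (auto simp: map_zero map_uminus map_add map_smult)

end

lemma (in module) carrier_submodule: "submodule (carrier M) R M"
  by (rule submoduleI) auto

lemma (in cring) free_module_module: "module R (free_module R X)"
proof (rule moduleI)
  show "abelian_group (free_module R X)"
  proof (rule abelian_groupI)
    fix f assume "f \<in> carrier (free_module R X)"
    thus "\<exists>g\<in>carrier (free_module R X). g \<oplus>\<^bsub>free_module R X\<^esub> f = \<zero>\<^bsub>free_module R X\<^esub>"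
      by (intro bexI[of _ "\<lambda>x. \<ominus> f x"]) (auto simp: l_neg free_closed)
  qed (auto simp: a_ac free_closed)
qed (auto simp: is_cring l_distr r_distr m_assoc free_closed)

locale quotient = module k M for k :: "('k, 'r) ring_scheme" and M :: "('k, 'm) module" (structure) +
  fixes H assumes sub: "submodule H k M"
begin

sublocale A: abelian_subgroup H M
  by (rule abelian_subgroupI3)
     (auto simp: additive_subgroup_def M.abelian_group_axioms intro: submodule.axioms(1)[OF sub])

abbreviation "Q \<equiv> quotient_module M H"

lemma carrier_Q: "carrier Q = (\<lambda>x. H +> x) ` carrier M"
  by (auto simp: quotient_module_def A_RCOSETS_def')

lemma coset_eq_iff: "x \<in> carrier M \<Longrightarrow> y \<in> carrier M \<Longrightarrow> H +> x = H +> y \<longleftrightarrow> x \<ominus> y \<in> H"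
  unfolding a_minus_def
  using A.a_rcos_module[of y x] A.a_repr_independence'[of x y] A.a_repr_independenceD[of x y] by metis

lemma coset_zero: "\<zero>\<^bsub>Q\<^esub> = H +> \<zero>"
  by (simp add: quotient_module_def A.a_subset)

lemma coset_add: "x \<in> carrier M \<Longrightarrow> y \<in> carrier M \<Longrightarrow> (H +> x) \<oplus>\<^bsub>Q\<^esub> (H +> y) = H +> (x \<oplus> y)"
  by (simp add: quotient_module_def A.a_rcos_sum)

text \<open>Scalar multiplication in \<open>quotient_module\<close> and the map
  \<open>tensor_map\<close> are unions over all representatives of a coset. Such a union collapses
  to one value as soon as the value does not change along \<open>H\<close>.\<close>

lemma coset_const:
  assumes "x \<in> carrier M" "\<And>z. z \<in> H \<Longrightarrow> g (z \<oplus> x) = g x"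
  shows "(\<Union>y\<in>H +> x. g y) = g x"
proof -
  have "(\<Union>y\<in>H +> x. g y) = (\<Union>z\<in>H. g (z \<oplus> x))" by (auto simp: a_r_coset_def')
  also have "\<dots> = (\<Union>z\<in>H. g x)" using assms(2) by (intro SUP_cong) auto
  also have "\<dots> = g x" using A.zero_closed by blast
  finally show ?thesis .
qed

lemma coset_smult:
  assumes "a \<in> carrier k" "x \<in> carrier M" shows "a \<odot>\<^bsub>Q\<^esub> (H +> x) = H +> (a \<odot> x)"
proof -
  have "(\<Union>y\<in>H +> x. H +> (a \<odot> y)) = H +> (a \<odot> x)"
  proof (rule coset_const[OF assms(2)])
    fix z assume z: "z \<in> H"
    hence c: "z \<in> carrier M" by simp
    have "a \<odot> (z \<oplus> x) \<ominus> a \<odot> x = a \<odot> z"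
      using assms c by (simp add: smult_r_distr a_minus_def M.a_assoc M.r_neg)
    thus "H +> (a \<odot> (z \<oplus> x)) = H +> (a \<odot> x)"
      using assms c z submodule.smult_closed[OF sub] by (subst coset_eq_iff) auto
  qed
  thus ?thesis by (simp add: quotient_module_def)
qed

lemma quotient_module: "module k Q"
proof (rule moduleI)
  show "abelian_group Q"
  proof (rule abelian_groupI)
    fix C assume "C \<in> carrier Q"
    then obtain x where x: "x \<in> carrier M" "C = H +> x" by (auto simp: carrier_Q)
    thus "\<exists>y\<in>carrier Q. y \<oplus>\<^bsub>Q\<^esub> C = \<zero>\<^bsub>Q\<^esub>"
      by (intro bexI[of _ "H +> (\<ominus> x)"]) (auto simp: coset_add coset_zero carrier_Q M.l_neg)
  qed (auto simp: carrier_Q coset_zero coset_add M.a_ac)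
qed (auto simp: R.is_cring carrier_Q coset_add coset_smult smult_l_distr smult_r_distr smult_assoc1)

lemma coset_linear: "(\<lambda>x. H +> x) \<in> linear_maps k M Q"
  by (auto intro!: linear_mapsI simp: carrier_Q coset_add coset_smult)

end

text \<open>Bijectivity is phrased through representatives: \<open>h\<close> reflects membership in
  the submodule and reaches every class. This is the form in which a chain map supplies it.\<close>

lemma quotient_map_iso:
  assumes M: "module k M" and N: "module k N" and H: "submodule H k M" and K: "submodule K k N"
    and h: "h \<in> linear_maps k M N"
    and inj: "\<And>x. x \<in> carrier M \<Longrightarrow> h x \<in> K \<longleftrightarrow> x \<in> H"
    and surj: "\<And>y. y \<in> carrier N \<Longrightarrow> \<exists>x\<in>carrier M. y \<ominus>\<^bsub>N\<^esub> h x \<in> K"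
  shows "(\<lambda>C. \<Union>x\<in>C. K +>\<^bsub>N\<^esub> h x) \<in> module_iso k (quotient_module M H) (quotient_module N K)"
    
proof -
  define \<phi> where "\<phi> C = (\<Union>x\<in>C. K +>\<^bsub>N\<^esub> h x)" for C
  interpret M: quotient k M H by (simp add: M H quotient.intro quotient_axioms.intro)
  interpret N: quotient k N K by (simp add: N K quotient.intro quotient_axioms.intro)
  interpret linear_map k M N h by (simp add: M N h linear_map.intro linear_map_axioms.intro)
  have \<phi>: "\<phi> (H +>\<^bsub>M\<^esub> x) = K +>\<^bsub>N\<^esub> h x" if x: "x \<in> carrier M" for x
    unfolding \<phi>_def
  proof (rule M.coset_const[OF x])
    fix z assume z: "z \<in> H"
    hence c: "z \<in> carrier M" by simp
    have "h (z \<oplus>\<^bsub>M\<^esub> x) \<ominus>\<^bsub>N\<^esub> h x = h z"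
      using x c map_closed by (simp add: map_add a_minus_def N.M.a_assoc N.M.r_neg)
    thus "K +>\<^bsub>N\<^esub> h (z \<oplus>\<^bsub>M\<^esub> x) = K +>\<^bsub>N\<^esub> h x"
      using x c z inj map_closed by (subst N.coset_eq_iff) auto
  qed
  have "\<phi> \<in> linear_maps k (quotient_module M H) (quotient_module N K)"
    by (auto intro!: linear_mapsI simp: M.carrier_Q N.carrier_Q \<phi> map_closed M.coset_add N.coset_add
        M.coset_smult N.coset_smult map_add map_smult)
  moreover have "inj_on \<phi> (carrier (quotient_module M H))"
  proof (rule inj_onI, clarsimp simp only: M.carrier_Q \<phi> image_iff bex_simps)
    fix x y assume xy: "x \<in> carrier M" "y \<in> carrier M" "K +>\<^bsub>N\<^esub> h x = K +>\<^bsub>N\<^esub> h y"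
    thus "H +>\<^bsub>M\<^esub> x = H +>\<^bsub>M\<^esub> y"
      by (simp only: M.coset_eq_iff N.coset_eq_iff map_closed inj M.M.minus_closed map_minus[symmetric])
  qed
  moreover have "\<exists>C\<in>carrier (quotient_module M H). D = \<phi> C" if D: "D \<in> carrier (quotient_module N K)" for D
  proof -
    obtain y where y: "y \<in> carrier N" "D = K +>\<^bsub>N\<^esub> y" using D by (auto simp: N.carrier_Q)
    obtain x where x: "x \<in> carrier M" "y \<ominus>\<^bsub>N\<^esub> h x \<in> K" using surj y by blast
    hence "D = \<phi> (H +>\<^bsub>M\<^esub> x)" using y map_closed by (simp add: \<phi> N.coset_eq_iff)
    thus ?thesis using x by (auto simp: M.carrier_Q)
  qed
  ultimately show ?thesis
    unfolding \<phi>_def[abs_def, symmetric] by (auto simp: module_iso_alt bij_betw_def dest: linear_mapsD(1))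
qed

text \<open>The first isomorphism theorem. The second claim records the value on a coset, from which
  the induced differentials are computed later.\<close>

lemma quotient_kernel_iso:
  assumes M: "module k M" and N: "module k N" and h: "h \<in> linear_maps k M N"
    and surj: "h ` carrier M = carrier N" and H: "H = {x \<in> carrier M. h x = \<zero>\<^bsub>N\<^esub>}"
  shows "(\<lambda>C. the_elem (h ` C)) \<in> module_iso k (quotient_module M H) N"
    and "x \<in> carrier M \<Longrightarrow> the_elem (h ` (H +>\<^bsub>M\<^esub> x)) = h x"
proof -
  interpret linear_map k M N h by (simp add: M N h linear_map.intro linear_map_axioms.intro)
  interpret M: quotient k M H using kernel_submodule M H by (simp add: quotient.intro quotient_axioms.intro)
  have \<phi>: "the_elem (h ` (H +>\<^bsub>M\<^esub> x)) = h x" if x: "x \<in> carrier M" for x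
  proof -
    have "h ` (H +>\<^bsub>M\<^esub> x) = (\<Union>y\<in>H +>\<^bsub>M\<^esub> x. {h y})"
      by (rule UNION_singleton_eq_range[symmetric])
    also have "\<dots> = {h x}"
    proof (rule M.coset_const[where g = "\<lambda>y. {h y}", OF x])
      fix z assume "z \<in> H"
      hence "z \<in> carrier M" "h z = \<zero>\<^bsub>N\<^esub>" unfolding H by blast+
      thus "{h (z \<oplus>\<^bsub>M\<^esub> x)} = {h x}" using x map_closed[OF x] by (simp add: map_add)
    qed
    finally show ?thesis by simp
  qed
  show "x \<in> carrier M \<Longrightarrow> the_elem (h ` (H +>\<^bsub>M\<^esub> x)) = h x" by (rule \<phi>)
  define \<psi> where "\<psi> C = the_elem (h ` C)" for C
  have \<psi>: "\<psi> (H +>\<^bsub>M\<^esub> x) = h x" if "x \<in> carrier M" for x using \<phi> that by (simp add: \<psi>_def)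
  have "\<psi> \<in> linear_maps k (quotient_module M H) N"
    by (auto intro!: linear_mapsI simp: M.carrier_Q \<psi> map_closed M.coset_add M.coset_smult map_add map_smult)
  moreover have "inj_on \<psi> (carrier (quotient_module M H))"
  proof (rule inj_onI, clarsimp simp only: M.carrier_Q \<psi> image_iff bex_simps)
    fix x y assume xy: "x \<in> carrier M" "y \<in> carrier M" "h x = h y"
    hence "h (x \<ominus>\<^bsub>M\<^esub> y) = \<zero>\<^bsub>N\<^esub>" using map_closed by (simp add: map_minus) (simp add: a_minus_def N.M.r_neg)
    hence "x \<ominus>\<^bsub>M\<^esub> y \<in> H" unfolding H using xy by simp
    thus "H +>\<^bsub>M\<^esub> x = H +>\<^bsub>M\<^esub> y" using xy by (simp only: M.coset_eq_iff)
  qed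
  moreover have "\<psi> ` carrier (quotient_module M H) = carrier N"
    unfolding M.carrier_Q image_image surj[symmetric] by (rule image_cong[OF refl \<psi>])
  ultimately show "(\<lambda>C. the_elem (h ` C)) \<in> module_iso k (quotient_module M H) N"
    unfolding \<psi>_def[abs_def, symmetric] by (simp add: module_iso_alt bij_betw_def)
qed

lemma module_iso_trans:
  assumes "f \<in> module_iso k L M" "g \<in> module_iso k M N"
  shows "g \<circ> f \<in> module_iso k L N"
proof -
  have l: "f \<in> linear_maps k L M" "g \<in> linear_maps k M N" using assms by (auto simp: module_iso_alt)
  have "g \<circ> f \<in> linear_maps k L N"
    by (rule linear_mapsI) (simp_all add: linear_mapsD[OF l(1)] linear_mapsD[OF l(2)])
  thus ?thesis using assms bij_betw_trans[of f "carrier L" "carrier M" g "carrier N"]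
    by (simp add: module_iso_alt)
qed

lemma module_iso_inv:
  assumes "module k M" and f: "f \<in> module_iso k M N"
  shows "inv_into (carrier M) f \<in> module_iso k N M"
proof -
  interpret M: module k M by fact
  let ?g = "inv_into (carrier M) f"
  have b: "bij_betw f (carrier M) (carrier N)" and l: "f \<in> linear_maps k M N"
    using f by (auto simp: module_iso_alt)
  have N: "carrier N = f ` carrier M" using b by (simp add: bij_betw_def)
  have g: "?g (f x) = x" if "x \<in> carrier M" for x using b that by (simp add: bij_betw_def)
  have "?g \<in> linear_maps k N M"
  proof (rule linear_mapsI)
    show "?g y \<in> carrier M" if "y \<in> carrier N" for y using that g by (auto simp: N)
    show "?g (x \<oplus>\<^bsub>N\<^esub> y) = ?g x \<oplus>\<^bsub>M\<^esub> ?g y" if xy: "x \<in> carrier N" "y \<in> carrier N" for x y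
    proof -
      obtain x' y' where "x' \<in> carrier M" "y' \<in> carrier M" "x = f x'" "y = f y'" using xy by (auto simp: N)
      thus ?thesis using g g[of "x' \<oplus>\<^bsub>M\<^esub> y'"] linear_mapsD(2)[OF l, of x' y'] by simp
    qed
    show "?g (a \<odot>\<^bsub>N\<^esub> y) = a \<odot>\<^bsub>M\<^esub> ?g y" if ay: "a \<in> carrier k" "y \<in> carrier N" for a y
    proof -
      obtain y' where "y' \<in> carrier M" "y = f y'" using ay by (auto simp: N)
      thus ?thesis using g g[of "a \<odot>\<^bsub>M\<^esub> y'"] linear_mapsD(3)[OF l, of a y'] ay by simp
    qed
  qed
  thus ?thesis using bij_betw_inv_into[OF b] by (simp add: module_iso_alt)
qed

text \<open>All chains of degree 0 count as cycles, which merges the two cases of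
  \<open>homology\<close> into the single formula \<open>homology_cycles\<close>.\<close>

definition cycles :: "(nat \<Rightarrow> ('k, 'm) module) \<Rightarrow> (nat \<Rightarrow> 'm \<Rightarrow> 'm) \<Rightarrow> nat \<Rightarrow> 'm set" where
  "cycles C d i = (case i of 0 \<Rightarrow> carrier (C 0)
     | Suc j \<Rightarrow> {x \<in> carrier (C (Suc j)). d j x = \<zero>\<^bsub>C j\<^esub>})"

lemma homology_cycles:
  "homology C d i = quotient_module ((C i)\<lparr>carrier := cycles C d i\<rparr>) (d i ` carrier (C (Suc i)))"
  by (cases i) (simp_all add: cycles_def a_kernel_def')

lemma cycles_subset: "cycles C d i \<subseteq> carrier (C i)"
  by (cases i) (auto simp: cycles_def)

locale k_complex =
  fixes k :: "('k, 'r) ring_scheme" and C :: "nat \<Rightarrow> ('k, 'm) module" and d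
  assumes mod: "\<And>i. module k (C i)" and dlin: "\<And>i. d i \<in> linear_maps k (C (Suc i)) (C i)"
    and dd: "\<And>i x. x \<in> carrier (C (Suc (Suc i))) \<Longrightarrow> d i (d (Suc i) x) = \<zero>\<^bsub>C i\<^esub>"
begin

lemma dmap: "linear_map k (C (Suc i)) (C i) (d i)"
  by (simp add: mod dlin linear_map.intro linear_map_axioms.intro)

lemma cycles_submodule: "submodule (cycles C d i) k (C i)"
proof (cases i)
  case 0 thus ?thesis using module.carrier_submodule[OF mod] by (simp add: cycles_def)
next
  case (Suc j) thus ?thesis using linear_map.kernel_submodule[OF dmap] by (simp add: cycles_def)
qed

lemma boundaries_submodule: "submodule (d i ` carrier (C (Suc i))) k (C i)"
  by (intro linear_map.image_submodule[OF dmap] module.carrier_submodule[OF mod])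

lemma boundary_cycle: "x \<in> carrier (C (Suc i)) \<Longrightarrow> d i x \<in> cycles C d i"
  using linear_map.map_closed[OF dmap] dd by (cases i) (auto simp: cycles_def)

lemma cycles_module: "module k ((C i)\<lparr>carrier := cycles C d i\<rparr>)"
  by (rule submodule.submodule_is_module[OF cycles_submodule mod])

lemma boundaries_submodule_cycles:
  "submodule (d i ` carrier (C (Suc i))) k ((C i)\<lparr>carrier := cycles C d i\<rparr>)"
proof -
  interpret Z: module k "(C i)\<lparr>carrier := cycles C d i\<rparr>" by (rule cycles_module)
  show ?thesis
    using submodule.submodule_is_module[OF boundaries_submodule mod] boundary_cycle
    by (intro Z.module_incl_imp_submodule) auto
qed

end

text \<open>The last two hypotheses express a quasi-isomorphism by elements. They cover isomorphisms
  of complexes as well as homotopy equivalences, and both uses occur.\<close>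

lemma homology_iso:
  assumes C: "k_complex k C d" and D: "k_complex k D e"
    and \<theta>: "\<And>i. \<theta> i \<in> linear_maps k (C i) (D i)"
    and comm: "\<And>i x. x \<in> carrier (C (Suc i)) \<Longrightarrow> \<theta> i (d i x) = e i (\<theta> (Suc i) x)"
    and inj: "\<And>i x. \<lbrakk>x \<in> cycles C d i; \<theta> i x \<in> e i ` carrier (D (Suc i))\<rbrakk> \<Longrightarrow> x \<in> d i ` carrier (C (Suc i))"
    and surj: "\<And>i y. y \<in> cycles D e i \<Longrightarrow>
      \<exists>x\<in>cycles C d i. y \<ominus>\<^bsub>D i\<^esub> \<theta> i x \<in> e i ` carrier (D (Suc i))"
  shows "\<exists>\<phi>. \<phi> \<in> module_iso k (homology C d i) (homology D e i)"
proof -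
  interpret C: k_complex k C d by (rule C)
  interpret D: k_complex k D e by (rule D)
  let ?Z = "(C i)\<lparr>carrier := cycles C d i\<rparr>" and ?W = "(D i)\<lparr>carrier := cycles D e i\<rparr>"
  have lm: "linear_map k (C i) (D i) (\<theta> i)" for i
    by (simp add: C.mod D.mod \<theta> linear_map.intro linear_map_axioms.intro)
  have cyc: "\<theta> i x \<in> cycles D e i" if "x \<in> cycles C d i" for x
    using that linear_mapsD(1)[OF \<theta>] comm linear_map.map_zero[OF lm]
  proof (cases i)
    case (Suc j)
    thus ?thesis using that linear_mapsD(1)[OF \<theta>] comm[of x j] linear_map.map_zero[OF lm, of j]
      by (simp add: cycles_def)
  qed (use that linear_mapsD(1)[OF \<theta>] in \<open>simp add: cycles_def\<close>)
  have Csub: "x \<in> carrier (C i)" if "x \<in> cycles C d i" for x by (rule subsetD[OF cycles_subset that])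
  have lin: "\<theta> i \<in> linear_maps k ?Z ?W"
    by (rule linear_mapsI) (auto simp: cyc Csub linear_mapsD[OF \<theta>])
  interpret W: module k ?W by (rule D.cycles_module)
  interpret Di: module k "D i" by (rule D.mod)
  \<comment> \<open>Negatives in a record are taken relative to its carrier, so differences of
    cycles in the module of cycles have to be matched with differences in the full chain
    module.\<close>
  have minus: "y \<ominus>\<^bsub>?W\<^esub> x = y \<ominus>\<^bsub>D i\<^esub> x" if "x \<in> cycles D e i" "y \<in> cycles D e i" for x y
  proof -
    have "\<ominus>\<^bsub>?W\<^esub> x = \<ominus>\<^bsub>D i\<^esub> x"
      using that W.M.l_neg[of x] W.M.a_inv_closed[of x] cycles_subset[of D e i] by (intro Di.M.minus_equality[symmetric]) auto
    thus ?thesis by (simp add: a_minus_def)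
  qed
  have "(\<lambda>c. \<Union>x\<in>c. (e i ` carrier (D (Suc i))) +>\<^bsub>?W\<^esub> \<theta> i x)
      \<in> module_iso k (homology C d i) (homology D e i)"
    unfolding homology_cycles
  proof (rule quotient_map_iso[OF C.cycles_module D.cycles_module C.boundaries_submodule_cycles
        D.boundaries_submodule_cycles lin])
    fix x assume "x \<in> carrier ?Z"
    hence x: "x \<in> cycles C d i" by simp
    show "\<theta> i x \<in> e i ` carrier (D (Suc i)) \<longleftrightarrow> x \<in> d i ` carrier (C (Suc i))"
      using inj[OF x] comm linear_mapsD(1)[OF \<theta>] by auto
  next
    fix y assume "y \<in> carrier ?W"
    thus "\<exists>x\<in>carrier ?Z. y \<ominus>\<^bsub>?W\<^esub> \<theta> i x \<in> e i ` carrier (D (Suc i))"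
      using surj[of y i] minus cyc by fastforce
  qed
  thus ?thesis by blast
qed

section \<open>Tor of an augmented algebra\<close>

text \<open>Transport of structure: linearity of \<open>d\<close> and the vanishing of its square
  are not assumed but read off \<open>D\<close> through the injective maps
  \<open>\<theta> i\<close>. For tensor products it is then enough to know what
  \<open>tensor_map\<close> becomes under the identification.\<close>

lemma homology_transfer:
  assumes D: "k_complex k D e" and Q: "\<And>i. module k (Q i)"
    and \<theta>: "\<And>i. \<theta> i \<in> module_iso k (Q i) (D i)"
    and d: "\<And>i x. x \<in> carrier (Q (Suc i)) \<Longrightarrow> d i x \<in> carrier (Q i)"
    and comm: "\<And>i x. x \<in> carrier (Q (Suc i)) \<Longrightarrow> \<theta> i (d i x) = e i (\<theta> (Suc i) x)"
  shows "\<exists>\<phi>. \<phi> \<in> module_iso k (homology Q d i) (homology D e i)" and "k_complex k Q d"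
proof -
  interpret D: k_complex k D e by (rule D)
  have lin: "\<theta> i \<in> linear_maps k (Q i) (D i)" for i using \<theta>[of i] by (simp add: module_iso_alt)
  have inj: "inj_on (\<theta> i) (carrier (Q i))" and im: "\<theta> i ` carrier (Q i) = carrier (D i)" for i
    using \<theta>[of i] by (auto simp: module_iso_alt bij_betw_def)
  have lm: "linear_map k (Q i) (D i) (\<theta> i)" for i
    by (simp add: Q D.mod lin linear_map.intro linear_map_axioms.intro)
  note th0 = linear_map.map_zero[OF lm] and thc = linear_map.map_closed[OF lm]
  have zero: "\<zero>\<^bsub>Q i\<^esub> \<in> carrier (Q i)" for i
    using Q by (simp add: abelian_group.axioms(1) abelian_monoid.zero_closed module_def)
  have closed: "x \<oplus>\<^bsub>Q i\<^esub> y \<in> carrier (Q i)" if "x \<in> carrier (Q i)" "y \<in> carrier (Q i)" for x y i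
    using Q that by (simp add: abelian_group.axioms(1) abelian_monoid.a_closed module_def)
  have eq: "x = y" if "\<theta> i x = \<theta> i y" "x \<in> carrier (Q i)" "y \<in> carrier (Q i)" for i x y
    by (rule inj_onD[OF inj that])
  show C: "k_complex k Q d"
  proof (rule k_complex.intro)
    show "module k (Q i)" for i by (rule Q)
    show "d i \<in> linear_maps k (Q (Suc i)) (Q i)" for i
    proof (rule linear_mapsI)
      show "d i x \<in> carrier (Q i)" if "x \<in> carrier (Q (Suc i))" for x by (rule d[OF that])
      show "d i (x \<oplus>\<^bsub>Q (Suc i)\<^esub> y) = d i x \<oplus>\<^bsub>Q i\<^esub> d i y"
        if xy: "x \<in> carrier (Q (Suc i))" "y \<in> carrier (Q (Suc i))" for x y
        by (rule eq[of i]) (simp_all add: xy d closed comm linear_mapsD(2)[OF lin] linear_mapsD(2)[OF D.dlin] thc)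
      show "d i (a \<odot>\<^bsub>Q (Suc i)\<^esub> x) = a \<odot>\<^bsub>Q i\<^esub> d i x"
        if ax: "a \<in> carrier k" "x \<in> carrier (Q (Suc i))" for a x
        by (rule eq[of i]) (simp_all add: ax d module.smult_closed[OF Q] comm linear_mapsD(3)[OF lin]
            linear_mapsD(3)[OF D.dlin] thc)
    qed
    show "d i (d (Suc i) x) = \<zero>\<^bsub>Q i\<^esub>" if "x \<in> carrier (Q (Suc (Suc i)))" for i x
      by (rule eq[of i]) (simp_all add: that d comm th0 zero D.dd thc)
  qed
  show "\<exists>\<phi>. \<phi> \<in> module_iso k (homology Q d i) (homology D e i)"
  proof (rule homology_iso[OF C D, where \<theta> = \<theta>])
    show "\<theta> i \<in> linear_maps k (Q i) (D i)" for i by (rule lin)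
    show "\<theta> i (d i x) = e i (\<theta> (Suc i) x)" if "x \<in> carrier (Q (Suc i))" for i x by (rule comm[OF that])
  next
    fix i x assume x: "x \<in> cycles Q d i" and "\<theta> i x \<in> e i ` carrier (D (Suc i))"
    then obtain w where w: "w \<in> carrier (Q (Suc i))" "\<theta> i x = e i (\<theta> (Suc i) w)"
      unfolding im[of "Suc i", symmetric] by blast
    have "x = d i w" using w subsetD[OF cycles_subset x] by (intro eq[of i]) (simp_all add: comm d)
    thus "x \<in> d i ` carrier (Q (Suc i))" using w by blast
  next
    fix i y assume y: "y \<in> cycles D e i"
    then obtain x where x: "x \<in> carrier (Q i)" "y = \<theta> i x"
      using subsetD[OF cycles_subset y] unfolding im[symmetric] by blast
    have "x \<in> cycles Q d i"
    proof (cases i)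
      case (Suc j)
      have "d j x = \<zero>\<^bsub>Q j\<^esub>"
        using x y comm[of x j] by (intro eq[of j]) (simp_all add: Suc d th0 zero cycles_def)
      thus ?thesis using x by (simp add: cycles_def Suc)
    qed (use x in \<open>simp add: cycles_def\<close>)
    moreover have "y \<ominus>\<^bsub>D i\<^esub> \<theta> i x \<in> e i ` carrier (D (Suc i))"
    proof -
      interpret Di: module k "D i" by (rule D.mod)
      have "y \<ominus>\<^bsub>D i\<^esub> \<theta> i x = \<zero>\<^bsub>D i\<^esub>" using x thc by (simp add: a_minus_def Di.M.r_neg)
      also have "\<dots> = e i \<zero>\<^bsub>D (Suc i)\<^esub>" by (rule linear_map.map_zero[OF D.dmap, symmetric])
      finally show ?thesis using th0[of "Suc i"] thc[OF zero[of "Suc i"]] by (metis imageI)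
    qed
    ultimately show "\<exists>x\<in>cycles Q d i. y \<ominus>\<^bsub>D i\<^esub> \<theta> i x \<in> e i ` carrier (D (Suc i))" by blast
  qed
qed

lemma (in cring) mat_map_linear:
  assumes "\<phi> \<in> X \<rightarrow> carrier (free_module R Y)"
  shows "mat_map R \<phi> \<in> linear_maps R (free_module R X) (free_module R Y)"
proof (rule linear_mapsI)
  fix f g assume f: "f \<in> carrier (free_module R X)" and g: "g \<in> carrier (free_module R X)"
  show "mat_map R \<phi> f \<in> carrier (free_module R Y)" by (rule mat_map_closed[OF f assms])
  show "mat_map R \<phi> (f \<oplus>\<^bsub>free_module R X\<^esub> g) = mat_map R \<phi> f \<oplus>\<^bsub>free_module R Y\<^esub> mat_map R \<phi> g"
    using mat_map_add[OF f g assms] by simp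
next
  fix a f assume a: "a \<in> carrier R" and f: "f \<in> carrier (free_module R X)"
  have "(\<lambda>x. a \<otimes> f x) = (\<lambda>x. f x \<otimes> a)" using a free_closed[OF f] by (simp add: m_comm)
  moreover have "(\<lambda>x. a \<otimes> mat_map R \<phi> f x) = (\<lambda>x. mat_map R \<phi> f x \<otimes> a)"
    using a free_closed[OF mat_map_closed[OF f assms]] by (simp add: m_comm)
  ultimately show "mat_map R \<phi> (a \<odot>\<^bsub>free_module R X\<^esub> f) = a \<odot>\<^bsub>free_module R Y\<^esub> mat_map R \<phi> f"
    using mat_map_smult[OF f a assms] by simp
qed

lemma (in ring) mat_map_zero_left:
  assumes "f \<in> carrier (free_module R X)" "\<And>x. x \<in> X \<Longrightarrow> \<phi> x = (\<lambda>_. \<zero>)"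
  shows "mat_map R \<phi> f = (\<lambda>_. \<zero>)"
proof -
  have "mat_map R \<phi> f y = \<zero>" for y
    unfolding mat_map_def using free_supp[OF assms(1)] assms(2) free_closed[OF assms(1)]
    by (intro add.finprod_one_eqI) auto
  thus ?thesis by blast
qed

section \<open>Tensor products of free modules with the module of an augmentation\<close>

lemma generated_submodule:
  assumes "module k M" "S \<subseteq> carrier M"
  shows "submodule (generated_submodule k M S) k M" "S \<subseteq> generated_submodule k M S"
proof -
  interpret module k M by fact
  let ?G = "generated_submodule k M S"
  have c: "submodule (carrier M) k M" by (rule carrier_submodule)
  show "S \<subseteq> ?G" by (auto simp: generated_submodule_def)
  show "submodule ?G k M"
  proof (rule submoduleI)
    show "?G \<subseteq> carrier M" using c assms(2) by (auto simp: generated_submodule_def)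
    show "\<zero>\<^bsub>M\<^esub> \<in> ?G"
      using subgroup.one_closed[OF submodule.axioms(1)] by (fastforce simp: generated_submodule_def)
    show "\<ominus>\<^bsub>M\<^esub> a \<in> ?G" if "a \<in> ?G" for a
      using that submoduleE(3) unfolding generated_submodule_def by blast
    show "a \<oplus>\<^bsub>M\<^esub> b \<in> ?G" if "a \<in> ?G" "b \<in> ?G" for a b
      using that submoduleE(5) unfolding generated_submodule_def by blast
    show "a \<odot>\<^bsub>M\<^esub> b \<in> ?G" if "a \<in> carrier k" "b \<in> ?G" for a b
      using that submoduleE(4) unfolding generated_submodule_def by blast
  qed
qed

lemma generated_submodule_least:
  "submodule H k M \<Longrightarrow> S \<subseteq> H \<Longrightarrow> generated_submodule k M S \<subseteq> H"
  by (auto simp: generated_submodule_def)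

text \<open>The trivial modules in a form that depends on the algebra only through its augmentation.
  As with \<open>trivial_module\<close>, commutativity of \<open>k\<close> lets one record serve on
  both sides.\<close>

definition char_module :: "('k, 'r) ring_scheme \<Rightarrow> ('a \<Rightarrow> 'k) \<Rightarrow> ('a, 'k) module" where
  "char_module k \<epsilon> = \<lparr>carrier = carrier k, monoid.mult = monoid.mult k, one = \<one>\<^bsub>k\<^esub>,
     ring.zero = \<zero>\<^bsub>k\<^esub>, add = add k, smult = (\<lambda>a x. \<epsilon> a \<otimes>\<^bsub>k\<^esub> x)\<rparr>"

lemma char_module_simps [simp]:
  "carrier (char_module k \<epsilon>) = carrier k" "\<zero>\<^bsub>char_module k \<epsilon>\<^esub> = \<zero>\<^bsub>k\<^esub>"
  "add (char_module k \<epsilon>) = add k" "a \<odot>\<^bsub>char_module k \<epsilon>\<^esub> x = \<epsilon> a \<otimes>\<^bsub>k\<^esub> x"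
  by (simp_all add: char_module_def)

lemma tensor_relations_subsetI:
  fixes k :: "('k, 'r) ring_scheme" and A :: "('k, 'a) module"
    and M :: "('a, 'm) module" and N :: "('a, 'n) module"
  defines "P \<equiv> free_module k (carrier M \<times> carrier N)"
  assumes "\<And>x x' y. \<lbrakk>x \<in> carrier M; x' \<in> carrier M; y \<in> carrier N\<rbrakk> \<Longrightarrow>
      basis_vec k (x \<oplus>\<^bsub>M\<^esub> x', y) \<ominus>\<^bsub>P\<^esub> (basis_vec k (x, y) \<oplus>\<^bsub>P\<^esub> basis_vec k (x', y)) \<in> Z"
    and "\<And>x y y'. \<lbrakk>x \<in> carrier M; y \<in> carrier N; y' \<in> carrier N\<rbrakk> \<Longrightarrow>
      basis_vec k (x, y \<oplus>\<^bsub>N\<^esub> y') \<ominus>\<^bsub>P\<^esub> (basis_vec k (x, y) \<oplus>\<^bsub>P\<^esub> basis_vec k (x, y')) \<in> Z"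
    and "\<And>a x y. \<lbrakk>a \<in> carrier A; x \<in> carrier M; y \<in> carrier N\<rbrakk> \<Longrightarrow>
      basis_vec k (a \<odot>\<^bsub>M\<^esub> x, y) \<ominus>\<^bsub>P\<^esub> basis_vec k (x, a \<odot>\<^bsub>N\<^esub> y) \<in> Z"
    and "\<And>c x y. \<lbrakk>c \<in> carrier k; x \<in> carrier M; y \<in> carrier N\<rbrakk> \<Longrightarrow>
      basis_vec k ((c \<odot>\<^bsub>A\<^esub> \<one>\<^bsub>A\<^esub>) \<odot>\<^bsub>M\<^esub> x, y) \<ominus>\<^bsub>P\<^esub> c \<odot>\<^bsub>P\<^esub> basis_vec k (x, y) \<in> Z"
  shows "tensor_relations k A M N \<subseteq> Z"
  unfolding tensor_relations_def Let_def P_def[symmetric] using assms(2-5) by blast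

locale augmented_algebra = k: cring k + A: ring A
  for k :: "('k, 'r) ring_scheme" and A :: "('k, 'a) module" and \<epsilon> +
  assumes aug: "\<epsilon> \<in> ring_hom A k"
    and unit_closed: "c \<in> carrier k \<Longrightarrow> c \<odot>\<^bsub>A\<^esub> \<one>\<^bsub>A\<^esub> \<in> carrier A"
    and aug_unit: "c \<in> carrier k \<Longrightarrow> \<epsilon> (c \<odot>\<^bsub>A\<^esub> \<one>\<^bsub>A\<^esub>) = c"
begin

lemma aug_hom: "ring_hom_ring A k \<epsilon>"
  by (simp add: aug A.ring_axioms k.ring_axioms ring_hom_ring.intro ring_hom_ring_axioms.intro)

lemmas aug_closed = ring_hom_ring.homh[OF aug_hom, THEN ring_hom_closed]
lemmas aug_mult = ring_hom_mult[OF aug]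
lemmas aug_add = ring_hom_add[OF aug]
lemmas aug_one = ring_hom_one[OF aug]

lemma aug_zero: "\<epsilon> \<zero>\<^bsub>A\<^esub> = \<zero>\<^bsub>k\<^esub>"
  by (rule ring_hom_zero[OF aug A.ring_axioms k.ring_axioms])

abbreviation "N \<equiv> char_module k \<epsilon>"

lemma right_module_N: "right_module A N"
proof (intro right_module.intro right_module_axioms.intro)
  show "abelian_group N"
  proof (rule abelian_groupI)
    fix x assume "x \<in> carrier N"
    thus "\<exists>y\<in>carrier N. y \<oplus>\<^bsub>N\<^esub> x = \<zero>\<^bsub>N\<^esub>"
      using k.l_neg[of x] k.a_inv_closed[of x] unfolding char_module_simps by blast
  qed (auto simp: k.a_ac)
qed (auto simp: A.ring_axioms aug_closed aug_add aug_mult aug_one k.l_distr k.r_distr k.m_ac)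

text \<open>The value on an elementary tensor \<open>f \<otimes> y\<close> of the isomorphism from
  the tensor product of the free right module on \<open>X\<close> with \<open>k\<close> to the free
  \<open>k\<close>-module on \<open>X\<close>.\<close>

definition tens_vec :: "('x \<Rightarrow> 'a) \<times> 'k \<Rightarrow> 'x \<Rightarrow> 'k" where
  "tens_vec p = (\<lambda>x. \<epsilon> (fst p x) \<otimes>\<^bsub>k\<^esub> snd p)"

abbreviation F where "F X \<equiv> free_right_module A X"
abbreviation P where "P X \<equiv> free_module k (carrier (F X) \<times> carrier k)"
abbreviation W where "W X \<equiv> tensor_kernel k A (F X) N"

lemma tens_vec: "tens_vec \<in> carrier (F X) \<times> carrier k \<rightarrow> carrier (free_module k X)"
  unfolding tens_vec_def
  by (auto intro!: k.free_smult_right hom_free[OF A.ring_axioms k.ring_axioms aug])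

lemma P_module: "module k (P X)" and K_module: "module k (free_module k X)"
  by (rule k.free_module_module)+

lemma ev_linear: "linear_map k (P X) (free_module k X) (mat_map k tens_vec)"
  by (intro linear_map.intro linear_map_axioms.intro P_module K_module k.mat_map_linear[OF tens_vec])

lemma ev_basis:
  assumes "m \<in> carrier (F X)" "y \<in> carrier k"
  shows "mat_map k tens_vec (basis_vec k (m, y)) = tens_vec (m, y)"
proof (rule k.mat_map_basis)
  show "tens_vec (m, y) \<in> carrier (free_module k X)" by (rule funcset_mem[OF tens_vec]) (use assms in simp)
qed

lemma P_basis: "m \<in> carrier (F X) \<Longrightarrow> y \<in> carrier k \<Longrightarrow> basis_vec k (m, y) \<in> carrier (P X)"
  by (rule k.basis_vec_free) simp

lemma relations_subset: "tensor_relations k A (F X) N \<subseteq> carrier (P X)"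
proof -
  interpret P: module k "P X" by (rule P_module)
  have c: "a \<odot>\<^bsub>F X\<^esub> m \<in> carrier (F X)" if "a \<in> carrier A" "m \<in> carrier (F X)" for a m
    using that by simp
  have s: "m \<oplus>\<^bsub>F X\<^esub> m' \<in> carrier (F X)" if "m \<in> carrier (F X)" "m' \<in> carrier (F X)" for m m'
    using that by simp
  show ?thesis
    by (rule tensor_relations_subsetI; unfold char_module_simps;
      intro P.M.minus_closed P.M.add.m_closed P.smult_closed P_basis c s unit_closed k.a_closed k.m_closed aug_closed;
      assumption)
qed

lemma W_submodule: "submodule (W X) k (P X)"
  and relations_W: "tensor_relations k A (F X) N \<subseteq> W X"
  unfolding tensor_kernel_def char_module_simps by (intro generated_submodule P_module relations_subset)+

text \<open>That evaluation kills the relations is a direct check. Conversely, modulo the relations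
  every element equals a canonical lift of its evaluation, so an element with evaluation zero is a
  consequence of the relations.\<close>

lemma W_eq:
  fixes X :: "'x set"
  shows "W X = {f \<in> carrier (P X). mat_map k tens_vec f = (\<lambda>_. \<zero>\<^bsub>k\<^esub>)}" (is "_ = ?Z")
proof
  interpret ev: linear_map k "P X" "free_module k X" "mat_map k tens_vec" by (rule ev_linear)
  have Z: "submodule ?Z k (P X)" using ev.kernel_submodule by simp
  have c: "tens_vec (m, y) x \<in> carrier k" if "m \<in> carrier (F X)" "y \<in> carrier k" for m x and y
    using that by (simp add: tens_vec_def aug_closed A.free_closed)
  have Fc: "m x \<in> carrier A" if "m \<in> carrier (F X)" for m x using that by (simp add: A.free_closed)
  have Zm: "f \<ominus>\<^bsub>P X\<^esub> g \<in> ?Z"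
    if "f \<in> carrier (P X)" "g \<in> carrier (P X)" "mat_map k tens_vec f = mat_map k tens_vec g" for f g
  proof -
    have "mat_map k tens_vec (f \<ominus>\<^bsub>P X\<^esub> g) = mat_map k tens_vec g \<ominus>\<^bsub>free_module k X\<^esub> mat_map k tens_vec g"
      using that by (simp only: ev.map_minus)
    also have "\<dots> = \<zero>\<^bsub>free_module k X\<^esub>"
      using ev.map_closed[OF that(2)] by (simp only: a_minus_def ev.N.M.r_neg)
    finally show ?thesis using ev.M.M.minus_closed[OF that(1,2)] by simp
  qed
  have Fs: "a \<odot>\<^bsub>F X\<^esub> m \<in> carrier (F X)" if "a \<in> carrier A" "m \<in> carrier (F X)" for a m
    using that by simp
  have Fa: "m \<oplus>\<^bsub>F X\<^esub> m' \<in> carrier (F X)" if "m \<in> carrier (F X)" "m' \<in> carrier (F X)" for m m'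
    using that by simp
  note closed = P_basis Fs Fa k.a_closed k.m_closed aug_closed unit_closed ev.M.smult_closed ev.M.M.add.m_closed
  have "tensor_relations k A (F X) N \<subseteq> ?Z"
  proof (rule tensor_relations_subsetI; unfold char_module_simps)
    fix m m' y assume *: "m \<in> carrier (F X)" "m' \<in> carrier (F X)" "y \<in> carrier k"
    show "basis_vec k (m \<oplus>\<^bsub>F X\<^esub> m', y) \<ominus>\<^bsub>P X\<^esub> (basis_vec k (m, y) \<oplus>\<^bsub>P X\<^esub> basis_vec k (m', y)) \<in> ?Z"
      by (intro Zm closed * ; simp only: ev.map_add ev_basis[where X = X] closed *)
        (simp add: tens_vec_def aug_add Fc[OF *(1)] Fc[OF *(2)] aug_closed * k.l_distr)
  next
    fix m y y' assume *: "m \<in> carrier (F X)" "y \<in> carrier k" "y' \<in> carrier k"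
    show "basis_vec k (m, y \<oplus>\<^bsub>k\<^esub> y') \<ominus>\<^bsub>P X\<^esub> (basis_vec k (m, y) \<oplus>\<^bsub>P X\<^esub> basis_vec k (m, y')) \<in> ?Z"
      by (intro Zm closed * ; simp only: ev.map_add ev_basis[where X = X] closed *)
        (simp add: tens_vec_def Fc[OF *(1)] aug_closed * k.r_distr)
  next
    fix a m y assume *: "a \<in> carrier A" "m \<in> carrier (F X)" "y \<in> carrier k"
    show "basis_vec k (a \<odot>\<^bsub>F X\<^esub> m, y) \<ominus>\<^bsub>P X\<^esub> basis_vec k (m, \<epsilon> a \<otimes>\<^bsub>k\<^esub> y) \<in> ?Z"
      by (intro Zm closed * ; simp only: ev_basis[where X = X] closed *)
        (simp add: tens_vec_def aug_mult Fc[OF *(2)] aug_closed * k.m_ac)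
  next
    fix c m y assume *: "c \<in> carrier k" "m \<in> carrier (F X)" "y \<in> carrier k"
    show "basis_vec k ((c \<odot>\<^bsub>A\<^esub> \<one>\<^bsub>A\<^esub>) \<odot>\<^bsub>F X\<^esub> m, y) \<ominus>\<^bsub>P X\<^esub> c \<odot>\<^bsub>P X\<^esub> basis_vec k (m, y) \<in> ?Z"
      by (intro Zm closed * ; simp only: ev.map_smult ev_basis[where X = X] closed *)
        (simp add: tens_vec_def aug_mult aug_unit unit_closed Fc[OF *(2)] aug_closed * k.m_ac)
  qed
  thus "W X \<subseteq> ?Z" unfolding tensor_kernel_def char_module_simps by (intro generated_submodule_least Z)
  interpret q: quotient k "P X" "W X" by (intro quotient.intro quotient_axioms.intro P_module W_submodule)
  let ?q = "\<lambda>f. W X +>\<^bsub>P X\<^esub> f"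
  interpret ql: linear_map k "P X" "q.Q" ?q
    by (intro linear_map.intro linear_map_axioms.intro P_module q.quotient_module q.coset_linear)
  have rel: "?q f = ?q g" if "f \<ominus>\<^bsub>P X\<^esub> g \<in> tensor_relations k A (F X) N" "f \<in> carrier (P X)" "g \<in> carrier (P X)" for f g
    using subsetD[OF relations_W that(1)] that(2,3) by (simp only: q.coset_eq_iff)
  have rel1: "?q (basis_vec k (m \<oplus>\<^bsub>F X\<^esub> m', y)) = ?q (basis_vec k (m, y)) \<oplus>\<^bsub>q.Q\<^esub> ?q (basis_vec k (m', y))"
    if *: "m \<in> carrier (F X)" "m' \<in> carrier (F X)" "y \<in> carrier k" for m m' y
  proof -
    have "?q (basis_vec k (m \<oplus>\<^bsub>F X\<^esub> m', y)) = ?q (basis_vec k (m, y) \<oplus>\<^bsub>P X\<^esub> basis_vec k (m', y))"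
      by (rule rel; (intro closed *)?)
        (unfold tensor_relations_def Let_def char_module_simps, use * in blast)
    thus ?thesis by (simp only: ql.map_add closed *)
  qed
  have rel3: "?q (basis_vec k (a \<odot>\<^bsub>F X\<^esub> m, y)) = ?q (basis_vec k (m, \<epsilon> a \<otimes>\<^bsub>k\<^esub> y))"
    if *: "a \<in> carrier A" "m \<in> carrier (F X)" "y \<in> carrier k" for a m y
    by (rule rel; (intro closed *)?)
      (unfold tensor_relations_def Let_def char_module_simps, use * in blast)
  have rel4: "?q (basis_vec k ((c \<odot>\<^bsub>A\<^esub> \<one>\<^bsub>A\<^esub>) \<odot>\<^bsub>F X\<^esub> m, y)) = c \<odot>\<^bsub>q.Q\<^esub> ?q (basis_vec k (m, y))"
    if *: "c \<in> carrier k" "m \<in> carrier (F X)" "y \<in> carrier k" for c m y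
  proof -
    have "?q (basis_vec k ((c \<odot>\<^bsub>A\<^esub> \<one>\<^bsub>A\<^esub>) \<odot>\<^bsub>F X\<^esub> m, y)) = ?q (c \<odot>\<^bsub>P X\<^esub> basis_vec k (m, y))"
      by (rule rel; (intro closed *)?)
        (unfold tensor_relations_def Let_def char_module_simps, use * in blast)
    thus ?thesis by (simp only: ql.map_smult closed *)
  qed
  \<comment> \<open>The canonical lift: it sends the basis vector at \<open>x\<close> to the
    elementary tensor of the basis vector at \<open>x\<close> with one.\<close>
  define s :: "('x \<Rightarrow> 'k) \<Rightarrow> ('x \<Rightarrow> 'a) \<times> 'k \<Rightarrow> 'k"
    where "s = mat_map k (\<lambda>x. basis_vec k (basis_vec A x, \<one>\<^bsub>k\<^esub>))"
  have bF: "x \<in> X \<Longrightarrow> basis_vec A x \<in> carrier (F X)" for x by simp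
  have smat: "(\<lambda>x. basis_vec k (basis_vec A x, \<one>\<^bsub>k\<^esub>)) \<in> X \<rightarrow> carrier (P X)"
    by (intro Pi_I P_basis bF k.one_closed)
  interpret s: linear_map k "free_module k X" "P X" s
    unfolding s_def by (intro linear_map.intro linear_map_axioms.intro P_module K_module k.mat_map_linear[OF smat])
  have tc: "tens_vec (m, y) \<in> carrier (free_module k X)" if "m \<in> carrier (F X)" "y \<in> carrier k" for m and y
    by (rule funcset_mem[OF tens_vec]) (use that in simp)
  \<comment> \<open>Induction on the left factor. Sums are split by the first relation; in a vector
    with one entry the entry is moved to the right factor, where it acts through
    \<open>\<epsilon>\<close>.\<close>
  have q_basis: "?q (basis_vec k (m, y)) = ?q (s (tens_vec (m, y)))" if m: "m \<in> carrier (F X)" and y: "y \<in> carrier k" for m y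
  proof -
    have "m \<in> carrier (free_module A X)" using m by simp
    thus ?thesis
    proof (induction rule: A.free_induct)
      case zero
      have z: "\<zero>\<^bsub>F X\<^esub> \<in> carrier (F X)" by simp
      have zz: "\<zero>\<^bsub>F X\<^esub> \<oplus>\<^bsub>F X\<^esub> \<zero>\<^bsub>F X\<^esub> = \<zero>\<^bsub>F X\<^esub>" by simp
      let ?b = "?q (basis_vec k (\<zero>\<^bsub>F X\<^esub>, y))"
      have bc: "?b \<in> carrier q.Q" by (intro ql.map_closed closed z y)
      \<comment> \<open>An element equal to its own double is zero; there is no separate relation
        for zero vectors.\<close>
      have "?b = ?b \<oplus>\<^bsub>q.Q\<^esub> ?b" using rel1[OF z z y] unfolding zz .
      hence b0: "?b = \<zero>\<^bsub>q.Q\<^esub>" using bc ql.N.M.add.r_cancel_one' by metis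
      have "tens_vec (\<zero>\<^bsub>F X\<^esub>, y) = \<zero>\<^bsub>free_module k X\<^esub>" using y by (simp add: tens_vec_def aug_zero)
      hence "?q (s (tens_vec (\<zero>\<^bsub>F X\<^esub>, y))) = \<zero>\<^bsub>q.Q\<^esub>" by (simp only: s.map_zero ql.map_zero)
      thus ?case using b0 by simp
    next
      case (add f g)
      have fg: "f \<in> carrier (F X)" "g \<in> carrier (F X)" using add(1,2) by simp_all
      have "tens_vec (f \<oplus>\<^bsub>F X\<^esub> g, y) = tens_vec (f, y) \<oplus>\<^bsub>free_module k X\<^esub> tens_vec (g, y)"
        using fg y by (simp add: tens_vec_def A.free_closed[OF add(1)] A.free_closed[OF add(2)] aug_add aug_closed k.l_distr)
      hence "?q (basis_vec k (f \<oplus>\<^bsub>F X\<^esub> g, y)) = ?q (s (tens_vec (f \<oplus>\<^bsub>F X\<^esub> g, y)))"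
        by (simp only: rel1 fg y add(3,4) s.map_add ql.map_add tc s.map_closed)
      thus ?case by simp
    next
      case (single x a)
      define c where "c = \<epsilon> a \<otimes>\<^bsub>k\<^esub> y"
      have c: "c \<in> carrier k" using single y by (simp add: c_def aug_closed)
      have bx: "basis_vec A x \<in> carrier (F X)" by (rule bF[OF single(1)])
      have sb: "single_vec A x a = a \<odot>\<^bsub>F X\<^esub> basis_vec A x"
        using single by (simp add: single_vec_def basis_vec_def fun_eq_iff)
      have 1: "?q (basis_vec k (single_vec A x a, y)) = ?q (basis_vec k (basis_vec A x, c))"
        unfolding sb c_def by (rule rel3[OF single(2) bx y])
      have cc: "\<epsilon> (c \<odot>\<^bsub>A\<^esub> \<one>\<^bsub>A\<^esub>) \<otimes>\<^bsub>k\<^esub> \<one>\<^bsub>k\<^esub> = c" using c by (simp add: aug_unit)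
      have 2: "?q (basis_vec k (basis_vec A x, c)) = c \<odot>\<^bsub>q.Q\<^esub> ?q (basis_vec k (basis_vec A x, \<one>\<^bsub>k\<^esub>))"
        using rel3[OF unit_closed[OF c] bx k.one_closed] rel4[OF c bx k.one_closed] unfolding cc by simp
      have "tens_vec (single_vec A x a, y) = c \<odot>\<^bsub>free_module k X\<^esub> basis_vec k x"
        using single y c by (simp add: tens_vec_def single_vec_def basis_vec_def c_def aug_zero fun_eq_iff)
      moreover have "s (basis_vec k x) = basis_vec k (basis_vec A x, \<one>\<^bsub>k\<^esub>)"
        unfolding s_def by (rule k.mat_map_basis) (rule funcset_mem[OF smat single(1)])
      ultimately have "?q (s (tens_vec (single_vec A x a, y))) = c \<odot>\<^bsub>q.Q\<^esub> ?q (basis_vec k (basis_vec A x, \<one>\<^bsub>k\<^esub>))"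
        using k.basis_vec_free[OF single(1)] by (simp only: s.map_smult ql.map_smult c closed bx k.one_closed)
      thus ?case using 1 2 by simp
    qed
  qed
  have q_all: "?q f = ?q (s (mat_map k tens_vec f))" if "f \<in> carrier (P X)" for f
    using that
  proof (induction rule: k.free_induct)
    case zero show ?case using s.map_zero ev.map_zero by simp
  next
    case (add f g)
    have "?q (f \<oplus>\<^bsub>P X\<^esub> g) = ?q (s (mat_map k tens_vec (f \<oplus>\<^bsub>P X\<^esub> g)))"
      by (simp only: ql.map_add ev.map_add s.map_add add ev.map_closed s.map_closed)
    thus ?case by simp
  next
    case (single p a)
    obtain m y where p: "p = (m, y)" "m \<in> carrier (F X)" "y \<in> carrier k" using single(1) by (cases p) simp
    have "single_vec k p a = a \<odot>\<^bsub>P X\<^esub> basis_vec k p"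
      using single by (simp add: single_vec_def basis_vec_def fun_eq_iff)
    thus ?case unfolding p(1)
      by (simp only: ql.map_smult ev.map_smult s.map_smult single p closed q_basis ev_basis[where X = X] tc s.map_closed)
  qed
  show "?Z \<subseteq> W X"
  proof
    fix f assume f: "f \<in> ?Z"
    hence fc: "f \<in> carrier (P X)" by simp
    have "?q f = ?q (s \<zero>\<^bsub>free_module k X\<^esub>)" using f q_all[of f] by simp
    hence "?q f = ?q \<zero>\<^bsub>P X\<^esub>" by (simp only: s.map_zero)
    also have "\<dots> = W X" by (rule ev.M.M.a_coset_add_zero[OF q.A.a_subset])
    finally show "f \<in> W X" using q.A.a_rcos_self[OF fc] by simp
  qed
qed

lemma ev_surj: "mat_map k tens_vec ` carrier (P X) = carrier (free_module k X)"
proof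
  interpret ev: linear_map k "P X" "free_module k X" "mat_map k tens_vec" by (rule ev_linear)
  show "mat_map k tens_vec ` carrier (P X) \<subseteq> carrier (free_module k X)" using ev.map_closed by blast
  show "carrier (free_module k X) \<subseteq> mat_map k tens_vec ` carrier (P X)"
  proof
    fix w assume w: "w \<in> carrier (free_module k X)"
    let ?s = "\<lambda>x. basis_vec k (basis_vec A x, \<one>\<^bsub>k\<^esub>)"
    have bF: "x \<in> X \<Longrightarrow> basis_vec A x \<in> carrier (F X)" for x by simp
    have smat: "?s \<in> X \<rightarrow> carrier (P X)" by (intro Pi_I P_basis bF k.one_closed)
    have "mat_map k tens_vec (mat_map k ?s w) = mat_map k (\<lambda>x. mat_map k tens_vec (?s x)) w"
      by (rule k.mat_map_comp[OF w smat tens_vec])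
    also have "\<dots> = mat_map k (basis_vec k) w"
    proof (rule k.mat_map_cong[OF w])
      fix x assume x: "x \<in> X"
      show "mat_map k tens_vec (?s x) = basis_vec k x"
        unfolding ev_basis[OF bF[OF x] k.one_closed]
        by (simp add: tens_vec_def basis_vec_def aug_one aug_zero fun_eq_iff)
    next
      show "basis_vec k \<in> X \<rightarrow> carrier (free_module k X)" by simp
    qed
    also have "\<dots> = w" by (rule k.mat_map_basis_id[OF w])
    finally have "w = mat_map k tens_vec (mat_map k ?s w)" by (rule sym)
    thus "w \<in> mat_map k tens_vec ` carrier (P X)" by (rule image_eqI[OF _ k.mat_map_closed[OF w smat]])
  qed
qed

definition \<Theta> :: "(('x \<Rightarrow> 'a) \<times> 'k \<Rightarrow> 'k) set \<Rightarrow> 'x \<Rightarrow> 'k" where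
  "\<Theta> C = the_elem (mat_map k tens_vec ` C)"

lemma \<Theta>_iso: "\<Theta> \<in> module_iso k (tensor_product k A (F X) N) (free_module k X)"
  and \<Theta>_coset: "f \<in> carrier (P X) \<Longrightarrow> \<Theta> (W X +>\<^bsub>P X\<^esub> f) = mat_map k tens_vec f"
proof -
  note * = quotient_kernel_iso[OF P_module K_module linear_map.lin[OF ev_linear] ev_surj, of "W X"]
  have W: "W X = {x \<in> carrier (P X). mat_map k tens_vec x = \<zero>\<^bsub>free_module k X\<^esub>}"
    unfolding W_eq by simp
  show "\<Theta> \<in> module_iso k (tensor_product k A (F X) N) (free_module k X)"
    unfolding \<Theta>_def[abs_def] tensor_product_def char_module_simps by (rule *(1)[OF W])
  show "f \<in> carrier (P X) \<Longrightarrow> \<Theta> (W X +>\<^bsub>P X\<^esub> f) = mat_map k tens_vec f"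
    unfolding \<Theta>_def by (rule *(2)[OF W])
qed

text \<open>Let \<open>\<phi>\<close> be a matrix over \<open>k\<close> that describes
  \<open>h\<close> after the coefficients are augmented. Then evaluation turns the map induced by
  \<open>h\<close> into \<open>\<phi>\<close>. The map \<open>push\<close> lifts it to formal
  combinations of pairs, and well-definedness on cosets follows from the description of
  \<open>W\<close> as a kernel.\<close>

lemma tensor_map_coset:
  fixes X :: "'x set" and X' :: "'y set" and h :: "('x \<Rightarrow> 'a) \<Rightarrow> 'y \<Rightarrow> 'a"
  assumes h: "\<And>m. m \<in> carrier (F X) \<Longrightarrow> h m \<in> carrier (F X')"
    and \<phi>: "\<phi> \<in> X \<rightarrow> carrier (free_module k X')"
    and h\<phi>: "\<And>m. m \<in> carrier (F X) \<Longrightarrow> mat_map k \<phi> (\<lambda>x. \<epsilon> (m x)) = (\<lambda>x. \<epsilon> (h m x))"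
    and f: "f \<in> carrier (P X)"
  shows "\<exists>g\<in>carrier (P X'). tensor_map k A (F X') N h (W X +>\<^bsub>P X\<^esub> f) = W X' +>\<^bsub>P X'\<^esub> g \<and>
    mat_map k tens_vec g = mat_map k \<phi> (mat_map k tens_vec f)"
proof -
  define push :: "(('x \<Rightarrow> 'a) \<times> 'k \<Rightarrow> 'k) \<Rightarrow> ('y \<Rightarrow> 'a) \<times> 'k \<Rightarrow> 'k"
    where "push = mat_map k (\<lambda>p. basis_vec k (h (fst p), snd p))"
  have pm: "(\<lambda>p. basis_vec k (h (fst p), snd p :: 'k)) \<in> carrier (F X) \<times> carrier k \<rightarrow> carrier (P X')"
    by (intro Pi_I P_basis) (auto intro!: h[simplified])
  interpret ev': linear_map k "P X'" "free_module k X'" "mat_map k tens_vec" by (rule ev_linear)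
  interpret ev: linear_map k "P X" "free_module k X" "mat_map k tens_vec" by (rule ev_linear)
  interpret W: quotient k "P X" "W X" by (intro quotient.intro quotient_axioms.intro P_module W_submodule)
  interpret W': quotient k "P X'" "W X'" by (intro quotient.intro quotient_axioms.intro P_module W_submodule)
  have pc: "push g \<in> carrier (P X')" if "g \<in> carrier (P X)" for g
    unfolding push_def by (rule k.mat_map_closed[OF that pm])
  have tv: "tens_vec (m, y) \<in> carrier (free_module k X)" if "m \<in> carrier (F X)" "y \<in> carrier k" for m and y
    by (rule funcset_mem[OF tens_vec]) (use that in simp)
  have ev_push: "mat_map k tens_vec (push g) = mat_map k \<phi> (mat_map k tens_vec g)" if g: "g \<in> carrier (P X)" for g
  proof -
    have "mat_map k tens_vec (push g) = mat_map k (\<lambda>p. mat_map k tens_vec (basis_vec k (h (fst p), snd p))) g"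
      unfolding push_def by (rule k.mat_map_comp[OF g pm tens_vec])
    also have "\<dots> = mat_map k (\<lambda>p. mat_map k \<phi> (tens_vec p)) g"
    proof (rule k.mat_map_cong[OF g])
      fix p :: "('x \<Rightarrow> 'a) \<times> 'k" assume p: "p \<in> carrier (F X) \<times> carrier k"
      obtain m y where [simp]: "p = (m, y)" and m: "m \<in> carrier (F X)" and y: "y \<in> carrier k"
        using p by (cases p) simp
      have mf: "m \<in> carrier (free_module A X)" using m by simp
      note em = hom_free[OF A.ring_axioms k.ring_axioms aug mf]
      have "mat_map k \<phi> (tens_vec p) = (\<lambda>x. mat_map k \<phi> (\<lambda>x. \<epsilon> (m x)) x \<otimes>\<^bsub>k\<^esub> y)"
        using k.mat_map_smult[OF em y \<phi>] by (simp add: tens_vec_def)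
      also have "\<dots> = tens_vec (h m, y)" unfolding h\<phi>[OF m] by (simp add: tens_vec_def)
      also have "\<dots> = mat_map k tens_vec (basis_vec k (h m, y))" by (rule ev_basis[OF h[OF m] y, symmetric])
      finally show "mat_map k tens_vec (basis_vec k (h (fst p), snd p)) = mat_map k \<phi> (tens_vec p)" by simp
    next
      show "(\<lambda>p. mat_map k \<phi> (tens_vec p)) \<in> carrier (F X) \<times> carrier k \<rightarrow> carrier (free_module k X')"
        by (rule Pi_I) (rule k.mat_map_closed[OF funcset_mem[OF tens_vec] \<phi>])
    qed
    also have "\<dots> = mat_map k \<phi> (mat_map k tens_vec g)"
      by (rule k.mat_map_comp[OF g tens_vec \<phi>, symmetric])
    finally show ?thesis .
  qed
  \<comment> \<open>The sum over a fibre of \<open>h\<close> in \<open>tensor_map\<close> is the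
    linear extension of the map of pairs that applies \<open>h\<close> to the first
    component.\<close>
  have push: "(\<lambda>(x', y). \<Oplus>\<^bsub>k\<^esub>x\<in>{x. g (x, y) \<noteq> \<zero>\<^bsub>k\<^esub> \<and> h x = x'}. g (x, y)) = push g" if g: "g \<in> carrier (P X)" for g
  proof (rule ext, clarify)
    fix x' y
    note gc = k.free_closed[OF g]
    let ?S = "{x. g (x, y) \<noteq> \<zero>\<^bsub>k\<^esub> \<and> h x = x'}"
    have "finite ((\<lambda>x. (x, y)) ` ?S)" by (rule finite_subset[OF _ k.free_finite[OF g]]) auto
    have inj: "inj_on (\<lambda>x. (x, y)) ?S" by (rule inj_onI) simp
    have "push g (x', y) = (\<Oplus>\<^bsub>k\<^esub>p\<in>{p. g p \<noteq> \<zero>\<^bsub>k\<^esub>}. basis_vec k (h (fst p), snd p) (x', y) \<otimes>\<^bsub>k\<^esub> g p)"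
      unfolding push_def mat_map_def ..
    also have "\<dots> = (\<Oplus>\<^bsub>k\<^esub>p\<in>(\<lambda>x. (x, y)) ` ?S. g p)"
      using k.free_finite[OF g] gc
      by (intro k.add.finprod_mono_neutral_cong_right) (auto simp: basis_vec_def)
    also have "\<dots> = (\<Oplus>\<^bsub>k\<^esub>x\<in>?S. g (x, y))"
      using gc by (intro k.finsum_reindex[OF _ inj]) auto
    finally show "(\<Oplus>\<^bsub>k\<^esub>x\<in>?S. g (x, y)) = push g (x', y)" by simp
  qed
  have "tensor_map k A (F X') N h (W X +>\<^bsub>P X\<^esub> f) = (\<Union>g\<in>W X +>\<^bsub>P X\<^esub> f. W X' +>\<^bsub>P X'\<^esub> push g)"
    unfolding tensor_map_def char_module_simps
  proof (rule SUP_cong[OF refl])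
    fix g assume "g \<in> W X +>\<^bsub>P X\<^esub> f"
    hence "g \<in> carrier (P X)" using W.A.a_elemrcos_carrier[OF f] by blast
    thus "W X' +>\<^bsub>P X'\<^esub> (\<lambda>(x', y). \<Oplus>\<^bsub>k\<^esub>x\<in>{x. g (x, y) \<noteq> \<zero>\<^bsub>k\<^esub> \<and> h x = x'}. g (x, y)) = W X' +>\<^bsub>P X'\<^esub> push g"
      by (simp only: push)
  qed
  also have "\<dots> = W X' +>\<^bsub>P X'\<^esub> push f"
  proof (rule W.coset_const[OF f])
    fix z assume zW: "z \<in> W X"
    hence z: "z \<in> carrier (P X)" and z0: "mat_map k tens_vec z = \<zero>\<^bsub>free_module k X\<^esub>"
      unfolding W_eq by simp_all
    have zf: "z \<oplus>\<^bsub>P X\<^esub> f \<in> carrier (P X)" by (rule ev.M.M.add.m_closed[OF z f])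
    have "mat_map k tens_vec (z \<oplus>\<^bsub>P X\<^esub> f) = mat_map k tens_vec f"
      unfolding ev.map_add[OF z f] z0 by (rule ev.N.M.l_zero[OF ev.map_closed[OF f]])
    hence "mat_map k tens_vec (push (z \<oplus>\<^bsub>P X\<^esub> f)) = mat_map k tens_vec (push f)"
      by (simp only: ev_push zf f)
    hence "mat_map k tens_vec (push (z \<oplus>\<^bsub>P X\<^esub> f) \<ominus>\<^bsub>P X'\<^esub> push f) = \<zero>\<^bsub>free_module k X'\<^esub>"
      by (simp only: ev'.map_minus pc zf f) (simp only: a_minus_def ev'.N.M.r_neg ev'.map_closed pc f)
    hence "push (z \<oplus>\<^bsub>P X\<^esub> f) \<ominus>\<^bsub>P X'\<^esub> push f \<in> W X'"
      unfolding W_eq using ev'.M.M.minus_closed[OF pc[OF zf] pc[OF f]] by simp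
    thus "W X' +>\<^bsub>P X'\<^esub> push (z \<oplus>\<^bsub>P X\<^esub> f) = W X' +>\<^bsub>P X'\<^esub> push f"
      by (simp only: W'.coset_eq_iff pc zf f)
  qed
  finally show ?thesis using pc[OF f] ev_push[OF f] by blast
qed

abbreviation gens where "gens \<equiv> std_gens A N"
abbreviation kmat :: "('a, 'k) gen \<Rightarrow> ('a, 'k) gen \<Rightarrow> 'k" where "kmat \<equiv> (\<lambda>x y. \<epsilon> (syz_fun A x y))"

lemma syz_mat: "syz_fun A \<in> gens (Suc i) \<rightarrow> carrier (free_module A (gens i))"
  using right_module.syz_fun_mem[OF right_module_N] unfolding free_right_module_simps by (rule Pi_I)

lemma kmat: "kmat \<in> gens (Suc i) \<rightarrow> carrier (free_module k (gens i))"
  by (intro Pi_I hom_free[OF A.ring_axioms k.ring_axioms aug] funcset_mem[OF syz_mat])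

lemma syz_boundary: "x \<in> gens (Suc (Suc i)) \<Longrightarrow> mat_map A (syz_fun A) (syz_fun A x) = (\<lambda>_. \<zero>\<^bsub>A\<^esub>)"
  by (auto simp: std_diff_mat_map)

lemma kmat_complex: "k_complex k (\<lambda>i. free_module k (gens i)) (\<lambda>_. mat_map k kmat)"
proof (rule k_complex.intro)
  show "module k (free_module k (gens i))" for i by (rule K_module)
  show "mat_map k kmat \<in> linear_maps k (free_module k (gens (Suc i))) (free_module k (gens i))" for i
    by (rule k.mat_map_linear[OF kmat])
  show "mat_map k kmat (mat_map k kmat f) = \<zero>\<^bsub>free_module k (gens i)\<^esub>"
    if f: "f \<in> carrier (free_module k (gens (Suc (Suc i))))" for i f
  proof -
    have "mat_map k kmat (mat_map k kmat f) = mat_map k (\<lambda>x. mat_map k kmat (kmat x)) f"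
      by (rule k.mat_map_comp[OF f kmat kmat])
    also have "\<dots> = (\<lambda>_. \<zero>\<^bsub>k\<^esub>)"
    proof (rule k.mat_map_zero_left[OF f])
      fix x assume x: "x \<in> gens (Suc (Suc i))"
      show "mat_map k kmat (kmat x) = (\<lambda>_. \<zero>\<^bsub>k\<^esub>)"
        unfolding mat_map_hom[OF A.ring_axioms k.ring_axioms aug funcset_mem[OF syz_mat x] syz_mat]
          syz_boundary[OF x] aug_zero ..
    qed
    finally show ?thesis by simp
  qed
qed

text \<open>Tensoring the free module on the generators with the trivial module leaves the free
  \<open>k\<close>-module on them, and the differential becomes its entrywise augmentation.\<close>

lemma Tor_iso:
  "\<exists>\<phi>. \<phi> \<in> module_iso k (Tor k A N N i) (homology (\<lambda>i. free_module k (gens i)) (\<lambda>_. mat_map k kmat) i)"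
  and Tor_complex: "k_complex k (\<lambda>i. tensor_product k A (std_res A N i) N)
     (\<lambda>i. tensor_map k A (std_res A N i) N (std_diff A))"
proof -
  let ?Q = "\<lambda>i. tensor_product k A (std_res A N i) N"
  let ?d = "\<lambda>i. tensor_map k A (std_res A N i) N (std_diff A)"
  have Q: "?Q i = quotient_module (P (gens i)) (W (gens i))" for i
    by (simp only: tensor_product_def std_res_def char_module_simps)
  have q: "quotient k (P (gens i)) (W (gens i))" for i
    by (intro quotient.intro quotient_axioms.intro P_module W_submodule)
  have step: "?d i C \<in> carrier (?Q i) \<and> \<Theta> (?d i C) = mat_map k kmat (\<Theta> C)" if C: "C \<in> carrier (?Q (Suc i))" for i C
  proof -
    obtain f where f: "f \<in> carrier (P (gens (Suc i)))" "C = W (gens (Suc i)) +>\<^bsub>P (gens (Suc i))\<^esub> f"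
      using C unfolding Q quotient.carrier_Q[OF q] by blast
    have d: "std_diff A m \<in> carrier (F (gens i))" if "m \<in> carrier (F (gens (Suc i)))" for m
      using A.mat_map_closed[OF _ syz_mat, of m i] that by (simp add: std_diff_mat_map)
    have h: "mat_map k kmat (\<lambda>x. \<epsilon> (m x)) = (\<lambda>x. \<epsilon> (std_diff A m x))" if "m \<in> carrier (F (gens (Suc i)))" for m
      unfolding std_diff_mat_map
      by (rule mat_map_hom[OF A.ring_axioms k.ring_axioms aug _ syz_mat]) (use that in simp)
    obtain g where g: "g \<in> carrier (P (gens i))" "?d i C = W (gens i) +>\<^bsub>P (gens i)\<^esub> g"
      "mat_map k tens_vec g = mat_map k kmat (mat_map k tens_vec f)"
      using tensor_map_coset[OF d kmat h f(1)] unfolding f(2) std_res_def by blast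
    show ?thesis
    proof
      show "?d i C \<in> carrier (?Q i)"
        unfolding g(2) Q quotient.carrier_Q[OF q] by (rule imageI[OF g(1)])
      have "\<Theta> (?d i C) = mat_map k tens_vec g" unfolding g(2) by (rule \<Theta>_coset[OF g(1)])
      moreover have "\<Theta> C = mat_map k tens_vec f" unfolding f(2) by (rule \<Theta>_coset[OF f(1)])
      ultimately show "\<Theta> (?d i C) = mat_map k kmat (\<Theta> C)" using g(3) by simp
    qed
  qed
  have iso: "\<Theta> \<in> module_iso k (?Q i) (free_module k (gens i))" for i
    unfolding std_res_def by (rule \<Theta>_iso)
  have mQ: "module k (?Q i)" for i unfolding Q by (rule quotient.quotient_module[OF q])
  show "k_complex k ?Q ?d"
    by (rule homology_transfer(2)[OF kmat_complex mQ iso]) (use step in blast)+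
  show "\<exists>\<phi>. \<phi> \<in> module_iso k (Tor k A N N i) (homology (\<lambda>i. free_module k (gens i)) (\<lambda>_. mat_map k kmat) i)"
    unfolding Tor_def by (rule homology_transfer(1)[OF kmat_complex mQ iso]) (use step in blast)+
qed

end

section \<open>Comparison of resolutions\<close>

lemma (in ring) mat_map_minus_left:
  assumes f: "f \<in> carrier (free_module R X)"
    and \<phi>: "\<phi> \<in> X \<rightarrow> carrier (free_module R Y)"
    and \<psi>: "\<psi> \<in> X \<rightarrow> carrier (free_module R Y)"
  shows "mat_map R (\<lambda>x y. \<phi> x y \<ominus> \<psi> x y) f = (\<lambda>y. mat_map R \<phi> f y \<ominus> mat_map R \<psi> f y)"
proof
  fix y
  have d: "(\<lambda>x y. \<phi> x y \<ominus> \<psi> x y) \<in> X \<rightarrow> carrier (free_module R Y)"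
    by (intro Pi_I free_minus funcset_mem[OF \<phi>] funcset_mem[OF \<psi>])
  note c = free_closed[OF mat_map_closed[OF f \<phi>]] free_closed[OF mat_map_closed[OF f \<psi>]]
    free_closed[OF mat_map_closed[OF f d]]
  have "mat_map R \<phi> f = mat_map R (\<lambda>x y. (\<phi> x y \<ominus> \<psi> x y) \<oplus> \<psi> x y) f"
  proof (rule mat_map_cong[OF f, symmetric])
    fix x assume x: "x \<in> X"
    show "(\<lambda>y. (\<phi> x y \<ominus> \<psi> x y) \<oplus> \<psi> x y) = \<phi> x"
      using mat_closed[OF \<phi> x] mat_closed[OF \<psi> x] by (simp add: fun_eq_iff a_minus_def a_assoc l_neg)
  qed (rule \<phi>)
  also have "\<dots> = (\<lambda>y. mat_map R (\<lambda>x y. \<phi> x y \<ominus> \<psi> x y) f y \<oplus> mat_map R \<psi> f y)"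
    by (rule mat_map_add_left[OF f d \<psi>])
  finally have "mat_map R \<phi> f y = mat_map R (\<lambda>x y. \<phi> x y \<ominus> \<psi> x y) f y \<oplus> mat_map R \<psi> f y"
    by (rule fun_cong)
  thus "mat_map R (\<lambda>x y. \<phi> x y \<ominus> \<psi> x y) f y = mat_map R \<phi> f y \<ominus> mat_map R \<psi> f y"
    using c by (simp add: a_minus_def a_assoc r_neg)
qed

text \<open>The augmentation of a resolution, encoded as a matrix with the one-element type as its
  set of rows. In this way linearity and composition of \<open>mat_map\<close> apply to it
  unchanged.\<close>

definition aug_eval :: "('k, 'r) ring_scheme \<Rightarrow> ('b \<Rightarrow> 'k) \<Rightarrow> ('x \<Rightarrow> 'k) \<Rightarrow> ('x \<Rightarrow> 'b) \<Rightarrow> 'k" where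
  "aug_eval k \<epsilon> e f = mat_map k (\<lambda>x (_::unit). e x) (\<lambda>x. \<epsilon> (f x)) ()"

text \<open>The action of \<open>k\<close> on the algebra is left out here: lifting and homotopies
  take place among right modules over the ring, and \<open>k\<close> enters only as the target of
  \<open>\<epsilon>\<close>.\<close>

locale aug_ring = k: cring k + B: ring B
  for k :: "('k, 'r) ring_scheme" and B :: "('b, 's) ring_scheme" and \<epsilon> +
  assumes aug: "\<epsilon> \<in> ring_hom B k"
begin

abbreviation ev where "ev \<equiv> aug_eval k \<epsilon>"
abbreviation F where "F X \<equiv> carrier (free_module B X)"
abbreviation K where "K X \<equiv> carrier (free_module k X)"
abbreviation bc where "bc \<phi> \<equiv> (\<lambda>x y. \<epsilon> (\<phi> x y))"

lemma aug_zero: "\<epsilon> \<zero>\<^bsub>B\<^esub> = \<zero>\<^bsub>k\<^esub>"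
  by (rule ring_hom_zero[OF aug B.ring_axioms k.ring_axioms])

lemmas aug_closed = ring_hom_closed[OF aug]
lemmas aug_add = ring_hom_add[OF aug]
lemmas aug_one = ring_hom_one[OF aug]

lemma aug_minus:
  assumes "a \<in> carrier B" "b \<in> carrier B" shows "\<epsilon> (a \<ominus>\<^bsub>B\<^esub> b) = \<epsilon> a \<ominus>\<^bsub>k\<^esub> \<epsilon> b"
proof -
  have "\<epsilon> (a \<ominus>\<^bsub>B\<^esub> b) \<oplus>\<^bsub>k\<^esub> \<epsilon> b = \<epsilon> ((a \<ominus>\<^bsub>B\<^esub> b) \<oplus>\<^bsub>B\<^esub> b)"
    using assms by (simp only: aug_add B.minus_closed)
  also have "(a \<ominus>\<^bsub>B\<^esub> b) \<oplus>\<^bsub>B\<^esub> b = a" using assms by (simp add: a_minus_def B.a_assoc B.l_neg)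
  finally have "\<epsilon> a = \<epsilon> (a \<ominus>\<^bsub>B\<^esub> b) \<oplus>\<^bsub>k\<^esub> \<epsilon> b" by (rule sym)
  thus ?thesis using assms by (simp add: aug_closed a_minus_def k.a_assoc k.r_neg)
qed

lemma aug_free: "f \<in> F X \<Longrightarrow> (\<lambda>x. \<epsilon> (f x)) \<in> K X"
  by (rule hom_free[OF B.ring_axioms k.ring_axioms aug])

lemma bc_mat: "\<phi> \<in> X \<rightarrow> F Y \<Longrightarrow> bc \<phi> \<in> X \<rightarrow> K Y"
  by (rule Pi_I, rule aug_free, erule funcset_mem)

lemma bc_map: "f \<in> F X \<Longrightarrow> \<phi> \<in> X \<rightarrow> F Y \<Longrightarrow>
    mat_map k (bc \<phi>) (\<lambda>x. \<epsilon> (f x)) = (\<lambda>y. \<epsilon> (mat_map B \<phi> f y))"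
  by (rule mat_map_hom[OF B.ring_axioms k.ring_axioms aug])

lemma ev_mat: "e \<in> X \<rightarrow> carrier k \<Longrightarrow> (\<lambda>x (_::unit). e x) \<in> X \<rightarrow> K UNIV"
  by (auto simp: free_module_mem)

lemma ev_minus:
  assumes f: "f \<in> F X" and g: "g \<in> F X" and e: "e \<in> X \<rightarrow> carrier k"
  shows "ev e (\<lambda>x. f x \<ominus>\<^bsub>B\<^esub> g x) = ev e f \<ominus>\<^bsub>k\<^esub> ev e g"
  unfolding aug_eval_def aug_minus[OF B.free_closed[OF f] B.free_closed[OF g]]
  by (simp only: k.mat_map_minus[OF aug_free[OF f] aug_free[OF g] ev_mat[OF e]])

lemma ev_basis:
  assumes e: "e \<in> X \<rightarrow> carrier k" and x: "x \<in> X" shows "ev e (basis_vec B x) = e x"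
proof -
  have "(\<lambda>y. \<epsilon> (basis_vec B x y)) = basis_vec k x" by (auto simp: basis_vec_def aug_one aug_zero)
  thus ?thesis unfolding aug_eval_def
    by (simp only: k.mat_map_basis[where \<phi> = "\<lambda>x (_::unit). e x", OF funcset_mem[OF ev_mat[OF e] x]])
qed

lemma ev_cong:
  assumes f: "f \<in> F X" and "\<And>x. x \<in> X \<Longrightarrow> e x = e' x" and e': "e' \<in> X \<rightarrow> carrier k"
  shows "ev e f = ev e' f"
proof -
  have "mat_map k (\<lambda>x (_::unit). e x) (\<lambda>x. \<epsilon> (f x)) = mat_map k (\<lambda>x (_::unit). e' x) (\<lambda>x. \<epsilon> (f x))"
    by (rule k.mat_map_cong[OF aug_free[OF f] _ ev_mat[OF e']]) (simp add: assms(2))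
  thus ?thesis unfolding aug_eval_def by simp
qed

lemma ev_map:
  assumes f: "f \<in> F X" and \<phi>: "\<phi> \<in> X \<rightarrow> F Y" and e: "e \<in> Y \<rightarrow> carrier k"
  shows "ev e (mat_map B \<phi> f) = ev (\<lambda>x. ev e (\<phi> x)) f"
proof -
  define M where "M x = mat_map k (\<lambda>x (_::unit). e x) (bc \<phi> x)" for x
  have M: "M = (\<lambda>x (_::unit). ev e (\<phi> x))"
  proof (intro ext)
    show "M x u = ev e (\<phi> x)" for x u by (cases u) (simp only: M_def aug_eval_def)
  qed
  have "ev e (mat_map B \<phi> f) = mat_map k (\<lambda>x (_::unit). e x) (mat_map k (bc \<phi>) (\<lambda>x. \<epsilon> (f x))) ()"
    unfolding aug_eval_def bc_map[OF f \<phi>] ..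
  also have "\<dots> = mat_map k M (\<lambda>x. \<epsilon> (f x)) ()"
    unfolding M_def[abs_def] by (rule fun_cong[OF k.mat_map_comp[OF aug_free[OF f] bc_mat[OF \<phi>] ev_mat[OF e]]])
  also have "\<dots> = ev (\<lambda>x. ev e (\<phi> x)) f"
    by (subst M) (simp only: aug_eval_def[of k \<epsilon> "\<lambda>x. ev e (\<phi> x)" f])
  finally show ?thesis .
qed

end

text \<open>A free resolution of \<open>k\<close>, seen as a right module through
  \<open>\<epsilon>\<close>. One matrix \<open>m\<close> serves all degrees because the generators
  of all degrees share a type, as they do in the standard resolution.\<close>

locale resolution = aug_ring k B \<epsilon> for k :: "('k, 'r) ring_scheme" and B :: "('b, 's) ring_scheme" and \<epsilon> +
  fixes X :: "nat \<Rightarrow> 'x set" and m :: "'x \<Rightarrow> 'x \<Rightarrow> 'b" and e :: "'x \<Rightarrow> 'k"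
  assumes m: "m \<in> X (Suc i) \<rightarrow> F (X i)"
    and e: "e \<in> X 0 \<rightarrow> carrier k"
    and surj: "y \<in> carrier k \<Longrightarrow> \<exists>f\<in>F (X 0). ev e f = y"
    and complex_0: "f \<in> F (X (Suc 0)) \<Longrightarrow> ev e (mat_map B m f) = \<zero>\<^bsub>k\<^esub>"
    and complex_Suc: "f \<in> F (X (Suc (Suc i))) \<Longrightarrow> mat_map B m (mat_map B m f) = (\<lambda>_. \<zero>\<^bsub>B\<^esub>)"
    and exact_0: "f \<in> F (X 0) \<Longrightarrow> ev e f = \<zero>\<^bsub>k\<^esub> \<Longrightarrow> \<exists>g\<in>F (X (Suc 0)). mat_map B m g = f"
    and exact_Suc: "f \<in> F (X (Suc i)) \<Longrightarrow> mat_map B m f = (\<lambda>_. \<zero>\<^bsub>B\<^esub>) \<Longrightarrow>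
      \<exists>g\<in>F (X (Suc (Suc i))). mat_map B m g = f"
begin

text \<open>Unlike \<open>cycles\<close>, this asks for a vanishing augmentation in degree 0. These
  are the cycles of the augmented complex, so exactness has the same form in every degree.\<close>

definition cyc :: "nat \<Rightarrow> ('x \<Rightarrow> 'b) \<Rightarrow> bool" where
  "cyc i f \<longleftrightarrow> f \<in> F (X i) \<and> (case i of 0 \<Rightarrow> ev e f = \<zero>\<^bsub>k\<^esub> | Suc _ \<Rightarrow> mat_map B m f = (\<lambda>_. \<zero>\<^bsub>B\<^esub>))"

lemma cyc_F: "cyc i f \<Longrightarrow> f \<in> F (X i)" by (simp add: cyc_def)

lemma cyc_boundary: "f \<in> F (X (Suc i)) \<Longrightarrow> cyc i (mat_map B m f)"
  using B.mat_map_closed[OF _ m] complex_0 complex_Suc by (cases i) (auto simp: cyc_def)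

lemma exact: "cyc i f \<Longrightarrow> \<exists>g\<in>F (X (Suc i)). mat_map B m g = f"
  using exact_0 exact_Suc by (cases i) (auto simp: cyc_def)

lemma cyc_m: assumes x: "x \<in> X (Suc i)" shows "cyc i (m x)"
  using cyc_boundary[OF B.basis_vec_free[OF x]]
  by (simp only: B.mat_map_basis[where \<phi> = m, OF funcset_mem[OF m x]])

lemma bc_complex: "k_complex k (\<lambda>i. free_module k (X i)) (\<lambda>_. mat_map k (bc m))"
proof (rule k_complex.intro)
  show "module k (free_module k (X i))" for i by (rule k.free_module_module)
  show "mat_map k (bc m) \<in> linear_maps k (free_module k (X (Suc i))) (free_module k (X i))" for i
    by (rule k.mat_map_linear[OF bc_mat[OF m]])
  show "mat_map k (bc m) (mat_map k (bc m) f) = \<zero>\<^bsub>free_module k (X i)\<^esub>"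
    if f: "f \<in> K (X (Suc (Suc i)))" for i f
  proof -
    have "mat_map k (bc m) (mat_map k (bc m) f) = mat_map k (\<lambda>x. mat_map k (bc m) (bc m x)) f"
      by (rule k.mat_map_comp[OF f bc_mat[OF m] bc_mat[OF m]])
    also have "\<dots> = (\<lambda>_. \<zero>\<^bsub>k\<^esub>)"
    proof (rule k.mat_map_zero_left[OF f])
      fix x assume x: "x \<in> X (Suc (Suc i))"
      have "mat_map B m (m x) = (\<lambda>_. \<zero>\<^bsub>B\<^esub>)" using cyc_m[OF x] by (simp add: cyc_def)
      thus "mat_map k (bc m) (bc m x) = (\<lambda>_. \<zero>\<^bsub>k\<^esub>)"
        unfolding bc_map[OF funcset_mem[OF m x] m] by (simp add: aug_zero)
    qed
    finally show ?thesis by simp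
  qed
qed

end

locale two_resolutions = X: resolution k B \<epsilon> X m e + Y: resolution k B \<epsilon> Y m' e'
  for k :: "('k, 'r) ring_scheme" and B :: "('b, 's) ring_scheme" and \<epsilon>
    and X :: "nat \<Rightarrow> 'x set" and m e and Y :: "nat \<Rightarrow> 'y set" and m' e'
begin

definition chain_lift :: "(nat \<Rightarrow> 'x \<Rightarrow> 'y \<Rightarrow> 'b) \<Rightarrow> bool" where
  "chain_lift p \<longleftrightarrow> (\<forall>i. p i \<in> X i \<rightarrow> X.F (Y i)) \<and> (\<forall>x\<in>X 0. X.ev e' (p 0 x) = e x) \<and>
     (\<forall>i. \<forall>x\<in>X (Suc i). mat_map B m' (p (Suc i) x) = mat_map B (p i) (m x))"

text \<open>The invariant is that cycles go to cycles. It makes the image of the boundary of each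
  generator a cycle, exactness provides a preimage for the next map, and the commuting square hands
  the invariant on.\<close>

lemma lift_step:
  assumes p: "p \<in> X i \<rightarrow> X.F (Y i)" and pc: "\<And>z. X.cyc i z \<Longrightarrow> Y.cyc i (mat_map B p z)"
  shows "\<exists>q. q \<in> X (Suc i) \<rightarrow> X.F (Y (Suc i)) \<and> (\<forall>x\<in>X (Suc i). mat_map B m' (q x) = mat_map B p (m x)) \<and>
    (\<forall>z. X.cyc (Suc i) z \<longrightarrow> Y.cyc (Suc i) (mat_map B q z))"
proof -
  have "\<forall>x\<in>X (Suc i). \<exists>g\<in>X.F (Y (Suc i)). mat_map B m' g = mat_map B p (m x)"
    using Y.exact[OF pc[OF X.cyc_m]] by blast
  then obtain q where q: "\<forall>x\<in>X (Suc i). q x \<in> X.F (Y (Suc i)) \<and> mat_map B m' (q x) = mat_map B p (m x)"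
    by metis
  have qm: "q \<in> X (Suc i) \<rightarrow> X.F (Y (Suc i))" using q by blast
  have "Y.cyc (Suc i) (mat_map B q z)" if z: "X.cyc (Suc i) z" for z
  proof -
    note zF = X.cyc_F[OF z]
    have "mat_map B m' (mat_map B q z) = mat_map B (\<lambda>x. mat_map B m' (q x)) z"
      by (rule X.B.mat_map_comp[OF zF qm Y.m])
    also have "\<dots> = mat_map B (\<lambda>x. mat_map B p (m x)) z"
    proof (rule X.B.mat_map_cong[OF zF])
      show "(\<lambda>x. mat_map B p (m x)) \<in> X (Suc i) \<rightarrow> X.F (Y i)"
        by (intro Pi_I X.B.mat_map_closed[OF _ p] funcset_mem[OF X.m])
    qed (use q in blast)
    also have "\<dots> = mat_map B p (mat_map B m z)" by (rule X.B.mat_map_comp[OF zF X.m p, symmetric])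
    also have "mat_map B m z = (\<lambda>_. \<zero>\<^bsub>B\<^esub>)" using z by (simp add: X.cyc_def)
    finally show ?thesis using X.B.mat_map_closed[OF zF qm] by (simp add: Y.cyc_def)
  qed
  thus ?thesis using q qm by blast
qed

lemma ex_chain_lift: "\<exists>p. chain_lift p"
proof -
  have "\<forall>x\<in>X 0. \<exists>g\<in>X.F (Y 0). X.ev e' g = e x" using Y.surj funcset_mem[OF X.e] by blast
  then obtain p0 where p0: "\<forall>x\<in>X 0. p0 x \<in> X.F (Y 0) \<and> X.ev e' (p0 x) = e x" by metis
  have p0m: "p0 \<in> X 0 \<rightarrow> X.F (Y 0)" using p0 by blast
  have p0c: "Y.cyc 0 (mat_map B p0 z)" if z: "X.cyc 0 z" for z
  proof -
    note zF = X.cyc_F[OF z]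
    have "X.ev e' (mat_map B p0 z) = X.ev (\<lambda>x. X.ev e' (p0 x)) z" by (rule X.ev_map[OF zF p0m Y.e])
    also have "\<dots> = X.ev e z" by (rule X.ev_cong[OF zF _ X.e]) (use p0 in blast)
    also have "\<dots> = \<zero>\<^bsub>k\<^esub>" using z by (simp add: X.cyc_def)
    finally show ?thesis using X.B.mat_map_closed[OF zF p0m] by (simp add: Y.cyc_def)
  qed
  let ?P = "\<lambda>i p. p \<in> X i \<rightarrow> X.F (Y i) \<and> (\<forall>z. X.cyc i z \<longrightarrow> Y.cyc i (mat_map B p z)) \<and>
    (i = 0 \<longrightarrow> (\<forall>x\<in>X 0. X.ev e' (p x) = e x))"
  let ?Q = "\<lambda>i p q. \<forall>x\<in>X (Suc i). mat_map B m' (q x) = mat_map B p (m x)"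
  \<comment> \<open>Dependent choice: the lift in one degree is chosen among preimages that are
    determined by the lift in the degree below.\<close>
  have "\<exists>p. \<forall>i. ?P i (p i) \<and> ?Q i (p i) (p (Suc i))"
  proof (rule dependent_nat_choice)
    show "\<exists>p. ?P 0 p" using p0 p0m p0c by blast
    show "\<exists>q. ?P (Suc i) q \<and> ?Q i p q" if "?P i p" for p i using lift_step[of p i] that by auto
  qed
  then obtain p where p: "\<forall>i. ?P i (p i) \<and> ?Q i (p i) (p (Suc i))" ..
  have "chain_lift p" unfolding chain_lift_def
  proof (intro conjI allI)
    show "p i \<in> X i \<rightarrow> X.F (Y i)" for i using p[rule_format, of i] by (elim conjE)
    show "\<forall>x\<in>X 0. X.ev e' (p 0 x) = e x" using p[rule_format, of 0] by simp
    show "\<forall>x\<in>X (Suc i). mat_map B m' (p (Suc i) x) = mat_map B (p i) (m x)" for i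
      using p[rule_format, of i] by (elim conjE)
  qed
  thus ?thesis by blast
qed

text \<open>The family \<open>r\<close> is a chain map over the zero map of \<open>k\<close>. In
  each degree the part of \<open>r\<close> not yet accounted for by the homotopy below is a cycle,
  and exactness of the second resolution extends the homotopy.\<close>

lemma null_homotopy:
  assumes r: "\<And>i. r i \<in> X i \<rightarrow> X.F (Y i)" and r0: "\<And>x. x \<in> X 0 \<Longrightarrow> X.ev e' (r 0 x) = \<zero>\<^bsub>k\<^esub>"
    and rS: "\<And>i x. x \<in> X (Suc i) \<Longrightarrow> mat_map B m' (r (Suc i) x) = mat_map B (r i) (m x)"
  shows "\<exists>h. (\<forall>i. h i \<in> X i \<rightarrow> X.F (Y (Suc i))) \<and> (\<forall>x\<in>X 0. mat_map B m' (h 0 x) = r 0 x) \<and>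
    (\<forall>i. \<forall>x\<in>X (Suc i). (\<lambda>y. mat_map B m' (h (Suc i) x) y \<oplus>\<^bsub>B\<^esub> mat_map B (h i) (m x) y) = r (Suc i) x)"
proof -
  \<comment> \<open>On a cycle the summand with the boundary drops out of the homotopy formula. What
    remains, that the boundary of \<open>h z\<close> is \<open>r z\<close>, is the invariant carried
    through the degrees.\<close>
  let ?P = "\<lambda>i h. h \<in> X i \<rightarrow> X.F (Y (Suc i)) \<and>
    (\<forall>z. X.cyc i z \<longrightarrow> mat_map B m' (mat_map B h z) = mat_map B (r i) z) \<and>
    (i = 0 \<longrightarrow> (\<forall>x\<in>X 0. mat_map B m' (h x) = r 0 x))"
  let ?Q = "\<lambda>i h h'. \<forall>x\<in>X (Suc i). (\<lambda>y. mat_map B m' (h' x) y \<oplus>\<^bsub>B\<^esub> mat_map B h (m x) y) = r (Suc i) x"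
  have "\<exists>h. \<forall>i. ?P i (h i) \<and> ?Q i (h i) (h (Suc i))"
  proof (rule dependent_nat_choice)
    have "Y.cyc 0 (r 0 x)" if "x \<in> X 0" for x
      using r0[OF that] funcset_mem[OF r that] by (simp add: Y.cyc_def)
    hence "\<forall>x\<in>X 0. \<exists>g\<in>X.F (Y (Suc 0)). mat_map B m' g = r 0 x" using Y.exact by blast
    then obtain h where h: "\<forall>x\<in>X 0. h x \<in> X.F (Y (Suc 0)) \<and> mat_map B m' (h x) = r 0 x" by metis
    have hm: "h \<in> X 0 \<rightarrow> X.F (Y (Suc 0))" using h by blast
    have "mat_map B m' (mat_map B h z) = mat_map B (r 0) z" if "X.cyc 0 z" for z
      unfolding X.B.mat_map_comp[OF X.cyc_F[OF that] hm Y.m]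
      by (rule X.B.mat_map_cong[OF X.cyc_F[OF that] _ r]) (use h in blast)
    thus "\<exists>h. ?P 0 h" using h hm by blast
  next
    fix h i assume hi: "?P i h"
    hence hm: "h \<in> X i \<rightarrow> X.F (Y (Suc i))"
      and hc: "\<And>z. X.cyc i z \<Longrightarrow> mat_map B m' (mat_map B h z) = mat_map B (r i) z" by blast+
    have hx: "mat_map B h (m x) \<in> X.F (Y (Suc i))" if "x \<in> X (Suc i)" for x
      by (rule X.B.mat_map_closed[OF funcset_mem[OF X.m that] hm])
    have hmm: "(\<lambda>x. mat_map B h (m x)) \<in> X (Suc i) \<rightarrow> X.F (Y (Suc i))" using hx by blast
    \<comment> \<open>The defect of \<open>r\<close> after subtraction of the homotopy in the degree
      below. Its boundary vanishes because the invariant applies to the cycle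
      \<open>m x\<close>.\<close>
    define s where "s x = (\<lambda>y. r (Suc i) x y \<ominus>\<^bsub>B\<^esub> mat_map B h (m x) y)" for x
    have sm: "s \<in> X (Suc i) \<rightarrow> X.F (Y (Suc i))"
      unfolding s_def[abs_def] by (intro Pi_I X.B.free_minus funcset_mem[OF r] hx)
    have "Y.cyc (Suc i) (s x)" if x: "x \<in> X (Suc i)" for x
    proof -
      have "mat_map B m' (s x) = (\<lambda>y. mat_map B m' (r (Suc i) x) y \<ominus>\<^bsub>B\<^esub> mat_map B m' (mat_map B h (m x)) y)"
        unfolding s_def by (rule X.B.mat_map_minus[OF funcset_mem[OF r x] hx[OF x] Y.m])
      also have "\<dots> = (\<lambda>_. \<zero>\<^bsub>B\<^esub>)"
        unfolding rS[OF x] hc[OF X.cyc_m[OF x]] a_minus_def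
        by (intro ext X.B.r_neg X.B.free_closed[OF X.B.mat_map_closed[OF funcset_mem[OF X.m x] r]])
      finally show ?thesis using funcset_mem[OF sm x] by (simp add: Y.cyc_def)
    qed
    hence "\<forall>x\<in>X (Suc i). \<exists>g\<in>X.F (Y (Suc (Suc i))). mat_map B m' g = s x" using Y.exact by blast
    then obtain h' where h': "\<forall>x\<in>X (Suc i). h' x \<in> X.F (Y (Suc (Suc i))) \<and> mat_map B m' (h' x) = s x" by metis
    have hm': "h' \<in> X (Suc i) \<rightarrow> X.F (Y (Suc (Suc i)))" using h' by blast
    have "?Q i h h'"
    proof
      fix x assume x: "x \<in> X (Suc i)"
      note c = X.B.free_closed[OF funcset_mem[OF r x]] X.B.free_closed[OF hx[OF x]]
      have "mat_map B m' (h' x) = s x" using h' x by blast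
      thus "(\<lambda>y. mat_map B m' (h' x) y \<oplus>\<^bsub>B\<^esub> mat_map B h (m x) y) = r (Suc i) x"
        by (simp add: s_def a_minus_def X.B.a_assoc X.B.l_neg c)
    qed
    moreover have "mat_map B m' (mat_map B h' z) = mat_map B (r (Suc i)) z" if z: "X.cyc (Suc i) z" for z
    proof -
      note zF = X.cyc_F[OF z]
      have "mat_map B m' (mat_map B h' z) = mat_map B (\<lambda>x. mat_map B m' (h' x)) z"
        by (rule X.B.mat_map_comp[OF zF hm' Y.m])
      also have "\<dots> = mat_map B s z" by (rule X.B.mat_map_cong[OF zF _ sm]) (use h' in blast)
      also have "\<dots> = (\<lambda>y. mat_map B (r (Suc i)) z y \<ominus>\<^bsub>B\<^esub> mat_map B (\<lambda>x. mat_map B h (m x)) z y)"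
        unfolding s_def[abs_def] by (rule X.B.mat_map_minus_left[OF zF r hmm])
      also have "mat_map B (\<lambda>x. mat_map B h (m x)) z = mat_map B h (mat_map B m z)"
        by (rule X.B.mat_map_comp[OF zF X.m hm, symmetric])
      also have "mat_map B m z = (\<lambda>_. \<zero>\<^bsub>B\<^esub>)" using z by (simp add: X.cyc_def)
      finally show ?thesis
        using X.B.free_closed[OF X.B.mat_map_closed[OF zF r]] by (simp add: a_minus_def)
    qed
    ultimately show "\<exists>h'. ?P (Suc i) h' \<and> ?Q i h h'" using hm' by blast
  qed
  then obtain h where h: "\<forall>i. ?P i (h i) \<and> ?Q i (h i) (h (Suc i))" ..
  show ?thesis
  proof (intro exI[of _ h] conjI allI)
    show "h i \<in> X i \<rightarrow> X.F (Y (Suc i))" for i using h[rule_format, of i] by (elim conjE)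
    show "\<forall>x\<in>X 0. mat_map B m' (h 0 x) = r 0 x" using h[rule_format, of 0] by simp
    show "\<forall>x\<in>X (Suc i). (\<lambda>y. mat_map B m' (h (Suc i) x) y \<oplus>\<^bsub>B\<^esub> mat_map B (h i) (m x) y) = r (Suc i) x" for i
      using h[rule_format, of i] by (elim conjE)
  qed
qed

end

context two_resolutions
begin

text \<open>The situation is symmetric: lifts are needed in both directions, and homotopies from a
  resolution to itself.\<close>

interpretation YX: two_resolutions k B \<epsilon> Y m' e' X m e ..
interpretation XX: two_resolutions k B \<epsilon> X m e X m e ..

text \<open>The identity minus the round trip lies over the zero map of \<open>k\<close>, so it is
  null-homotopic. The homotopy lives over \<open>B\<close>; augmenting its entries gives one over
  \<open>k\<close>, under which every cycle differs from its round trip by a boundary.\<close>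

lemma lift_homotopy:
  assumes p: "chain_lift p" and q: "YX.chain_lift q"
    and f: "f \<in> cycles (\<lambda>i. free_module k (X i)) (\<lambda>_. mat_map k (X.bc m)) i"
  shows "\<exists>w\<in>X.K (X (Suc i)). mat_map k (X.bc m) w =
    (\<lambda>x. f x \<ominus>\<^bsub>k\<^esub> mat_map k (X.bc (q i)) (mat_map k (X.bc (p i)) f) x)"
proof -
  have pm: "p i \<in> X i \<rightarrow> X.F (Y i)" and qm: "q i \<in> Y i \<rightarrow> X.F (X i)" for i
    using p q by (auto simp: chain_lift_def YX.chain_lift_def)
  have pS: "mat_map B m' (p (Suc i) x) = mat_map B (p i) (m x)" if "x \<in> X (Suc i)" for i x
    using p that by (simp add: chain_lift_def)
  have qS: "mat_map B m (q (Suc i) x) = mat_map B (q i) (m' x)" if "x \<in> Y (Suc i)" for i x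
    using q that by (simp add: YX.chain_lift_def)
  define qp where "qp i x = mat_map B (q i) (p i x)" for i x
  have qpm: "qp i \<in> X i \<rightarrow> X.F (X i)" for i
    unfolding qp_def[abs_def] by (intro Pi_I X.B.mat_map_closed[OF _ qm] funcset_mem[OF pm])
  \<comment> \<open>Over generators the identity is the matrix with columns
    \<open>basis_vec B x\<close>; \<open>r\<close> is this matrix minus that of the round
    trip.\<close>
  define r where "r i x = (\<lambda>y. basis_vec B x y \<ominus>\<^bsub>B\<^esub> qp i x y)" for i x
  have bm: "basis_vec B \<in> Z \<rightarrow> X.F Z" for Z :: "'x set" by simp
  have rm: "r i \<in> X i \<rightarrow> X.F (X i)" for i
    unfolding r_def[abs_def] by (intro Pi_I X.B.free_minus funcset_mem[OF bm] funcset_mem[OF qpm])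
  have r_map: "mat_map B (r i) z = (\<lambda>y. z y \<ominus>\<^bsub>B\<^esub> mat_map B (qp i) z y)" if z: "z \<in> X.F (X i)" for i z
    unfolding r_def[abs_def] by (simp only: X.B.mat_map_minus_left[OF z bm qpm] X.B.mat_map_basis_id[OF z])
  have r0: "X.ev e (r 0 x) = \<zero>\<^bsub>k\<^esub>" if x: "x \<in> X 0" for x
  proof -
    note px = funcset_mem[OF pm x]
    have "X.ev e (qp 0 x) = X.ev (\<lambda>y. X.ev e (q 0 y)) (p 0 x)"
      unfolding qp_def by (rule X.ev_map[OF px qm X.e])
    also have "\<dots> = X.ev e' (p 0 x)"
      by (rule X.ev_cong[OF px _ Y.e]) (use q in \<open>simp add: YX.chain_lift_def\<close>)
    also have "\<dots> = e x" using p x by (simp add: chain_lift_def)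
    finally show ?thesis
      unfolding r_def X.ev_minus[OF funcset_mem[OF bm x] funcset_mem[OF qpm x] X.e] X.ev_basis[OF X.e x]
      using funcset_mem[OF X.e x] by (simp add: a_minus_def X.k.r_neg)
  qed
  have rS: "mat_map B m (r (Suc i) x) = mat_map B (r i) (m x)" if x: "x \<in> X (Suc i)" for i x
  proof -
    note px = funcset_mem[OF pm x] and mx = funcset_mem[OF X.m x]
    have "mat_map B m (qp (Suc i) x) = mat_map B (\<lambda>y. mat_map B m (q (Suc i) y)) (p (Suc i) x)"
      unfolding qp_def by (rule X.B.mat_map_comp[OF px qm X.m])
    also have "\<dots> = mat_map B (\<lambda>y. mat_map B (q i) (m' y)) (p (Suc i) x)"
    proof (rule X.B.mat_map_cong[OF px qS])
      show "(\<lambda>y. mat_map B (q i) (m' y)) \<in> Y (Suc i) \<rightarrow> X.F (X i)"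
        by (intro Pi_I X.B.mat_map_closed[OF _ qm] funcset_mem[OF Y.m])
    qed
    also have "\<dots> = mat_map B (q i) (mat_map B m' (p (Suc i) x))"
      by (rule X.B.mat_map_comp[OF px Y.m qm, symmetric])
    also have "\<dots> = mat_map B (q i) (mat_map B (p i) (m x))" by (simp only: pS[OF x])
    also have "\<dots> = mat_map B (qp i) (m x)"
      unfolding qp_def[abs_def] by (rule X.B.mat_map_comp[OF mx pm qm])
    finally have qp: "mat_map B m (qp (Suc i) x) = mat_map B (qp i) (m x)" .
    have "mat_map B m (r (Suc i) x) = (\<lambda>y. mat_map B m (basis_vec B x) y \<ominus>\<^bsub>B\<^esub> mat_map B m (qp (Suc i) x) y)"
      unfolding r_def by (rule X.B.mat_map_minus[OF funcset_mem[OF bm x] funcset_mem[OF qpm x] X.m])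
    thus ?thesis unfolding qp X.B.mat_map_basis[where \<phi> = m, OF mx] r_map[OF mx] .
  qed
  obtain h where hm: "\<And>i. h i \<in> X i \<rightarrow> X.F (X (Suc i))" and h0: "\<And>x. x \<in> X 0 \<Longrightarrow> mat_map B m (h 0 x) = r 0 x"
    and hS: "\<And>i x. x \<in> X (Suc i) \<Longrightarrow> (\<lambda>y. mat_map B m (h (Suc i) x) y \<oplus>\<^bsub>B\<^esub> mat_map B (h i) (m x) y) = r (Suc i) x"
    using XX.null_homotopy[OF rm r0 rS] by blast
  have fK: "f \<in> X.K (X i)" by (rule subsetD[OF cycles_subset f])
  let ?w = "mat_map k (X.bc (h i)) f"
  have w: "?w \<in> X.K (X (Suc i))" by (rule X.k.mat_map_closed[OF fK X.bc_mat[OF hm]])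
  have mh: "(\<lambda>x. mat_map B m (h i x)) \<in> X i \<rightarrow> X.F (X i)" for i
    by (intro Pi_I X.B.mat_map_closed[OF _ X.m] funcset_mem[OF hm])
  have bch: "mat_map k (X.bc m) ?w = mat_map k (X.bc (\<lambda>x. mat_map B m (h i x))) f"
  proof -
    have "mat_map k (X.bc m) ?w = mat_map k (\<lambda>x. mat_map k (X.bc m) (X.bc (h i) x)) f"
      by (rule X.k.mat_map_comp[OF fK X.bc_mat[OF hm] X.bc_mat[OF X.m]])
    also have "\<dots> = mat_map k (X.bc (\<lambda>x. mat_map B m (h i x))) f"
      by (rule X.k.mat_map_cong[OF fK X.bc_map[OF funcset_mem[OF hm] X.m] X.bc_mat[OF mh]])
    finally show ?thesis .
  qed
  have "mat_map k (X.bc (r i)) f = mat_map k (\<lambda>x y. basis_vec k x y \<ominus>\<^bsub>k\<^esub> X.bc (qp i) x y) f"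
  proof (rule X.k.mat_map_cong[OF fK])
    fix x assume x: "x \<in> X i"
    show "X.bc (r i) x = (\<lambda>y. basis_vec k x y \<ominus>\<^bsub>k\<^esub> X.bc (qp i) x y)"
      unfolding r_def X.aug_minus[OF X.B.free_closed[OF funcset_mem[OF bm x]] X.B.free_closed[OF funcset_mem[OF qpm x]]]
      by (auto simp: basis_vec_def X.aug_one X.aug_zero)
  next
    show "(\<lambda>x y. basis_vec k x y \<ominus>\<^bsub>k\<^esub> X.bc (qp i) x y) \<in> X i \<rightarrow> X.K (X i)"
      by (intro Pi_I X.k.free_minus X.k.basis_vec_free funcset_mem[OF X.bc_mat[OF qpm]])
  qed
  also have "\<dots> = (\<lambda>y. mat_map k (basis_vec k) f y \<ominus>\<^bsub>k\<^esub> mat_map k (X.bc (qp i)) f y)"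
    by (rule X.k.mat_map_minus_left[OF fK _ X.bc_mat[OF qpm]]) simp
  also have "mat_map k (basis_vec k) f = f" by (rule X.k.mat_map_basis_id[OF fK])
  also have "mat_map k (X.bc (qp i)) f = mat_map k (\<lambda>x. mat_map k (X.bc (q i)) (X.bc (p i) x)) f"
    unfolding qp_def[abs_def]
  proof (rule X.k.mat_map_cong[OF fK])
    fix x assume x: "x \<in> X i"
    show "X.bc (\<lambda>x. mat_map B (q i) (p i x)) x = mat_map k (X.bc (q i)) (X.bc (p i) x)"
      by (rule X.bc_map[OF funcset_mem[OF pm x] qm, symmetric])
  next
    show "(\<lambda>x. mat_map k (X.bc (q i)) (X.bc (p i) x)) \<in> X i \<rightarrow> X.K (X i)"
      by (intro Pi_I X.k.mat_map_closed[OF _ X.bc_mat[OF qm]] funcset_mem[OF X.bc_mat[OF pm]])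
  qed
  also have "\<dots> = mat_map k (X.bc (q i)) (mat_map k (X.bc (p i)) f)"
    by (rule X.k.mat_map_comp[OF fK X.bc_mat[OF pm] X.bc_mat[OF qm], symmetric])
  finally have R: "mat_map k (X.bc (r i)) f =
    (\<lambda>y. f y \<ominus>\<^bsub>k\<^esub> mat_map k (X.bc (q i)) (mat_map k (X.bc (p i)) f) y)" .
  \<comment> \<open>In positive degrees the second half of the homotopy formula is applied to the
    boundary of the cycle \<open>f\<close> and vanishes. In degree 0 there is no second
    half.\<close>
  have "mat_map k (X.bc m) ?w = mat_map k (X.bc (r i)) f"
  proof (cases i)
    case 0
    show ?thesis unfolding bch using fK rm[of 0] h0 unfolding 0
      by (intro X.k.mat_map_cong[OF _ _ X.bc_mat[OF rm]]) simp_all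
  next
    case (Suc j)
    have D: "mat_map k (X.bc m) f = (\<lambda>_. \<zero>\<^bsub>k\<^esub>)" using f by (simp add: Suc cycles_def)
    have fS: "f \<in> X.K (X (Suc j))" using fK by (simp add: Suc)
    have hmj: "(\<lambda>x. mat_map B (h j) (m x)) \<in> X (Suc j) \<rightarrow> X.F (X (Suc j))"
      by (intro Pi_I X.B.mat_map_closed[OF _ hm] funcset_mem[OF X.m])
    have "mat_map k (X.bc (r (Suc j))) f = mat_map k (\<lambda>x y. X.bc (\<lambda>x. mat_map B m (h (Suc j) x)) x y
        \<oplus>\<^bsub>k\<^esub> X.bc (\<lambda>x. mat_map B (h j) (m x)) x y) f"
    proof (rule X.k.mat_map_cong[OF fS])
      fix x assume x: "x \<in> X (Suc j)"
      show "X.bc (r (Suc j)) x = (\<lambda>y. X.bc (\<lambda>x. mat_map B m (h (Suc j) x)) x y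
        \<oplus>\<^bsub>k\<^esub> X.bc (\<lambda>x. mat_map B (h j) (m x)) x y)"
        unfolding hS[OF x, symmetric]
          X.aug_add[OF X.B.free_closed[OF funcset_mem[OF mh x]] X.B.free_closed[OF funcset_mem[OF hmj x]]] ..
    next
      show "(\<lambda>x y. X.bc (\<lambda>x. mat_map B m (h (Suc j) x)) x y \<oplus>\<^bsub>k\<^esub> X.bc (\<lambda>x. mat_map B (h j) (m x)) x y)
          \<in> X (Suc j) \<rightarrow> X.K (X (Suc j))"
        by (intro Pi_I X.k.free_add funcset_mem[OF X.bc_mat[OF mh]] funcset_mem[OF X.bc_mat[OF hmj]])
    qed
    also have "\<dots> = (\<lambda>y. mat_map k (X.bc (\<lambda>x. mat_map B m (h (Suc j) x))) f y
        \<oplus>\<^bsub>k\<^esub> mat_map k (X.bc (\<lambda>x. mat_map B (h j) (m x))) f y)"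
      by (rule X.k.mat_map_add_left[OF fS X.bc_mat[OF mh] X.bc_mat[OF hmj]])
    also have "mat_map k (X.bc (\<lambda>x. mat_map B (h j) (m x))) f = mat_map k (\<lambda>x. mat_map k (X.bc (h j)) (X.bc m x)) f"
    proof (rule X.k.mat_map_cong[OF fS])
      fix x assume x: "x \<in> X (Suc j)"
      show "X.bc (\<lambda>x. mat_map B (h j) (m x)) x = mat_map k (X.bc (h j)) (X.bc m x)"
        by (rule X.bc_map[OF funcset_mem[OF X.m x] hm, symmetric])
    next
      show "(\<lambda>x. mat_map k (X.bc (h j)) (X.bc m x)) \<in> X (Suc j) \<rightarrow> X.K (X (Suc j))"
        by (intro Pi_I X.k.mat_map_closed[OF _ X.bc_mat[OF hm]] funcset_mem[OF X.bc_mat[OF X.m]])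
    qed
    also have "\<dots> = mat_map k (X.bc (h j)) (mat_map k (X.bc m) f)"
      by (rule X.k.mat_map_comp[OF fS X.bc_mat[OF X.m] X.bc_mat[OF hm], symmetric])
    also have "\<dots> = (\<lambda>_. \<zero>\<^bsub>k\<^esub>)" unfolding D by (rule X.k.mat_map_zero)
    finally show ?thesis
      using X.k.free_closed[OF X.k.mat_map_closed[OF fS X.bc_mat[OF mh]]] unfolding Suc bch[unfolded Suc] by simp
  qed
  thus ?thesis unfolding R using w by blast
qed

lemma bc_chain:
  assumes p: "chain_lift p" and f: "f \<in> X.K (X (Suc i))"
  shows "mat_map k (X.bc (p i)) (mat_map k (X.bc m) f) = mat_map k (X.bc m') (mat_map k (X.bc (p (Suc i))) f)"
proof -
  have pm: "p i \<in> X i \<rightarrow> X.F (Y i)" for i using p by (simp add: chain_lift_def)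
  have "mat_map k (X.bc (p i)) (mat_map k (X.bc m) f) = mat_map k (\<lambda>x. mat_map k (X.bc (p i)) (X.bc m x)) f"
    by (rule X.k.mat_map_comp[OF f X.bc_mat[OF X.m] X.bc_mat[OF pm]])
  also have "\<dots> = mat_map k (\<lambda>x. mat_map k (X.bc m') (X.bc (p (Suc i)) x)) f"
  proof (rule X.k.mat_map_cong[OF f])
    fix x assume x: "x \<in> X (Suc i)"
    have "mat_map B m' (p (Suc i) x) = mat_map B (p i) (m x)" using p x by (simp add: chain_lift_def)
    thus "mat_map k (X.bc (p i)) (X.bc m x) = mat_map k (X.bc m') (X.bc (p (Suc i)) x)"
      by (simp only: X.bc_map[OF funcset_mem[OF X.m x] pm] X.bc_map[OF funcset_mem[OF pm x] Y.m])
  next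
    show "(\<lambda>x. mat_map k (X.bc m') (X.bc (p (Suc i)) x)) \<in> X (Suc i) \<rightarrow> X.K (Y i)"
      by (intro Pi_I X.k.mat_map_closed[OF _ X.bc_mat[OF Y.m]] funcset_mem[OF X.bc_mat[OF pm]])
  qed
  also have "\<dots> = mat_map k (X.bc m') (mat_map k (X.bc (p (Suc i))) f)"
    by (rule X.k.mat_map_comp[OF f X.bc_mat[OF pm] X.bc_mat[OF Y.m], symmetric])
  finally show ?thesis .
qed

lemma bc_cycle:
  assumes p: "chain_lift p" and f: "f \<in> cycles (\<lambda>i. free_module k (X i)) (\<lambda>_. mat_map k (X.bc m)) i"
  shows "mat_map k (X.bc (p i)) f \<in> cycles (\<lambda>i. free_module k (Y i)) (\<lambda>_. mat_map k (X.bc m')) i"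
proof -
  have pm: "p i \<in> X i \<rightarrow> X.F (Y i)" for i using p by (simp add: chain_lift_def)
  have fK: "f \<in> X.K (X i)" by (rule subsetD[OF cycles_subset f])
  note pf = X.k.mat_map_closed[OF fK X.bc_mat[OF pm]]
  show ?thesis
  proof (cases i)
    case 0 thus ?thesis using pf by (simp add: cycles_def)
  next
    case (Suc j)
    have D: "mat_map k (X.bc m) f = (\<lambda>_. \<zero>\<^bsub>k\<^esub>)" using f by (simp add: Suc cycles_def)
    have fS: "f \<in> X.K (X (Suc j))" using fK by (simp add: Suc)
    show ?thesis using bc_chain[OF p fS] pf unfolding D by (simp add: cycles_def Suc X.k.mat_map_zero)
  qed
qed

end

context two_resolutions
begin

interpretation YX: two_resolutions k B \<epsilon> Y m' e' X m e ..

text \<open>One round trip being the identity up to boundaries gives injectivity on homology, the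
  other gives surjectivity.\<close>

theorem comparison:
  "\<exists>\<phi>. \<phi> \<in> module_iso k (homology (\<lambda>i. free_module k (X i)) (\<lambda>_. mat_map k (X.bc m)) i)
     (homology (\<lambda>i. free_module k (Y i)) (\<lambda>_. mat_map k (X.bc m')) i)"
proof -
  obtain p where p: "chain_lift p" using ex_chain_lift by blast
  obtain q where q: "YX.chain_lift q" using YX.ex_chain_lift by blast
  have pm: "p i \<in> X i \<rightarrow> X.F (Y i)" and qm: "q i \<in> Y i \<rightarrow> X.F (X i)" for i
    using p q by (auto simp: chain_lift_def YX.chain_lift_def)
  show ?thesis
  proof (rule homology_iso[OF X.bc_complex Y.bc_complex, where \<theta> = "\<lambda>i. mat_map k (X.bc (p i))"])
    show "mat_map k (X.bc (p i)) \<in> linear_maps k (free_module k (X i)) (free_module k (Y i))" for i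
      by (rule X.k.mat_map_linear[OF X.bc_mat[OF pm]])
    show "mat_map k (X.bc (p i)) (mat_map k (X.bc m) f) = mat_map k (X.bc m') (mat_map k (X.bc (p (Suc i))) f)"
      if "f \<in> X.K (X (Suc i))" for f i by (rule bc_chain[OF p that])
  next
    fix i f assume f: "f \<in> cycles (\<lambda>i. free_module k (X i)) (\<lambda>_. mat_map k (X.bc m)) i"
      and "mat_map k (X.bc (p i)) f \<in> mat_map k (X.bc m') ` X.K (Y (Suc i))"
    then obtain v where v: "v \<in> X.K (Y (Suc i))" "mat_map k (X.bc (p i)) f = mat_map k (X.bc m') v" by blast
    obtain w where w: "w \<in> X.K (X (Suc i))" "mat_map k (X.bc m) w =
        (\<lambda>x. f x \<ominus>\<^bsub>k\<^esub> mat_map k (X.bc (q i)) (mat_map k (X.bc (p i)) f) x)"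
      using lift_homotopy[OF p q f] by blast
    let ?u = "mat_map k (X.bc (q (Suc i))) v"
    have u: "?u \<in> X.K (X (Suc i))" by (rule X.k.mat_map_closed[OF v(1) X.bc_mat[OF qm]])
    have fK: "f \<in> X.K (X i)" by (rule subsetD[OF cycles_subset f])
    \<comment> \<open>Write \<open>f\<close> as the sum of its difference from the round trip and
      the round trip itself. The first is the boundary of \<open>w\<close>; the second is the
      boundary of \<open>?u\<close> because \<open>p\<close> sends \<open>f\<close> to a
      boundary.\<close>
    have "mat_map k (X.bc m) (\<lambda>x. w x \<oplus>\<^bsub>k\<^esub> ?u x) = (\<lambda>x. mat_map k (X.bc m) w x \<oplus>\<^bsub>k\<^esub> mat_map k (X.bc m) ?u x)"
      by (rule X.k.mat_map_add[OF w(1) u X.bc_mat[OF X.m]])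
    also have "\<dots> = f"
      unfolding w(2) v(2) YX.bc_chain[OF q v(1)]
      using X.k.free_closed[OF fK] X.k.free_closed[OF X.k.mat_map_closed[OF u X.bc_mat[OF X.m]]]
      by (simp add: a_minus_def X.k.a_assoc X.k.l_neg)
    finally have "f = mat_map k (X.bc m) (\<lambda>x. w x \<oplus>\<^bsub>k\<^esub> ?u x)" by (rule sym)
    thus "f \<in> mat_map k (X.bc m) ` X.K (X (Suc i))" by (rule image_eqI[OF _ X.k.free_add[OF w(1) u]])
  next
    fix i g assume g: "g \<in> cycles (\<lambda>i. free_module k (Y i)) (\<lambda>_. mat_map k (X.bc m')) i"
    let ?f = "mat_map k (X.bc (q i)) g"
    have f: "?f \<in> cycles (\<lambda>i. free_module k (X i)) (\<lambda>_. mat_map k (X.bc m)) i" by (rule YX.bc_cycle[OF q g])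
    obtain w where w: "w \<in> X.K (Y (Suc i))" "mat_map k (X.bc m') w = (\<lambda>x. g x \<ominus>\<^bsub>k\<^esub> mat_map k (X.bc (p i)) ?f x)"
      using YX.lift_homotopy[OF q p g] by blast
    have gK: "g \<in> X.K (Y i)" by (rule subsetD[OF cycles_subset g])
    have fK: "?f \<in> X.K (X i)" by (rule X.k.mat_map_closed[OF gK X.bc_mat[OF qm]])
    note pf = X.k.mat_map_closed[OF fK X.bc_mat[OF pm]]
    interpret M: module k "free_module k (Y i)" by (rule X.k.free_module_module)
    have "\<ominus>\<^bsub>free_module k (Y i)\<^esub> mat_map k (X.bc (p i)) ?f = (\<lambda>x. \<ominus>\<^bsub>k\<^esub> mat_map k (X.bc (p i)) ?f x)"
      using pf X.k.free_uminus[OF pf] X.k.free_closed[OF pf] by (intro M.M.minus_equality) (simp_all add: X.k.l_neg)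
    hence "g \<ominus>\<^bsub>free_module k (Y i)\<^esub> mat_map k (X.bc (p i)) ?f = mat_map k (X.bc m') w"
      unfolding w(2) by (simp add: a_minus_def)
    hence "g \<ominus>\<^bsub>free_module k (Y i)\<^esub> mat_map k (X.bc (p i)) ?f \<in> mat_map k (X.bc m') ` X.K (Y (Suc i))"
      by (rule image_eqI[OF _ w(1)])
    thus "\<exists>f\<in>cycles (\<lambda>i. free_module k (X i)) (\<lambda>_. mat_map k (X.bc m)) i.
        g \<ominus>\<^bsub>free_module k (Y i)\<^esub> mat_map k (X.bc (p i)) f \<in> mat_map k (X.bc m') ` X.K (Y (Suc i))"
      using f by blast
  qed
qed

end

section \<open>Change of rings\<close>

lemma homology_cong:
  assumes "\<And>i x. x \<in> carrier (C (Suc i)) \<Longrightarrow> d i x = d' i x"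
  shows "homology C d i = homology C d' i"
proof -
  have "cycles C d i = cycles C d' i" using assms by (cases i) (auto simp: cycles_def)
  moreover have "d i ` carrier (C (Suc i)) = d' i ` carrier (C (Suc i))" by (rule image_cong[OF refl assms])
  ultimately show ?thesis by (simp only: homology_cycles)
qed

lemma (in k_complex) homology_module: "module k (homology C d i)"
  unfolding homology_cycles
  by (intro quotient.quotient_module quotient.intro quotient_axioms.intro cycles_module boundaries_submodule_cycles)

context augmented_algebra
begin

lemma aug_ring: "aug_ring k A \<epsilon>"
  by (intro aug_ring.intro aug_ring_axioms.intro aug k.cring_axioms A.ring_axioms)

sublocale G: aug_ring k A \<epsilon> by (rule aug_ring)

lemma elt_mat: "elt \<in> gens 0 \<rightarrow> carrier k" by auto

lemma std_aug_ev: assumes f: "f \<in> carrier (free_module A (gens 0))" shows "std_aug A N f = aug_eval k \<epsilon> elt f"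
proof -
  have e: "elt x \<in> carrier k" if "f x \<noteq> \<zero>\<^bsub>A\<^esub>" for x
    using funcset_mem[OF elt_mat] A.free_supp[OF f] that by blast
  have c: "\<epsilon> (f x) \<in> carrier k" for x by (rule aug_closed[OF A.free_closed[OF f]])
  have e': "elt x \<in> carrier k" if "\<epsilon> (f x) \<noteq> \<zero>\<^bsub>k\<^esub>" for x
    by (rule e) (use that aug_zero in auto)
  have "std_aug A N f = (\<Oplus>\<^bsub>k\<^esub>x\<in>{x. f x \<noteq> \<zero>\<^bsub>A\<^esub>}. \<epsilon> (f x) \<otimes>\<^bsub>k\<^esub> elt x)"
    by (simp add: std_aug_def finsum_def finprod_def)
  also have "\<dots> = (\<Oplus>\<^bsub>k\<^esub>x\<in>{x. \<epsilon> (f x) \<noteq> \<zero>\<^bsub>k\<^esub>}. elt x \<otimes>\<^bsub>k\<^esub> \<epsilon> (f x))"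
    using A.free_finite[OF f] e e' c aug_zero
    by (intro k.add.finprod_mono_neutral_cong_right) (auto simp: k.m_comm)
  also have "\<dots> = aug_eval k \<epsilon> elt f" by (simp add: aug_eval_def mat_map_def)
  finally show ?thesis .
qed

text \<open>The known exactness statements equate images with kernels. Each equation is used twice,
  once for exactness and once for the composite being zero.\<close>

lemma std_resolution: "resolution k A \<epsilon> gens (syz_fun A) elt"
proof -
  interpret R: right_module A N by (rule right_module_N)
  have e0: "mat_map A (syz_fun A) ` carrier (free_module A (gens (Suc 0))) =
      {f \<in> carrier (free_module A (gens 0)). aug_eval k \<epsilon> elt f = \<zero>\<^bsub>k\<^esub>}"
    using R.std_res_exact_0 std_aug_ev by (auto simp: std_res_def std_diff_mat_map simp del: std_gens.simps)
  have eS: "mat_map A (syz_fun A) ` carrier (free_module A (gens (Suc (Suc i)))) =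
      {f \<in> carrier (free_module A (gens (Suc i))). mat_map A (syz_fun A) f = (\<lambda>_. \<zero>\<^bsub>A\<^esub>)}" for i
    using R.std_res_exact_Suc[of i] by (simp add: std_res_def std_diff_mat_map del: std_gens.simps)
  have s: "\<exists>f\<in>carrier (free_module A (gens 0)). aug_eval k \<epsilon> elt f = y" if "y \<in> carrier k" for y
  proof -
    have "y \<in> std_aug A N ` carrier (free_module A (gens 0))"
      using R.std_aug_surj that by (simp add: std_res_def del: std_gens.simps)
    thus ?thesis using std_aug_ev by auto
  qed
  have x0: "\<exists>g\<in>carrier (free_module A (gens (Suc 0))). mat_map A (syz_fun A) g = f"
    if "f \<in> carrier (free_module A (gens 0))" "aug_eval k \<epsilon> elt f = \<zero>\<^bsub>k\<^esub>" for f
  proof -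
    have "f \<in> mat_map A (syz_fun A) ` carrier (free_module A (gens (Suc 0)))" unfolding e0 using that by blast
    thus ?thesis by (auto simp del: std_gens.simps)
  qed
  have xS: "\<exists>g\<in>carrier (free_module A (gens (Suc (Suc i)))). mat_map A (syz_fun A) g = f"
    if "f \<in> carrier (free_module A (gens (Suc i)))" "mat_map A (syz_fun A) f = (\<lambda>_. \<zero>\<^bsub>A\<^esub>)" for f i
  proof -
    have "f \<in> mat_map A (syz_fun A) ` carrier (free_module A (gens (Suc (Suc i))))" unfolding eS using that by blast
    thus ?thesis by (auto simp del: std_gens.simps)
  qed
  show ?thesis
    by (intro resolution.intro resolution_axioms.intro aug_ring syz_mat elt_mat s x0 xS) (use e0 eS in blast)+
qed

end

section \<open>Passage of the standard resolution to a quotient algebra\<close>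

locale change_of_rings = A: augmented_algebra k A \<epsilon> + B: augmented_algebra k B \<epsilon>'
  for k :: "('k, 'r) ring_scheme" and A :: "('k, 'a) module" and \<epsilon> and B :: "('k, 'b) module" and \<epsilon>' +
  fixes \<pi> assumes \<pi>: "\<pi> \<in> ring_hom A B" and \<pi>_surj: "\<pi> ` carrier A = carrier B"
    and \<pi>_aug: "\<And>a. a \<in> carrier A \<Longrightarrow> \<epsilon>' (\<pi> a) = \<epsilon> a"
begin

lemma R: "resolution k A \<epsilon> A.gens (syz_fun A) elt" by (rule A.std_resolution)
sublocale R: resolution k A \<epsilon> A.gens "syz_fun A" elt by (rule R)

lemma \<pi>_zero: "\<pi> \<zero>\<^bsub>A\<^esub> = \<zero>\<^bsub>B\<^esub>"
  by (rule ring_hom_zero[OF \<pi> A.A.ring_axioms B.A.ring_axioms])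

lemma \<pi>_free: "f \<in> carrier (free_module A X) \<Longrightarrow> (\<lambda>x. \<pi> (f x)) \<in> carrier (free_module B X)"
  by (rule hom_free[OF A.A.ring_axioms B.A.ring_axioms \<pi>])

lemma lift_free:
  assumes g: "g \<in> carrier (free_module B X)"
  obtains f where "f \<in> carrier (free_module A X)" "(\<lambda>x. \<pi> (f x)) = g"
proof -
  have "\<exists>a\<in>carrier A. \<pi> a = g x" for x using \<pi>_surj B.A.free_closed[OF g, of x] by (metis image_iff)
  then obtain s where s: "\<And>x. s x \<in> carrier A" "\<And>x. \<pi> (s x) = g x" by metis
  \<comment> \<open>Zero must be lifted to zero, since arbitrary preimages would destroy finite
    support.\<close>
  let ?f = "\<lambda>x. if g x = \<zero>\<^bsub>B\<^esub> then \<zero>\<^bsub>A\<^esub> else s x"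
  have "{x. ?f x \<noteq> \<zero>\<^bsub>A\<^esub>} \<subseteq> {x. g x \<noteq> \<zero>\<^bsub>B\<^esub>}" by auto
  hence "finite {x. ?f x \<noteq> \<zero>\<^bsub>A\<^esub>}" by (rule finite_subset) (rule B.A.free_finite[OF g])
  hence "?f \<in> carrier (free_module A X)"
    unfolding free_module_mem using s(1) B.A.free_outside[OF g] by simp
  moreover have "(\<lambda>x. \<pi> (?f x)) = g" using s(2) \<pi>_zero by auto
  ultimately show ?thesis by (rule that)
qed

lemma \<pi>_map: "f \<in> carrier (free_module A X) \<Longrightarrow> \<phi> \<in> X \<rightarrow> carrier (free_module A Y) \<Longrightarrow>
    mat_map B (\<lambda>x y. \<pi> (\<phi> x y)) (\<lambda>x. \<pi> (f x)) = (\<lambda>y. \<pi> (mat_map A \<phi> f y))"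
  by (rule mat_map_hom[OF A.A.ring_axioms B.A.ring_axioms \<pi>])

lemma \<pi>_ev: assumes f: "f \<in> carrier (free_module A X)"
  shows "aug_eval k \<epsilon>' e (\<lambda>x. \<pi> (f x)) = aug_eval k \<epsilon> e f"
  unfolding aug_eval_def by (simp only: \<pi>_aug[OF A.A.free_closed[OF f]])

abbreviation d where "d \<equiv> mat_map A (syz_fun A)"
abbreviation m' where "m' \<equiv> (\<lambda>x y. \<pi> (syz_fun A x y))"

text \<open>The hypothesis says that the chains with coefficients in the kernel of
  \<open>\<pi>\<close> form an exact complex. A cycle over \<open>B\<close> lifts to a chain whose
  boundary has coefficients in the kernel; correcting the lift there turns it into a cycle over
  \<open>A\<close>, which bounds. In degree 0 no correction is required because
  \<open>\<epsilon>\<close> factors through \<open>\<pi>\<close>.\<close>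

lemma base_change_resolution:
  assumes acyc: "\<And>i z. \<lbrakk>R.cyc i z; \<And>x. \<pi> (z x) = \<zero>\<^bsub>B\<^esub>\<rbrakk> \<Longrightarrow>
    \<exists>y\<in>carrier (free_module A (A.gens (Suc i))). (\<forall>x. \<pi> (y x) = \<zero>\<^bsub>B\<^esub>) \<and> d y = z"
  shows "resolution k B \<epsilon>' A.gens m' elt"
proof (intro resolution.intro resolution_axioms.intro B.aug_ring)
  show "m' \<in> A.gens (Suc i) \<rightarrow> carrier (free_module B (A.gens i))" for i
    by (intro Pi_I \<pi>_free funcset_mem[OF A.syz_mat])
  show "elt \<in> A.gens 0 \<rightarrow> carrier k" by (rule A.elt_mat)
  show "\<exists>f\<in>carrier (free_module B (A.gens 0)). aug_eval k \<epsilon>' elt f = y" if y: "y \<in> carrier k" for y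
    using R.surj[OF y] \<pi>_free \<pi>_ev by blast
  note dm = \<pi>_map[OF _ A.syz_mat]
  show "aug_eval k \<epsilon>' elt (mat_map B m' g) = \<zero>\<^bsub>k\<^esub>" if g: "g \<in> carrier (free_module B (A.gens (Suc 0)))" for g
  proof -
    obtain f where f: "f \<in> carrier (free_module A (A.gens (Suc 0)))" "(\<lambda>x. \<pi> (f x)) = g" using lift_free[OF g] .
    show ?thesis
      unfolding f(2)[symmetric] dm[OF f(1)] \<pi>_ev[OF A.A.mat_map_closed[OF f(1) A.syz_mat]]
      by (rule R.complex_0[OF f(1)])
  qed
  show "mat_map B m' (mat_map B m' g) = (\<lambda>_. \<zero>\<^bsub>B\<^esub>)" if g: "g \<in> carrier (free_module B (A.gens (Suc (Suc i))))" for g i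
  proof -
    obtain f where f: "f \<in> carrier (free_module A (A.gens (Suc (Suc i))))" "(\<lambda>x. \<pi> (f x)) = g" using lift_free[OF g] .
    show ?thesis
      unfolding f(2)[symmetric] dm[OF f(1)] dm[OF A.A.mat_map_closed[OF f(1) A.syz_mat]] R.complex_Suc[OF f(1)] \<pi>_zero ..
  qed
  show "\<exists>h\<in>carrier (free_module B (A.gens (Suc 0))). mat_map B m' h = g"
    if g: "g \<in> carrier (free_module B (A.gens 0))" "aug_eval k \<epsilon>' elt g = \<zero>\<^bsub>k\<^esub>" for g
  proof -
    obtain f where f: "f \<in> carrier (free_module A (A.gens 0))" "(\<lambda>x. \<pi> (f x)) = g" using lift_free[OF g(1)] .
    have "aug_eval k \<epsilon> elt f = \<zero>\<^bsub>k\<^esub>" using g(2) unfolding f(2)[symmetric] \<pi>_ev[OF f(1)] .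
    from R.exact_0[OF f(1) this] obtain h where h: "h \<in> carrier (free_module A (A.gens (Suc 0)))" "d h = f" by blast
    have "mat_map B m' (\<lambda>x. \<pi> (h x)) = g" unfolding dm[OF h(1)] h(2) f(2) ..
    thus ?thesis using \<pi>_free[OF h(1)] by blast
  qed
  show "\<exists>h\<in>carrier (free_module B (A.gens (Suc (Suc i)))). mat_map B m' h = g"
    if g: "g \<in> carrier (free_module B (A.gens (Suc i)))" "mat_map B m' g = (\<lambda>_. \<zero>\<^bsub>B\<^esub>)" for g i
  proof -
    obtain f where f: "f \<in> carrier (free_module A (A.gens (Suc i)))" "(\<lambda>x. \<pi> (f x)) = g" using lift_free[OF g(1)] .
    have "(\<lambda>y. \<pi> (d f y)) = (\<lambda>_. \<zero>\<^bsub>B\<^esub>)" using g(2) unfolding f(2)[symmetric] dm[OF f(1)] .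
    hence z: "\<And>x. \<pi> (d f x) = \<zero>\<^bsub>B\<^esub>" by (rule fun_cong)
    obtain y where y: "y \<in> carrier (free_module A (A.gens (Suc i)))" "\<And>x. \<pi> (y x) = \<zero>\<^bsub>B\<^esub>" "d y = d f"
      using acyc[OF R.cyc_boundary[OF f(1)] z] by blast
    \<comment> \<open>The corrected lift: it has boundary zero, and it still projects to
      \<open>g\<close> since \<open>y\<close> projects to zero.\<close>
    let ?w = "\<lambda>x. f x \<ominus>\<^bsub>A\<^esub> y x"
    have w: "?w \<in> carrier (free_module A (A.gens (Suc i)))" by (rule A.A.free_minus[OF f(1) y(1)])
    have "d ?w = (\<lambda>x. d f x \<ominus>\<^bsub>A\<^esub> d y x)" by (rule A.A.mat_map_minus[OF f(1) y(1) A.syz_mat])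
    also have "\<dots> = (\<lambda>_. \<zero>\<^bsub>A\<^esub>)"
      unfolding y(3) a_minus_def by (intro ext A.A.r_neg A.A.free_closed[OF A.A.mat_map_closed[OF f(1) A.syz_mat]])
    finally have dw: "d ?w = (\<lambda>_. \<zero>\<^bsub>A\<^esub>)" .
    obtain h where h: "h \<in> carrier (free_module A (A.gens (Suc (Suc i))))" "d h = ?w" using R.exact_Suc[OF w dw] by blast
    have "\<pi> (?w x) = g x" for x
    proof -
      have c: "f x \<in> carrier A" "y x \<in> carrier A" "?w x \<in> carrier A"
        by (rule A.A.free_closed[OF f(1)], rule A.A.free_closed[OF y(1)], rule A.A.free_closed[OF w])
      have "\<pi> (?w x) \<oplus>\<^bsub>B\<^esub> \<pi> (y x) = \<pi> (?w x \<oplus>\<^bsub>A\<^esub> y x)" by (rule ring_hom_add[OF \<pi> c(3,2), symmetric])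
      also have "?w x \<oplus>\<^bsub>A\<^esub> y x = f x" using c by (simp add: a_minus_def A.A.a_assoc A.A.l_neg)
      also have "\<pi> (f x) = g x" by (rule fun_cong[OF f(2)])
      finally show ?thesis using y(2)[of x] ring_hom_closed[OF \<pi> c(3)] by simp
    qed
    hence "mat_map B m' (\<lambda>x. \<pi> (h x)) = g" unfolding dm[OF h(1)] h(2) by (rule ext)
    thus ?thesis using \<pi>_free[OF h(1)] by blast
  qed
qed

text \<open>The resolution over \<open>A\<close> and its image over \<open>B\<close> have the same
  reduction to \<open>k\<close>, because \<open>\<epsilon>\<close> is the composite of
  \<open>\<epsilon>'\<close> and \<open>\<pi>\<close>. The image is a resolution over
  \<open>B\<close> and is compared with the standard one.\<close>

theorem Tor_change_of_rings:
  assumes acyc: "\<And>i z. \<lbrakk>R.cyc i z; \<And>x. \<pi> (z x) = \<zero>\<^bsub>B\<^esub>\<rbrakk> \<Longrightarrow>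
    \<exists>y\<in>carrier (free_module A (A.gens (Suc i))). (\<forall>x. \<pi> (y x) = \<zero>\<^bsub>B\<^esub>) \<and> d y = z"
  shows "\<exists>\<phi>. \<phi> \<in> module_iso k (Tor k A A.N A.N i) (Tor k B B.N B.N i)"
proof -
  let ?HA = "homology (\<lambda>i. free_module k (A.gens i)) (\<lambda>_. mat_map k A.kmat) i"
  let ?HB = "homology (\<lambda>i. free_module k (B.gens i)) (\<lambda>_. mat_map k B.kmat) i"
  let ?H = "homology (\<lambda>i. free_module k (A.gens i)) (\<lambda>_. mat_map k (\<lambda>x y. \<epsilon>' (m' x y))) i"
  have eq: "?HA = ?H"
  proof (rule homology_cong)
    fix j f assume f: "f \<in> carrier (free_module k (A.gens (Suc j)))"
    show "mat_map k A.kmat f = mat_map k (\<lambda>x y. \<epsilon>' (m' x y)) f"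
    proof (rule A.k.mat_map_cong[OF f, symmetric])
      fix x assume "x \<in> A.gens (Suc j)"
      note c = A.A.free_closed[OF funcset_mem[OF A.syz_mat this]]
      show "(\<lambda>y. \<epsilon>' (m' x y)) = A.kmat x" by (simp only: \<pi>_aug[OF c])
    qed (rule A.kmat)
  qed
  have "two_resolutions k B \<epsilon>' A.gens m' elt B.gens (syz_fun B) elt"
    by (intro two_resolutions.intro base_change_resolution[OF acyc] B.std_resolution)
  from two_resolutions.comparison[OF this] obtain \<gamma> where \<gamma>: "\<gamma> \<in> module_iso k ?H ?HB" by blast
  obtain \<alpha> where \<alpha>: "\<alpha> \<in> module_iso k (Tor k A A.N A.N i) ?H" using A.Tor_iso[of i] unfolding eq by blast
  obtain \<beta> where \<beta>: "\<beta> \<in> module_iso k (Tor k B B.N B.N i) ?HB" using B.Tor_iso by blast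
  note \<beta>' = module_iso_inv[OF k_complex.homology_module[OF B.Tor_complex, folded Tor_def] \<beta>]
  show ?thesis by (rule exI[where x = "inv_into (carrier (Tor k B B.N B.N i)) \<beta> \<circ> (\<gamma> \<circ> \<alpha>)"],
    rule module_iso_trans[OF module_iso_trans[OF \<alpha> \<gamma>] \<beta>'])
qed

end

section \<open>Left ideals spanned by basis elements, and acyclicity of chains over them\<close>

locale based_augmented = augmented_algebra k A \<epsilon>
  for k :: "('k, 'r) ring_scheme" and A :: "('k, 'd \<Rightarrow> 'k) module" and \<epsilon> +
  fixes D I :: "'d set"
  assumes carrier_A: "carrier A = carrier (free_module k D)"
    and add_A: "a \<oplus>\<^bsub>A\<^esub> b = (\<lambda>x. a x \<oplus>\<^bsub>k\<^esub> b x)" and zero_A: "\<zero>\<^bsub>A\<^esub> = (\<lambda>_. \<zero>\<^bsub>k\<^esub>)"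
    and I: "I \<subseteq> D" and aug_I: "a \<in> carrier (free_module k I) \<Longrightarrow> \<epsilon> a = \<zero>\<^bsub>k\<^esub>"
begin

sublocale R: resolution k A \<epsilon> gens "syz_fun A" elt by (rule std_resolution)

abbreviation S where "S U \<equiv> carrier (free_module k U)"
abbreviation d where "d \<equiv> mat_map A (syz_fun A)"

text \<open>The set \<open>U\<close> consists of basis elements and stands for its span
  \<open>S U\<close>. Sums and intersections of such spans belong to unions and intersections of
  sets, which general left ideals do not offer.\<close>

definition left_ideal :: "'d set \<Rightarrow> bool" where
  "left_ideal U \<longleftrightarrow> U \<subseteq> I \<and> (\<forall>a\<in>carrier A. \<forall>b\<in>S U. a \<otimes>\<^bsub>A\<^esub> b \<in> S U)"

text \<open>Exactness of the resolution with coefficients in the left ideal spanned by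
  \<open>U\<close>. For \<open>U\<close> inside \<open>I\<close> the condition that
  \<open>R.cyc\<close> imposes in degree 0 holds by itself, as \<open>ev_I\<close> shows.\<close>

definition acyclic :: "'d set \<Rightarrow> bool" where
  "acyclic U \<longleftrightarrow> (\<forall>i z. R.cyc i z \<longrightarrow> (\<forall>x. z x \<in> S U) \<longrightarrow>
     (\<exists>y\<in>carrier (free_module A (gens (Suc i))). (\<forall>x. y x \<in> S U) \<and> d y = z))"

lemma S_mono: "U \<subseteq> V \<Longrightarrow> S U \<subseteq> S V" by (rule k.free_mono)

lemma S_add: "a \<in> S U \<Longrightarrow> b \<in> S U \<Longrightarrow> a \<oplus>\<^bsub>A\<^esub> b \<in> S U" by (simp add: add_A)

lemma S_A: "U \<subseteq> D \<Longrightarrow> S U \<subseteq> carrier A" unfolding carrier_A by (rule k.free_mono)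

lemma S_Int: "S U \<inter> S V = S (U \<inter> V)" by (auto simp: free_module_mem)

lemma S_minus: "U \<subseteq> D \<Longrightarrow> a \<in> S U \<Longrightarrow> b \<in> S U \<Longrightarrow> a \<ominus>\<^bsub>A\<^esub> b \<in> S U"
proof -
  assume U: "U \<subseteq> D" and a: "a \<in> S U" and b: "b \<in> S U"
  let ?n = "\<lambda>x. \<ominus>\<^bsub>k\<^esub> b x"
  have n: "?n \<in> S U" by (rule k.free_uminus[OF b])
  have "\<ominus>\<^bsub>A\<^esub> b = ?n"
    using S_A[OF U] n b by (intro A.minus_equality) (auto simp: add_A zero_A k.l_neg k.free_closed[OF b])
  thus ?thesis using S_add[OF a n] by (simp add: a_minus_def)
qed

lemma S_finsum:
  assumes U: "U \<subseteq> D" and "finite T" "\<And>x. x \<in> T \<Longrightarrow> g x \<in> S U" shows "(\<Oplus>\<^bsub>A\<^esub>x\<in>T. g x) \<in> S U"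
  using assms(2,3)
proof (induction T rule: finite_induct)
  case empty show ?case by (simp add: zero_A)
next
  case (insert x T)
  have "g \<in> insert x T \<rightarrow> carrier A" using insert(4) S_A[OF U] by blast
  hence "(\<Oplus>\<^bsub>A\<^esub>x\<in>insert x T. g x) = g x \<oplus>\<^bsub>A\<^esub> (\<Oplus>\<^bsub>A\<^esub>x\<in>T. g x)"
    using insert(1,2) by (intro A.finsum_insert) auto
  thus ?case using S_add insert by auto
qed

text \<open>The differential multiplies coefficients from the left, so chains over a left ideal form
  a subcomplex.\<close>

lemma d_ideal:
  assumes U: "left_ideal U" and f: "f \<in> carrier (free_module A (gens (Suc i)))" "\<And>x. f x \<in> S U"
  shows "d f y \<in> S U"
  unfolding mat_map_def
proof (rule S_finsum)
  show "U \<subseteq> D" using U I by (auto simp: left_ideal_def)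
  show "finite {x. f x \<noteq> \<zero>\<^bsub>A\<^esub>}" by (rule A.free_finite[OF f(1)])
  fix x assume "x \<in> {x. f x \<noteq> \<zero>\<^bsub>A\<^esub>}"
  hence "syz_fun A x y \<in> carrier A"
    using A.mat_closed[OF syz_mat] A.free_supp[OF f(1)] by blast
  thus "syz_fun A x y \<otimes>\<^bsub>A\<^esub> f x \<in> S U" using U f(2) by (simp add: left_ideal_def)
qed

lemma ev_I:
  assumes "\<And>x. f x \<in> S U" "U \<subseteq> I" shows "aug_eval k \<epsilon> e f = \<zero>\<^bsub>k\<^esub>"
proof -
  have "\<epsilon> (f x) = \<zero>\<^bsub>k\<^esub>" for x by (rule aug_I) (use assms S_mono in blast)
  thus ?thesis by (simp add: aug_eval_def k.mat_map_zero)
qed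

text \<open>Mayer-Vietoris: if \<open>z = a + b\<close> with \<open>a\<close> over \<open>U\<close> and \<open>b\<close> over \<open>V\<close>, then the
  boundary of \<open>a\<close> lies over \<open>U \<inter> V\<close>, and a chain over \<open>U \<inter> V\<close> with the same boundary
  corrects \<open>a\<close> and \<open>b\<close> to cycles.\<close>

lemma acyclic_Un:
  assumes U: "left_ideal U" "acyclic U" and V: "left_ideal V" "acyclic V" and UV: "acyclic (U \<inter> V)"
  shows "acyclic (U \<union> V)"
  unfolding acyclic_def
proof (intro allI impI)
  fix i z assume z: "R.cyc i z" and zS: "\<forall>x. z x \<in> S (U \<union> V)"
  have UD: "U \<subseteq> D" "V \<subseteq> D" "U \<union> V \<subseteq> D" "U \<inter> V \<subseteq> D" using U(1) V(1) I by (auto simp: left_ideal_def)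
  have zF: "z \<in> carrier (free_module A (gens i))" by (rule R.cyc_F[OF z])
  \<comment> \<open>Basis elements in both sets are assigned to \<open>a\<close>; any fixed rule
    would do, since \<open>w\<close> corrects for it.\<close>
  define a where "a x = (\<lambda>b. if b \<in> U then z x b else \<zero>\<^bsub>k\<^esub>)" for x
  define b where "b x = (\<lambda>b. if b \<notin> U then z x b else \<zero>\<^bsub>k\<^esub>)" for x
  have aS: "a x \<in> S U" for x
    using k.free_restrict[OF zS[rule_format, of x], of "\<lambda>b. b \<in> U"] unfolding a_def by (auto simp: free_module_mem)
  have bS: "b x \<in> S V" for x
    using k.free_restrict[OF zS[rule_format, of x], of "\<lambda>b. b \<notin> U"] unfolding b_def by (auto simp: free_module_mem)
  have ab: "a x \<oplus>\<^bsub>A\<^esub> b x = z x" for x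
    using k.free_closed[OF zS[rule_format, of x]] by (auto simp: a_def b_def add_A)
  have aA: "a x \<in> carrier A" and bA: "b x \<in> carrier A" for x using aS bS S_A UD by blast+
  have sub: "a x = \<zero>\<^bsub>A\<^esub>" "b x = \<zero>\<^bsub>A\<^esub>" if "z x = \<zero>\<^bsub>A\<^esub>" for x using that by (auto simp: a_def b_def zero_A)
  have aF: "a \<in> carrier (free_module A (gens i))"
    unfolding free_module_mem using aA sub(1) A.free_outside[OF zF]
    by (auto intro: finite_subset[OF _ A.free_finite[OF zF]])
  have bF: "b \<in> carrier (free_module A (gens i))"
    unfolding free_module_mem using bA sub(2) A.free_outside[OF zF]
    by (auto intro: finite_subset[OF _ A.free_finite[OF zF]])
  have zab: "z = (\<lambda>x. a x \<oplus>\<^bsub>A\<^esub> b x)" using ab by simp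
  have "\<exists>w\<in>carrier (free_module A (gens i)). (\<forall>x. w x \<in> S (U \<inter> V)) \<and>
      R.cyc i (\<lambda>x. a x \<ominus>\<^bsub>A\<^esub> w x) \<and> R.cyc i (\<lambda>x. b x \<oplus>\<^bsub>A\<^esub> w x)"
  proof (cases i)
    case 0
    \<comment> \<open>In degree 0 both parts are cycles already, because \<open>\<epsilon>\<close>
      vanishes on the span of \<open>I\<close>; the correction \<open>w\<close> is zero.\<close>
    have "R.cyc i a" "R.cyc i b"
      using aF bF ev_I[of a U elt] ev_I[of b V elt] aS bS U(1) V(1) by (auto simp: R.cyc_def 0 left_ideal_def)
    moreover have "(\<lambda>x. a x \<ominus>\<^bsub>A\<^esub> \<zero>\<^bsub>A\<^esub>) = a" "(\<lambda>x. b x \<oplus>\<^bsub>A\<^esub> \<zero>\<^bsub>A\<^esub>) = b" using aA bA by (auto simp: a_minus_def)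
    moreover have "\<zero>\<^bsub>A\<^esub> \<in> S (U \<inter> V)" by (simp add: zero_A)
    ultimately show ?thesis by (intro bexI[OF _ A.free_zero]) simp
  next
    case (Suc j)
    have aF': "a \<in> carrier (free_module A (gens (Suc j)))" and bF': "b \<in> carrier (free_module A (gens (Suc j)))"
      using aF bF by (simp_all only: Suc)
    have "d z = (\<lambda>x. d a x \<oplus>\<^bsub>A\<^esub> d b x)" unfolding zab by (rule A.mat_map_add[OF aF' bF' syz_mat])
    moreover have "d z = (\<lambda>_. \<zero>\<^bsub>A\<^esub>)" using z by (simp add: R.cyc_def Suc)
    ultimately have s0: "d a x \<oplus>\<^bsub>A\<^esub> d b x = \<zero>\<^bsub>A\<^esub>" for x by metis
    have daA: "d a x \<in> carrier A" "d b x \<in> carrier A" for x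
      by (rule A.free_closed[OF A.mat_map_closed[OF aF' syz_mat]], rule A.free_closed[OF A.mat_map_closed[OF bF' syz_mat]])
    \<comment> \<open>The boundary of \<open>a\<close> is over \<open>U\<close> by construction and
      over \<open>V\<close> as the negative of the boundary of \<open>b\<close>.\<close>
    have "d a x = \<zero>\<^bsub>A\<^esub> \<ominus>\<^bsub>A\<^esub> d b x" for x
      using s0[of x] daA[of x] A.minus_equality[of "d a x" "d b x"] by (simp add: a_minus_def)
    hence "d a x \<in> S V" for x
      using S_minus[OF UD(2) _ d_ideal[OF V(1) bF' bS], of "\<zero>\<^bsub>A\<^esub>" x] by (simp add: zero_A)
    hence "\<forall>x. d a x \<in> S (U \<inter> V)" using d_ideal[OF U(1) aF' aS] S_Int by blast
    then obtain w where w: "w \<in> carrier (free_module A (gens (Suc j)))" "\<forall>x. w x \<in> S (U \<inter> V)" "d w = d a"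
      using UV R.cyc_boundary[OF aF'] unfolding acyclic_def by blast
    have c1: "d (\<lambda>x. a x \<ominus>\<^bsub>A\<^esub> w x) = (\<lambda>_. \<zero>\<^bsub>A\<^esub>)"
      unfolding A.mat_map_minus[OF aF' w(1) syz_mat] w(3) using daA by (simp add: a_minus_def A.r_neg)
    have c2: "d (\<lambda>x. b x \<oplus>\<^bsub>A\<^esub> w x) = (\<lambda>_. \<zero>\<^bsub>A\<^esub>)"
      unfolding A.mat_map_add[OF bF' w(1) syz_mat] w(3) using s0 daA by (auto simp: A.a_comm)
    show ?thesis
      using w(1,2) A.free_minus[OF aF' w(1)] A.free_add[OF bF' w(1)] c1 c2
      by (intro bexI[of _ w]) (simp_all add: R.cyc_def Suc del: std_gens.simps)
  qed
  then obtain w where w: "w \<in> carrier (free_module A (gens i))" "\<forall>x. w x \<in> S (U \<inter> V)"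
    "R.cyc i (\<lambda>x. a x \<ominus>\<^bsub>A\<^esub> w x)" "R.cyc i (\<lambda>x. b x \<oplus>\<^bsub>A\<^esub> w x)" by blast
  have wU: "w x \<in> S U" and wV: "w x \<in> S V" for x using w(2) S_Int by blast+
  have wA: "w x \<in> carrier A" for x by (rule A.free_closed[OF w(1)])
  have "\<forall>x. a x \<ominus>\<^bsub>A\<^esub> w x \<in> S U" by (intro allI S_minus[OF UD(1)] aS wU)
  then obtain u where u: "u \<in> carrier (free_module A (gens (Suc i)))" "\<forall>x. u x \<in> S U" "d u = (\<lambda>x. a x \<ominus>\<^bsub>A\<^esub> w x)"
    using U(2) w(3) unfolding acyclic_def by blast
  have "\<forall>x. b x \<oplus>\<^bsub>A\<^esub> w x \<in> S V" by (intro allI S_add bS wV)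
  then obtain v where v: "v \<in> carrier (free_module A (gens (Suc i)))" "\<forall>x. v x \<in> S V" "d v = (\<lambda>x. b x \<oplus>\<^bsub>A\<^esub> w x)"
    using V(2) w(4) unfolding acyclic_def by blast
  have "d (\<lambda>x. u x \<oplus>\<^bsub>A\<^esub> v x) = (\<lambda>x. (a x \<ominus>\<^bsub>A\<^esub> w x) \<oplus>\<^bsub>A\<^esub> (b x \<oplus>\<^bsub>A\<^esub> w x))"
    unfolding A.mat_map_add[OF u(1) v(1) syz_mat] u(3) v(3) ..
  also have "\<dots> = z"
  proof
    fix x
    have "(a x \<ominus>\<^bsub>A\<^esub> w x) \<oplus>\<^bsub>A\<^esub> (b x \<oplus>\<^bsub>A\<^esub> w x) = a x \<oplus>\<^bsub>A\<^esub> b x \<oplus>\<^bsub>A\<^esub> (\<ominus>\<^bsub>A\<^esub> w x \<oplus>\<^bsub>A\<^esub> w x)"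
      using aA bA wA by (simp add: a_minus_def A.a_ac)
    also have "\<dots> = z x" using aA[of x] bA[of x] wA[of x] by (simp add: A.l_neg ab[symmetric])
    finally show "(a x \<ominus>\<^bsub>A\<^esub> w x) \<oplus>\<^bsub>A\<^esub> (b x \<oplus>\<^bsub>A\<^esub> w x) = z x" .
  qed
  finally have "d (\<lambda>x. u x \<oplus>\<^bsub>A\<^esub> v x) = z" .
  moreover have "\<forall>x. u x \<oplus>\<^bsub>A\<^esub> v x \<in> S (U \<union> V)"
    using u(2) v(2) S_add S_mono[of U "U \<union> V"] S_mono[of V "U \<union> V"] by blast
  ultimately show "\<exists>y\<in>carrier (free_module A (gens (Suc i))). (\<forall>x. y x \<in> S (U \<union> V)) \<and> d y = z"
    by (intro bexI[of _ "\<lambda>x. u x \<oplus>\<^bsub>A\<^esub> v x"] A.free_add[OF u(1) v(1)] conjI)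
qed

lemma left_ideal_Un:
  assumes U: "left_ideal U" and V: "left_ideal V" shows "left_ideal (U \<union> V)"
  unfolding left_ideal_def
proof (intro conjI ballI)
  show "U \<union> V \<subseteq> I" using U V by (auto simp: left_ideal_def)
  have UD: "U \<subseteq> D" "V \<subseteq> D" using U V I by (auto simp: left_ideal_def)
  fix a b assume a: "a \<in> carrier A" and b: "b \<in> S (U \<union> V)"
  define b1 where "b1 = (\<lambda>x. if x \<in> U then b x else \<zero>\<^bsub>k\<^esub>)"
  define b2 where "b2 = (\<lambda>x. if x \<notin> U then b x else \<zero>\<^bsub>k\<^esub>)"
  have S: "b1 \<in> S U" "b2 \<in> S V"
    using k.free_restrict[OF b, of "\<lambda>x. x \<in> U"] k.free_restrict[OF b, of "\<lambda>x. x \<notin> U"]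
    unfolding b1_def b2_def by (auto simp: free_module_mem)
  have "b = b1 \<oplus>\<^bsub>A\<^esub> b2" using k.free_closed[OF b] by (auto simp: add_A b1_def b2_def)
  moreover have "a \<otimes>\<^bsub>A\<^esub> (b1 \<oplus>\<^bsub>A\<^esub> b2) = a \<otimes>\<^bsub>A\<^esub> b1 \<oplus>\<^bsub>A\<^esub> a \<otimes>\<^bsub>A\<^esub> b2"
    by (rule A.r_distr[OF subsetD[OF S_A[OF UD(1)] S(1)] subsetD[OF S_A[OF UD(2)] S(2)] a])
  moreover have "a \<otimes>\<^bsub>A\<^esub> b1 \<in> S (U \<union> V)"
    by (rule subsetD[OF S_mono[OF Un_upper1]]) (use U S(1) a in \<open>simp add: left_ideal_def\<close>)
  moreover have "a \<otimes>\<^bsub>A\<^esub> b2 \<in> S (U \<union> V)"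
    by (rule subsetD[OF S_mono[OF Un_upper2]]) (use V S(2) a in \<open>simp add: left_ideal_def\<close>)
  ultimately show "a \<otimes>\<^bsub>A\<^esub> b \<in> S (U \<union> V)" by (simp only: S_add)
qed

lemma S_empty: "a \<in> S {} \<longleftrightarrow> a = \<zero>\<^bsub>A\<^esub>"
  by (auto simp: free_module_mem zero_A)

lemma left_ideal_empty: "left_ideal {}"
  by (auto simp: left_ideal_def S_empty)

lemma acyclic_empty: "acyclic {}"
  unfolding acyclic_def S_empty
proof (intro allI impI)
  fix i and z :: "('d \<Rightarrow> 'k, 'k) gen \<Rightarrow> 'd \<Rightarrow> 'k" assume "\<forall>x. z x = \<zero>\<^bsub>A\<^esub>"
  hence "z = (\<lambda>_. \<zero>\<^bsub>A\<^esub>)" by (simp add: fun_eq_iff[of z])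
  thus "\<exists>y\<in>carrier (free_module A (gens (Suc i))). (\<forall>x. y x = \<zero>\<^bsub>A\<^esub>) \<and> d y = z"
    by (intro bexI[OF _ A.free_zero]) (simp add: A.mat_map_zero)
qed

text \<open>Splitting off one member \<open>U\<close> calls for the statement about the remaining
  members and about their intersections with \<open>U\<close>. The latter need not be members of
  \<open>\<F>\<close>, so the induction runs over a bound on the size with \<open>\<F>\<close>
  arbitrary.\<close>

lemma acyclic_finite_Union:
  assumes \<U>: "\<And>U. U \<in> \<U> \<Longrightarrow> left_ideal U \<and> acyclic U"
    and Int: "\<And>U V. U \<in> \<U> \<Longrightarrow> V \<in> \<U> \<Longrightarrow> U \<inter> V \<in> \<U>"
  shows "finite \<F> \<Longrightarrow> card \<F> \<le> n \<Longrightarrow> \<F> \<subseteq> \<U> \<Longrightarrow> left_ideal (\<Union>\<F>) \<and> acyclic (\<Union>\<F>)"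
proof (induction n arbitrary: \<F>)
  case 0 thus ?case by (simp add: left_ideal_empty acyclic_empty)
next
  case (Suc n)
  show ?case
  proof (cases "\<F> = {}")
    case True thus ?thesis by (simp add: left_ideal_empty acyclic_empty)
  next
    case False
    then obtain U where U: "U \<in> \<F>" by blast
    let ?G = "\<F> - {U}" and ?H = "(\<inter>) U ` (\<F> - {U})"
    have G: "finite ?G" "card ?G \<le> n" "?G \<subseteq> \<U>" using Suc.prems U by auto
    have H: "finite ?H" "card ?H \<le> n" "?H \<subseteq> \<U>"
      using G card_image_le[OF G(1), of "(\<inter>) U"] Int U Suc.prems(3) by (auto intro: order_trans)
    have e: "\<Union>\<F> = U \<union> \<Union>?G" "\<Union>?H = U \<inter> \<Union>?G" using U by auto
    note Suc.IH[OF G] Suc.IH[OF H, unfolded e(2)]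
    moreover have "left_ideal U" "acyclic U" using \<U> U Suc.prems(3) by blast+
    ultimately show ?thesis unfolding e(1) by (intro conjI left_ideal_Un acyclic_Un) simp_all
  qed
qed

text \<open>A chain has finitely many nonzero coefficients, each a finite combination of basis
  elements. It therefore lives over a finite subfamily, and so does its filling.\<close>

lemma acyclic_Union:
  assumes \<U>: "\<And>U. U \<in> \<U> \<Longrightarrow> left_ideal U \<and> acyclic U"
    and Int: "\<And>U V. U \<in> \<U> \<Longrightarrow> V \<in> \<U> \<Longrightarrow> U \<inter> V \<in> \<U>"
  shows "acyclic (\<Union>\<U>)"
  unfolding acyclic_def
proof (intro allI impI)
  fix i z assume z: "R.cyc i z" and zS: "\<forall>x. z x \<in> S (\<Union>\<U>)"
  let ?T = "\<Union>x\<in>{x. z x \<noteq> \<zero>\<^bsub>A\<^esub>}. {b. z x b \<noteq> \<zero>\<^bsub>k\<^esub>}"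
  have "finite ?T" using A.free_finite[OF R.cyc_F[OF z]] k.free_finite zS by blast
  moreover have "?T \<subseteq> \<Union>\<U>" using k.free_supp zS by blast
  ultimately obtain \<F> where F: "finite \<F>" "\<F> \<subseteq> \<U>" "?T \<subseteq> \<Union>\<F>" by (rule finite_subset_Union)
  have "z x b = \<zero>\<^bsub>k\<^esub>" if "b \<notin> \<Union>\<F>" for x b
  proof (cases "z x = \<zero>\<^bsub>A\<^esub>")
    case True thus ?thesis by (simp add: zero_A)
  next
    case False thus ?thesis using that F(3) by blast
  qed
  hence "\<forall>x. z x \<in> S (\<Union>\<F>)" using zS unfolding free_module_mem by blast
  moreover have "acyclic (\<Union>\<F>)" using acyclic_finite_Union[OF \<U> Int F(1) order_refl F(2)] by blast
  ultimately obtain y where y: "y \<in> carrier (free_module A (gens (Suc i)))" "\<forall>x. y x \<in> S (\<Union>\<F>)" "d y = z"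
    using z unfolding acyclic_def by blast
  have "S (\<Union>\<F>) \<subseteq> S (\<Union>\<U>)" by (rule S_mono[OF Union_mono[OF F(2)]])
  thus "\<exists>y\<in>carrier (free_module A (gens (Suc i))). (\<forall>x. y x \<in> S (\<Union>\<U>)) \<and> d y = z"
    using y by (intro bexI[OF _ y(1)]) blast
qed

text \<open>The differential commutes with right multiplication. Multiplying any filling of
  \<open>z\<close> by \<open>e\<close> pushes its coefficients into \<open>S U\<close> and leaves
  the boundary \<open>z\<close> unchanged.\<close>

lemma acyclic_idempotent:
  assumes e: "e \<in> carrier A" "\<And>a. a \<in> S U \<Longrightarrow> a \<otimes>\<^bsub>A\<^esub> e = a" "\<And>a. a \<in> carrier A \<Longrightarrow> a \<otimes>\<^bsub>A\<^esub> e \<in> S U"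
  shows "acyclic U"
  unfolding acyclic_def
proof (intro allI impI)
  fix i z assume z: "R.cyc i z" and zS: "\<forall>x. z x \<in> S U"
  obtain y where y: "y \<in> carrier (free_module A (gens (Suc i)))" "d y = z" using R.exact[OF z] by blast
  have "d (\<lambda>x. y x \<otimes>\<^bsub>A\<^esub> e) = (\<lambda>x. z x \<otimes>\<^bsub>A\<^esub> e)"
    unfolding y(2)[symmetric] by (rule A.mat_map_smult[OF y(1) e(1) syz_mat])
  also have "\<dots> = z" by (simp add: e(2)[OF zS[rule_format]])
  finally have "d (\<lambda>x. y x \<otimes>\<^bsub>A\<^esub> e) = z" .
  thus "\<exists>y\<in>carrier (free_module A (gens (Suc i))). (\<forall>x. y x \<in> S U) \<and> d y = z"
    using e(3)[OF A.free_closed[OF y(1)]] by (intro bexI[OF _ A.free_smult_right[OF y(1) e(1)]]) blast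
qed

end

section \<open>Algebras with a basis\<close>

lemma (in abelian_monoid) finsum_Times:
  assumes "finite S" "finite T" "\<And>x y. x \<in> S \<Longrightarrow> y \<in> T \<Longrightarrow> h (x, y) \<in> carrier G"
  shows "(\<Oplus>p\<in>S \<times> T. h p) = (\<Oplus>x\<in>S. \<Oplus>y\<in>T. h (x, y))"
  using assms(1,3)
proof (induction S rule: finite_induct)
  case empty show ?case by simp
next
  case (insert s S)
  have 1: "insert s S \<times> T = Pair s ` T \<union> S \<times> T" by auto
  have "(\<Oplus>p\<in>insert s S \<times> T. h p) = (\<Oplus>p\<in>Pair s ` T. h p) \<oplus> (\<Oplus>p\<in>S \<times> T. h p)"
    unfolding 1 using insert assms(2) by (intro finsum_Un_disjoint) auto
  also have "(\<Oplus>p\<in>Pair s ` T. h p) = (\<Oplus>y\<in>T. h (s, y))"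
    using insert by (intro finsum_reindex) (auto simp: inj_on_def)
  also have "(\<Oplus>p\<in>S \<times> T. h p) = (\<Oplus>x\<in>S. \<Oplus>y\<in>T. h (x, y))" using insert by simp
  finally show ?case using insert by (simp add: Pi_def)
qed

text \<open>A twisted monoid algebra: \<open>D\<close> is a monoid and \<open>c\<close> a normalized
  2-cocycle with values in the multiplicative monoid of \<open>k\<close>. Loop factors are such a
  cocycle; for the group algebra it is constantly one.\<close>

locale based_ring = k: cring k for k :: "('k, 'r) ring_scheme" +
  fixes D :: "'d set" and mul :: "'d \<Rightarrow> 'd \<Rightarrow> 'd" and c :: "'d \<Rightarrow> 'd \<Rightarrow> 'k" and u :: 'd
  assumes mul_closed: "\<lbrakk>x \<in> D; y \<in> D\<rbrakk> \<Longrightarrow> mul x y \<in> D"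
    and c_closed: "\<lbrakk>x \<in> D; y \<in> D\<rbrakk> \<Longrightarrow> c x y \<in> carrier k"
    and mul_assoc: "\<lbrakk>x \<in> D; y \<in> D; z \<in> D\<rbrakk> \<Longrightarrow> mul (mul x y) z = mul x (mul y z)"
    and cocycle: "\<lbrakk>x \<in> D; y \<in> D; z \<in> D\<rbrakk> \<Longrightarrow>
      c x y \<otimes>\<^bsub>k\<^esub> c (mul x y) z = c y z \<otimes>\<^bsub>k\<^esub> c x (mul y z)"
    and u: "u \<in> D" and mul_u: "x \<in> D \<Longrightarrow> mul x u = x" "x \<in> D \<Longrightarrow> mul u x = x"
    and c_u: "x \<in> D \<Longrightarrow> c x u = \<one>\<^bsub>k\<^esub>" "x \<in> D \<Longrightarrow> c u x = \<one>\<^bsub>k\<^esub>"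
begin

definition alg :: "('k, 'd \<Rightarrow> 'k) module" where "alg = based_algebra k D mul c u"

abbreviation S where "S U \<equiv> carrier (free_module k U)"

lemma alg_simps [simp]:
  "carrier alg = S D" "\<zero>\<^bsub>alg\<^esub> = (\<lambda>_. \<zero>\<^bsub>k\<^esub>)" "f \<oplus>\<^bsub>alg\<^esub> g = (\<lambda>x. f x \<oplus>\<^bsub>k\<^esub> g x)"
  "a \<odot>\<^bsub>alg\<^esub> f = (\<lambda>x. a \<otimes>\<^bsub>k\<^esub> f x)" "\<one>\<^bsub>alg\<^esub> = basis_vec k u"
  by (simp_all add: alg_def based_algebra_def free_module_def)

text \<open>Left multiplication by the basis element \<open>x\<close>, as a matrix. Together with
  \<open>mult_eq\<close> it replaces the sum over pairs in \<open>based_algebra\<close> by two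
  nested linear extensions.\<close>

definition lmul :: "'d \<Rightarrow> ('d \<Rightarrow> 'k) \<Rightarrow> 'd \<Rightarrow> 'k" where
  "lmul x g = mat_map k (\<lambda>y. single_vec k (mul x y) (c x y)) g"

lemma single_mat: "x \<in> D \<Longrightarrow> (\<lambda>y. single_vec k (mul x y) (c x y)) \<in> D \<rightarrow> S D"
  by (intro Pi_I k.single_mem mul_closed c_closed)

lemma lmul_mat: "g \<in> S D \<Longrightarrow> (\<lambda>x. lmul x g) \<in> D \<rightarrow> S D"
  unfolding lmul_def by (rule Pi_I, rule k.mat_map_closed, assumption, rule single_mat, assumption)

lemma mult_eq:
  assumes f: "f \<in> S D" and g: "g \<in> S D"
  shows "f \<otimes>\<^bsub>alg\<^esub> g = mat_map k (\<lambda>x. lmul x g) f"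
proof
  fix b
  note cl = k.free_closed[OF f] k.free_closed[OF g]
  let ?F = "{x. f x \<noteq> \<zero>\<^bsub>k\<^esub>}" and ?G = "{y. g y \<noteq> \<zero>\<^bsub>k\<^esub>}"
  have FD: "?F \<subseteq> D" "?G \<subseteq> D" by (rule k.free_supp[OF f], rule k.free_supp[OF g])
  have fin: "finite ?F" "finite ?G" by (rule k.free_finite[OF f], rule k.free_finite[OF g])
  let ?t = "\<lambda>x y. single_vec k (mul x y) (c x y) b \<otimes>\<^bsub>k\<^esub> g y"
  have sc: "single_vec k (mul x y) (c x y) b \<in> carrier k" if "x \<in> ?F" "y \<in> ?G" for x y
    using that FD c_closed by (auto simp: single_vec_def)
  have cc: "c x y \<in> carrier k" if "x \<in> ?F" "y \<in> ?G" for x y using that FD c_closed by blast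
  have "mat_map k (\<lambda>x. lmul x g) f b = (\<Oplus>\<^bsub>k\<^esub>x\<in>?F. (\<Oplus>\<^bsub>k\<^esub>y\<in>?G. ?t x y) \<otimes>\<^bsub>k\<^esub> f x)"
    by (simp only: mat_map_def lmul_def)
  also have "\<dots> = (\<Oplus>\<^bsub>k\<^esub>x\<in>?F. \<Oplus>\<^bsub>k\<^esub>y\<in>?G. ?t x y \<otimes>\<^bsub>k\<^esub> f x)"
  proof (intro k.add.finprod_cong' refl)
    fix x assume x: "x \<in> ?F"
    show "(\<Oplus>\<^bsub>k\<^esub>y\<in>?G. ?t x y) \<otimes>\<^bsub>k\<^esub> f x = (\<Oplus>\<^bsub>k\<^esub>y\<in>?G. ?t x y \<otimes>\<^bsub>k\<^esub> f x)"
      using fin cl sc[OF x] by (intro k.finsum_ldistr) auto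
  next
    show "(\<lambda>x. \<Oplus>\<^bsub>k\<^esub>y\<in>?G. ?t x y \<otimes>\<^bsub>k\<^esub> f x) \<in> ?F \<rightarrow> carrier k"
      using cl sc by (intro Pi_I k.finsum_closed) auto
  qed
  also have "\<dots> = (\<Oplus>\<^bsub>k\<^esub>p\<in>?F \<times> ?G. ?t (fst p) (snd p) \<otimes>\<^bsub>k\<^esub> f (fst p))"
    using fin cl sc by (subst k.finsum_Times) auto
  also have "\<dots> = (\<Oplus>\<^bsub>k\<^esub>p\<in>{p. f (fst p) \<noteq> \<zero>\<^bsub>k\<^esub> \<and> g (snd p) \<noteq> \<zero>\<^bsub>k\<^esub> \<and> mul (fst p) (snd p) = b}.
                f (fst p) \<otimes>\<^bsub>k\<^esub> g (snd p) \<otimes>\<^bsub>k\<^esub> c (fst p) (snd p))"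
    using fin cl sc cc
    by (intro k.add.finprod_mono_neutral_cong_right) (auto simp: single_vec_def k.m_ac)
  also have "\<dots> = (f \<otimes>\<^bsub>alg\<^esub> g) b" by (simp add: alg_def based_algebra_def)
  finally show "(f \<otimes>\<^bsub>alg\<^esub> g) b = mat_map k (\<lambda>x. lmul x g) f b" by (rule sym)
qed

lemma mult_closed: "f \<in> S D \<Longrightarrow> g \<in> S D \<Longrightarrow> f \<otimes>\<^bsub>alg\<^esub> g \<in> S D"
  by (simp only: mult_eq k.mat_map_closed[OF _ lmul_mat])

lemma mult_add_left:
  assumes "f \<in> S D" "f' \<in> S D" "g \<in> S D"
  shows "(\<lambda>x. f x \<oplus>\<^bsub>k\<^esub> f' x) \<otimes>\<^bsub>alg\<^esub> g = (\<lambda>x. (f \<otimes>\<^bsub>alg\<^esub> g) x \<oplus>\<^bsub>k\<^esub> (f' \<otimes>\<^bsub>alg\<^esub> g) x)"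
  by (simp only: mult_eq assms k.free_add k.mat_map_add[OF assms(1,2) lmul_mat[OF assms(3)]])

lemma mult_add_right:
  assumes f: "f \<in> S D" and g: "g \<in> S D" and g': "g' \<in> S D"
  shows "f \<otimes>\<^bsub>alg\<^esub> (\<lambda>x. g x \<oplus>\<^bsub>k\<^esub> g' x) = (\<lambda>x. (f \<otimes>\<^bsub>alg\<^esub> g) x \<oplus>\<^bsub>k\<^esub> (f \<otimes>\<^bsub>alg\<^esub> g') x)"
proof -
  have "f \<otimes>\<^bsub>alg\<^esub> (\<lambda>x. g x \<oplus>\<^bsub>k\<^esub> g' x) = mat_map k (\<lambda>x. lmul x (\<lambda>x. g x \<oplus>\<^bsub>k\<^esub> g' x)) f"
    by (rule mult_eq[OF f k.free_add[OF g g']])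
  also have "\<dots> = mat_map k (\<lambda>x y. lmul x g y \<oplus>\<^bsub>k\<^esub> lmul x g' y) f"
  proof (rule k.mat_map_cong[OF f])
    fix x assume x: "x \<in> D"
    show "lmul x (\<lambda>x. g x \<oplus>\<^bsub>k\<^esub> g' x) = (\<lambda>y. lmul x g y \<oplus>\<^bsub>k\<^esub> lmul x g' y)"
      unfolding lmul_def by (rule k.mat_map_add[OF g g' single_mat[OF x]])
  next
    show "(\<lambda>x y. lmul x g y \<oplus>\<^bsub>k\<^esub> lmul x g' y) \<in> D \<rightarrow> S D"
      by (intro Pi_I k.free_add funcset_mem[OF lmul_mat[OF g]] funcset_mem[OF lmul_mat[OF g']])
  qed
  also have "\<dots> = (\<lambda>x. (f \<otimes>\<^bsub>alg\<^esub> g) x \<oplus>\<^bsub>k\<^esub> (f \<otimes>\<^bsub>alg\<^esub> g') x)"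
    by (simp only: k.mat_map_add_left[OF f lmul_mat[OF g] lmul_mat[OF g']] mult_eq[OF f g] mult_eq[OF f g'])
  finally show ?thesis .
qed

lemma mult_zero_left: "g \<in> S D \<Longrightarrow> (\<lambda>_. \<zero>\<^bsub>k\<^esub>) \<otimes>\<^bsub>alg\<^esub> g = (\<lambda>_. \<zero>\<^bsub>k\<^esub>)"
  by (simp only: mult_eq k.free_zero k.mat_map_zero)

lemma mult_zero_right: "f \<in> S D \<Longrightarrow> f \<otimes>\<^bsub>alg\<^esub> (\<lambda>_. \<zero>\<^bsub>k\<^esub>) = (\<lambda>_. \<zero>\<^bsub>k\<^esub>)"
  by (simp only: mult_eq k.free_zero lmul_def k.mat_map_zero k.mat_map_zero_left[OF _ refl])

lemma mult_single:
  assumes "x \<in> D" "y \<in> D" "a \<in> carrier k" "b \<in> carrier k"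
  shows "single_vec k x a \<otimes>\<^bsub>alg\<^esub> single_vec k y b = single_vec k (mul x y) (c x y \<otimes>\<^bsub>k\<^esub> b \<otimes>\<^bsub>k\<^esub> a)"
proof -
  note s = k.single_mem[OF assms(1,3)] k.single_mem[OF assms(2,4)]
  have l: "lmul x (single_vec k y b) = (\<lambda>z. single_vec k (mul x y) (c x y) z \<otimes>\<^bsub>k\<^esub> b)"
    unfolding lmul_def
    by (rule k.mat_map_single[where \<phi> = "\<lambda>y. single_vec k (mul x y) (c x y)",
        OF assms(4) funcset_mem[OF single_mat[OF assms(1)] assms(2)]])
  have "single_vec k x a \<otimes>\<^bsub>alg\<^esub> single_vec k y b = (\<lambda>z. lmul x (single_vec k y b) z \<otimes>\<^bsub>k\<^esub> a)"
    unfolding mult_eq[OF s]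
    by (rule k.mat_map_single[where \<phi> = "\<lambda>x. lmul x (single_vec k y b)",
        OF assms(3) funcset_mem[OF lmul_mat[OF s(2)] assms(1)]])
  thus ?thesis unfolding l using assms c_closed[OF assms(1,2)] by (simp add: single_vec_def fun_eq_iff)
qed

text \<open>Additivity in each factor reduces to multiples of basis elements, where the claim is
  associativity in \<open>D\<close> together with the cocycle identity.\<close>

lemma mult_assoc:
  assumes f: "f \<in> S D" and g: "g \<in> S D" and h: "h \<in> S D"
  shows "f \<otimes>\<^bsub>alg\<^esub> g \<otimes>\<^bsub>alg\<^esub> h = f \<otimes>\<^bsub>alg\<^esub> (g \<otimes>\<^bsub>alg\<^esub> h)"
  using f
proof (induction rule: k.free_induct)
  case zero show ?case by (simp only: mult_zero_left g h mult_closed)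
next
  case (add f f') thus ?case by (simp only: mult_add_left mult_closed g h)
next
  case (single x a)
  note X = k.single_mem[OF single]
  show ?case using g
  proof (induction rule: k.free_induct)
    case zero show ?case by (simp only: mult_zero_left mult_zero_right X h mult_closed)
  next
    case (add g g') thus ?case by (simp only: mult_add_left mult_add_right mult_closed X h)
  next
    case (single y b)
    note Y = k.single_mem[OF single]
    show ?case using h
    proof (induction rule: k.free_induct)
      case zero show ?case by (simp only: mult_zero_right X Y mult_closed)
    next
      case (add h h') thus ?case by (simp only: mult_add_right mult_closed X Y)
    next
      case (single z e)
      have cl: "x \<in> D" "y \<in> D" "z \<in> D" "a \<in> carrier k" "b \<in> carrier k" "e \<in> carrier k"
        using \<open>x \<in> D\<close> \<open>y \<in> D\<close> \<open>a \<in> carrier k\<close> \<open>b \<in> carrier k\<close> single by simp_all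
      note cc = c_closed[OF cl(1,2)] c_closed[OF cl(2,3)] c_closed[OF mul_closed[OF cl(1,2)] cl(3)]
        c_closed[OF cl(1) mul_closed[OF cl(2,3)]]
      have "c (mul x y) z \<otimes>\<^bsub>k\<^esub> e \<otimes>\<^bsub>k\<^esub> (c x y \<otimes>\<^bsub>k\<^esub> b \<otimes>\<^bsub>k\<^esub> a) = c x y \<otimes>\<^bsub>k\<^esub> c (mul x y) z \<otimes>\<^bsub>k\<^esub> (e \<otimes>\<^bsub>k\<^esub> b \<otimes>\<^bsub>k\<^esub> a)"
        using cc cl by (simp add: k.m_ac)
      also have "\<dots> = c x (mul y z) \<otimes>\<^bsub>k\<^esub> (c y z \<otimes>\<^bsub>k\<^esub> e \<otimes>\<^bsub>k\<^esub> b) \<otimes>\<^bsub>k\<^esub> a"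
        unfolding cocycle[OF cl(1-3)] using cc cl by (simp add: k.m_ac)
      finally show ?case
        by (simp only: mult_single mul_closed c_closed k.m_closed cl mul_assoc)
    qed
  qed
qed

lemma mult_one:
  assumes "f \<in> S D"
  shows "f \<otimes>\<^bsub>alg\<^esub> basis_vec k u = f" "basis_vec k u \<otimes>\<^bsub>alg\<^esub> f = f"
  unfolding basis_vec_single using assms
proof (induction rule: k.free_induct)
  case zero
  show "(\<lambda>_. \<zero>\<^bsub>k\<^esub>) \<otimes>\<^bsub>alg\<^esub> single_vec k u \<one>\<^bsub>k\<^esub> = (\<lambda>_. \<zero>\<^bsub>k\<^esub>)"
    "single_vec k u \<one>\<^bsub>k\<^esub> \<otimes>\<^bsub>alg\<^esub> (\<lambda>_. \<zero>\<^bsub>k\<^esub>) = (\<lambda>_. \<zero>\<^bsub>k\<^esub>)"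
    by (simp_all only: mult_zero_left mult_zero_right k.single_mem u k.one_closed)
next
  case (add f g)
  note U = k.single_mem[OF u k.one_closed]
  show "(\<lambda>x. f x \<oplus>\<^bsub>k\<^esub> g x) \<otimes>\<^bsub>alg\<^esub> single_vec k u \<one>\<^bsub>k\<^esub> = (\<lambda>x. f x \<oplus>\<^bsub>k\<^esub> g x)"
    by (simp only: mult_add_left add U)
  show "single_vec k u \<one>\<^bsub>k\<^esub> \<otimes>\<^bsub>alg\<^esub> (\<lambda>x. f x \<oplus>\<^bsub>k\<^esub> g x) = (\<lambda>x. f x \<oplus>\<^bsub>k\<^esub> g x)"
    by (simp only: mult_add_right add U)
next
  case (single x a)
  show "single_vec k x a \<otimes>\<^bsub>alg\<^esub> single_vec k u \<one>\<^bsub>k\<^esub> = single_vec k x a"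
    "single_vec k u \<one>\<^bsub>k\<^esub> \<otimes>\<^bsub>alg\<^esub> single_vec k x a = single_vec k x a"
    using single u by (simp_all add: mult_single mul_u c_u)
qed

lemma alg_ring: "ring alg"
proof (rule ringI)
  show "abelian_group alg"
  proof (rule abelian_groupI)
    fix f assume "f \<in> carrier alg"
    thus "\<exists>g\<in>carrier alg. g \<oplus>\<^bsub>alg\<^esub> f = \<zero>\<^bsub>alg\<^esub>"
      by (intro bexI[of _ "\<lambda>x. \<ominus>\<^bsub>k\<^esub> f x"]) (auto simp: k.l_neg k.free_closed)
  qed (auto simp: k.a_ac k.free_closed)
  show "monoid alg"
    by (rule monoidI) (simp_all add: mult_closed mult_assoc mult_one u)
qed (simp_all add: mult_add_left mult_add_right)

text \<open>Since \<open>h\<close> is only additive, multiplicativity is asked for all scalar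
  multiples of basis elements rather than for the basis alone.\<close>

lemma hom_by_singles:
  fixes R :: "('x, 'y) ring_scheme"
  assumes R: "ring R" and h: "\<And>f. f \<in> S D \<Longrightarrow> h f \<in> carrier R"
    and add: "\<And>f g. \<lbrakk>f \<in> S D; g \<in> S D\<rbrakk> \<Longrightarrow> h (\<lambda>x. f x \<oplus>\<^bsub>k\<^esub> g x) = h f \<oplus>\<^bsub>R\<^esub> h g"
    and mult: "\<And>x y a b. \<lbrakk>x \<in> D; y \<in> D; a \<in> carrier k; b \<in> carrier k\<rbrakk> \<Longrightarrow>
      h (single_vec k (mul x y) (c x y \<otimes>\<^bsub>k\<^esub> b \<otimes>\<^bsub>k\<^esub> a)) = h (single_vec k x a) \<otimes>\<^bsub>R\<^esub> h (single_vec k y b)"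
    and one: "h (basis_vec k u) = \<one>\<^bsub>R\<^esub>"
  shows "h \<in> ring_hom alg R"
proof -
  interpret R: ring R by (rule R)
  have zero: "h (\<lambda>_. \<zero>\<^bsub>k\<^esub>) = \<zero>\<^bsub>R\<^esub>"
  proof -
    have "h (\<lambda>_. \<zero>\<^bsub>k\<^esub>) = h (\<lambda>_. \<zero>\<^bsub>k\<^esub>) \<oplus>\<^bsub>R\<^esub> h (\<lambda>_. \<zero>\<^bsub>k\<^esub>)"
      using add[of "\<lambda>_. \<zero>\<^bsub>k\<^esub>" "\<lambda>_. \<zero>\<^bsub>k\<^esub>"] by simp
    thus ?thesis using h[OF k.free_zero] R.add.r_cancel_one' by metis
  qed
  have "h (f \<otimes>\<^bsub>alg\<^esub> g) = h f \<otimes>\<^bsub>R\<^esub> h g" if f: "f \<in> S D" and g: "g \<in> S D" for f g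
    using f
  proof (induction rule: k.free_induct)
    case zero' : zero show ?case by (simp only: mult_zero_left g zero R.l_null h)
  next
    case add': (add f f') thus ?case by (simp only: mult_add_left g add mult_closed R.l_distr h)
  next
    case (single x a)
    note X = k.single_mem[OF single]
    show ?case using g
    proof (induction rule: k.free_induct)
      case zero' : zero show ?case by (simp only: mult_zero_right X zero R.r_null h)
    next
      case add': (add g g') thus ?case by (simp only: mult_add_right X add mult_closed R.r_distr h)
    next
      case s: (single y b) show ?case by (simp only: mult_single single s mult)
    qed
  qed
  thus ?thesis by (intro ring_hom_memI) (simp_all add: h add one)
qed

lemma mult_right_closed:
  assumes t: "t \<in> D" and UV: "\<And>x. x \<in> U \<Longrightarrow> mul x t \<in> V" and UD: "U \<subseteq> D" and a: "a \<in> S U"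
  shows "a \<otimes>\<^bsub>alg\<^esub> basis_vec k t \<in> S V"
  unfolding basis_vec_single using a
proof (induction rule: k.free_induct)
  case zero show ?case by (simp only: mult_zero_left k.single_mem t k.one_closed k.free_zero)
next
  case (add f g)
  have "f \<in> S D" "g \<in> S D" using add k.free_mono[OF UD] by blast+
  thus ?case using add by (simp only: mult_add_left k.single_mem t k.one_closed k.free_add)
next
  case (single x a)
  have x: "x \<in> D" using single UD by blast
  show ?case using single t x UV[OF single(1)] c_closed[OF x t] by (simp add: mult_single)
qed

lemma mult_right_id:
  assumes t: "t \<in> D" and U: "\<And>x. x \<in> U \<Longrightarrow> mul x t = x \<and> c x t = \<one>\<^bsub>k\<^esub>" and UD: "U \<subseteq> D" and a: "a \<in> S U"
  shows "a \<otimes>\<^bsub>alg\<^esub> basis_vec k t = a"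
  unfolding basis_vec_single using a
proof (induction rule: k.free_induct)
  case zero show ?case by (simp only: mult_zero_left k.single_mem t k.one_closed)
next
  case (add f g)
  have "f \<in> S D" "g \<in> S D" using add k.free_mono[OF UD] by blast+
  thus ?case using add by (simp only: mult_add_left k.single_mem t k.one_closed)
next
  case (single x a)
  thus ?case using t UD U[OF single(1)] by (auto simp: mult_single subset_iff)
qed

lemma mult_left_closed:
  assumes U: "\<And>x y. \<lbrakk>x \<in> D; y \<in> U\<rbrakk> \<Longrightarrow> mul x y \<in> U" and UD: "U \<subseteq> D" and a: "a \<in> S D" and b: "b \<in> S U"
  shows "a \<otimes>\<^bsub>alg\<^esub> b \<in> S U"
proof -
  have bD: "b \<in> S D" using b k.free_mono[OF UD] by blast
  show ?thesis using a
  proof (induction rule: k.free_induct)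
    case zero show ?case by (simp only: mult_zero_left bD k.free_zero)
  next
    case (add f g) thus ?case by (simp only: mult_add_left bD k.free_add)
  next
    case (single x a)
    note X = k.single_mem[OF single]
    show ?case using b
    proof (induction rule: k.free_induct)
      case zero show ?case by (simp only: mult_zero_right X k.free_zero)
    next
      case (add f g)
      have "f \<in> S D" "g \<in> S D" using add k.free_mono[OF UD] by blast+
      thus ?case using add by (simp only: mult_add_right X k.free_add)
    next
      case s: (single y b)
      have y: "y \<in> D" using s UD by blast
      show ?case using single s y c_closed[OF single(1) y] U[OF single(1) s(1)] by (simp add: mult_single)
    qed
  qed
qed

definition trivial_aug :: "'d set \<Rightarrow> ('d \<Rightarrow> 'k) \<Rightarrow> 'k" where
  "trivial_aug T f = (\<Oplus>\<^bsub>k\<^esub>b\<in>{b\<in>T. f b \<noteq> \<zero>\<^bsub>k\<^esub>}. f b)"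

lemma trivial_aug_map:
  assumes "f \<in> S D"
  shows "trivial_aug T f = mat_map k (\<lambda>x (_::unit). if x \<in> T then \<one>\<^bsub>k\<^esub> else \<zero>\<^bsub>k\<^esub>) f ()"
  unfolding trivial_aug_def mat_map_def using k.free_finite[OF assms] k.free_closed[OF assms]
  by (intro k.add.finprod_mono_neutral_cong_left) auto

lemma trivial_aug_single:
  assumes "x \<in> D" "a \<in> carrier k"
  shows "trivial_aug T (single_vec k x a) = (if x \<in> T then a else \<zero>\<^bsub>k\<^esub>)"
proof -
  have "(\<lambda>_::unit. if x \<in> T then \<one>\<^bsub>k\<^esub> else \<zero>\<^bsub>k\<^esub>) \<in> carrier (free_module k UNIV)" by (simp add: free_module_mem)
  from k.mat_map_single[where \<phi> = "\<lambda>x (_::unit). if x \<in> T then \<one>\<^bsub>k\<^esub> else \<zero>\<^bsub>k\<^esub>", OF assms(2) this]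
  show ?thesis using assms by (simp add: trivial_aug_map)
qed

text \<open>A product lies in \<open>T\<close> exactly when both factors do, and no scalar arises
  there. So the characteristic function of \<open>T\<close> is multiplicative on the basis and
  extends to a character.\<close>

lemma trivial_aug_hom:
  assumes T: "u \<in> T" "\<And>x y. \<lbrakk>x \<in> D; y \<in> D\<rbrakk> \<Longrightarrow> mul x y \<in> T \<longleftrightarrow> x \<in> T \<and> y \<in> T"
    "\<And>x y. \<lbrakk>x \<in> D; y \<in> D; x \<in> T; y \<in> T\<rbrakk> \<Longrightarrow> c x y = \<one>\<^bsub>k\<^esub>"
  shows "trivial_aug T \<in> ring_hom alg k"
proof (rule hom_by_singles[OF k.ring_axioms])
  have m: "(\<lambda>x (_::unit). if x \<in> T then \<one>\<^bsub>k\<^esub> else \<zero>\<^bsub>k\<^esub>) \<in> D \<rightarrow> carrier (free_module k UNIV)"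
    by (simp add: free_module_mem)
  show "trivial_aug T f \<in> carrier k" if "f \<in> S D" for f
    unfolding trivial_aug_map[OF that] by (rule k.free_closed[OF k.mat_map_closed[OF that m]])
  show "trivial_aug T (\<lambda>x. f x \<oplus>\<^bsub>k\<^esub> g x) = trivial_aug T f \<oplus>\<^bsub>k\<^esub> trivial_aug T g" if "f \<in> S D" "g \<in> S D" for f g
    by (simp only: trivial_aug_map that k.free_add k.mat_map_add[OF that m])
  show "trivial_aug T (basis_vec k u) = \<one>\<^bsub>k\<^esub>"
    using T(1) u by (simp add: basis_vec_single trivial_aug_single)
qed (auto simp: trivial_aug_single mul_closed c_closed T(2,3) k.m_comm)

lemma unit_smult: "a \<in> carrier k \<Longrightarrow> a \<odot>\<^bsub>alg\<^esub> \<one>\<^bsub>alg\<^esub> = single_vec k u a"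
  by (auto simp: basis_vec_def single_vec_def)

lemma augmented:
  assumes T: "u \<in> T" "\<And>x y. \<lbrakk>x \<in> D; y \<in> D\<rbrakk> \<Longrightarrow> mul x y \<in> T \<longleftrightarrow> x \<in> T \<and> y \<in> T"
    "\<And>x y. \<lbrakk>x \<in> D; y \<in> D; x \<in> T; y \<in> T\<rbrakk> \<Longrightarrow> c x y = \<one>\<^bsub>k\<^esub>"
  shows "augmented_algebra k alg (trivial_aug T)"
  by (intro augmented_algebra.intro augmented_algebra_axioms.intro k.cring_axioms alg_ring trivial_aug_hom[OF T];
    (simp only: unit_smult)?) (auto simp: u T(1) trivial_aug_single)

lemma trivial_module_char: "trivial_module k T = char_module k (trivial_aug T)"
  by (simp add: trivial_module_def char_module_def trivial_aug_def)

end

section \<open>The quotient of a based algebra by the span of the complement of a submonoid\<close>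

locale based_quotient = A: based_ring k D mul c u + B: based_ring k E mul' "\<lambda>_ _. \<one>\<^bsub>k\<^esub>" u'
  for k :: "('k, 'r) ring_scheme" and D :: "'d set" and mul c u and E :: "'e set" and mul' u' +
  fixes \<delta> :: "'e \<Rightarrow> 'd"
  assumes \<delta>_D: "\<alpha> \<in> E \<Longrightarrow> \<delta> \<alpha> \<in> D" and \<delta>_inj: "inj_on \<delta> E"
    and \<delta>_mul: "\<lbrakk>\<alpha> \<in> E; \<beta> \<in> E\<rbrakk> \<Longrightarrow> mul (\<delta> \<alpha>) (\<delta> \<beta>) = \<delta> (mul' \<alpha> \<beta>)"
    and \<delta>_c: "\<lbrakk>\<alpha> \<in> E; \<beta> \<in> E\<rbrakk> \<Longrightarrow> c (\<delta> \<alpha>) (\<delta> \<beta>) = \<one>\<^bsub>k\<^esub>"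
    and \<delta>_u: "\<delta> u' = u"
    and prime: "\<lbrakk>x \<in> D; y \<in> D; mul x y \<in> \<delta> ` E\<rbrakk> \<Longrightarrow> x \<in> \<delta> ` E \<and> y \<in> \<delta> ` E"
begin

abbreviation I where "I \<equiv> D - \<delta> ` E"

text \<open>\<open>prime\<close> and \<open>\<delta>_mul\<close> together make membership in the
  image of \<open>\<delta>\<close> compatible with products in both directions, as a character
  requires.\<close>

lemma augA: "augmented_algebra k A.alg (A.trivial_aug (\<delta> ` E))"
proof (rule A.augmented)
  show "u \<in> \<delta> ` E" using \<delta>_u B.u by blast
  show "mul x y \<in> \<delta> ` E \<longleftrightarrow> x \<in> \<delta> ` E \<and> y \<in> \<delta> ` E" if "x \<in> D" "y \<in> D" for x y
    using prime[OF that] \<delta>_mul B.mul_closed by auto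
qed (use \<delta>_c in auto)

lemma augB: "augmented_algebra k B.alg (B.trivial_aug E)"
  by (rule B.augmented) (use B.u B.mul_closed in auto)

text \<open>The quotient map in coordinates: the coefficients at the basis elements
  \<open>\<delta> \<alpha>\<close> are kept, all others are forgotten. Its kernel is the span of
  \<open>I\<close>, by \<open>proj_kernel\<close>.\<close>

definition proj :: "('d \<Rightarrow> 'k) \<Rightarrow> 'e \<Rightarrow> 'k" where
  "proj f = (\<lambda>\<alpha>. if \<alpha> \<in> E then f (\<delta> \<alpha>) else \<zero>\<^bsub>k\<^esub>)"

lemma proj_closed: assumes f: "f \<in> A.S D" shows "proj f \<in> A.S E"
proof -
  let ?T = "{\<alpha> \<in> E. f (\<delta> \<alpha>) \<noteq> \<zero>\<^bsub>k\<^esub>}"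
  have "finite (\<delta> ` ?T)" by (rule finite_subset[OF _ A.k.free_finite[OF f]]) auto
  hence "finite ?T" by (rule finite_imageD) (rule inj_on_subset[OF \<delta>_inj], auto)
  moreover have "{\<alpha>. proj f \<alpha> \<noteq> \<zero>\<^bsub>k\<^esub>} = ?T" by (auto simp: proj_def)
  ultimately show ?thesis using A.k.free_closed[OF f] unfolding free_module_mem by (simp add: proj_def)
qed

lemma proj_single: "\<alpha> \<in> E \<Longrightarrow> proj (single_vec k (\<delta> \<alpha>) a) = single_vec k \<alpha> a"
  using \<delta>_inj by (auto simp: proj_def single_vec_def fun_eq_iff inj_on_def)

lemma proj_single_0: "x \<notin> \<delta> ` E \<Longrightarrow> proj (single_vec k x a) = (\<lambda>_. \<zero>\<^bsub>k\<^esub>)"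
  by (auto simp: proj_def single_vec_def fun_eq_iff)

lemma proj_hom: "proj \<in> ring_hom A.alg B.alg"
proof (rule A.hom_by_singles[OF B.alg_ring])
  show "proj f \<in> carrier B.alg" if "f \<in> A.S D" for f using proj_closed[OF that] by simp
  show "proj (\<lambda>x. f x \<oplus>\<^bsub>k\<^esub> g x) = proj f \<oplus>\<^bsub>B.alg\<^esub> proj g" for f g by (auto simp: proj_def)
  show "proj (basis_vec k u) = \<one>\<^bsub>B.alg\<^esub>"
    using proj_single[OF B.u] by (simp add: basis_vec_single \<delta>_u)
  fix x y a b assume xy: "x \<in> D" "y \<in> D" and ab: "a \<in> carrier k" "b \<in> carrier k"
  show "proj (single_vec k (mul x y) (c x y \<otimes>\<^bsub>k\<^esub> b \<otimes>\<^bsub>k\<^esub> a)) = proj (single_vec k x a) \<otimes>\<^bsub>B.alg\<^esub> proj (single_vec k y b)"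
  proof (cases "x \<in> \<delta> ` E \<and> y \<in> \<delta> ` E")
    case True
    then obtain \<alpha> \<beta> where e: "\<alpha> \<in> E" "\<beta> \<in> E" "x = \<delta> \<alpha>" "y = \<delta> \<beta>" by blast
    show ?thesis using e ab by (simp add: \<delta>_mul \<delta>_c proj_single B.mul_closed B.mult_single)
  next
    case False
    \<comment> \<open>A factor outside the image keeps the product outside, so both sides are zero;
      on the right one of the two projected factors already is.\<close>
    hence "mul x y \<notin> \<delta> ` E" using prime[OF xy] by blast
    hence "proj (single_vec k (mul x y) (c x y \<otimes>\<^bsub>k\<^esub> b \<otimes>\<^bsub>k\<^esub> a)) = (\<lambda>_. \<zero>\<^bsub>k\<^esub>)" by (rule proj_single_0)
    moreover have "proj (single_vec k x a) \<otimes>\<^bsub>B.alg\<^esub> proj (single_vec k y b) = (\<lambda>_. \<zero>\<^bsub>k\<^esub>)"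
    proof (cases "x \<in> \<delta> ` E")
      case True
      hence "proj (single_vec k y b) = (\<lambda>_. \<zero>\<^bsub>k\<^esub>)" using False by (intro proj_single_0) blast
      thus ?thesis using proj_closed[OF A.k.single_mem[OF xy(1) ab(1)]] by (simp only: B.mult_zero_right)
    next
      case False
      hence "proj (single_vec k x a) = (\<lambda>_. \<zero>\<^bsub>k\<^esub>)" by (rule proj_single_0)
      thus ?thesis using proj_closed[OF A.k.single_mem[OF xy(2) ab(2)]] by (simp only: B.mult_zero_left)
    qed
    ultimately show ?thesis by simp
  qed
qed

lemma proj_surj: "proj ` carrier A.alg = carrier B.alg"
proof -
  have "g \<in> proj ` A.S D" if g: "g \<in> A.S E" for g
  proof -
    let ?f = "mat_map k (\<lambda>\<alpha>. basis_vec k (\<delta> \<alpha>)) g"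
    have f: "?f \<in> A.S D" by (rule A.k.mat_map_closed[OF g]) (intro Pi_I A.k.basis_vec_free \<delta>_D)
    have "proj ?f \<alpha> = g \<alpha>" for \<alpha>
    proof (cases "\<alpha> \<in> E")
      case True
      have "?f (\<delta> \<alpha>) = (\<Oplus>\<^bsub>k\<^esub>\<beta>\<in>{\<beta>. g \<beta> \<noteq> \<zero>\<^bsub>k\<^esub>}. basis_vec k \<alpha> \<beta> \<otimes>\<^bsub>k\<^esub> g \<beta>)"
        unfolding mat_map_def using A.k.free_closed[OF g] A.k.free_supp[OF g] \<delta>_inj True
        by (intro A.k.add.finprod_cong') (auto simp: basis_vec_def inj_on_def subset_iff)
      also have "\<dots> = (\<Oplus>\<^bsub>k\<^esub>\<beta>\<in>{\<beta>. g \<beta> \<noteq> \<zero>\<^bsub>k\<^esub>}. basis_vec k \<beta> \<alpha> \<otimes>\<^bsub>k\<^esub> g \<beta>)"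
        using A.k.free_closed[OF g] by (intro A.k.add.finprod_cong') (auto simp: basis_vec_def)
      also have "\<dots> = g \<alpha>" using A.k.mat_map_basis_id[OF g] unfolding mat_map_def by (rule fun_cong)
      finally show ?thesis using True by (simp add: proj_def)
    next
      case False thus ?thesis using A.k.free_outside[OF g] by (simp add: proj_def)
    qed
    hence "g = proj ?f" by (simp add: fun_eq_iff[of g])
    thus ?thesis by (rule image_eqI[OF _ f])
  qed
  thus ?thesis using proj_closed by auto
qed

lemma proj_aug: assumes f: "f \<in> A.S D" shows "B.trivial_aug E (proj f) = A.trivial_aug (\<delta> ` E) f"
proof -
  have "{b \<in> \<delta> ` E. f b \<noteq> \<zero>\<^bsub>k\<^esub>} = \<delta> ` {\<alpha> \<in> E. proj f \<alpha> \<noteq> \<zero>\<^bsub>k\<^esub>}" by (auto simp: proj_def)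
  hence "A.trivial_aug (\<delta> ` E) f = (\<Oplus>\<^bsub>k\<^esub>\<alpha>\<in>{\<alpha> \<in> E. proj f \<alpha> \<noteq> \<zero>\<^bsub>k\<^esub>}. f (\<delta> \<alpha>))"
    unfolding A.trivial_aug_def using A.k.free_closed[OF f]
    by (simp only:) (intro A.k.finsum_reindex inj_on_subset[OF \<delta>_inj], auto)
  also have "\<dots> = B.trivial_aug E (proj f)"
    unfolding B.trivial_aug_def using A.k.free_closed[OF f]
    by (intro A.k.add.finprod_cong') (auto simp: proj_def)
  finally show ?thesis by (rule sym)
qed

lemma proj_kernel: assumes f: "f \<in> A.S D" shows "proj f = (\<lambda>_. \<zero>\<^bsub>k\<^esub>) \<longleftrightarrow> f \<in> A.S I"
proof
  assume "proj f = (\<lambda>_. \<zero>\<^bsub>k\<^esub>)"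
  hence "f (\<delta> \<alpha>) = \<zero>\<^bsub>k\<^esub>" if "\<alpha> \<in> E" for \<alpha> using that by (simp add: proj_def fun_eq_iff) metis
  thus "f \<in> A.S I" using f unfolding free_module_mem by blast
next
  assume "f \<in> A.S I"
  hence "f (\<delta> \<alpha>) = \<zero>\<^bsub>k\<^esub>" if "\<alpha> \<in> E" for \<alpha> using that by (simp add: free_module_mem)
  thus "proj f = (\<lambda>_. \<zero>\<^bsub>k\<^esub>)" by (auto simp: proj_def)
qed

lemma change: "change_of_rings k A.alg (A.trivial_aug (\<delta> ` E)) B.alg (B.trivial_aug E) proj"
  by (intro change_of_rings.intro change_of_rings_axioms.intro augA augB proj_hom proj_surj) (simp add: proj_aug)

lemma based: "based_augmented k A.alg (A.trivial_aug (\<delta> ` E)) D I"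
proof (intro based_augmented.intro based_augmented_axioms.intro augA)
  show "A.trivial_aug (\<delta> ` E) a = \<zero>\<^bsub>k\<^esub>" if "a \<in> A.S I" for a
  proof -
    have "{b \<in> \<delta> ` E. a b \<noteq> \<zero>\<^bsub>k\<^esub>} = {}" using that by (auto simp: free_module_mem)
    thus ?thesis by (simp only: A.trivial_aug_def A.k.finsum_empty)
  qed
qed auto

text \<open>Coefficients killed by \<open>proj\<close> are those in the span of \<open>I\<close>.
  This translates acyclicity of \<open>I\<close> into the hypothesis of the change of rings.\<close>

theorem Tor_iso_of_acyclic:
  assumes "based_augmented.acyclic k A.alg (A.trivial_aug (\<delta> ` E)) I"
  shows "\<exists>\<phi>. \<phi> \<in> module_iso k
    (Tor k A.alg (trivial_module k (\<delta> ` E)) (trivial_module k (\<delta> ` E)) i)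
    (Tor k B.alg (trivial_module k E) (trivial_module k E) i)"
  unfolding A.trivial_module_char B.trivial_module_char
proof (rule change_of_rings.Tor_change_of_rings[OF change])
  interpret C: change_of_rings k A.alg "A.trivial_aug (\<delta> ` E)" B.alg "B.trivial_aug E" proj by (rule change)
  interpret X: based_augmented k A.alg "A.trivial_aug (\<delta> ` E)" D I by (rule based)
  fix i z assume z: "C.R.cyc i z" and pz: "\<And>x. proj (z x) = \<zero>\<^bsub>B.alg\<^esub>"
  have zc: "z x \<in> A.S D" for x using C.A.A.free_closed[OF C.R.cyc_F[OF z]] by simp
  have "\<forall>x. z x \<in> A.S I" using pz proj_kernel[OF zc] by simp
  then obtain y where y: "y \<in> carrier (free_module A.alg (C.A.gens (Suc i)))" "\<forall>x. y x \<in> A.S I" "C.d y = z"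
    using assms z unfolding X.acyclic_def by blast
  have yc: "y x \<in> A.S D" for x using C.A.A.free_closed[OF y(1)] by simp
  have "\<forall>x. proj (y x) = \<zero>\<^bsub>B.alg\<^esub>" using y(2) proj_kernel[OF yc] by simp
  thus "\<exists>y\<in>carrier (free_module A.alg (C.A.gens (Suc i))). (\<forall>x. proj (y x) = \<zero>\<^bsub>B.alg\<^esub>) \<and> C.d y = z"
    using y by blast
qed

end

section \<open>Connected components and contraction\<close>

definition edge_closed :: "'v set set \<Rightarrow> 'v set \<Rightarrow> bool" where
  "edge_closed E Z \<longleftrightarrow> (\<forall>e\<in>E. e \<inter> Z \<noteq> {} \<longrightarrow> e \<subseteq> Z)"

text \<open>Components as minimal nonempty sets closed under edges. An edge may be any set of
  vertices, so a component that was contracted can itself serve as an edge, and minimality is easily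
  followed through renaming and contraction.\<close>

definition comps :: "'v set \<Rightarrow> 'v set set \<Rightarrow> 'v set set" where
  "comps V E = {C. C \<noteq> {} \<and> C \<subseteq> V \<and> edge_closed E C \<and>
     (\<forall>W. W \<subseteq> C \<longrightarrow> W \<noteq> {} \<longrightarrow> edge_closed E W \<longrightarrow> W = C)}"

lemma compsI:
  assumes "C \<noteq> {}" "C \<subseteq> V" "edge_closed E C"
    "\<And>W. W \<subseteq> C \<Longrightarrow> W \<noteq> {} \<Longrightarrow> edge_closed E W \<Longrightarrow> W = C"
  shows "C \<in> comps V E"
  using assms by (simp add: comps_def)

lemma compsD:
  assumes "C \<in> comps V E"
  shows "C \<noteq> {}" "C \<subseteq> V" "edge_closed E C"
    "W \<subseteq> C \<Longrightarrow> W \<noteq> {} \<Longrightarrow> edge_closed E W \<Longrightarrow> W = C"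
  using assms by (auto simp: comps_def)

lemma edge_closed_Int: "edge_closed E A \<Longrightarrow> edge_closed E B \<Longrightarrow> edge_closed E (A \<inter> B)"
  unfolding edge_closed_def by blast

lemma edge_closed_Un: "edge_closed (E \<union> F) Z \<longleftrightarrow> edge_closed E Z \<and> edge_closed F Z"
  unfolding edge_closed_def by blast

lemma edge_closedD: "edge_closed E Z \<Longrightarrow> e \<in> E \<Longrightarrow> v \<in> e \<Longrightarrow> v \<in> Z \<Longrightarrow> e \<subseteq> Z"
  unfolding edge_closed_def by blast

lemma comps_closed_subset:
  assumes C: "C \<in> comps V E" and Z: "edge_closed E Z" and m: "C \<inter> Z \<noteq> {}" shows "C \<subseteq> Z"
  using compsD(4)[OF C _ m edge_closed_Int[OF compsD(3)[OF C] Z]] by blast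

lemma comps_eq: "C \<in> comps V E \<Longrightarrow> C' \<in> comps V' E \<Longrightarrow> v \<in> C \<Longrightarrow> v \<in> C' \<Longrightarrow> C = C'"
  using comps_closed_subset compsD(3) by (metis disjoint_iff subset_antisym)

lemma comps_disjoint: "C \<in> comps V E \<Longrightarrow> C' \<in> comps V' E \<Longrightarrow> C \<noteq> C' \<Longrightarrow> C \<inter> C' = {}"
  using comps_eq by (metis disjoint_iff)

definition edge_rel :: "'v set set \<Rightarrow> ('v \<times> 'v) set" where
  "edge_rel E = {(u, v). \<exists>e\<in>E. u \<in> e \<and> v \<in> e}"

lemma edge_rel_closed:
  assumes Z: "edge_closed E Z" and "(u, v) \<in> (edge_rel E)\<^sup>*" "u \<in> Z" shows "v \<in> Z"
  using assms(2,3)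
proof (induction rule: rtrancl_induct)
  case (step v w) thus ?case using Z unfolding edge_rel_def edge_closed_def by blast
qed

lemma class_comp:
  assumes V: "edge_closed E V" and v: "v \<in> V"
  shows "(edge_rel E)\<^sup>* `` {v} \<in> comps V E"
proof (rule compsI)
  let ?C = "(edge_rel E)\<^sup>* `` {v}"
  show "?C \<noteq> {}" by blast
  show "?C \<subseteq> V" using edge_rel_closed[OF V _ v] by blast
  show "edge_closed E ?C"
    unfolding edge_closed_def
  proof (intro ballI impI subsetI)
    fix e w assume e: "e \<in> E" "e \<inter> ?C \<noteq> {}" "w \<in> e"
    then obtain u where u: "u \<in> e" "(v, u) \<in> (edge_rel E)\<^sup>*" by blast
    have "(u, w) \<in> edge_rel E" using e u unfolding edge_rel_def by blast
    thus "w \<in> ?C" using u by (auto intro: rtrancl_into_rtrancl)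
  qed
  fix W assume W: "W \<subseteq> ?C" "W \<noteq> {}" "edge_closed E W"
  then obtain w where w: "w \<in> W" "(v, w) \<in> (edge_rel E)\<^sup>*" by blast
  have s: "sym ((edge_rel E)\<^sup>*)" by (rule sym_rtrancl) (auto simp: sym_def edge_rel_def)
  have "v \<in> W" using edge_rel_closed[OF W(3) symD[OF s w(2)] w(1)] .
  thus "W = ?C" using edge_rel_closed[OF W(3)] W(1) by blast
qed

lemma ex_comp: "edge_closed E V \<Longrightarrow> v \<in> V \<Longrightarrow> \<exists>C\<in>comps V E. v \<in> C"
  using class_comp[of E V v] by blast

text \<open>The link to \<open>components\<close>, which is defined by equivalence classes of the
  reachability relation.\<close>

lemma quotient_comps:
  assumes V: "edge_closed E V" shows "V // (edge_rel E)\<^sup>* = comps V E"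
proof
  show "V // (edge_rel E)\<^sup>* \<subseteq> comps V E" using class_comp[OF V] by (auto elim!: quotientE)
  show "comps V E \<subseteq> V // (edge_rel E)\<^sup>*"
  proof
    fix C assume C: "C \<in> comps V E"
    then obtain v where v: "v \<in> C" "v \<in> V" using compsD(1,2) by blast
    have "C = (edge_rel E)\<^sup>* `` {v}" by (rule comps_eq[OF C class_comp[OF V v(2)] v(1)]) blast
    thus "C \<in> V // (edge_rel E)\<^sup>*" using v(2) by (auto intro: quotientI)
  qed
qed

lemma comps_partition:
  assumes "\<D> \<subseteq> comps V E" "V \<subseteq> \<Union>\<D>" shows "comps V E = \<D>"
proof
  show "comps V E \<subseteq> \<D>"
  proof
    fix C assume C: "C \<in> comps V E"
    then obtain v where "v \<in> C" "v \<in> V" using compsD(1,2) by blast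
    then obtain D where "D \<in> \<D>" "v \<in> D" using assms(2) by blast
    thus "C \<in> \<D>" using comps_eq[OF C, of D V] assms(1) \<open>v \<in> C\<close> by blast
  qed
qed (rule assms(1))

lemma edge_closed_image:
  assumes f: "inj_on f V" and E: "\<And>e. e \<in> E \<Longrightarrow> e \<subseteq> V" and Z: "Z \<subseteq> V"
  shows "edge_closed ((`) f ` E) (f ` Z) \<longleftrightarrow> edge_closed E Z"
proof -
  have "f ` e \<inter> f ` Z \<noteq> {} \<longleftrightarrow> e \<inter> Z \<noteq> {}" "f ` e \<subseteq> f ` Z \<longleftrightarrow> e \<subseteq> Z" if e: "e \<in> E" for e
  proof -
    have m: "f v \<in> f ` Z \<longleftrightarrow> v \<in> Z" if "v \<in> e" for v
      using inj_on_image_mem_iff[OF f _ Z, of v] E[OF e] that by blast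
    show "f ` e \<inter> f ` Z \<noteq> {} \<longleftrightarrow> e \<inter> Z \<noteq> {}" "f ` e \<subseteq> f ` Z \<longleftrightarrow> e \<subseteq> Z"
      using m by blast+
  qed
  thus ?thesis unfolding edge_closed_def ball_simps by (intro ball_cong refl) (simp only:)
qed

lemma comps_image:
  assumes f: "inj_on f V" and E: "\<And>e. e \<in> E \<Longrightarrow> e \<subseteq> V"
  shows "comps (f ` V) ((`) f ` E) = (`) f ` comps V E"
proof (intro equalityI subsetI)
  fix C assume C: "C \<in> (`) f ` comps V E"
  then obtain D where D: "D \<in> comps V E" "C = f ` D" by blast
  note DV = compsD(2)[OF D(1)]
  show "C \<in> comps (f ` V) ((`) f ` E)" unfolding D(2)
  proof (rule compsI)
    show "f ` D \<noteq> {}" using compsD(1)[OF D(1)] by blast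
    show "f ` D \<subseteq> f ` V" using DV by blast
    show "edge_closed ((`) f ` E) (f ` D)" using edge_closed_image[OF f E DV] compsD(3)[OF D(1)] by blast
    fix W assume W: "W \<subseteq> f ` D" "W \<noteq> {}" "edge_closed ((`) f ` E) W"
    then obtain W' where W': "W' \<subseteq> D" "W = f ` W'" by (auto simp: subset_image_iff)
    have "edge_closed E W'" using edge_closed_image[OF f E, where Z = W'] W' W(3) DV by blast
    hence "W' = D" using compsD(4)[OF D(1) W'(1)] W(2) W'(2) by blast
    thus "W = f ` D" using W'(2) by simp
  qed
next
  fix C assume C: "C \<in> comps (f ` V) ((`) f ` E)"
  then obtain D where D: "D \<subseteq> V" "C = f ` D" using compsD(2)[OF C] by (auto simp: subset_image_iff)
  have "D \<in> comps V E"
  proof (rule compsI)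
    show "D \<noteq> {}" using compsD(1)[OF C] D(2) by blast
    show "D \<subseteq> V" by (rule D(1))
    show "edge_closed E D" using edge_closed_image[OF f E D(1)] compsD(3)[OF C] D(2) by blast
    fix W assume W: "W \<subseteq> D" "W \<noteq> {}" "edge_closed E W"
    have "f ` W = C"
      using edge_closed_image[OF f E, where Z = W] W D by (intro compsD(4)[OF C]) auto
    thus "W = D" using W(1) D inj_on_image_eq_iff[OF f, of W D] by auto
  qed
  thus "C \<in> (`) f ` comps V E" using D(2) by blast
qed

text \<open>Gluing in two stages: the graph \<open>E1\<close> is glued first and its inner vertices
  \<open>M\<close> are removed before \<open>E2\<close> is attached. As \<open>E2\<close> avoids
  \<open>M\<close>, no connection to \<open>E2\<close> is lost.\<close>

locale contraction =
  fixes V V1 M :: "'v set" and E1 E2 :: "'v set set"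
  assumes V1: "V1 \<subseteq> V" and M: "M \<subseteq> V1" and E1: "e \<in> E1 \<Longrightarrow> e \<subseteq> V1"
    and E2: "e \<in> E2 \<Longrightarrow> e \<subseteq> V - M"
begin

abbreviation "CC \<equiv> comps V1 E1"

definition E' :: "'v set set" where "E' = (\<lambda>C. C - M) ` {C\<in>CC. \<not> C \<subseteq> M}"

text \<open>Undoes the removal of \<open>M\<close>: every component of the first stage that meets
  \<open>W\<close> is restored completely.\<close>

definition ext :: "'v set \<Rightarrow> 'v set" where "ext W = W \<union> \<Union>{C\<in>CC. C \<inter> W \<noteq> {}}"

lemma V1_closed: "edge_closed E1 V1" using E1 unfolding edge_closed_def by blast

lemma restrict_closed:
  assumes Z: "edge_closed (E1 \<union> E2) Z" shows "edge_closed (E' \<union> E2) (Z - M)"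
  unfolding edge_closed_def
proof (intro ballI impI)
  fix e assume e: "e \<in> E' \<union> E2" "e \<inter> (Z - M) \<noteq> {}"
  from e(1) show "e \<subseteq> Z - M"
  proof
    assume "e \<in> E'"
    then obtain C where C: "C \<in> CC" "e = C - M" by (auto simp: E'_def)
    have "C \<subseteq> Z" using Z e(2) C by (intro comps_closed_subset[OF C(1)]) (auto simp: edge_closed_Un)
    thus ?thesis using C(2) by blast
  next
    assume "e \<in> E2"
    thus ?thesis using Z e(2) E2 unfolding edge_closed_def by blast
  qed
qed

lemma ext_Diff:
  assumes W: "W \<subseteq> V - M" "edge_closed (E' \<union> E2) W" shows "ext W - M = W"
proof -
  have "C - M \<subseteq> W" if C: "C \<in> CC" "C \<inter> W \<noteq> {}" for C
  proof -
    have "C - M \<in> E'" using C W(1) unfolding E'_def by blast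
    moreover obtain v where "v \<in> C" "v \<in> W" using C(2) by blast
    moreover have "v \<notin> M" using \<open>v \<in> W\<close> W(1) by blast
    ultimately show ?thesis using edge_closedD[OF W(2), of "C - M" v] by simp
  qed
  moreover have "W - M = W" using W(1) by blast
  ultimately show ?thesis unfolding ext_def by blast
qed

lemma ext_closed:
  assumes W: "W \<subseteq> V - M" "edge_closed (E' \<union> E2) W" shows "edge_closed (E1 \<union> E2) (ext W)"
  unfolding edge_closed_def
proof (intro ballI impI)
  fix e assume e: "e \<in> E1 \<union> E2" "e \<inter> ext W \<noteq> {}"
  then obtain v where v: "v \<in> e" "v \<in> ext W" by blast
  from e(1) show "e \<subseteq> ext W"
  proof
    assume e1: "e \<in> E1"
    then obtain C where C: "C \<in> CC" "v \<in> C" using ex_comp[OF V1_closed] E1 v(1) by blast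
    have eC: "e \<subseteq> C" by (rule edge_closedD[OF compsD(3)[OF C(1)] e1 v(1) C(2)])
    have "C \<inter> W \<noteq> {}"
    proof (cases "v \<in> W")
      case False
      then obtain C' where C': "C' \<in> CC" "C' \<inter> W \<noteq> {}" "v \<in> C'" using v(2) unfolding ext_def by blast
      thus ?thesis using comps_eq[OF C(1) C'(1) C(2) C'(3)] by blast
    qed (use C in blast)
    thus ?thesis using C(1) eC unfolding ext_def by blast
  next
    assume e2: "e \<in> E2"
    hence "v \<in> W" using v ext_Diff[OF W] E2 by blast
    thus ?thesis using e2 v(1) W(2) unfolding ext_def edge_closed_def by blast
  qed
qed

lemma ext_subset: "W \<subseteq> V \<Longrightarrow> ext W \<subseteq> V"
  using compsD(2) V1 unfolding ext_def by blast

lemma ext_of_closed: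
  assumes Z: "edge_closed (E1 \<union> E2) Z" shows "ext (Z - M) \<subseteq> Z"
proof -
  have "C \<subseteq> Z" if "C \<in> CC" "C \<inter> (Z - M) \<noteq> {}" for C
    using Z that by (intro comps_closed_subset[OF that(1)]) (auto simp: edge_closed_Un)
  thus ?thesis unfolding ext_def by blast
qed

lemma ext_comp:
  assumes W: "W \<in> comps (V - M) (E' \<union> E2)" shows "ext W \<in> comps V (E1 \<union> E2)"
proof (rule compsI)
  note WD = compsD(2,3)[OF W]
  show "ext W \<noteq> {}" using compsD(1)[OF W] unfolding ext_def by blast
  show "ext W \<subseteq> V" using WD(1) by (intro ext_subset) blast
  show "edge_closed (E1 \<union> E2) (ext W)" by (rule ext_closed[OF WD])
  fix Z assume Z: "Z \<subseteq> ext W" "Z \<noteq> {}" "edge_closed (E1 \<union> E2) Z"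
  \<comment> \<open>A vertex of \<open>M\<close> enters \<open>ext W\<close> only within a component
    of \<open>E1\<close> that meets \<open>W\<close>. The closed set \<open>Z\<close> would contain
    that component, hence a vertex outside \<open>M\<close>.\<close>
  have "\<not> Z \<subseteq> M"
  proof
    assume ZM: "Z \<subseteq> M"
    then obtain v where v: "v \<in> Z" "v \<in> M" using Z(2) by blast
    have "v \<notin> W" using v(2) WD(1) by blast
    hence "v \<in> \<Union>{C\<in>CC. C \<inter> W \<noteq> {}}" using v(1) Z(1) unfolding ext_def by (meson UnE subsetD)
    then obtain C where C: "C \<in> CC" "C \<inter> W \<noteq> {}" "v \<in> C" by blast
    have "edge_closed E1 Z" using Z(3) by (simp add: edge_closed_Un)
    hence "C \<subseteq> Z" by (rule comps_closed_subset[OF C(1)]) (use C v in blast)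
    thus False using C(2) ZM WD(1) by blast
  qed
  hence "Z - M \<noteq> {}" by blast
  moreover have "Z - M \<subseteq> W" using Z(1) ext_Diff[OF WD] by blast
  ultimately have "Z - M = W" by (intro compsD(4)[OF W] restrict_closed[OF Z(3)])
  hence "ext W \<subseteq> Z" using ext_of_closed[OF Z(3)] by simp
  thus "Z = ext W" using Z(1) by (intro subset_antisym)
qed

lemma loop_comp:
  assumes C: "C \<in> CC" "C \<subseteq> M" shows "C \<in> comps V (E1 \<union> E2)"
proof (rule compsI)
  show "C \<noteq> {}" "C \<subseteq> V" using compsD(1,2)[OF C(1)] V1 by blast+
  show "edge_closed (E1 \<union> E2) C"
    using compsD(3)[OF C(1)] C(2) E2 unfolding edge_closed_def by blast
  show "W = C" if "W \<subseteq> C" "W \<noteq> {}" "edge_closed (E1 \<union> E2) W" for W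
    using compsD(4)[OF C(1) that(1,2)] that(3) by (simp add: edge_closed_Un)
qed

lemma E'_subset: "e \<in> E' \<Longrightarrow> e \<subseteq> V - M"
  using compsD(2) V1 unfolding E'_def by blast

text \<open>The combinatorial core of associativity. A component of the full graph either was closed
  up inside \<open>M\<close> by the first stage or is recovered by \<open>ext\<close> from its trace
  outside \<open>M\<close>.\<close>

lemma comps_contract:
  "comps V (E1 \<union> E2) = {C\<in>CC. C \<subseteq> M} \<union> ext ` comps (V - M) (E' \<union> E2)"
proof (rule comps_partition)
  show "{C\<in>CC. C \<subseteq> M} \<union> ext ` comps (V - M) (E' \<union> E2) \<subseteq> comps V (E1 \<union> E2)"
    using ext_comp loop_comp by blast
  have VM: "edge_closed (E' \<union> E2) (V - M)"
    using E'_subset E2 unfolding edge_closed_def by blast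
  have out: "\<exists>W\<in>comps (V - M) (E' \<union> E2). v \<in> ext W" if "v \<in> V - M" for v
    using ex_comp[OF VM that] unfolding ext_def by blast
  show "V \<subseteq> \<Union>({C\<in>CC. C \<subseteq> M} \<union> ext ` comps (V - M) (E' \<union> E2))"
  proof
    fix v assume v: "v \<in> V"
    show "v \<in> \<Union>({C\<in>CC. C \<subseteq> M} \<union> ext ` comps (V - M) (E' \<union> E2))"
    proof (cases "v \<in> M")
      case False thus ?thesis using out v by blast
    next
      case True
      then obtain C where C: "C \<in> CC" "v \<in> C" using ex_comp[OF V1_closed] M by blast
      show ?thesis
      proof (cases "C \<subseteq> M")
        case False
        then obtain w where w: "w \<in> C" "w \<in> V - M" using compsD(2)[OF C(1)] V1 by blast
        then obtain W where W: "W \<in> comps (V - M) (E' \<union> E2)" "w \<in> W" using ex_comp[OF VM] by blast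
        hence "C \<subseteq> ext W" using C(1) w(1) unfolding ext_def by blast
        thus ?thesis using W(1) C(2) by blast
      qed (use C in blast)
    qed
  qed
qed

lemma ext_inj: "inj_on ext (comps (V - M) (E' \<union> E2))"
  by (rule inj_on_inverseI[of _ "\<lambda>Z. Z - M"]) (rule ext_Diff[OF compsD(2,3)])

lemma ext_not_loop: "W \<in> comps (V - M) (E' \<union> E2) \<Longrightarrow> \<not> ext W \<subseteq> M"
  using ext_Diff[of W] compsD(1,2,3)[of W] by blast

text \<open>The left set indexes the first-stage components over which labels are multiplied in the
  full graph, the right one the contracted edges that are multiplied in the second stage.\<close>

lemma ext_absorb:
  assumes W: "W \<in> comps (V - M) (E' \<union> E2)"
  shows "{C\<in>CC. C \<subseteq> ext W} = {C\<in>CC. \<not> C \<subseteq> M \<and> C - M \<subseteq> W}"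
proof -
  note e = ext_Diff[OF compsD(2,3)[OF W]]
  have "\<not> C \<subseteq> M" if C: "C \<in> CC" "C \<subseteq> ext W" for C
  proof
    assume "C \<subseteq> M"
    hence "C = ext W" using compsD(4)[OF ext_comp[OF W] C(2)] compsD(1)[OF C(1)] compsD(3)[OF loop_comp[OF C(1)]] by blast
    thus False using \<open>C \<subseteq> M\<close> ext_not_loop[OF W] by blast
  qed
  moreover have "C \<subseteq> ext W" if "C \<in> CC" "\<not> C \<subseteq> M" "C - M \<subseteq> W" for C
    using that unfolding ext_def by blast
  ultimately show ?thesis using e by blast
qed

lemma edge_comp_ext:
  assumes W: "W \<in> comps (V - M) (E' \<union> E2)" and e: "e \<in> E1" "e \<noteq> {}"
  shows "e \<subseteq> ext W \<longleftrightarrow> (\<exists>C\<in>CC. C \<subseteq> ext W \<and> e \<subseteq> C)"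
proof
  assume "e \<subseteq> ext W"
  obtain v where v: "v \<in> e" using e(2) by blast
  then obtain C where C: "C \<in> CC" "v \<in> C" using ex_comp[OF V1_closed] E1[OF e(1)] by blast
  have "e \<subseteq> C" by (rule edge_closedD[OF compsD(3)[OF C(1)] e(1) v C(2)])
  moreover have "C \<subseteq> ext W"
    using ext_closed[OF compsD(2,3)[OF W]] v C \<open>e \<subseteq> ext W\<close>
    by (intro comps_closed_subset[OF C(1)]) (auto simp: edge_closed_Un)
  ultimately show "\<exists>C\<in>CC. C \<subseteq> ext W \<and> e \<subseteq> C" using C(1) by blast
qed blast

end

section \<open>Composition of labelled graphs\<close>

definition lab :: "('g, 's) monoid_scheme \<Rightarrow> ('v set \<times> 'g) set \<Rightarrow> 'v set \<Rightarrow> 'g" where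
  "lab G P C = (\<Otimes>\<^bsub>G\<^esub>p\<in>{p\<in>P. fst p \<subseteq> C}. snd p)"

text \<open>Composition before any renumbering of columns: \<open>P\<close> and \<open>Q\<close> are
  glued on \<open>V\<close>, the vertices of \<open>M\<close> are forgotten, and each component
  reaching outside \<open>M\<close> becomes one labelled edge.\<close>

definition contr :: "('g, 's) monoid_scheme \<Rightarrow> 'v set \<Rightarrow> 'v set \<Rightarrow> ('v set \<times> 'g) set \<Rightarrow>
    ('v set \<times> 'g) set \<Rightarrow> ('v set \<times> 'g) set" where
  "contr G V M P Q = (\<lambda>C. (C - M, lab G P C \<otimes>\<^bsub>G\<^esub> lab G Q C)) ` {C\<in>comps V (fst ` P \<union> fst ` Q). \<not> C \<subseteq> M}"

definition loopset :: "'v set \<Rightarrow> 'v set \<Rightarrow> ('v set \<times> 'g) set \<Rightarrow> ('v set \<times> 'g) set \<Rightarrow> 'v set set" where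
  "loopset V M P Q = {C\<in>comps V (fst ` P \<union> fst ` Q). C \<subseteq> M}"

definition lmap :: "('v \<Rightarrow> 'w) \<Rightarrow> ('v set \<times> 'g) set \<Rightarrow> ('w set \<times> 'g) set" where
  "lmap f P = (\<lambda>p. (f ` fst p, snd p)) ` P"

lemma filter_image: "{q \<in> h ` P. Q q} = h ` {p\<in>P. Q (h p)}" by blast

lemma fst_lmap: "fst ` lmap f P = (`) f ` fst ` P"
  by (auto simp: lmap_def image_image)

lemma lmap_comp: "lmap f (lmap g P) = lmap (f \<circ> g) P"
  by (auto simp: lmap_def image_image image_comp)

lemma lmap_cong:
  assumes "\<And>p v. p \<in> P \<Longrightarrow> v \<in> fst p \<Longrightarrow> f v = g v" shows "lmap f P = lmap g P"
  unfolding lmap_def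
proof (rule image_cong[OF refl])
  fix p assume "p \<in> P"
  hence "f ` fst p = g ` fst p" by (intro image_cong[OF refl] assms)
  thus "(f ` fst p, snd p) = (g ` fst p, snd p)" by simp
qed

lemma lmap_id:
  assumes "\<And>p v. p \<in> P \<Longrightarrow> v \<in> fst p \<Longrightarrow> f v = v" shows "lmap f P = P"
proof -
  have "lmap f P = lmap id P" by (rule lmap_cong) (simp add: assms)
  thus ?thesis by (simp add: lmap_def)
qed

locale labels = comm_group G for G :: "('g, 's) monoid_scheme" (structure)
begin

text \<open>Edges may have any positive number of vertices and may overlap. Associativity is proved
  in this generality; matchings and planarity matter only for closure under composition.\<close>

definition wf :: "'v set \<Rightarrow> ('v set \<times> 'g) set \<Rightarrow> bool" where
  "wf V P \<longleftrightarrow> finite P \<and> (\<forall>p\<in>P. fst p \<subseteq> V \<and> fst p \<noteq> {} \<and> snd p \<in> carrier G)"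

lemma wfD: "wf V P \<Longrightarrow> finite P" "wf V P \<Longrightarrow> p \<in> P \<Longrightarrow> fst p \<subseteq> V"
  "wf V P \<Longrightarrow> p \<in> P \<Longrightarrow> fst p \<noteq> {}" "wf V P \<Longrightarrow> p \<in> P \<Longrightarrow> snd p \<in> carrier G"
  unfolding wf_def by blast+

lemma wf_mono: "wf V P \<Longrightarrow> V \<subseteq> W \<Longrightarrow> wf W P" unfolding wf_def by blast

lemma lab_closed [simp]: "wf V P \<Longrightarrow> lab G P C \<in> carrier G"
  unfolding lab_def by (intro finprod_closed) (auto simp: wf_def)

lemma wf_lmap: "wf V P \<Longrightarrow> wf (f ` V) (lmap f P)"
  unfolding wf_def lmap_def by auto

lemma lab_lmap:
  assumes f: "inj_on f V" and P: "wf V P" and C: "C \<subseteq> V"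
  shows "lab G (lmap f P) (f ` C) = lab G P C"
proof -
  have m: "f ` fst p \<subseteq> f ` C \<longleftrightarrow> fst p \<subseteq> C" if "p \<in> P" for p
  proof -
    have "f v \<in> f ` C \<longleftrightarrow> v \<in> C" if "v \<in> fst p" for v
      using inj_on_image_mem_iff[OF f _ C, of v] wfD(2)[OF P \<open>p \<in> P\<close>] that by blast
    thus ?thesis by blast
  qed
  let ?h = "\<lambda>p. (f ` fst p, snd p)"
  have inj: "inj_on ?h P"
  proof (rule inj_onI)
    fix p q assume pq: "p \<in> P" "q \<in> P" "?h p = ?h q"
    hence "fst p = fst q" using inj_on_image_eq_iff[OF f wfD(2)[OF P pq(1)] wfD(2)[OF P pq(2)]] by simp
    thus "p = q" using pq(3) by (simp add: prod_eq_iff)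
  qed
  have "{p \<in> lmap f P. fst p \<subseteq> f ` C} = ?h ` {p\<in>P. fst p \<subseteq> C}"
    unfolding lmap_def filter_image fst_conv using m by (intro arg_cong[where f = "(`) ?h"]) blast
  hence "lab G (lmap f P) (f ` C) = (\<Otimes>p\<in>?h ` {p\<in>P. fst p \<subseteq> C}. snd p)" by (simp add: lab_def)
  also have "\<dots> = (\<Otimes>p\<in>{p\<in>P. fst p \<subseteq> C}. snd (?h p))"
    using wfD(4)[OF P] by (intro finprod_reindex inj_on_subset[OF inj]) auto
  finally show ?thesis by (simp add: lab_def)
qed

lemma comps_lmap:
  assumes f: "inj_on f V" and P: "wf V P" and Q: "wf V Q"
  shows "comps (f ` V) (fst ` lmap f P \<union> fst ` lmap f Q) = (`) f ` comps V (fst ` P \<union> fst ` Q)"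
  unfolding fst_lmap image_Un[symmetric]
  by (rule comps_image[OF f]) (use wfD(2)[OF P] wfD(2)[OF Q] in blast)

text \<open>Iterated products renumber columns several times. Equivariance under injective renaming
  brings all gluings into one common picture.\<close>

lemma contr_lmap:
  assumes f: "inj_on f V" and P: "wf V P" and Q: "wf V Q" and M: "M \<subseteq> V"
  shows "contr G (f ` V) (f ` M) (lmap f P) (lmap f Q) = lmap f (contr G V M P Q)"
proof -
  let ?E = "fst ` P \<union> fst ` Q"
  have m: "f ` C \<subseteq> f ` M \<longleftrightarrow> C \<subseteq> M" "f ` C - f ` M = f ` (C - M)" if "C \<subseteq> V" for C
  proof -
    show "f ` C \<subseteq> f ` M \<longleftrightarrow> C \<subseteq> M" using inj_on_image_mem_iff[OF f _ M] that by blast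
    show "f ` C - f ` M = f ` (C - M)" using inj_on_image_set_diff[OF f, of C M] that M by blast
  qed
  have s: "{C \<in> comps (f ` V) (fst ` lmap f P \<union> fst ` lmap f Q). \<not> C \<subseteq> f ` M} = (`) f ` {C\<in>comps V ?E. \<not> C \<subseteq> M}"
    unfolding comps_lmap[OF f P Q] filter_image
    using m(1) compsD(2)[of _ V ?E] by (intro arg_cong[where f = "(`) ((`) f)"]) blast
  show ?thesis
    unfolding contr_def s lmap_def[of f "_ ` _"] image_image
  proof (rule image_cong[OF refl])
    fix C assume "C \<in> {C\<in>comps V ?E. \<not> C \<subseteq> M}"
    hence C: "C \<subseteq> V" using compsD(2)[of C V ?E] by blast
    show "(f ` C - f ` M, lab G (lmap f P) (f ` C) \<otimes> lab G (lmap f Q) (f ` C)) =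
      (f ` fst (C - M, lab G P C \<otimes> lab G Q C), snd (C - M, lab G P C \<otimes> lab G Q C))"
      by (simp add: m(2)[OF C] lab_lmap[OF f P C] lab_lmap[OF f Q C])
  qed
qed

lemma contr_commute: "wf V P \<Longrightarrow> wf V Q \<Longrightarrow> contr G V M P Q = contr G V M Q P"
  unfolding contr_def by (intro image_cong) (auto simp: Un_commute m_comm)

lemma finite_comps: "finite V \<Longrightarrow> finite (comps V E)"
  by (rule finite_subset[of _ "Pow V"]) (auto simp: comps_def)

lemma wf_contr:
  assumes "finite V" "wf V P" "wf V Q" shows "wf (V - M) (contr G V M P Q)"
  using assms finite_comps[OF assms(1)] compsD(2)[of _ V "fst ` P \<union> fst ` Q"]
  unfolding wf_def[of "V - M"] contr_def by (auto simp: lab_closed[OF assms(2)] lab_closed[OF assms(3)])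

text \<open>Three graphs glued at once. Both bracketings are reduced to this expression, which is
  symmetric in the three graphs up to the order of factors in an abelian group.\<close>

definition triple :: "'v set \<Rightarrow> 'v set \<Rightarrow> ('v set \<times> 'g) set \<Rightarrow> ('v set \<times> 'g) set \<Rightarrow>
    ('v set \<times> 'g) set \<Rightarrow> ('v set \<times> 'g) set" where
  "triple V M P Q R = (\<lambda>C. (C - M, lab G P C \<otimes> lab G Q C \<otimes> lab G R C)) `
     {C\<in>comps V (fst ` P \<union> fst ` Q \<union> fst ` R). \<not> C \<subseteq> M}"

lemma triple_rotate:
  assumes "wf V P" "wf V Q" "wf V R" shows "triple V M Q R P = triple V M P Q R"
proof -
  have "fst ` Q \<union> fst ` R \<union> fst ` P = fst ` P \<union> fst ` Q \<union> fst ` R" by blast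
  thus ?thesis unfolding triple_def using assms
    by (intro image_cong) (simp_all add: m_ac)
qed

end

locale contract_twice = labels G + L?: contraction V V1 M "fst ` P \<union> fst ` Q" "fst ` R"
  for G :: "('g, 's) monoid_scheme" (structure) and V V1 M :: "'v set" and P Q R :: "('v set \<times> 'g) set" +
  assumes V: "finite V" and P: "wf V1 P" and Q: "wf V1 Q" and R: "wf (V - M) R"
begin

lemma fst_contr: "fst ` contr G V1 M P Q = E'"
  by (simp add: contr_def L.E'_def image_image)

lemma finV1: "finite V1" using V L.V1 finite_subset by blast

text \<open>The first-stage components are disjoint and every edge lies in one of them, so the
  product of labels is regrouped by components.\<close>

lemma lab_split:
  assumes W: "W \<in> comps (V - M) (E' \<union> fst ` R)" and S: "wf V1 S" "fst ` S \<subseteq> fst ` P \<union> fst ` Q"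
  shows "lab G S (ext W) = (\<Otimes>C\<in>{C\<in>CC. C \<subseteq> ext W}. lab G S C)"
proof -
  have m: "fst p \<subseteq> ext W \<longleftrightarrow> (\<exists>C\<in>CC. C \<subseteq> ext W \<and> fst p \<subseteq> C)" if p: "p \<in> S" for p
    by (rule L.edge_comp_ext[OF W subsetD[OF S(2) imageI[OF p]] wfD(3)[OF S(1) p]])
  have "{p\<in>S. fst p \<subseteq> ext W} = {p\<in>S. \<exists>C\<in>CC. C \<subseteq> ext W \<and> fst p \<subseteq> C}"
    by (intro Collect_cong conj_cong refl m)
  also have "\<dots> = (\<Union>C\<in>{C\<in>CC. C \<subseteq> ext W}. {p\<in>S. fst p \<subseteq> C})" by auto
  finally have "{p\<in>S. fst p \<subseteq> ext W} = (\<Union>C\<in>{C\<in>CC. C \<subseteq> ext W}. {p\<in>S. fst p \<subseteq> C})" .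
  hence "lab G S (ext W) = (\<Otimes>p\<in>(\<Union>C\<in>{C\<in>CC. C \<subseteq> ext W}. {p\<in>S. fst p \<subseteq> C}). snd p)"
    by (simp only: lab_def)
  also have "\<dots> = (\<Otimes>C\<in>{C\<in>CC. C \<subseteq> ext W}. \<Otimes>p\<in>{p\<in>S. fst p \<subseteq> C}. snd p)"
  proof (rule finprod_UN_disjoint)
    show "finite {C\<in>CC. C \<subseteq> ext W}" using finite_comps[OF finV1] by simp
    show "finite {p\<in>S. fst p \<subseteq> C}" for C using wfD(1)[OF S(1)] by simp
    show "snd p \<in> carrier G" if "p \<in> {p\<in>S. fst p \<subseteq> C}" for C p using that wfD(4)[OF S(1)] by simp
    show "pairwise (\<lambda>C C'. disjnt {p\<in>S. fst p \<subseteq> C} {p\<in>S. fst p \<subseteq> C'}) {C\<in>CC. C \<subseteq> ext W}"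
    proof (rule pairwiseI)
      fix C C' assume "C \<in> {C\<in>CC. C \<subseteq> ext W}" "C' \<in> {C\<in>CC. C \<subseteq> ext W}" "C \<noteq> C'"
      hence "C \<inter> C' = {}" using comps_disjoint[of C V1 _ C' V1] by blast
      thus "disjnt {p\<in>S. fst p \<subseteq> C} {p\<in>S. fst p \<subseteq> C'}"
        using wfD(3)[OF S(1)] unfolding disjnt_def by blast
    qed
  qed
  finally show ?thesis by (simp only: lab_def)
qed

text \<open>An edge of the contracted graph carries the product over a whole component. Multiplying
  these over \<open>W\<close> yields all labels of the first two graphs inside \<open>ext W\<close>,
  each exactly once.\<close>

lemma lab_contr:
  assumes W: "W \<in> comps (V - M) (E' \<union> fst ` R)"
  shows "lab G (contr G V1 M P Q) W = lab G P (ext W) \<otimes> lab G Q (ext W)"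
proof -
  let ?h = "\<lambda>C. (C - M, lab G P C \<otimes> lab G Q C)"
  let ?S = "{C\<in>CC. \<not> C \<subseteq> M \<and> C - M \<subseteq> W}"
  have inj: "inj_on ?h ?S"
  proof (rule inj_onI)
    fix C C' assume C: "C \<in> ?S" "C' \<in> ?S" "?h C = ?h C'"
    then obtain v where "v \<in> C" "v \<in> C'" by blast
    thus "C = C'" using C(1,2) comps_eq[of C V1 _ C' V1 v] by blast
  qed
  have "{q \<in> contr G V1 M P Q. fst q \<subseteq> W} = ?h ` ?S"
    unfolding contr_def filter_image fst_conv by (intro arg_cong[where f = "(`) ?h"]) blast
  hence "lab G (contr G V1 M P Q) W = (\<Otimes>q\<in>?h ` ?S. snd q)" by (simp only: lab_def)
  also have "\<dots> = (\<Otimes>C\<in>?S. snd (?h C))"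
    using lab_closed[OF P] lab_closed[OF Q] by (intro finprod_reindex[OF _ inj]) auto
  also have "\<dots> = (\<Otimes>C\<in>{C\<in>CC. C \<subseteq> ext W}. lab G P C \<otimes> lab G Q C)"
    unfolding L.ext_absorb[OF W] by simp
  also have "\<dots> = (\<Otimes>C\<in>{C\<in>CC. C \<subseteq> ext W}. lab G P C) \<otimes> (\<Otimes>C\<in>{C\<in>CC. C \<subseteq> ext W}. lab G Q C)"
    using lab_closed[OF P] lab_closed[OF Q] by (intro finprod_multf) auto
  also have "\<dots> = lab G P (ext W) \<otimes> lab G Q (ext W)"
    using lab_split[OF W P] lab_split[OF W Q] by simp
  finally show ?thesis .
qed

lemma lab_R:
  assumes W: "W \<in> comps (V - M) (E' \<union> fst ` R)" shows "lab G R W = lab G R (ext W)"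
proof -
  have "fst p \<subseteq> W \<longleftrightarrow> fst p \<subseteq> ext W" if "p \<in> R" for p
    using L.ext_Diff[OF compsD(2,3)[OF W]] wfD(2)[OF R that] by blast
  hence "{p\<in>R. fst p \<subseteq> W} = {p\<in>R. fst p \<subseteq> ext W}" by blast
  thus ?thesis by (simp only: lab_def)
qed

lemma lab_R_loop: "C \<subseteq> M \<Longrightarrow> lab G R C = \<one>"
proof -
  assume "C \<subseteq> M"
  hence "{p\<in>R. fst p \<subseteq> C} = {}" using wfD(2,3)[OF R] by blast
  thus ?thesis by (simp only: lab_def finprod_empty)
qed

lemma ext_subset_iff:
  assumes W: "W \<in> comps (V - M) (E' \<union> fst ` R)" shows "ext W \<subseteq> M \<union> M2 \<longleftrightarrow> W \<subseteq> M2" "ext W - (M \<union> M2) = W - M2"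
  using L.ext_Diff[OF compsD(2,3)[OF W]] compsD(2)[OF W] by blast+

text \<open>\<open>ext\<close> matches the components that survive the second stage with those of
  the threefold gluing, and preserves outer vertices and labels.\<close>

lemma contr_contr: "contr G (V - M) M2 (contr G V1 M P Q) R = triple V (M \<union> M2) P Q R"
proof -
  let ?K = "comps (V - M) (E' \<union> fst ` R)"
  have s: "{C\<in>comps V (fst ` P \<union> fst ` Q \<union> fst ` R). \<not> C \<subseteq> M \<union> M2} = ext ` {W\<in>?K. \<not> W \<subseteq> M2}"
    unfolding L.comps_contract using ext_subset_iff(1) by blast
  show ?thesis
    unfolding triple_def s image_image contr_def[of G "V - M"] fst_contr
    by (rule image_cong[OF refl]) (simp add: lab_contr lab_R ext_subset_iff(2))
qed

text \<open>A loop of the threefold gluing is either closed in the first stage, where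
  \<open>R\<close> contributes no label, or it is \<open>ext W\<close> for a loop \<open>W\<close>
  of the second stage. The product over all loops splits accordingly.\<close>

lemma loops_contr:
  assumes K: "comm_monoid K" and F: "F \<in> carrier G \<rightarrow> carrier K"
  shows "(\<Otimes>\<^bsub>K\<^esub>C\<in>loopset V1 M P Q. F (lab G P C \<otimes> lab G Q C)) \<otimes>\<^bsub>K\<^esub>
      (\<Otimes>\<^bsub>K\<^esub>W\<in>loopset (V - M) M2 (contr G V1 M P Q) R. F (lab G (contr G V1 M P Q) W \<otimes> lab G R W)) =
    (\<Otimes>\<^bsub>K\<^esub>C\<in>{C\<in>comps V (fst ` P \<union> fst ` Q \<union> fst ` R). C \<subseteq> M \<union> M2}. F (lab G P C \<otimes> lab G Q C \<otimes> lab G R C))"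
proof -
  interpret K: comm_monoid K by (rule K)
  let ?K = "comps (V - M) (E' \<union> fst ` R)"
  let ?L = "\<lambda>C. F (lab G P C \<otimes> lab G Q C \<otimes> lab G R C)"
  have R': "wf V R" using R by (rule wf_mono) blast
  have Lc: "?L C \<in> carrier K" for C
    using lab_closed[OF P] lab_closed[OF Q] lab_closed[OF R'] by (intro funcset_mem[OF F]) simp
  have fin: "finite CC" "finite ?K" by (rule finite_comps[OF finV1], rule finite_comps, simp add: V)
  have s: "{C\<in>comps V (fst ` P \<union> fst ` Q \<union> fst ` R). C \<subseteq> M \<union> M2} = {C\<in>CC. C \<subseteq> M} \<union> ext ` {W\<in>?K. W \<subseteq> M2}"
    unfolding L.comps_contract using ext_subset_iff(1) by blast
  have "(\<Otimes>\<^bsub>K\<^esub>C\<in>{C\<in>CC. C \<subseteq> M} \<union> ext ` {W\<in>?K. W \<subseteq> M2}. ?L C) =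
      (\<Otimes>\<^bsub>K\<^esub>C\<in>{C\<in>CC. C \<subseteq> M}. ?L C) \<otimes>\<^bsub>K\<^esub> (\<Otimes>\<^bsub>K\<^esub>C\<in>ext ` {W\<in>?K. W \<subseteq> M2}. ?L C)"
    using fin Lc L.ext_not_loop by (intro K.finprod_Un_disjoint) auto
  also have "(\<Otimes>\<^bsub>K\<^esub>C\<in>{C\<in>CC. C \<subseteq> M}. ?L C) = (\<Otimes>\<^bsub>K\<^esub>C\<in>loopset V1 M P Q. F (lab G P C \<otimes> lab G Q C))"
    unfolding loopset_def using lab_closed[OF P] lab_closed[OF Q] funcset_mem[OF F]
    by (intro K.finprod_cong') (simp_all add: lab_R_loop Pi_def)
  also have "(\<Otimes>\<^bsub>K\<^esub>C\<in>ext ` {W\<in>?K. W \<subseteq> M2}. ?L C) = (\<Otimes>\<^bsub>K\<^esub>W\<in>{W\<in>?K. W \<subseteq> M2}. ?L (ext W))"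
    using Lc by (intro K.finprod_reindex inj_on_subset[OF L.ext_inj]) auto
  also have "\<dots> = (\<Otimes>\<^bsub>K\<^esub>W\<in>loopset (V - M) M2 (contr G V1 M P Q) R. F (lab G (contr G V1 M P Q) W \<otimes> lab G R W))"
  proof (rule K.finprod_cong')
    show "{W\<in>?K. W \<subseteq> M2} = loopset (V - M) M2 (contr G V1 M P Q) R" by (simp add: loopset_def fst_contr)
    show "(\<lambda>W. F (lab G (contr G V1 M P Q) W \<otimes> lab G R W)) \<in> loopset (V - M) M2 (contr G V1 M P Q) R \<rightarrow> carrier K"
      using lab_closed[OF wf_contr[OF finV1 P Q, of M]] lab_closed[OF R] by (intro Pi_I funcset_mem[OF F]) simp
    show "?L (ext W) = F (lab G (contr G V1 M P Q) W \<otimes> lab G R W)"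
      if "W \<in> loopset (V - M) M2 (contr G V1 M P Q) R" for W
      using that by (simp add: loopset_def fst_contr lab_contr lab_R)
  qed
  finally show ?thesis unfolding s by (rule sym)
qed

end

text \<open>Renumbers the outer columns of a glued strip as 0 and 1. Every nonzero column goes to 1,
  so the same map serves for three and for four columns.\<close>

definition outm :: "node \<Rightarrow> node" where "outm v = (if fst v = 0 then 0 else 1, snd v)"

lemma shift_inj: "inj_on shift A" by (rule inj_onI) (auto simp: shift_def prod_eq_iff)

section \<open>Composition of diagrams as gluing of labelled graphs\<close>

context labels
begin

abbreviation "V3 n \<equiv> {0, 1, 2} \<times> {..<n} :: node set"
abbreviation "M1 n \<equiv> {1} \<times> {..<n} :: node set"

lemma wf_diagram:
  assumes "x \<in> diagrams G n" shows "wf (nodes n) x"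
proof -
  have e: "fst p \<subseteq> nodes n" "card (fst p) = 2" "snd p \<in> carrier G" if "p \<in> x" for p
  proof -
    have "\<forall>(e, g)\<in>x. e \<subseteq> nodes n \<and> card e = 2 \<and> g \<in> carrier G" using assms by (simp add: diagrams_def)
    from bspec[OF this that] show "fst p \<subseteq> nodes n" "card (fst p) = 2" "snd p \<in> carrier G"
      by (simp_all add: case_prod_beta)
  qed
  have u: "\<exists>!p. p \<in> x \<and> v \<in> fst p" if "v \<in> nodes n" for v using assms that by (simp add: diagrams_def)
  have ne: "fst p \<noteq> {}" if "p \<in> x" for p using e(2)[OF that] by auto
  have "x \<subseteq> (\<lambda>v. THE p. p \<in> x \<and> v \<in> fst p) ` nodes n"
  proof
    fix p assume p: "p \<in> x"
    then obtain v where v: "v \<in> fst p" using ne by blast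
    have vn: "v \<in> nodes n" using e(1)[OF p] v by blast
    have "p = (THE p. p \<in> x \<and> v \<in> fst p)" by (rule the1_equality[OF u[OF vn], symmetric]) (simp add: p v)
    thus "p \<in> (\<lambda>v. THE p. p \<in> x \<and> v \<in> fst p) ` nodes n" by (rule image_eqI[OF _ vn])
  qed
  hence "finite x" by (rule finite_subset) (simp add: nodes_def)
  thus ?thesis using e ne unfolding wf_def by blast
qed

lemma wf_V3: "wf (nodes n) x \<Longrightarrow> wf (V3 n) x" by (rule wf_mono) (auto simp: nodes_def)

lemma wf_shift: "wf (nodes n) y \<Longrightarrow> wf (V3 n) (lmap shift y)"
  by (rule wf_mono[OF wf_lmap[of "nodes n"]]) (auto simp: nodes_def shift_def)

lemma components_eq:
  assumes "wf (nodes n) x" "wf (nodes n) y"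
  shows "components n x y = comps (V3 n) (fst ` x \<union> fst ` lmap shift y)"
proof -
  have g: "glued_edges x y = fst ` x \<union> fst ` lmap shift y" by (simp add: glued_edges_def fst_lmap image_image)
  have "edge_closed (fst ` x \<union> fst ` lmap shift y) (V3 n)"
    using wfD(2)[OF wf_V3[OF assms(1)]] wfD(2)[OF wf_shift[OF assms(2)]] unfolding edge_closed_def by blast
  from quotient_comps[OF this] show ?thesis by (simp add: components_def edge_rel_def g)
qed

lemma component_label_eq:
  assumes y: "wf (nodes n) y" shows "component_label G x y C = lab G x C \<otimes> lab G (lmap shift y) C"
proof -
  let ?h = "\<lambda>p. (shift ` fst p, snd p)"
  have inj: "inj_on ?h A" for A :: "(node set \<times> 'g) set"
    by (rule inj_onI) (auto simp: prod_eq_iff inj_image_eq_iff[OF shift_inj])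
  have "{p \<in> lmap shift y. fst p \<subseteq> C} = ?h ` {p\<in>y. shift ` fst p \<subseteq> C}"
    unfolding lmap_def filter_image fst_conv ..
  hence "lab G (lmap shift y) C = (\<Otimes>p\<in>?h ` {p\<in>y. shift ` fst p \<subseteq> C}. snd p)" by (simp only: lab_def)
  also have "\<dots> = (\<Otimes>p\<in>{p\<in>y. shift ` fst p \<subseteq> C}. snd (?h p))"
    using wfD(4)[OF y] by (intro finprod_reindex inj) auto
  finally show ?thesis by (simp add: component_label_def lab_def)
qed

lemma outer_nodes_eq: assumes C: "C \<subseteq> V3 n" shows "outer_nodes C = outm ` (C - M1 n)"
proof (intro equalityI subsetI)
  fix v assume "v \<in> outer_nodes C"
  then consider i where "v = (0, i)" "(0, i) \<in> C" | i where "v = (1, i)" "(2, i) \<in> C"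
    unfolding outer_nodes_def by blast
  thus "v \<in> outm ` (C - M1 n)"
  proof cases
    case 1 thus ?thesis by (intro image_eqI[of _ _ "(0, i)" for i]) (auto simp: outm_def)
  next
    case 2 thus ?thesis by (intro image_eqI[of _ _ "(2, i)" for i]) (auto simp: outm_def)
  qed
next
  fix v assume "v \<in> outm ` (C - M1 n)"
  then obtain c i where w: "v = outm (c, i)" "(c, i) \<in> C" "(c, i) \<notin> M1 n" by auto
  hence "c = 0 \<or> c = 2" using C by auto
  thus "v \<in> outer_nodes C" using w by (auto simp: outer_nodes_def outm_def)
qed

lemma loops_eq:
  assumes "wf (nodes n) x" "wf (nodes n) y" shows "loops n x y = loopset (V3 n) (M1 n) x (lmap shift y)"
  by (simp add: loops_def loopset_def components_eq[OF assms])

lemma compose_eq: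
  assumes x: "wf (nodes n) x" and y: "wf (nodes n) y"
  shows "compose_diagrams G n x y = lmap outm (contr G (V3 n) (M1 n) x (lmap shift y))"
proof -
  let ?E = "fst ` x \<union> fst ` lmap shift y"
  have s: "components n x y - loops n x y = {C\<in>comps (V3 n) ?E. \<not> C \<subseteq> M1 n}"
    unfolding loops_eq[OF x y] components_eq[OF x y] loopset_def by blast
  show ?thesis unfolding compose_diagrams_def s contr_def lmap_def[of outm] image_image
    using compsD(2)[of _ "V3 n" ?E]
    by (intro image_cong[OF refl]) (simp add: component_label_eq[OF y] outer_nodes_eq[of _ n])
qed

lemma wf_compose:
  assumes x: "wf (nodes n) x" and y: "wf (nodes n) y" shows "wf (nodes n) (compose_diagrams G n x y)"
  unfolding compose_eq[OF x y]
  by (rule wf_mono[OF wf_lmap[OF wf_contr[OF _ wf_V3[OF x] wf_shift[OF y], of "M1 n"]]])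
    (auto simp: nodes_def outm_def)

definition factor :: "('k, 'r) monoid_scheme \<Rightarrow> ('g \<Rightarrow> 'k) \<Rightarrow> 'v set \<Rightarrow> 'v set \<Rightarrow> ('v set \<times> 'g) set \<Rightarrow> ('v set \<times> 'g) set \<Rightarrow> 'k" where
  "factor K F V M P Q = (\<Otimes>\<^bsub>K\<^esub>C\<in>loopset V M P Q. F (lab G P C \<otimes> lab G Q C))"

lemma factor_lmap:
  assumes K: "comm_monoid K" and F: "F \<in> carrier G \<rightarrow> carrier K"
    and f: "inj_on f V" and P: "wf V P" and Q: "wf V Q" and M: "M \<subseteq> V"
  shows "factor K F (f ` V) (f ` M) (lmap f P) (lmap f Q) = factor K F V M P Q"
proof -
  interpret K: comm_monoid K by (rule K)
  let ?E = "fst ` P \<union> fst ` Q"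
  have CV: "C \<subseteq> V" if "C \<in> loopset V M P Q" for C using that compsD(2)[of C V ?E] by (simp add: loopset_def)
  have m: "f ` C \<subseteq> f ` M \<longleftrightarrow> C \<subseteq> M" if "C \<subseteq> V" for C using inj_on_image_mem_iff[OF f _ M] that by blast
  have s: "loopset (f ` V) (f ` M) (lmap f P) (lmap f Q) = (`) f ` loopset V M P Q"
    unfolding loopset_def comps_lmap[OF f P Q] filter_image
    using m compsD(2)[of _ V ?E] by (intro arg_cong[where f = "(`) ((`) f)"]) blast
  have inj: "inj_on ((`) f) (loopset V M P Q)"
  proof (rule inj_onI)
    fix C C' assume "C \<in> loopset V M P Q" "C' \<in> loopset V M P Q" "f ` C = f ` C'"
    thus "C = C'" using inj_on_image_eq_iff[OF f CV CV, of C C'] by simp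
  qed
  have "factor K F (f ` V) (f ` M) (lmap f P) (lmap f Q) =
      (\<Otimes>\<^bsub>K\<^esub>C\<in>loopset V M P Q. F (lab G (lmap f P) (f ` C) \<otimes> lab G (lmap f Q) (f ` C)))"
    unfolding factor_def s using lab_closed[OF wf_lmap[OF P, of f]] lab_closed[OF wf_lmap[OF Q, of f]]
    by (intro K.finprod_reindex[OF _ inj] Pi_I funcset_mem[OF F] m_closed)
  also have "\<dots> = factor K F V M P Q"
    unfolding factor_def using lab_closed[OF P] lab_closed[OF Q]
    by (intro K.finprod_cong' Pi_I funcset_mem[OF F]) (simp_all add: lab_lmap[OF f P CV] lab_lmap[OF f Q CV])
  finally show ?thesis .
qed

lemma factor_commute:
  assumes "wf V P" "wf V Q" shows "factor K F V M P Q = factor K F V M Q P"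
  using assms by (simp add: factor_def loopset_def Un_commute m_comm)

section \<open>Associativity of composition and the cocycle of loop factors\<close>

abbreviation "V4 n \<equiv> {0, 1, 2, 3} \<times> {..<n} :: node set"
abbreviation "M2 n \<equiv> {2} \<times> {..<n} :: node set"

text \<open>Both maps spread three columns over four: \<open>r1\<close> leaves the gap at column 1,
  removed by composing the first two diagrams, and \<open>r2\<close> leaves it at column 2, removed
  by composing the last two.\<close>

definition r1 :: "node \<Rightarrow> node" where "r1 v = (if fst v = 0 then 0 else fst v + 1, snd v)"
definition r2 :: "node \<Rightarrow> node" where "r2 v = (if fst v \<le> 1 then fst v else fst v + 1, snd v)"

lemma r1_inj: "inj_on r1 A" and r2_inj: "inj_on r2 A"
  by (rule inj_onI, auto simp: r1_def r2_def prod_eq_iff split: if_splits)+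

lemma image_cols:
  "r1 ` V3 n = V4 n - M1 n" "r1 ` M1 n = M2 n" "r2 ` V3 n = V4 n - M2 n" "r2 ` M1 n = M1 n"
  "shift ` M1 n = M2 n"
  by (force simp: r1_def r2_def shift_def image_iff)+

text \<open>With the three diagrams in columns 0 to 3, the left bracketing removes column 1 and then
  2, the right bracketing 2 and then 1. Renumbering carries each second stage into this picture,
  where it is an instance of gluing in two stages.\<close>

lemma triple_composition:
  assumes x: "wf (nodes n) x" and y: "wf (nodes n) y" and z: "wf (nodes n) z"
  defines "y' \<equiv> lmap shift y" and "z' \<equiv> lmap shift (lmap shift z)"
  shows "compose_diagrams G n (compose_diagrams G n x y) z = lmap outm (triple (V4 n) (M1 n \<union> M2 n) x y' z')"
    and "compose_diagrams G n x (compose_diagrams G n y z) = lmap outm (triple (V4 n) (M2 n \<union> M1 n) y' z' x)"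
    and "comm_monoid K \<Longrightarrow> F \<in> carrier G \<rightarrow> carrier K \<Longrightarrow>
      factor K F (V3 n) (M1 n) x (lmap shift y) \<otimes>\<^bsub>K\<^esub>
        factor K F (V3 n) (M1 n) (compose_diagrams G n x y) (lmap shift z) =
      (\<Otimes>\<^bsub>K\<^esub>C\<in>{C\<in>comps (V4 n) (fst ` x \<union> fst ` y' \<union> fst ` z'). C \<subseteq> M1 n \<union> M2 n}.
        F (lab G x C \<otimes> lab G y' C \<otimes> lab G z' C))"
    and "comm_monoid K \<Longrightarrow> F \<in> carrier G \<rightarrow> carrier K \<Longrightarrow>
      factor K F (V3 n) (M1 n) y (lmap shift z) \<otimes>\<^bsub>K\<^esub>
        factor K F (V3 n) (M1 n) x (lmap shift (compose_diagrams G n y z)) =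
      (\<Otimes>\<^bsub>K\<^esub>C\<in>{C\<in>comps (V4 n) (fst ` y' \<union> fst ` z' \<union> fst ` x). C \<subseteq> M2 n \<union> M1 n}.
        F (lab G y' C \<otimes> lab G z' C \<otimes> lab G x C))"
proof -
  let ?xy = "compose_diagrams G n x y" and ?yz = "compose_diagrams G n y z"
  let ?X = "contr G (V3 n) (M1 n) x (lmap shift y)" and ?Y = "contr G (V3 n) (M1 n) y (lmap shift z)"
  have fin: "finite (V3 n)" "finite (V4 n)" by simp_all
  note xV = wf_V3[OF x] and yV = wf_V3[OF y] and ys = wf_shift[OF y] and zs = wf_shift[OF z]
  note xy = wf_compose[OF x y] and yz = wf_compose[OF y z]
  have wX: "wf (V3 n - M1 n) ?X" and wY: "wf (V3 n - M1 n) ?Y"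
    by (rule wf_contr[OF fin(1) xV ys], rule wf_contr[OF fin(1) yV zs])
  have M13: "M1 n \<subseteq> V3 n" by auto
  have rX: "lmap r1 ?xy = ?X"
    unfolding compose_eq[OF x y] lmap_comp
  proof (rule lmap_id)
    fix p v assume "p \<in> ?X" "v \<in> fst p"
    hence "v \<in> V3 n - M1 n" using wfD(2)[OF wX] by blast
    thus "(r1 \<circ> outm) v = v" by (auto simp: r1_def outm_def)
  qed
  have rz: "lmap r1 (lmap shift z) = z'"
    unfolding z'_def lmap_comp by (rule lmap_cong) (simp add: r1_def shift_def)
  have rx: "lmap r2 x = x"
  proof (rule lmap_id)
    fix p v assume "p \<in> x" "v \<in> fst p"
    hence "v \<in> nodes n" using wfD(2)[OF x] by blast
    thus "r2 v = v" by (auto simp: r2_def nodes_def)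
  qed
  have rY: "lmap r2 (lmap shift ?yz) = lmap shift ?Y"
    unfolding compose_eq[OF y z] lmap_comp
  proof (rule lmap_cong)
    fix p v assume "p \<in> ?Y" "v \<in> fst p"
    hence "v \<in> V3 n - M1 n" using wfD(2)[OF wY] by blast
    thus "(r2 \<circ> (shift \<circ> outm)) v = shift v" by (auto simp: r2_def outm_def shift_def)
  qed
  have sY: "lmap shift ?Y = contr G (shift ` V3 n) (M2 n) y' z'"
    unfolding y'_def z'_def image_cols(5)[of n, symmetric] by (rule contr_lmap[OF shift_inj yV zs M13, symmetric])
  have shV: "shift ` V3 n = {1, 2, 3} \<times> {..<n}" by (force simp: shift_def image_iff)
  have y'w: "wf (V3 n) y'" "wf (shift ` V3 n) y'" using ys wf_lmap[OF yV, of shift] by (simp_all add: y'_def)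
  have z'w: "wf (shift ` V3 n) z'" using wf_lmap[OF zs, of shift] by (simp add: z'_def)
  have z'w1: "wf (V4 n - M1 n) z'"
    using wf_lmap[OF wf_lmap[OF z, of shift], of shift] unfolding z'_def
    by (rule wf_mono) (auto simp: nodes_def shift_def)
  have xw2: "wf (V4 n - M2 n) x" using x by (rule wf_mono) (auto simp: nodes_def)
  interpret A: contract_twice G "V4 n" "V3 n" "M1 n" x y' z'
  proof (intro contract_twice.intro contract_twice_axioms.intro contraction.intro labels_axioms xV y'w z'w1 fin(2))
    show "V3 n \<subseteq> V4 n" "M1 n \<subseteq> V3 n" by auto
    show "e \<subseteq> V3 n" if "e \<in> fst ` x \<union> fst ` y'" for e using that wfD(2)[OF xV] wfD(2)[OF y'w(1)] by blast
    show "e \<subseteq> V4 n - M1 n" if "e \<in> fst ` z'" for e using that wfD(2)[OF z'w1] by blast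
  qed
  interpret B: contract_twice G "V4 n" "shift ` V3 n" "M2 n" y' z' x
  proof (intro contract_twice.intro contract_twice_axioms.intro contraction.intro labels_axioms y'w z'w xw2 fin(2))
    show "shift ` V3 n \<subseteq> V4 n" "M2 n \<subseteq> shift ` V3 n" unfolding shV by auto
    show "e \<subseteq> shift ` V3 n" if "e \<in> fst ` y' \<union> fst ` z'" for e using that wfD(2)[OF y'w(2)] wfD(2)[OF z'w] by blast
    show "e \<subseteq> V4 n - M2 n" if "e \<in> fst ` x" for e using that wfD(2)[OF xw2] by blast
  qed
  have outr: "lmap outm (lmap r P) = lmap outm P"
    if "r = r1 \<or> r = r2" "wf (V3 n - M1 n) P" for r P
    unfolding lmap_comp
  proof (rule lmap_cong)
    fix p v assume "p \<in> P" "v \<in> fst p"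
    hence "v \<in> V3 n - M1 n" using wfD(2)[OF that(2)] by blast
    thus "(outm \<circ> r) v = outm v" using that(1) by (auto simp: r1_def r2_def outm_def)
  qed
  have c1: "lmap r1 (contr G (V3 n) (M1 n) ?xy (lmap shift z)) = triple (V4 n) (M1 n \<union> M2 n) x y' z'"
    unfolding contr_lmap[OF r1_inj wf_V3[OF xy] zs M13, symmetric] image_cols rX rz
    using A.contr_contr[of "M2 n"] by (simp only: y'_def)
  have w1: "wf (V3 n - M1 n) (contr G (V3 n) (M1 n) ?xy (lmap shift z))"
    by (rule wf_contr[OF fin(1) wf_V3[OF xy] zs])
  show "compose_diagrams G n ?xy z = lmap outm (triple (V4 n) (M1 n \<union> M2 n) x y' z')"
    unfolding compose_eq[OF xy z] c1[symmetric] using outr[OF _ w1] by simp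
  note yzs = wf_shift[OF yz]
  have wsY: "wf (V4 n - M2 n) (contr G (shift ` V3 n) (M2 n) y' z')"
    by (rule wf_mono[OF wf_contr[OF _ y'w(2) z'w, of "M2 n"]]) (simp, unfold shV, blast)
  \<comment> \<open>The pair that is glued first has to come first, so \<open>x\<close> takes the
    third place and the arguments of the outer gluing are exchanged.\<close>
  have c2: "lmap r2 (contr G (V3 n) (M1 n) x (lmap shift ?yz)) = triple (V4 n) (M2 n \<union> M1 n) y' z' x"
    unfolding contr_lmap[OF r2_inj xV yzs M13, symmetric] image_cols rx rY sY contr_commute[OF xw2 wsY]
    by (rule B.contr_contr)
  have w2: "wf (V3 n - M1 n) (contr G (V3 n) (M1 n) x (lmap shift ?yz))"
    by (rule wf_contr[OF fin(1) xV yzs])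
  show "compose_diagrams G n x ?yz = lmap outm (triple (V4 n) (M2 n \<union> M1 n) y' z' x)"
    unfolding compose_eq[OF x yz] c2[symmetric] using outr[OF _ w2] by simp
  assume K: "comm_monoid K" and F: "F \<in> carrier G \<rightarrow> carrier K"
  have f1: "factor K F (V3 n) (M1 n) ?xy (lmap shift z) = factor K F (V4 n - M1 n) (M2 n) ?X z'"
    using factor_lmap[OF K F r1_inj wf_V3[OF xy] zs M13] unfolding image_cols rX rz by (rule sym)
  show "factor K F (V3 n) (M1 n) x (lmap shift y) \<otimes>\<^bsub>K\<^esub> factor K F (V3 n) (M1 n) ?xy (lmap shift z) =
      (\<Otimes>\<^bsub>K\<^esub>C\<in>{C\<in>comps (V4 n) (fst ` x \<union> fst ` y' \<union> fst ` z'). C \<subseteq> M1 n \<union> M2 n}.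
        F (lab G x C \<otimes> lab G y' C \<otimes> lab G z' C))"
    unfolding f1 using A.loops_contr[OF K F, of "M2 n"] by (simp only: factor_def y'_def)
  have f2: "factor K F (V3 n) (M1 n) x (lmap shift ?yz) =
      factor K F (V4 n - M2 n) (M1 n) (contr G (shift ` V3 n) (M2 n) y' z') x"
    using factor_lmap[OF K F r2_inj xV yzs M13] unfolding image_cols rx rY sY factor_commute[OF xw2 wsY] by (rule sym)
  have f3: "factor K F (V3 n) (M1 n) y (lmap shift z) = factor K F (shift ` V3 n) (M2 n) y' z'"
    using factor_lmap[OF K F shift_inj yV zs M13] unfolding image_cols y'_def z'_def by (rule sym)
  show "factor K F (V3 n) (M1 n) y (lmap shift z) \<otimes>\<^bsub>K\<^esub> factor K F (V3 n) (M1 n) x (lmap shift ?yz) =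
      (\<Otimes>\<^bsub>K\<^esub>C\<in>{C\<in>comps (V4 n) (fst ` y' \<union> fst ` z' \<union> fst ` x). C \<subseteq> M2 n \<union> M1 n}.
        F (lab G y' C \<otimes> lab G z' C \<otimes> lab G x C))"
    unfolding f2 f3 using B.loops_contr[OF K F, of "M1 n"] by (simp only: factor_def)
qed

lemma compose_assoc:
  assumes x: "wf (nodes n) x" and y: "wf (nodes n) y" and z: "wf (nodes n) z"
  shows "compose_diagrams G n (compose_diagrams G n x y) z = compose_diagrams G n x (compose_diagrams G n y z)"
proof -
  have w: "wf (V4 n) x" "wf (V4 n) (lmap shift y)" "wf (V4 n) (lmap shift (lmap shift z))"
    by (rule wf_mono[OF x], force simp: nodes_def)
      (rule wf_mono[OF wf_lmap[OF y]], force simp: nodes_def shift_def,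
       rule wf_mono[OF wf_lmap[OF wf_lmap[OF z]]], force simp: nodes_def shift_def)
  show ?thesis unfolding triple_composition(1,2)[OF x y z] Un_commute[of "M2 n"] triple_rotate[OF w] ..
qed

text \<open>Both sides are the product of \<open>act g \<delta>\<close> over all loops of the
  threefold gluing, where \<open>g\<close> is the label of the loop.\<close>

lemma loop_factor_cocycle:
  assumes x: "wf (nodes n) x" and y: "wf (nodes n) y" and z: "wf (nodes n) z"
    and k: "comm_monoid k" and F: "(\<lambda>g. act g \<delta>) \<in> carrier G \<rightarrow> carrier k"
  shows "loop_factor G k act \<delta> n x y \<otimes>\<^bsub>k\<^esub> loop_factor G k act \<delta> n (compose_diagrams G n x y) z =
    loop_factor G k act \<delta> n y z \<otimes>\<^bsub>k\<^esub> loop_factor G k act \<delta> n x (compose_diagrams G n y z)"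
proof -
  interpret k: comm_monoid k by (rule k)
  let ?F = "\<lambda>g. act g \<delta>"
  have lf: "loop_factor G k act \<delta> n x y = factor k ?F (V3 n) (M1 n) x (lmap shift y)"
    if "wf (nodes n) x" "wf (nodes n) y" for x y
    by (simp add: loop_factor_def factor_def loops_eq[OF that] component_label_eq[OF that(2)])
  let ?y = "lmap shift y" and ?z = "lmap shift (lmap shift z)"
  have w: "wf (V4 n) x" "wf (V4 n) ?y" "wf (V4 n) ?z"
    by (rule wf_mono[OF x], force simp: nodes_def)
      (rule wf_mono[OF wf_lmap[OF y]], force simp: nodes_def shift_def,
       rule wf_mono[OF wf_lmap[OF wf_lmap[OF z]]], force simp: nodes_def shift_def)
  have e: "fst ` ?y \<union> fst ` ?z \<union> fst ` x = fst ` x \<union> fst ` ?y \<union> fst ` ?z" "M2 n \<union> M1 n = M1 n \<union> M2 n" by blast+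
  have l: "lab G ?y C \<otimes> lab G ?z C \<otimes> lab G x C = lab G x C \<otimes> lab G ?y C \<otimes> lab G ?z C" for C
    using lab_closed[OF w(1)] lab_closed[OF w(2)] lab_closed[OF w(3)] by (simp add: m_ac)
  show ?thesis
    unfolding lf[OF x y] lf[OF y z] lf[OF wf_compose[OF x y] z] lf[OF x wf_compose[OF y z]]
      triple_composition(3)[OF x y z k F] triple_composition(4)[OF x y z k F] e l ..
qed

end

section \<open>Planarity of composites\<close>

text \<open>Two chords with disjoint end points are uncrossed if and only if this count is even for their
  pairs of end points.  As it is additive over edges, the components of two glued planar diagrams
  inherit evenness from the edges of both diagrams.\<close>

definition pair_count :: "('v \<Rightarrow> nat) \<Rightarrow> 'v set \<Rightarrow> 'v set \<Rightarrow> nat" where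
  "pair_count pos U W = (\<Sum>u\<in>U. \<Sum>w\<in>W. if pos u < pos w then 1 else 0)"

text \<open>Of the four comparisons between the end points of two chords, 0 or 4 hold if the chords
  lie side by side, 2 if they are nested, and 1 or 3 if they interleave.\<close>

lemma even_pair_count_edges:
  assumes e: "card e = 2" and f: "card f = 2" and d: "inj_on pos (e \<union> f)" "e \<inter> f = {}"
    and pl: "\<not> (\<exists>a b c d. {a, b} = e \<and> {c, d} = f \<and> pos a < pos c \<and> pos c < pos b \<and> pos b < pos d)"
      "\<not> (\<exists>a b c d. {a, b} = f \<and> {c, d} = e \<and> pos a < pos c \<and> pos c < pos b \<and> pos b < pos d)"
  shows "even (pair_count pos e f)"
proof -
  have sorted: "\<exists>a b. S = {a, b} \<and> pos a < pos b" if "card S = 2" "S \<subseteq> e \<union> f" for S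
  proof -
    obtain a b where ab: "S = {a, b}" "a \<noteq> b" using \<open>card S = 2\<close> by (auto simp: card_2_iff)
    hence "pos a \<noteq> pos b" using inj_onD[OF d(1), of a b] that(2) by blast
    thus ?thesis using ab by (metis insert_commute nat_neq_iff)
  qed
  obtain a b where ab: "e = {a, b}" "pos a < pos b" using sorted[OF e] by blast
  obtain c d where cd: "f = {c, d}" "pos c < pos d" using sorted[OF f] by blast
  have ne: "pos a \<noteq> pos c" "pos a \<noteq> pos d" "pos b \<noteq> pos c" "pos b \<noteq> pos d"
    using assms(3,4) unfolding ab cd by (auto simp: inj_on_def)
  have n1: "\<not> (pos a < pos c \<and> pos c < pos b \<and> pos b < pos d)" using pl(1) ab cd by blast
  have n2: "\<not> (pos c < pos a \<and> pos a < pos d \<and> pos d < pos b)" using pl(2) ab cd by blast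
  have ne': "a \<noteq> b" "c \<noteq> d" using ab cd by auto
  have "pair_count pos e f = (if pos a < pos c then 1 else 0) + (if pos a < pos d then 1 else 0) +
      ((if pos b < pos c then 1 else 0) + (if pos b < pos d then 1 else 0))"
    using ne' unfolding pair_count_def ab(1) cd(1) by simp
  thus ?thesis using ab(2) cd(2) ne n1 n2 by (auto split: if_splits)
qed

text \<open>Perfect matchings of \<open>U\<close> with labels. The locale is used for
  \<open>x\<close> on columns 0 and 1 and for the shifted \<open>y\<close> on columns 1 and
  2.\<close>

locale matching =
  fixes P :: "('v set \<times> 'g) set" and U :: "'v set"
  assumes fin: "finite P" and finU: "finite U" and sub: "p \<in> P \<Longrightarrow> fst p \<subseteq> U" and card2: "p \<in> P \<Longrightarrow> card (fst p) = 2"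
    and ex1: "v \<in> U \<Longrightarrow> \<exists>!p. p \<in> P \<and> v \<in> fst p"
begin

lemma uniq: "p \<in> P \<Longrightarrow> q \<in> P \<Longrightarrow> v \<in> fst p \<Longrightarrow> v \<in> fst q \<Longrightarrow> p = q"
  using ex1[of v] sub by blast

lemma nonempty: "p \<in> P \<Longrightarrow> fst p \<noteq> {}" using card2[of p] by auto

lemma finite_edge: "p \<in> P \<Longrightarrow> finite (fst p)" using card2[of p] by (simp add: card_ge_0_finite)

lemma closed_cover:
  assumes "edge_closed (fst ` P) C" shows "C \<inter> U = (\<Union>p\<in>{p\<in>P. fst p \<subseteq> C}. fst p)"
proof (intro equalityI subsetI)
  fix v assume v: "v \<in> C \<inter> U"
  then obtain p where p: "p \<in> P" "v \<in> fst p" using ex1[of v] by blast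
  have "fst p \<subseteq> C" using edge_closedD[OF assms imageI[OF p(1)] p(2)] v by blast
  thus "v \<in> (\<Union>p\<in>{p\<in>P. fst p \<subseteq> C}. fst p)" using p by blast
qed (use sub in blast)

lemma disjoint_edges: "p \<in> P \<Longrightarrow> q \<in> P \<Longrightarrow> p \<noteq> q \<Longrightarrow> fst p \<inter> fst q = {}"
  using uniq by blast

lemma card_closed:
  assumes "edge_closed (fst ` P) C" shows "card (C \<inter> U) = 2 * card {p\<in>P. fst p \<subseteq> C}"
proof -
  have "card (\<Union>p\<in>{p\<in>P. fst p \<subseteq> C}. fst p) = (\<Sum>p\<in>{p\<in>P. fst p \<subseteq> C}. card (fst p))"
    using fin finite_edge disjoint_edges by (intro card_UN_disjoint) auto
  also have "\<dots> = (\<Sum>p\<in>{p\<in>P. fst p \<subseteq> C}. 2)" using card2 by (intro sum.cong) auto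
  finally show ?thesis unfolding closed_cover[OF assms] by simp
qed

text \<open>A closed set meets \<open>U\<close> in a disjoint union of edges, so the count is a sum
  of counts for pairs of edges, each even by planarity.\<close>

lemma even_pair_count:
  assumes C: "edge_closed (fst ` P) C" and C': "edge_closed (fst ` P) C'" and d: "C \<inter> C' = {}"
    and pos: "inj_on pos U"
    and pl: "\<And>a b c d. \<lbrakk>{a, b} \<in> fst ` P; {c, d} \<in> fst ` P; pos a < pos c; pos c < pos b; pos b < pos d\<rbrakk> \<Longrightarrow> False"
  shows "even (pair_count pos (C \<inter> U) (C' \<inter> U))"
proof -
  let ?X = "{p\<in>P. fst p \<subseteq> C}" and ?Y = "{p\<in>P. fst p \<subseteq> C'}"
  have split: "(\<Sum>u\<in>(\<Union>p\<in>S. fst p). g u) = (\<Sum>p\<in>S. \<Sum>u\<in>fst p. g u)" if "S \<subseteq> P" for S and g :: "'v \<Rightarrow> nat"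
  proof (rule sum.UNION_disjoint)
    show "finite S" using that fin by (rule finite_subset)
    show "\<forall>p\<in>S. finite (fst p)" using that finite_edge by blast
    show "\<forall>p\<in>S. \<forall>q\<in>S. p \<noteq> q \<longrightarrow> fst p \<inter> fst q = {}" using that disjoint_edges by blast
  qed
  have "pair_count pos (C \<inter> U) (C' \<inter> U) =
      (\<Sum>p\<in>?X. \<Sum>u\<in>fst p. \<Sum>q\<in>?Y. \<Sum>w\<in>fst q. if pos u < pos w then 1 else 0)"
    unfolding pair_count_def closed_cover[OF C] closed_cover[OF C'] by (simp add: split)
  also have "\<dots> = (\<Sum>p\<in>?X. \<Sum>q\<in>?Y. pair_count pos (fst p) (fst q))"
    unfolding pair_count_def by (intro sum.cong refl) (rule sum.swap)
  also have "even \<dots>"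
  proof (intro dvd_sum)
    fix p q assume p: "p \<in> ?X" and q: "q \<in> ?Y"
    show "even (pair_count pos (fst p) (fst q))"
    proof (rule even_pair_count_edges)
      show "card (fst p) = 2" "card (fst q) = 2" using p q card2 by auto
      show "inj_on pos (fst p \<union> fst q)" by (rule inj_on_subset[OF pos]) (use p q sub in blast)
      show "fst p \<inter> fst q = {}" using p q d by blast
      have np: "\<not> (\<exists>a b c d. {a, b} = fst p \<and> {c, d} = fst q \<and> pos a < pos c \<and> pos c < pos b \<and> pos b < pos d)"
        if pq: "p \<in> P" "q \<in> P" for p q
      proof (rule notI, elim exE conjE)
        fix a b c d assume "{a, b} = fst p" "{c, d} = fst q" and lt: "pos a < pos c" "pos c < pos b" "pos b < pos d"
        hence "{a, b} \<in> fst ` P" "{c, d} \<in> fst ` P" using pq by simp_all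
        thus False using lt by (rule pl)
      qed
      have pq: "p \<in> P" "q \<in> P" using p q by blast+
      show "\<not> (\<exists>a b c d. {a, b} = fst p \<and> {c, d} = fst q \<and> pos a < pos c \<and> pos c < pos b \<and> pos b < pos d)"
        by (rule np[OF pq])
      show "\<not> (\<exists>a b c d. {a, b} = fst q \<and> {c, d} = fst p \<and> pos a < pos c \<and> pos c < pos b \<and> pos b < pos d)"
        by (rule np[OF pq(2,1)])
    qed
  qed
  finally show ?thesis .
qed

end

text \<open>The spanning tree bound. A proper nonempty part of a component is not closed, so some
  edge leaves it; adding the other end of that edge adds one vertex and at least one inner
  edge.\<close>

lemma connected_card:
  assumes C: "C \<in> comps V (fst ` P \<union> fst ` Q)" and fin: "finite P" "finite Q" "finite C"
    and c2: "\<And>p. p \<in> P \<union> Q \<Longrightarrow> card (fst p) = 2"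
  shows "card C \<le> 1 + card {p\<in>P. fst p \<subseteq> C} + card {q\<in>Q. fst q \<subseteq> C}"
proof -
  have "\<exists>W\<subseteq>C. card W = Suc j \<and> Suc j \<le> 1 + card {p\<in>P. fst p \<subseteq> W} + card {q\<in>Q. fst q \<subseteq> W}"
    if "Suc j \<le> card C" for j
    using that
  proof (induction j)
    case 0
    obtain v where "v \<in> C" using compsD(1)[OF C] by blast
    thus ?case by (intro exI[of _ "{v}"]) simp
  next
    case (Suc j)
    then obtain W where W: "W \<subseteq> C" "card W = Suc j"
      "Suc j \<le> 1 + card {p\<in>P. fst p \<subseteq> W} + card {q\<in>Q. fst q \<subseteq> W}" by auto
    have "W \<noteq> C" "W \<noteq> {}" using W Suc.prems by auto
    hence "\<not> edge_closed (fst ` P \<union> fst ` Q) W" using compsD(4)[OF C W(1)] by blast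
    then obtain e where e: "e \<in> P \<union> Q" "fst e \<inter> W \<noteq> {}" "\<not> fst e \<subseteq> W"
      unfolding edge_closed_def by auto
    have eC: "fst e \<subseteq> C"
    proof -
      obtain v where v: "v \<in> fst e" "v \<in> C" using e(2) W(1) by blast
      have "fst e \<in> fst ` P \<union> fst ` Q" using e(1) by blast
      thus ?thesis by (rule edge_closedD[OF compsD(3)[OF C] _ v])
    qed
    obtain a b where ab: "fst e = {a, b}" "a \<in> W" "b \<notin> W"
    proof -
      obtain s t where st: "fst e = {s, t}" using c2[OF e(1)] by (auto simp: card_2_iff)
      consider "s \<in> W" "t \<notin> W" | "t \<in> W" "s \<notin> W" using e(2,3) unfolding st by blast
      thus thesis
      proof cases
        case 1 thus thesis using that[of s t] st by blast
      next
        case 2 thus thesis using that[of t s] st by (simp add: insert_commute)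
      qed
    qed
    have finW: "finite W" using W(1) fin(3) finite_subset by blast
    let ?W = "insert b W"
    have sub: "fst e \<subseteq> ?W" unfolding ab(1) using ab(2) by simp
    have "card {p\<in>P. fst p \<subseteq> W} + card {q\<in>Q. fst q \<subseteq> W} < card {p\<in>P. fst p \<subseteq> ?W} + card {q\<in>Q. fst q \<subseteq> ?W}"
      using e(1)
    proof
      assume "e \<in> P"
      hence "{p\<in>P. fst p \<subseteq> W} \<subset> {p\<in>P. fst p \<subseteq> ?W}" using sub e(3) by blast
      hence "card {p\<in>P. fst p \<subseteq> W} < card {p\<in>P. fst p \<subseteq> ?W}" by (rule psubset_card_mono[rotated]) (simp add: fin)
      moreover have "card {q\<in>Q. fst q \<subseteq> W} \<le> card {q\<in>Q. fst q \<subseteq> ?W}" using fin by (intro card_mono) auto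
      ultimately show ?thesis by linarith
    next
      assume "e \<in> Q"
      hence "{p\<in>Q. fst p \<subseteq> W} \<subset> {p\<in>Q. fst p \<subseteq> ?W}" using sub e(3) by blast
      hence "card {p\<in>Q. fst p \<subseteq> W} < card {p\<in>Q. fst p \<subseteq> ?W}" by (rule psubset_card_mono[rotated]) (simp add: fin)
      moreover have "card {q\<in>P. fst q \<subseteq> W} \<le> card {q\<in>P. fst q \<subseteq> ?W}" using fin by (intro card_mono) auto
      ultimately show ?thesis by linarith
    qed
    moreover have "card ?W = Suc (Suc j)" using ab(3) W(2) finW by simp
    moreover have "?W \<subseteq> C" using W(1) eC unfolding ab(1) by simp
    ultimately show ?case using W(3) by (intro exI[of _ ?W]) auto
  qed
  from this[of "card C - 1"] obtain W where W: "W \<subseteq> C" "card W = card C"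
    "card C \<le> 1 + card {p\<in>P. fst p \<subseteq> W} + card {q\<in>Q. fst q \<subseteq> W}"
    using compsD(1)[OF C] fin(3) by (auto simp: card_gt_0_iff Suc_leI)
  have "W = C" using W(1,2) fin(3) by (rule_tac card_subset_eq)
  thus ?thesis using W(3) by simp
qed

definition up_count :: "nat set \<Rightarrow> nat set \<Rightarrow> nat" where
  "up_count A B = (\<Sum>a\<in>A. \<Sum>b\<in>B. if a < b then 1 else 0)"

lemma up_count_swap:
  assumes "finite A" "finite B" "A \<inter> B = {}"
  shows "up_count A B + up_count B A = card A * card B"
proof -
  have "up_count B A = (\<Sum>a\<in>A. \<Sum>b\<in>B. if b < a then 1 else 0)" unfolding up_count_def by (rule sum.swap)
  hence "up_count A B + up_count B A = (\<Sum>a\<in>A. \<Sum>b\<in>B. (if a < b then 1 else 0) + (if b < a then 1 else 0))"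
    by (simp add: up_count_def sum.distrib)
  also have "\<dots> = (\<Sum>a\<in>A. \<Sum>b\<in>B. 1)"
    using assms(3) by (intro sum.cong refl) auto
  finally show ?thesis by simp
qed

text \<open>Every position in column \<open>c\<close> precedes every position in column
  \<open>c'\<close>, which gives the product. The boundary runs through column \<open>c'\<close>
  backwards, hence the exchanged arguments in the last term.\<close>

lemma pair_count_strip:
  assumes cc: "(c::nat) \<noteq> c'" and A: "A \<subseteq> {..<n}" "A' \<subseteq> {..<n}" and B: "B \<subseteq> {..<n}" "B' \<subseteq> {..<n}"
    and pos: "\<And>i. pos (c, i) = i" "\<And>i. pos (c', i) = 2 * n - 1 - i"
  shows "pair_count pos ({c} \<times> A \<union> {c'} \<times> A') ({c} \<times> B \<union> {c'} \<times> B') =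
    up_count A B + card A * card B' + up_count B' A'"
proof -
  have fin: "finite A" "finite A'" "finite B" "finite B'" using A B finite_subset by blast+
  have s: "(\<Sum>u\<in>{c} \<times> X \<union> {c'} \<times> X'. g u) = (\<Sum>i\<in>X. g (c, i)) + (\<Sum>i\<in>X'. g (c', i))"
    if "finite X" "finite X'" for X X' and g :: "nat \<times> nat \<Rightarrow> nat"
  proof -
    have "{c} \<times> X = Pair c ` X" "{c'} \<times> X' = Pair c' ` X'" by auto
    thus ?thesis using that cc
      by (subst sum.union_disjoint) (auto simp: sum.reindex inj_on_def)
  qed
  have 1: "(\<Sum>i\<in>A. \<Sum>j\<in>B'. if pos (c, i) < pos (c', j) then 1 else 0 :: nat) = (\<Sum>i\<in>A. \<Sum>j\<in>B'. 1)"
  proof (intro sum.cong refl)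
    fix i j assume "i \<in> A" "j \<in> B'"
    hence "i < n" "j < n" using A B by auto
    thus "(if pos (c, i) < pos (c', j) then 1 else 0 :: nat) = 1" by (auto simp: pos)
  qed
  have 2: "(\<Sum>i\<in>A'. \<Sum>j\<in>B. if pos (c', i) < pos (c, j) then 1 else 0 :: nat) = (\<Sum>i\<in>A'. \<Sum>j\<in>B. 0)"
  proof (intro sum.cong refl)
    fix i j assume "i \<in> A'" "j \<in> B"
    hence "i < n" "j < n" using A B by auto
    thus "(if pos (c', i) < pos (c, j) then 1 else 0 :: nat) = 0" by (auto simp: pos)
  qed
  have 3: "(\<Sum>i\<in>A'. \<Sum>j\<in>B'. if pos (c', i) < pos (c', j) then 1 else 0 :: nat) = (\<Sum>i\<in>A'. \<Sum>j\<in>B'. if j < i then 1 else 0)"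
  proof (intro sum.cong refl)
    fix i j assume "i \<in> A'" "j \<in> B'"
    hence "i < n" "j < n" using A B by auto
    thus "(if pos (c', i) < pos (c', j) then 1 else 0 :: nat) = (if j < i then 1 else 0)" by (auto simp: pos)
  qed
  have 4: "(\<Sum>i\<in>A'. \<Sum>j\<in>B'. if j < i then 1 else 0 :: nat) = up_count B' A'"
    unfolding up_count_def by (rule sum.swap)
  have "pair_count pos ({c} \<times> A \<union> {c'} \<times> A') ({c} \<times> B \<union> {c'} \<times> B') =
      (\<Sum>i\<in>A. \<Sum>j\<in>B. if pos (c, i) < pos (c, j) then 1 else 0) + (\<Sum>i\<in>A. \<Sum>j\<in>B'. if pos (c, i) < pos (c', j) then 1 else 0) +
      ((\<Sum>i\<in>A'. \<Sum>j\<in>B. if pos (c', i) < pos (c, j) then 1 else 0) + (\<Sum>i\<in>A'. \<Sum>j\<in>B'. if pos (c', i) < pos (c', j) then 1 else 0))"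
    unfolding pair_count_def using fin by (simp add: s sum.distrib)
  thus ?thesis unfolding 1 2 3 4 by (simp add: up_count_def pos)
qed

section \<open>Composites of planar matchings are planar matchings\<close>

context labels
begin

lemma diagramD:
  assumes "x \<in> diagrams G n"
  shows "p \<in> x \<Longrightarrow> fst p \<subseteq> nodes n" "p \<in> x \<Longrightarrow> card (fst p) = 2" "p \<in> x \<Longrightarrow> snd p \<in> carrier G"
    "v \<in> nodes n \<Longrightarrow> \<exists>!p. p \<in> x \<and> v \<in> fst p" "planar n (fst ` x)"
proof -
  have *: "\<forall>(e, g)\<in>x. e \<subseteq> nodes n \<and> card e = 2 \<and> g \<in> carrier G" "\<forall>v\<in>nodes n. \<exists>!p. p \<in> x \<and> v \<in> fst p"
    "planar n (fst ` x)" using assms by (simp_all add: diagrams_def)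
  show "p \<in> x \<Longrightarrow> fst p \<subseteq> nodes n" "p \<in> x \<Longrightarrow> card (fst p) = 2" "p \<in> x \<Longrightarrow> snd p \<in> carrier G"
    using bspec[OF *(1), of p] by (simp_all add: case_prod_beta)
  show "v \<in> nodes n \<Longrightarrow> \<exists>!p. p \<in> x \<and> v \<in> fst p" using *(2) by blast
  show "planar n (fst ` x)" by (rule *(3))
qed

lemma finite_nodes: "finite (nodes n)" by (simp add: nodes_def)

lemma matching_diagram: assumes "x \<in> diagrams G n" shows "matching x (nodes n)"
  by (intro matching.intro diagramD[OF assms] finite_nodes wfD(1)[OF wf_diagram[OF assms]])

lemma matching_shift: assumes y: "y \<in> diagrams G n" shows "matching (lmap shift y) (shift ` nodes n)"
proof (intro matching.intro)
  show "finite (lmap shift y)" using wfD(1)[OF wf_diagram[OF y]] by (simp add: lmap_def)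
  show "finite (shift ` nodes n)" by (simp add: finite_nodes)
  fix p assume "p \<in> lmap shift y"
  then obtain q where q: "q \<in> y" "p = (shift ` fst q, snd q)" by (auto simp: lmap_def)
  show "fst p \<subseteq> shift ` nodes n" using diagramD(1)[OF y q(1)] q(2) by auto
  show "card (fst p) = 2" using diagramD(2)[OF y q(1)] q(2) by (simp add: card_image[OF shift_inj])
next
  fix v assume "v \<in> shift ` nodes n"
  then obtain w where w: "w \<in> nodes n" "v = shift w" by blast
  obtain q where q: "q \<in> y" "w \<in> fst q" and u: "\<And>q'. q' \<in> y \<Longrightarrow> w \<in> fst q' \<Longrightarrow> q' = q"
    using diagramD(4)[OF y w(1)] by blast
  show "\<exists>!p. p \<in> lmap shift y \<and> v \<in> fst p"
  proof (rule ex1I[of _ "(shift ` fst q, snd q)"])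
    show "(shift ` fst q, snd q) \<in> lmap shift y \<and> v \<in> fst (shift ` fst q, snd q)" using q w by (auto simp: lmap_def)
    fix p assume p: "p \<in> lmap shift y \<and> v \<in> fst p"
    then obtain q' where q': "q' \<in> y" "p = (shift ` fst q', snd q')" by (auto simp: lmap_def)
    have "w \<in> fst q'" using p q' w(2) inj_image_mem_iff[OF shift_inj[of UNIV]] by auto
    thus "p = (shift ` fst q, snd q)" using u[OF q'(1)] q'(2) by simp
  qed
qed

lemma pos_inj: "inj_on (boundary_pos n) (nodes n)"
  by (rule inj_onI) (auto simp: boundary_pos_def nodes_def split: if_splits)

definition unshift :: "node \<Rightarrow> node" where "unshift v = (fst v - 1, snd v)"

lemma unshift_shift [simp]: "unshift (shift v) = v" by (simp add: unshift_def shift_def)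

definition col :: "nat \<Rightarrow> node set \<Rightarrow> nat set" where "col c C = {i. (c, i) \<in> C}"

lemma inj_outm: "inj_on outm (V3 n - M1 n)"
proof (rule inj_onI)
  fix v w assume v: "v \<in> V3 n - M1 n" and w: "w \<in> V3 n - M1 n" and eq: "outm v = outm w"
  have c: "fst u = 0 \<or> fst u = 2" if "u \<in> V3 n - M1 n" for u using that by (cases u) auto
  have "snd v = snd w" "(if fst v = 0 then 0 else 1 :: nat) = (if fst w = 0 then 0 else 1)"
    using eq by (simp_all add: outm_def)
  thus "v = w" using c[OF v] c[OF w] by (cases v, cases w) auto
qed

lemma shift_nodes: "shift ` nodes n = {1, 2} \<times> {..<n}"
proof
  show "shift ` nodes n \<subseteq> {1, 2} \<times> {..<n}" by (auto simp: shift_def nodes_def)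
  show "{1, 2} \<times> {..<n} \<subseteq> shift ` nodes n"
  proof
    fix v :: node assume "v \<in> {1, 2} \<times> {..<n}"
    hence "v = shift (fst v - 1, snd v)" "(fst v - 1, snd v) \<in> nodes n" by (auto simp: shift_def nodes_def prod_eq_iff)
    thus "v \<in> shift ` nodes n" by (rule image_eqI)
  qed
qed

lemma component_cols:
  assumes "C \<subseteq> V3 n"
  shows "C \<inter> nodes n = {0} \<times> col 0 C \<union> {1} \<times> col 1 C" "C \<inter> shift ` nodes n = {1} \<times> col 1 C \<union> {2} \<times> col 2 C"
    "outm ` (C - M1 n) = {0} \<times> col 0 C \<union> {1} \<times> col 2 C" "col c C \<subseteq> {..<n}"
proof -
  show "C \<inter> nodes n = {0} \<times> col 0 C \<union> {1} \<times> col 1 C" using assms by (auto simp: nodes_def col_def)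
  show "C \<inter> shift ` nodes n = {1} \<times> col 1 C \<union> {2} \<times> col 2 C" using assms unfolding shift_nodes by (auto simp: col_def)
  show "outm ` (C - M1 n) = {0} \<times> col 0 C \<union> {1} \<times> col 2 C"
    unfolding outer_nodes_eq[OF assms, symmetric] outer_nodes_def col_def by auto
  show "col c C \<subseteq> {..<n}" using assms by (auto simp: col_def)
qed

context
  fixes n x y
  assumes x: "x \<in> diagrams G n" and y: "y \<in> diagrams G n"
begin

interpretation X: matching x "nodes n" by (rule matching_diagram[OF x])
interpretation Y: matching "lmap shift y" "shift ` nodes n" by (rule matching_shift[OF y])

abbreviation (input) "EE \<equiv> fst ` x \<union> fst ` lmap shift y"

lemma V3_closed: "edge_closed EE (V3 n)"
  using wfD(2)[OF wf_V3[OF wf_diagram[OF x]]] wfD(2)[OF wf_shift[OF wf_diagram[OF y]]]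
  unfolding edge_closed_def by blast

lemma card_cols:
  assumes C: "C \<in> comps (V3 n) EE"
  shows "card (col 0 C) + card (col 1 C) = 2 * card {p\<in>x. fst p \<subseteq> C}"
    "card (col 1 C) + card (col 2 C) = 2 * card {p\<in>lmap shift y. fst p \<subseteq> C}"
    "card C = card (col 0 C) + card (col 1 C) + card (col 2 C)"
proof -
  have cl: "edge_closed (fst ` x) C" "edge_closed (fst ` lmap shift y) C"
    using compsD(3)[OF C] by (simp_all add: edge_closed_Un)
  note cc = component_cols[OF compsD(2)[OF C]]
  have fin: "finite (col c C)" for c using cc(4) finite_subset by blast
  have u: "card ({a::nat} \<times> col a C \<union> {b} \<times> col b C) = card (col a C) + card (col b C)" if "a \<noteq> b" for a b
    using that fin by (subst card_Un_disjoint) (auto simp: card_cartesian_product)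
  show "card (col 0 C) + card (col 1 C) = 2 * card {p\<in>x. fst p \<subseteq> C}"
    using X.card_closed[OF cl(1)] unfolding cc(1) by (simp add: u)
  show "card (col 1 C) + card (col 2 C) = 2 * card {p\<in>lmap shift y. fst p \<subseteq> C}"
    using Y.card_closed[OF cl(2)] unfolding cc(2) by (simp add: u)
  have "C = ({0} \<times> col 0 C \<union> {1} \<times> col 1 C) \<union> {2} \<times> col 2 C"
    using compsD(2)[OF C] by (auto simp: col_def)
  hence "card C = card (({0::nat} \<times> col 0 C \<union> {1} \<times> col 1 C) \<union> {2} \<times> col 2 C)"
    by (rule arg_cong[where f = card])
  also have "\<dots> = card ({0::nat} \<times> col 0 C \<union> {1} \<times> col 1 C) + card ({2::nat} \<times> col 2 C)"
    using fin by (intro card_Un_disjoint) auto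
  also have "\<dots> = card (col 0 C) + card (col 1 C) + card (col 2 C)" by (simp add: u card_cartesian_product)
  finally show "card C = card (col 0 C) + card (col 1 C) + card (col 2 C)" .
qed

text \<open>A component consists of whole edges of both diagrams, so columns 0 and 1 together and
  columns 1 and 2 together contain even numbers of its nodes, and the number of outer nodes is even.
  The spanning tree bound limits it to two, and it is not zero.\<close>

lemma card_outer:
  assumes C: "C \<in> comps (V3 n) EE" "\<not> C \<subseteq> M1 n" shows "card (outm ` (C - M1 n)) = 2"
proof -
  note cc = component_cols[OF compsD(2)[OF C(1)]] and k = card_cols[OF C(1)]
  have fin: "finite (col c C)" for c using cc(4) finite_subset by blast
  have finC: "finite C" using compsD(2)[OF C(1)] by (rule finite_subset) simp
  have o: "card (outm ` (C - M1 n)) = card (col 0 C) + card (col 2 C)"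
    unfolding cc(3) using fin by (subst card_Un_disjoint) (auto simp: card_cartesian_product)
  have "card C \<le> 1 + card {p\<in>x. fst p \<subseteq> C} + card {p\<in>lmap shift y. fst p \<subseteq> C}"
    by (rule connected_card[OF C(1) X.fin Y.fin finC]) (use X.card2 Y.card2 in blast)
  moreover have "card (outm ` (C - M1 n)) \<noteq> 0"
  proof
    assume "card (outm ` (C - M1 n)) = 0"
    moreover have "finite (outm ` (C - M1 n))" using finC by simp
    ultimately have "outm ` (C - M1 n) = {}" by (simp only: card_0_eq)
    thus False using C(2) by blast
  qed
  moreover have "a + c = 2" if "a + b = 2 * X" "b + c = 2 * Y" "t = a + b + c" "t \<le> 1 + X + Y" "a + c \<noteq> 0"
    for a b c X Y t :: nat
  proof -
    have "a + c + 2 * b = 2 * (X + Y)" using that(1,2) by simp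
    hence "even (a + c + 2 * b)" by simp
    hence "even (a + c)" by simp
    moreover have "a + c \<le> 2" using that(1-4) by linarith
    ultimately show ?thesis using that(5) by (cases "a + c = 1") auto
  qed
  ultimately show ?thesis unfolding o using k by blast
qed

text \<open>Adding the counts for the first diagram, the second diagram and the composite, all
  comparisons within an outer column occur twice. Those within the middle column occur once in each
  direction and add up to a product of cardinalities. The rest combines to a product with the even
  factor \<open>card (?a 0) + card (?a 1)\<close>.\<close>

lemma even_outer:
  assumes C: "C \<in> comps (V3 n) EE" and C': "C' \<in> comps (V3 n) EE" and ne: "C \<noteq> C'"
  shows "even (pair_count (boundary_pos n) (outm ` (C - M1 n)) (outm ` (C' - M1 n)))"
proof -
  have cl: "edge_closed (fst ` x) C" "edge_closed (fst ` lmap shift y) C"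
    "edge_closed (fst ` x) C'" "edge_closed (fst ` lmap shift y) C'"
    using compsD(3)[OF C] compsD(3)[OF C'] by (simp_all add: edge_closed_Un)
  note cc = component_cols[OF compsD(2)[OF C]] and cc' = component_cols[OF compsD(2)[OF C']]
  have fin: "finite (col c C)" "finite (col c C')" for c
    by (rule finite_subset[OF cc(4)], simp, rule finite_subset[OF cc'(4)], simp)
  have d: "C \<inter> C' = {}" by (rule comps_disjoint[OF C C' ne])
  let ?a = "\<lambda>c. col c C" and ?b = "\<lambda>c. col c C'"
  have Nx: "even (up_count (?a 0) (?b 0) + card (?a 0) * card (?b 1) + up_count (?b 1) (?a 1))"
  proof -
    have "even (pair_count (boundary_pos n) (C \<inter> nodes n) (C' \<inter> nodes n))"
    proof (rule X.even_pair_count[OF cl(1,3) d pos_inj])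
      fix a b c d assume "{a, b} \<in> fst ` x" "{c, d} \<in> fst ` x" "boundary_pos n a < boundary_pos n c"
        "boundary_pos n c < boundary_pos n b" "boundary_pos n b < boundary_pos n d"
      thus False using diagramD(5)[OF x] unfolding planar_def by blast
    qed
    thus ?thesis unfolding cc(1) cc'(1)
      using pair_count_strip[of 0 1 "?a 0" n "?a 1" "?b 0" "?b 1" "boundary_pos n"] cc(4) cc'(4)
      by (simp add: boundary_pos_def)
  qed
  have Ny: "even (up_count (?a 1) (?b 1) + card (?a 1) * card (?b 2) + up_count (?b 2) (?a 2))"
  proof -
    let ?pos = "\<lambda>v. boundary_pos n (unshift v)"
    have "even (pair_count ?pos (C \<inter> shift ` nodes n) (C' \<inter> shift ` nodes n))"
    proof (rule Y.even_pair_count[OF cl(2,4) d])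
      show "inj_on ?pos (shift ` nodes n)"
      proof (rule inj_onI)
        fix v w assume "v \<in> shift ` nodes n" "w \<in> shift ` nodes n" and eq: "?pos v = ?pos w"
        then obtain v' w' where v': "v' \<in> nodes n" "v = shift v'" and w': "w' \<in> nodes n" "w = shift w'" by blast
        have "v' = w'" by (rule inj_onD[OF pos_inj _ v'(1) w'(1)]) (use eq v' w' in simp)
        thus "v = w" using v' w' by simp
      qed
      fix a b c d assume ab: "{a, b} \<in> fst ` lmap shift y" and cd: "{c, d} \<in> fst ` lmap shift y"
        and lt: "?pos a < ?pos c" "?pos c < ?pos b" "?pos b < ?pos d"
      have u: "{unshift a, unshift b} \<in> fst ` y" if ab: "{a, b} \<in> fst ` lmap shift y" for a b
      proof -
        obtain q where q: "q \<in> y" "{a, b} = shift ` fst q" using ab by (auto simp: lmap_def)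
        have "{unshift a, unshift b} = unshift ` {a, b}" by simp
        also have "\<dots> = fst q" unfolding q(2) image_image by simp
        finally show ?thesis using q(1) by blast
      qed
      show False using diagramD(5)[OF y] u[OF ab] u[OF cd] lt unfolding planar_def by blast
    qed
    thus ?thesis unfolding cc(2) cc'(2)
      using pair_count_strip[of 1 2 "?a 1" n "?a 2" "?b 1" "?b 2" ?pos] cc(4) cc'(4)
      by (simp add: boundary_pos_def unshift_def)
  qed
  have No: "pair_count (boundary_pos n) (outm ` (C - M1 n)) (outm ` (C' - M1 n)) =
      up_count (?a 0) (?b 0) + card (?a 0) * card (?b 2) + up_count (?b 2) (?a 2)"
    unfolding cc(3) cc'(3)
    using pair_count_strip[of 0 1 "?a 0" n "?a 2" "?b 0" "?b 2" "boundary_pos n"] cc(4) cc'(4)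
    by (simp add: boundary_pos_def)
  have sw: "up_count (?a 1) (?b 1) + up_count (?b 1) (?a 1) = card (?a 1) * card (?b 1)"
    by (rule up_count_swap[OF fin]) (use d in \<open>auto simp: col_def\<close>)
  have "even (card (?a 0) + card (?a 1))" using card_cols(1)[OF C] by simp
  hence "even ((card (?a 0) + card (?a 1)) * (card (?b 1) + card (?b 2)))" by simp
  moreover have "(up_count (?a 0) (?b 0) + card (?a 0) * card (?b 1) + up_count (?b 1) (?a 1)) +
      (up_count (?a 1) (?b 1) + card (?a 1) * card (?b 2) + up_count (?b 2) (?a 2)) +
      (up_count (?a 0) (?b 0) + card (?a 0) * card (?b 2) + up_count (?b 2) (?a 2)) =
      2 * (up_count (?a 0) (?b 0) + up_count (?b 2) (?a 2)) +
      (card (?a 0) + card (?a 1)) * (card (?b 1) + card (?b 2))"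
    using sw by (simp add: algebra_simps)
  ultimately show ?thesis unfolding No using Nx Ny by (metis dvd_triv_left even_add)
qed

lemma outer_unique:
  assumes "C \<in> comps (V3 n) EE" "C' \<in> comps (V3 n) EE" "v \<in> outm ` (C - M1 n)" "v \<in> outm ` (C' - M1 n)"
  shows "C = C'"
proof -
  obtain w where w0: "w \<in> C - M1 n" "v = outm w" using assms(3) by blast
  obtain w' where w1: "w' \<in> C' - M1 n" "v = outm w'" using assms(4) by blast
  have w: "w \<in> C - M1 n" "w' \<in> C' - M1 n" "outm w = outm w'" using w0 w1 by simp_all
  have "w = w'"
    by (rule inj_onD[OF inj_outm[of n] w(3)]) (use compsD(2)[OF assms(1)] compsD(2)[OF assms(2)] w in blast)+
  thus ?thesis using w comps_eq[OF assms(1,2)] by blast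
qed

theorem compose_closed: "compose_diagrams G n x y \<in> diagrams G n"
proof -
  let ?z = "compose_diagrams G n x y"
  note wx = wf_diagram[OF x] and wy = wf_diagram[OF y]
  note wz = wf_compose[OF wx wy]
  have zeq: "?z = (\<lambda>C. (outm ` (C - M1 n), lab G x C \<otimes> lab G (lmap shift y) C)) ` {C \<in> comps (V3 n) EE. \<not> C \<subseteq> M1 n}"
    unfolding compose_eq[OF wx wy] contr_def lmap_def[of outm] image_image fst_conv snd_conv ..
  have mem: "\<exists>C. C \<in> comps (V3 n) EE \<and> \<not> C \<subseteq> M1 n \<and> p = (outm ` (C - M1 n), lab G x C \<otimes> lab G (lmap shift y) C)"
    if "p \<in> ?z" for p
    using that unfolding zeq by blast
  have memI: "(outm ` (C - M1 n), lab G x C \<otimes> lab G (lmap shift y) C) \<in> ?z"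
    if "C \<in> comps (V3 n) EE" "\<not> C \<subseteq> M1 n" for C
    using that unfolding zeq by blast
  have "\<forall>(e, g)\<in>?z. e \<subseteq> nodes n \<and> card e = 2 \<and> g \<in> carrier G"
  proof (rule ballI, clarify)
    fix e g assume p: "(e, g) \<in> ?z"
    obtain C where C: "C \<in> comps (V3 n) EE" "\<not> C \<subseteq> M1 n" "e = outm ` (C - M1 n)" using mem[OF p] by blast
    show "e \<subseteq> nodes n \<and> card e = 2 \<and> g \<in> carrier G"
      using wfD(2)[OF wz p] wfD(4)[OF wz p] card_outer[OF C(1,2)] C(3) by simp
  qed
  moreover have "\<exists>!p. p \<in> ?z \<and> v \<in> fst p" if v: "v \<in> nodes n" for v
  proof -
    define w where "w = (if fst v = 0 then 0 else 2 :: nat, snd v)"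
    have w: "w \<in> V3 n - M1 n" "outm w = v" using v by (auto simp: w_def nodes_def outm_def prod_eq_iff)
    obtain C where C: "C \<in> comps (V3 n) EE" "w \<in> C" using ex_comp[OF V3_closed] w(1) by blast
    have nC: "\<not> C \<subseteq> M1 n" using w(1) C(2) by blast
    have vC: "v \<in> outm ` (C - M1 n)" using w C(2) by blast
    show ?thesis
    proof (rule ex1I)
      show "(outm ` (C - M1 n), lab G x C \<otimes> lab G (lmap shift y) C) \<in> ?z \<and>
          v \<in> fst (outm ` (C - M1 n), lab G x C \<otimes> lab G (lmap shift y) C)" using memI[OF C(1) nC] vC by simp
      fix p assume p: "p \<in> ?z \<and> v \<in> fst p"
      then obtain C' where C': "C' \<in> comps (V3 n) EE"
        "p = (outm ` (C' - M1 n), lab G x C' \<otimes> lab G (lmap shift y) C')" using mem by blast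
      have "C' = C" using outer_unique[OF C'(1) C(1) _ vC] p C'(2) by simp
      thus "p = (outm ` (C - M1 n), lab G x C \<otimes> lab G (lmap shift y) C)" using C'(2) by simp
    qed
  qed
  moreover have "planar n (fst ` ?z)"
    unfolding planar_def
  proof (rule notI, elim exE conjE)
    fix a b c d assume ab: "{a, b} \<in> fst ` ?z" and cd: "{c, d} \<in> fst ` ?z"
      and lt: "boundary_pos n a < boundary_pos n c" "boundary_pos n c < boundary_pos n b" "boundary_pos n b < boundary_pos n d"
    obtain C where C: "C \<in> comps (V3 n) EE" "{a, b} = outm ` (C - M1 n)"
    proof -
      obtain p where p: "p \<in> ?z" "{a, b} = fst p" using ab by blast
      obtain D where D: "D \<in> comps (V3 n) EE" "p = (outm ` (D - M1 n), lab G x D \<otimes> lab G (lmap shift y) D)"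
        using mem[OF p(1)] by blast
      show thesis by (rule that[OF D(1)]) (simp only: p(2) D(2) fst_conv)
    qed
    obtain C' where C': "C' \<in> comps (V3 n) EE" "{c, d} = outm ` (C' - M1 n)"
    proof -
      obtain p where p: "p \<in> ?z" "{c, d} = fst p" using cd by blast
      obtain D where D: "D \<in> comps (V3 n) EE" "p = (outm ` (D - M1 n), lab G x D \<otimes> lab G (lmap shift y) D)"
        using mem[OF p(1)] by blast
      show thesis by (rule that[OF D(1)]) (simp only: p(2) D(2) fst_conv)
    qed
    have "C \<noteq> C'"
    proof
      assume "C = C'"
      hence "{a, b} = {c, d}" using C(2) C'(2) by simp
      hence "a = c \<or> a = d" by blast
      thus False using lt by auto
    qed
    \<comment> \<open>Chords interleaved in the order assumed in \<open>lt\<close> satisfy three of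
      the four comparisons, an odd number.\<close>
    from even_outer[OF C(1) C'(1) this] have "even (pair_count (boundary_pos n) {a, b} {c, d})"
      unfolding C(2) C'(2) .
    moreover have "a \<noteq> b" "c \<noteq> d" using lt by auto
    ultimately show False using lt unfolding pair_count_def by simp
  qed
  ultimately show ?thesis by (simp add: diagrams_def)
qed

end

end

section \<open>Composition along straight strands\<close>

context labels
begin

abbreviation (input) "glue x y \<equiv> fst ` x \<union> fst ` lmap shift y"

lemma diag_uniq:
  assumes "x \<in> diagrams G n" "p \<in> x" "q \<in> x" "v \<in> fst p" "v \<in> fst q" shows "p = q"
  using diagramD(4)[OF assms(1), of v] diagramD(1)[OF assms(1,2)] assms(2-5) by blast

text \<open>Both sets match all nodes, so one inclusion suffices. To identify a composite it is
  enough to exhibit its edges.\<close>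

lemma diag_eqI:
  assumes x: "x \<in> diagrams G n" and z: "z \<in> diagrams G n" and zx: "z \<subseteq> x" shows "x = z"
proof
  show "x \<subseteq> z"
  proof
    fix p assume p: "p \<in> x"
    obtain v where v: "v \<in> fst p" using diagramD(2)[OF x p] by (auto simp: card_2_iff)
    then obtain q where q: "q \<in> z" "v \<in> fst q" using diagramD(4)[OF z, of v] diagramD(1)[OF x p] by blast
    have "q \<in> x" using zx q(1) by blast
    thus "p \<in> z" using diag_uniq[OF x p _ v q(2)] q(1) by simp
  qed
qed (rule zx)

text \<open>A certificate for one component of a gluing: the edges \<open>P\<close> and
  \<open>Q\<close> it uses must cover its nodes on either side, and a set closed under these edges
  must be everything. The product of their labels is the label of the resulting edge.\<close>

lemma comp_member:
  assumes x: "x \<in> diagrams G n" and y: "y \<in> diagrams G n"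
    and P: "P \<subseteq> x" and Q: "Q \<subseteq> lmap shift y" and C: "C = (\<Union>p\<in>P \<union> Q. fst p)"
    and cx: "\<And>v. v \<in> C \<Longrightarrow> v \<in> nodes n \<Longrightarrow> \<exists>p\<in>P. v \<in> fst p"
    and cy: "\<And>v. v \<in> C \<Longrightarrow> v \<in> shift ` nodes n \<Longrightarrow> \<exists>q\<in>Q. v \<in> fst q"
    and conn: "\<And>W. \<lbrakk>W \<subseteq> C; W \<noteq> {}; \<And>p. p \<in> P \<union> Q \<Longrightarrow> fst p \<inter> W \<noteq> {} \<Longrightarrow> fst p \<subseteq> W\<rbrakk> \<Longrightarrow> W = C"
    and ne: "\<not> C \<subseteq> M1 n"
  shows "C \<in> comps (V3 n) (glue x y)"
    and "(outm ` (C - M1 n), (\<Otimes>p\<in>P. snd p) \<otimes> (\<Otimes>q\<in>Q. snd q)) \<in> compose_diagrams G n x y"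
proof -
  interpret X: matching x "nodes n" by (rule matching_diagram[OF x])
  interpret Y: matching "lmap shift y" "shift ` nodes n" by (rule matching_shift[OF y])
  have Px: "fst p \<subseteq> C" if "p \<in> P" for p using that unfolding C by blast
  have Qy: "fst q \<subseteq> C" if "q \<in> Q" for q using that unfolding C by blast
  have xP: "p \<in> P" if p: "p \<in> x" "v \<in> fst p" "v \<in> C" for p v
  proof -
    have "v \<in> nodes n" using X.sub[OF p(1)] p(2) by blast
    then obtain q where q: "q \<in> P" "v \<in> fst q" using cx[OF p(3)] by blast
    have "p = q" by (rule X.uniq[OF p(1) subsetD[OF P q(1)] p(2) q(2)])
    thus ?thesis using q(1) by simp
  qed
  have yQ: "p \<in> Q" if p: "p \<in> lmap shift y" "v \<in> fst p" "v \<in> C" for p v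
  proof -
    have "v \<in> shift ` nodes n" using Y.sub[OF p(1)] p(2) by blast
    then obtain q where q: "q \<in> Q" "v \<in> fst q" using cy[OF p(3)] by blast
    have "p = q" by (rule Y.uniq[OF p(1) subsetD[OF Q q(1)] p(2) q(2)])
    thus ?thesis using q(1) by simp
  qed
  have PX: "{p\<in>x. fst p \<subseteq> C} = P"
  proof (intro equalityI subsetI)
    fix p assume p: "p \<in> {p\<in>x. fst p \<subseteq> C}"
    then obtain v where "v \<in> fst p" using X.nonempty by blast
    thus "p \<in> P" using xP[of p v] p by blast
  qed (use P Px in blast)
  have QY: "{p\<in>lmap shift y. fst p \<subseteq> C} = Q"
  proof (intro equalityI subsetI)
    fix p assume p: "p \<in> {p\<in>lmap shift y. fst p \<subseteq> C}"
    then obtain v where "v \<in> fst p" using Y.nonempty by blast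
    thus "p \<in> Q" using yQ[of p v] p by blast
  qed (use Q Qy in blast)
  show comp: "C \<in> comps (V3 n) (glue x y)"
  proof (rule compsI)
    show "C \<noteq> {}" using ne by blast
    have "nodes n \<subseteq> V3 n" "shift ` nodes n \<subseteq> V3 n" unfolding shift_nodes by (auto simp: nodes_def)
    moreover have "C \<subseteq> nodes n \<union> shift ` nodes n"
      unfolding C using X.sub Y.sub P Q by blast
    ultimately show "C \<subseteq> V3 n" by blast
    show "edge_closed (glue x y) C"
      unfolding edge_closed_def
    proof (intro ballI impI)
      fix e assume e: "e \<in> glue x y" "e \<inter> C \<noteq> {}"
      then obtain v where v: "v \<in> e" "v \<in> C" by blast
      from e(1) show "e \<subseteq> C"
      proof
        assume "e \<in> fst ` x"
        then obtain p where p: "p \<in> x" "e = fst p" by blast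
        show ?thesis using Px[OF xP[OF p(1) _ v(2)]] v(1) p(2) by simp
      next
        assume "e \<in> fst ` lmap shift y"
        then obtain p where p: "p \<in> lmap shift y" "e = fst p" by blast
        show ?thesis using Qy[OF yQ[OF p(1) _ v(2)]] v(1) p(2) by simp
      qed
    qed
    fix W assume W: "W \<subseteq> C" "W \<noteq> {}" "edge_closed (glue x y) W"
    show "W = C"
    proof (rule conn[OF W(1,2)])
      fix p assume p: "p \<in> P \<union> Q" "fst p \<inter> W \<noteq> {}"
      have "fst p \<in> glue x y" using p(1) P Q by blast
      thus "fst p \<subseteq> W" using W(3) p(2) unfolding edge_closed_def by blast
    qed
  qed
  have "(outm ` (C - M1 n), lab G x C \<otimes> lab G (lmap shift y) C) \<in> compose_diagrams G n x y"
    unfolding compose_eq[OF wf_diagram[OF x] wf_diagram[OF y]] contr_def lmap_def[of outm] image_image fst_conv snd_conv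
    using comp ne by blast
  thus "(outm ` (C - M1 n), (\<Otimes>p\<in>P. snd p) \<otimes> (\<Otimes>q\<in>Q. snd q)) \<in> compose_diagrams G n x y"
    by (simp only: lab_def PX QY)
qed

lemma lmap_shiftI: "(e, h) \<in> y \<Longrightarrow> e' = shift ` e \<Longrightarrow> (e', h) \<in> lmap shift y"
  by (force simp: lmap_def)

text \<open>An edge whose right ends continue along straight strands with trivial label passes
  unchanged into the composite. If it has no right end, the hypothesis on \<open>y\<close> is void:
  arcs of the left column always survive. The second claim serves to exclude loops.\<close>

lemma straight_right:
  assumes x: "x \<in> diagrams G n" and y: "y \<in> diagrams G n" and p: "(e, h) \<in> x"
    and s: "\<And>i. (1, i) \<in> e \<Longrightarrow> ({(0, i), (1, i)}, \<one>) \<in> y"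
  shows "(e, h) \<in> compose_diagrams G n x y"
    and "\<exists>C\<in>comps (V3 n) (glue x y). e \<subseteq> C \<and> \<not> C \<subseteq> M1 n"
proof -
  \<comment> \<open>The heights at which the edge reaches the glued column; there may be none, one
    or two.\<close>
  define K where "K = {i. (1::nat, i) \<in> e}"
  define Q where "Q = (\<lambda>i. ({(1::nat, i), (2, i)}, \<one>)) ` K"
  define C where "C = (\<Union>p\<in>{(e, h)} \<union> Q. fst p)"
  have en: "e \<subseteq> nodes n" "card e = 2" "h \<in> carrier G" using diagramD(1-3)[OF x p] by simp_all
  have C_eq: "C = e \<union> {2} \<times> K" unfolding C_def Q_def K_def by auto
  have Qy: "Q \<subseteq> lmap shift y"
    unfolding Q_def K_def using s by (auto intro!: lmap_shiftI[of "{(0, i), (1, i)}" for i] simp: shift_def)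
  have e0: "e \<noteq> {}" using en(2) by auto
  have M: "\<not> C \<subseteq> M1 n"
  proof
    assume a: "C \<subseteq> M1 n"
    obtain v where v: "v \<in> e" using e0 by blast
    hence "fst v = 1" using a unfolding C_eq by auto
    hence "snd v \<in> K" using v by (cases v) (simp add: K_def)
    thus False using a unfolding C_eq by auto
  qed
  have cx: "\<exists>p\<in>{(e, h)}. v \<in> fst p" if "v \<in> C" "v \<in> nodes n" for v
    using that unfolding C_eq by (auto simp: nodes_def)
  have cy: "\<exists>q\<in>Q. v \<in> fst q" if "v \<in> C" "v \<in> shift ` nodes n" for v
    using that en(1) unfolding C_eq Q_def shift_nodes K_def by (cases v) (auto simp: nodes_def)
  have conn: "W = C" if W: "W \<subseteq> C" "W \<noteq> {}" and cl: "\<And>p. p \<in> {(e, h)} \<union> Q \<Longrightarrow> fst p \<inter> W \<noteq> {} \<Longrightarrow> fst p \<subseteq> W" for W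
  proof -
    have eW: "e \<inter> W \<noteq> {} \<Longrightarrow> e \<subseteq> W" using cl[of "(e, h)"] by simp
    have kW: "(1, i) \<in> W \<and> (2, i) \<in> W" if "i \<in> K" "(1, i) \<in> W \<or> (2, i) \<in> W" for i
      using cl[of "({(1, i), (2, i)}, \<one>)"] that by (auto simp: Q_def)
    obtain v where v: "v \<in> W" using W(2) by blast
    have "e \<inter> W \<noteq> {}"
    proof (cases "v \<in> e")
      case False
      then obtain i where i: "v = (2, i)" "i \<in> K" using v W(1) C_eq by blast
      hence "(1, i) \<in> W" using kW v by blast
      thus ?thesis using i(2) by (auto simp: K_def)
    qed (use v in blast)
    hence e: "e \<subseteq> W" by (rule eW)
    have "(2, i) \<in> W" if "i \<in> K" for i using kW[OF that] e that by (auto simp: K_def)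
    thus ?thesis using e W(1) unfolding C_eq by blast
  qed
  have px: "{(e, h)} \<subseteq> x" using p by simp
  have cm: "C \<in> comps (V3 n) (glue x y)"
    "(outm ` (C - M1 n), (\<Otimes>p\<in>{(e, h)}. snd p) \<otimes> (\<Otimes>q\<in>Q. snd q)) \<in> compose_diagrams G n x y"
    by (rule comp_member[OF x y px Qy C_def _ _ _ M]; fact)+
  have q1: "(\<Otimes>q\<in>Q. snd q) = \<one>" by (rule finprod_one_eqI) (auto simp: Q_def)
  have o: "outm ` (C - M1 n) = e"
  proof -
    have "C - M1 n = {v\<in>e. fst v = 0} \<union> {2} \<times> K" unfolding C_eq using en(1) by (auto simp: nodes_def)
    hence "outm ` (C - M1 n) = outm ` {v\<in>e. fst v = 0} \<union> outm ` ({2} \<times> K)" by (simp only: image_Un)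
    also have "outm ` {v\<in>e. fst v = 0} = {v\<in>e. fst v = 0}" by (force simp: outm_def image_iff)
    also have "outm ` ({2} \<times> K) = {1} \<times> K" by (force simp: outm_def image_iff)
    also have "{v\<in>e. fst v = 0} \<union> {1} \<times> K = e" using en(1) by (auto simp: nodes_def K_def)
    finally show ?thesis .
  qed
  have l: "(\<Otimes>p\<in>{(e, h)}. snd p) \<otimes> (\<Otimes>q\<in>Q. snd q) = h" using q1 en(3) by simp
  have r: "(e, h) \<in> compose_diagrams G n x y" by (rule subst[OF o], rule subst[OF l], rule cm(2))
  show "(e, h) \<in> compose_diagrams G n x y" by (rule r)
  show "\<exists>C\<in>comps (V3 n) (glue x y). e \<subseteq> C \<and> \<not> C \<subseteq> M1 n"
    by (rule bexI[OF _ cm(1)], rule conjI[OF _ M]) (simp add: C_eq)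
qed

lemma straight_left:
  assumes x: "x \<in> diagrams G n" and y: "y \<in> diagrams G n" and p: "(e, h) \<in> y"
    and s: "\<And>i. (0, i) \<in> e \<Longrightarrow> ({(0, i), (1, i)}, \<one>) \<in> x"
  shows "(e, h) \<in> compose_diagrams G n x y"
    and "\<exists>C\<in>comps (V3 n) (glue x y). shift ` e \<subseteq> C \<and> \<not> C \<subseteq> M1 n"
proof -
  define K where "K = {i. (0::nat, i) \<in> e}"
  define Q where "Q = (\<lambda>i. ({(0::nat, i), (1, i)}, \<one>)) ` K"
  define C where "C = (\<Union>p\<in>Q \<union> {(shift ` e, h)}. fst p)"
  have en: "e \<subseteq> nodes n" "card e = 2" "h \<in> carrier G" using diagramD(1-3)[OF y p] by simp_all
  have sK: "(1, i) \<in> shift ` e \<longleftrightarrow> i \<in> K" for i by (force simp: K_def shift_def)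
  have C_eq: "C = shift ` e \<union> {0} \<times> K" unfolding C_def Q_def using sK by auto
  have Qx: "Q \<subseteq> x" unfolding Q_def K_def using s by auto
  have e0: "e \<noteq> {}" using en(2) by auto
  have M: "\<not> C \<subseteq> M1 n"
  proof
    assume a: "C \<subseteq> M1 n"
    obtain v where v: "v \<in> e" using e0 by blast
    hence "shift v \<in> M1 n" using a unfolding C_eq by blast
    hence "fst v = 0" by (auto simp: shift_def)
    hence "snd v \<in> K" using v by (cases v) (simp add: K_def)
    thus False using a unfolding C_eq by auto
  qed
  have sh0: "fst v \<noteq> 0" if "v \<in> shift ` e" for v using that by (auto simp: shift_def)
  have cx: "\<exists>p\<in>Q. v \<in> fst p" if "v \<in> C" "v \<in> nodes n" for v
  proof -
    obtain a i where v: "v = (a, i)" by (cases v)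
    have "i \<in> K" using that sK[of i] sh0[of v] unfolding C_eq v by (auto simp: nodes_def)
    thus ?thesis using that(2) unfolding v Q_def by (auto simp: nodes_def)
  qed
  have cy: "\<exists>q\<in>{(shift ` e, h)}. v \<in> fst q" if "v \<in> C" "v \<in> shift ` nodes n" for v
    using that unfolding C_eq shift_nodes by auto
  have conn: "W = C" if W: "W \<subseteq> C" "W \<noteq> {}" and cl: "\<And>p. p \<in> Q \<union> {(shift ` e, h)} \<Longrightarrow> fst p \<inter> W \<noteq> {} \<Longrightarrow> fst p \<subseteq> W" for W
  proof -
    have eW: "shift ` e \<inter> W \<noteq> {} \<Longrightarrow> shift ` e \<subseteq> W" using cl[of "(shift ` e, h)"] by simp
    have kW: "(0, i) \<in> W \<and> (1, i) \<in> W" if "i \<in> K" "(0, i) \<in> W \<or> (1, i) \<in> W" for i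
      using cl[of "({(0, i), (1, i)}, \<one>)"] that by (auto simp: Q_def)
    obtain v where v: "v \<in> W" using W(2) by blast
    have "shift ` e \<inter> W \<noteq> {}"
    proof (cases "v \<in> shift ` e")
      case False
      then obtain i where i: "v = (0, i)" "i \<in> K" using v W(1) C_eq by blast
      hence "(1, i) \<in> W" using kW v by blast
      thus ?thesis using i(2) sK by blast
    qed (use v in blast)
    hence e: "shift ` e \<subseteq> W" by (rule eW)
    have "(0, i) \<in> W" if "i \<in> K" for i using kW[OF that] e that sK by blast
    thus ?thesis using e W(1) unfolding C_eq by blast
  qed
  have py: "{(shift ` e, h)} \<subseteq> lmap shift y" using lmap_shiftI[OF p refl] by simp
  have cm: "C \<in> comps (V3 n) (glue x y)"
    "(outm ` (C - M1 n), (\<Otimes>q\<in>Q. snd q) \<otimes> (\<Otimes>p\<in>{(shift ` e, h)}. snd p)) \<in> compose_diagrams G n x y"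
    by (rule comp_member[OF x y Qx py C_def _ _ _ M]; fact)+
  have q1: "(\<Otimes>q\<in>Q. snd q) = \<one>" by (rule finprod_one_eqI) (auto simp: Q_def)
  have o: "outm ` (C - M1 n) = e"
  proof -
    have "C - M1 n = shift ` {v\<in>e. fst v = 1} \<union> {0} \<times> K"
    proof (intro equalityI subsetI)
      fix v assume v: "v \<in> C - M1 n"
      show "v \<in> shift ` {v\<in>e. fst v = 1} \<union> {0} \<times> K"
      proof (cases "v \<in> {0} \<times> K")
        case False
        then obtain w where w: "w \<in> e" "v = shift w" using v unfolding C_eq by blast
        obtain a i where ai: "w = (a, i)" by (cases w)
        have "a < 2" "i < n" using w(1) en(1) unfolding ai by (auto simp: nodes_def)
        moreover have "a \<noteq> 0" using v \<open>i < n\<close> unfolding w(2) ai by (simp add: shift_def)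
        ultimately have "fst w = 1" unfolding ai by simp
        thus ?thesis using w by blast
      qed blast
    next
      fix v assume v: "v \<in> shift ` {v\<in>e. fst v = 1} \<union> {0} \<times> K"
      hence "fst v \<noteq> 1" by (auto simp: shift_def)
      thus "v \<in> C - M1 n" using v unfolding C_eq by auto
    qed
    hence "outm ` (C - M1 n) = outm ` shift ` {v\<in>e. fst v = 1} \<union> outm ` ({0} \<times> K)" by (simp only: image_Un)
    also have "outm ` shift ` {v\<in>e. fst v = 1} = {v\<in>e. fst v = 1}" by (force simp: outm_def shift_def image_iff)
    also have "outm ` ({0} \<times> K) = {0} \<times> K" by (force simp: outm_def image_iff)
    also have "{v\<in>e. fst v = 1} \<union> {0} \<times> K = e" using en(1) by (auto simp: nodes_def K_def)
    finally show ?thesis .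
  qed
  have l: "(\<Otimes>q\<in>Q. snd q) \<otimes> (\<Otimes>p\<in>{(shift ` e, h)}. snd p) = h" using q1 en(3) by simp
  have r: "(e, h) \<in> compose_diagrams G n x y" by (rule subst[OF o], rule subst[OF l], rule cm(2))
  show "(e, h) \<in> compose_diagrams G n x y" by (rule r)
  show "\<exists>C\<in>comps (V3 n) (glue x y). shift ` e \<subseteq> C \<and> \<not> C \<subseteq> M1 n"
    by (rule bexI[OF _ cm(1)], rule conjI[OF _ M]) (simp add: C_eq)
qed

text \<open>A loop has a node in the middle column, and it would coincide with the component of that
  node that leaves the column.\<close>

lemma no_loops:
  assumes x: "x \<in> diagrams G n" and y: "y \<in> diagrams G n"
    and c: "\<And>i. i < n \<Longrightarrow> \<exists>C\<in>comps (V3 n) (glue x y). (1, i) \<in> C \<and> \<not> C \<subseteq> M1 n"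
  shows "loops n x y = {}"
proof (rule ccontr)
  assume "loops n x y \<noteq> {}"
  then obtain C where C: "C \<in> comps (V3 n) (glue x y)" "C \<subseteq> M1 n"
    unfolding loops_eq[OF wf_diagram[OF x] wf_diagram[OF y]] loopset_def by blast
  then obtain v where v: "v \<in> C" using compsD(1) by blast
  then obtain i where i: "v = (1, i)" "i < n" using C(2) by auto
  then obtain C' where C': "C' \<in> comps (V3 n) (glue x y)" "(1, i) \<in> C'" "\<not> C' \<subseteq> M1 n" using c by blast
  have "C = C'" using comps_eq[OF C(1) C'(1), of v] v i C'(2) by simp
  thus False using C(2) C'(3) by simp
qed

lemma loop_factor_one:
  assumes "comm_monoid k" "loops n x y = {}" shows "loop_factor G k act \<delta> n x y = \<one>\<^bsub>k\<^esub>"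
proof -
  interpret k: comm_monoid k by fact
  show ?thesis by (simp add: loop_factor_def assms(2))
qed

lemma diag_node_edge:
  assumes x: "x \<in> diagrams G n" and v: "v \<in> nodes n"
  obtains w h where "({v, w}, h) \<in> x" "w \<in> nodes n" "w \<noteq> v" "h \<in> carrier G"
proof -
  obtain p where p: "p \<in> x" "v \<in> fst p" using diagramD(4)[OF x v] by blast
  obtain s t where st: "fst p = {s, t}" "s \<noteq> t" using diagramD(2)[OF x p(1)] by (auto simp: card_2_iff)
  obtain w where w: "fst p = {v, w}" "w \<noteq> v"
  proof (cases "v = s")
    case True thus thesis using that[of t] st by auto
  next
    case False
    hence "v = t" using p(2) st(1) by simp
    thus thesis using that[of s] st by auto
  qed
  show thesis
  proof (rule that)
    show "({v, w}, snd p) \<in> x" using p(1) by (simp only: w(1)[symmetric] prod.collapse)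
    show "w \<in> nodes n" using diagramD(1)[OF x p(1)] unfolding w(1) by simp
  qed (use w(2) diagramD(3)[OF x p(1)] in simp_all)
qed

section \<open>Straight diagrams and the unit\<close>

definition through :: "nat \<Rightarrow> (nat \<Rightarrow> 'a) \<Rightarrow> 'a diagram" where
  "through n \<gamma> = (\<lambda>i. ({(0, i), (1, i)}, \<gamma> i)) ` {..<n}"

lemma through_diagram:
  assumes "\<gamma> \<in> {..<n} \<rightarrow> carrier G" shows "through n \<gamma> \<in> diagrams G n"
proof -
  have 1: "\<forall>(e, g)\<in>through n \<gamma>. e \<subseteq> nodes n \<and> card e = 2 \<and> g \<in> carrier G"
    using assms by (auto simp: through_def nodes_def)
  have 2: "\<exists>!p. p \<in> through n \<gamma> \<and> v \<in> fst p" if v: "v \<in> nodes n" for v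
  proof (rule ex1I)
    show "({(0, snd v), (1, snd v)}, \<gamma> (snd v)) \<in> through n \<gamma> \<and> v \<in> fst ({(0, snd v), (1, snd v)}, \<gamma> (snd v))"
      using v by (cases v) (auto simp: through_def nodes_def)
    show "p = ({(0, snd v), (1, snd v)}, \<gamma> (snd v))" if "p \<in> through n \<gamma> \<and> v \<in> fst p" for p
      using that by (auto simp: through_def)
  qed
  have 3: "planar n (fst ` through n \<gamma>)"
    unfolding planar_def
  proof (rule notI, elim exE conjE)
    fix a b c d assume ab: "{a, b} \<in> fst ` through n \<gamma>" and cd: "{c, d} \<in> fst ` through n \<gamma>"
      and lt: "boundary_pos n a < boundary_pos n c" "boundary_pos n c < boundary_pos n b" "boundary_pos n b < boundary_pos n d"
    have e: "\<exists>i<n. {boundary_pos n a, boundary_pos n b} = {i, 2 * n - 1 - i}" if ab: "{a, b} \<in> fst ` through n \<gamma>" for a b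
    proof -
      obtain i where i: "i < n" "{a, b} = {(0, i), (1, i)}" using ab by (auto simp: through_def)
      have "{boundary_pos n a, boundary_pos n b} = boundary_pos n ` {a, b}" by simp
      thus ?thesis unfolding i(2) using i(1) by (auto simp: boundary_pos_def)
    qed
    from e[OF ab] e[OF cd] lt show False by (auto simp: doubleton_eq_iff)
  qed
  show ?thesis using 1 2 3 by (simp add: diagrams_def)
qed

lemma identity_through: "identity_diagram G n = through n (\<lambda>_. \<one>)"
  by (simp add: identity_diagram_def through_def)

lemma identity_diag: "identity_diagram G n \<in> diagrams G n"
  unfolding identity_through by (rule through_diagram) simp

lemma identity_edge: "i < n \<Longrightarrow> ({(0, i), (1, i)}, \<one>) \<in> identity_diagram G n"
  by (auto simp: identity_diagram_def)

lemma compose_identity_right: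
  assumes x: "x \<in> diagrams G n"
  shows "compose_diagrams G n x (identity_diagram G n) = x" "loops n x (identity_diagram G n) = {}"
proof -
  have s: "({(0, i), (1, i)}, \<one>) \<in> identity_diagram G n" if "(e, h) \<in> x" "(1, i) \<in> e" for e h i
    by (rule identity_edge) (use diagramD(1)[OF x that(1)] that(2) in \<open>auto simp: nodes_def\<close>)
  show "compose_diagrams G n x (identity_diagram G n) = x"
  proof (rule diag_eqI[OF compose_closed[OF x identity_diag] x], rule subsetI)
    fix p assume p: "p \<in> x"
    obtain e h where eh: "p = (e, h)" by (cases p)
    show "p \<in> compose_diagrams G n x (identity_diagram G n)"
      unfolding eh by (rule straight_right(1)[OF x identity_diag]) (use p s eh in auto)
  qed
  show "loops n x (identity_diagram G n) = {}"
  proof (rule no_loops[OF x identity_diag])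
    fix i assume "i < n"
    hence "(1, i) \<in> nodes n" by (simp add: nodes_def)
    then obtain w h where w: "({(1, i), w}, h) \<in> x" by (rule diag_node_edge[OF x])
    show "\<exists>C\<in>comps (V3 n) (glue x (identity_diagram G n)). (1, i) \<in> C \<and> \<not> C \<subseteq> M1 n"
      using straight_right(2)[OF x identity_diag w s[OF w]] by blast
  qed
qed

lemma compose_identity_left:
  assumes y: "y \<in> diagrams G n"
  shows "compose_diagrams G n (identity_diagram G n) y = y" "loops n (identity_diagram G n) y = {}"
proof -
  have s: "({(0, i), (1, i)}, \<one>) \<in> identity_diagram G n" if "(e, h) \<in> y" "(0, i) \<in> e" for e h i
    by (rule identity_edge) (use diagramD(1)[OF y that(1)] that(2) in \<open>auto simp: nodes_def\<close>)
  show "compose_diagrams G n (identity_diagram G n) y = y"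
  proof (rule diag_eqI[OF compose_closed[OF identity_diag y] y], rule subsetI)
    fix p assume p: "p \<in> y"
    obtain e h where eh: "p = (e, h)" by (cases p)
    show "p \<in> compose_diagrams G n (identity_diagram G n) y"
      unfolding eh by (rule straight_left(1)[OF identity_diag y]) (use p s eh in auto)
  qed
  show "loops n (identity_diagram G n) y = {}"
  proof (rule no_loops[OF identity_diag y])
    fix i assume "i < n"
    hence "(0, i) \<in> nodes n" by (simp add: nodes_def)
    then obtain w h where w: "({(0, i), w}, h) \<in> y" by (rule diag_node_edge[OF y])
    have "(1, i) \<in> shift ` {(0, i), w}" by (simp add: shift_def)
    thus "\<exists>C\<in>comps (V3 n) (glue (identity_diagram G n) y). (1, i) \<in> C \<and> \<not> C \<subseteq> M1 n"
      using straight_left(2)[OF identity_diag y w s[OF w]] by blast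
  qed
qed

lemma compose_through:
  assumes g: "\<gamma> \<in> {..<n} \<rightarrow> carrier G" and g': "\<gamma>' \<in> {..<n} \<rightarrow> carrier G"
  shows "compose_diagrams G n (through n \<gamma>) (through n \<gamma>') = through n (\<lambda>i. \<gamma> i \<otimes> \<gamma>' i)"
    and "loops n (through n \<gamma>) (through n \<gamma>') = {}"
proof -
  note x = through_diagram[OF g] and y = through_diagram[OF g']
  have gg: "(\<lambda>i. \<gamma> i \<otimes> \<gamma>' i) \<in> {..<n} \<rightarrow> carrier G" using g g' by (simp add: Pi_iff)
  have key: "({(0, i), (1, i)}, \<gamma> i \<otimes> \<gamma>' i) \<in> compose_diagrams G n (through n \<gamma>) (through n \<gamma>') \<and>
      {(0, i), (1, i), (2, i)} \<in> comps (V3 n) (glue (through n \<gamma>) (through n \<gamma>'))" if i: "i < n" for i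
  proof -
    let ?P = "{({(0::nat, i), (1, i)}, \<gamma> i)}" and ?Q = "{({(1::nat, i), (2, i)}, \<gamma>' i)}"
    have P: "?P \<subseteq> through n \<gamma>" using i by (auto simp: through_def)
    have Q: "?Q \<subseteq> lmap shift (through n \<gamma>')"
      using i by (auto simp: through_def shift_def intro!: lmap_shiftI[of "{(0, i), (1, i)}"])
    have C: "{(0, i), (1, i), (2, i)} = (\<Union>p\<in>?P \<union> ?Q. fst p)" by auto
    have conn: "W = {(0, i), (1, i), (2, i)}" if W: "W \<subseteq> {(0, i), (1, i), (2, i)}" "W \<noteq> {}"
      and cl: "\<And>p. p \<in> ?P \<union> ?Q \<Longrightarrow> fst p \<inter> W \<noteq> {} \<Longrightarrow> fst p \<subseteq> W" for W
      using cl[of "({(0::nat, i), (1, i)}, \<gamma> i)"] cl[of "({(1::nat, i), (2, i)}, \<gamma>' i)"] W by auto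
    note cm = comp_member[OF x y P Q C _ _ conn]
    have c: "\<gamma> i \<in> carrier G" "\<gamma>' i \<in> carrier G" using g g' i by auto
    have "{(0, i), (1, i), (2, i)} - M1 n = {(0, i), (2::nat, i)}" using i by auto
    hence o: "outm ` ({(0, i), (1, i), (2, i)} - M1 n) = {(0, i), (1, i)}" by (simp add: outm_def)
    have "(outm ` ({(0, i), (1, i), (2, i)} - M1 n), (\<Otimes>p\<in>?P. snd p) \<otimes> (\<Otimes>p\<in>?Q. snd p)) \<in>
        compose_diagrams G n (through n \<gamma>) (through n \<gamma>') \<and>
        {(0, i), (1, i), (2, i)} \<in> comps (V3 n) (glue (through n \<gamma>) (through n \<gamma>'))"
      by (intro conjI cm) (auto simp: nodes_def shift_def)
    thus ?thesis using c unfolding o by simp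
  qed
  show "compose_diagrams G n (through n \<gamma>) (through n \<gamma>') = through n (\<lambda>i. \<gamma> i \<otimes> \<gamma>' i)"
    by (rule diag_eqI[OF compose_closed[OF x y] through_diagram[OF gg]]) (use key in \<open>auto simp: through_def\<close>)
  show "loops n (through n \<gamma>) (through n \<gamma>') = {}"
  proof (rule no_loops[OF x y])
    fix i assume "i < n"
    thus "\<exists>C\<in>comps (V3 n) (glue (through n \<gamma>) (through n \<gamma>')). (1, i) \<in> C \<and> \<not> C \<subseteq> M1 n"
      using key[of i] by (intro bexI[of _ "{(0, i), (1, i), (2, i)}"]) auto
  qed
qed

end

section \<open>Through diagrams and cups\<close>

text \<open>Counting up from 0 gives \<open>i \<le> f i\<close>; counting on to the last index below
  the bound gives \<open>f i \<le> i\<close>.\<close>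

lemma strict_mono_bounded:
  fixes f :: "nat \<Rightarrow> nat"
  assumes m: "\<And>i j. \<lbrakk>i < j; j < n\<rbrakk> \<Longrightarrow> f i < f j" and b: "\<And>i. i < n \<Longrightarrow> f i < n" and i: "i < n"
  shows "f i = i"
proof -
  have "i \<le> f i" using i
  proof (induction i)
    case (Suc i)
    thus ?case using m[of i "Suc i"] by simp
  qed simp
  moreover have "f i + k \<le> f (i + k)" if "i + k < n" for k using that
  proof (induction k)
    case (Suc k)
    thus ?case using m[of "i + k" "i + Suc k"] by simp
  qed simp
  from this[of "n - 1 - i"] have "f i + (n - 1 - i) \<le> f (n - 1)" using i by simp
  ultimately show ?thesis using b[of "n - 1"] i by linarith
qed

context labels
begin

lemma diag_planar:
  assumes "x \<in> diagrams G n" "({a, b}, g) \<in> x" "({c, d}, h) \<in> x"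
  shows "\<not> (boundary_pos n a < boundary_pos n c \<and> boundary_pos n c < boundary_pos n b \<and>
    boundary_pos n b < boundary_pos n d)"
proof -
  have "{a, b} \<in> fst ` x" "{c, d} \<in> fst ` x" using assms(2,3) by (force intro: image_eqI)+
  thus ?thesis using diagramD(5)[OF assms(1)] unfolding planar_def by blast
qed

lemma diag_edge_uniq:
  assumes "x \<in> diagrams G n" "({v, w}, g) \<in> x" "({v, w'}, h) \<in> x" "v \<noteq> w'" shows "w = w' \<and> g = h"
  using diag_uniq[OF assms(1-3), of v] assms(4) by (auto simp: doubleton_eq_iff)

lemma diag_edge_nodes:
  assumes "x \<in> diagrams G n" "({v, w}, g) \<in> x"
  shows "v \<in> nodes n" "w \<in> nodes n" "v \<noteq> w" "g \<in> carrier G"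
  using diagramD(1-3)[OF assms] by auto

text \<open>An arc that does not join neighbours encloses the node \<open>Suc a\<close>. By
  planarity the edge at that node stays inside the arc, which gives a shorter one.\<close>

lemma exists_short_cup:
  assumes x: "x \<in> diagrams G n" and "({(1, a), (1, b)}, h) \<in> x" "a < b"
  shows "\<exists>i g. ({(1, i), (1, Suc i)}, g) \<in> x"
  using assms(2,3)
proof (induction "b - a" arbitrary: a b h rule: less_induct)
  case less
  note ab = less.prems
  have bn: "b < n" using diag_edge_nodes(2)[OF x ab(1)] by (simp add: nodes_def)
  show ?case
  proof (cases "b = Suc a")
    case True thus ?thesis using ab by blast
  next
    case False
    have "(1, Suc a) \<in> nodes n" using bn ab(2) by (simp add: nodes_def)
    then obtain w h' where w: "({(1, Suc a), w}, h') \<in> x" by (rule diag_node_edge[OF x])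
    note wn = diag_edge_nodes[OF x w]
    obtain e c where ec: "w = (e, c)" by (cases w)
    have c: "c < n" "e = 0 \<or> e = 1" using wn(2) unfolding ec by (auto simp: nodes_def)
    have ab': "({(1, b), (1, a)}, h) \<in> x" using ab(1) by (simp add: insert_commute)
    have w': "({(e, c), (1, Suc a)}, h') \<in> x" using w unfolding ec by (simp add: insert_commute)
    note pl = diag_planar[OF x ab' w[unfolded ec]] diag_planar[OF x w' ab']
    have "w \<noteq> (1, a)"
    proof
      assume "w = (1, a)"
      hence "(1, Suc a) = (1::nat, b)" using diag_edge_uniq[OF x w'[folded ec] , of "(1, b)" h] ab by simp
      thus False using False by simp
    qed
    moreover have "w \<noteq> (1, b)"
    proof
      assume "w = (1, b)"
      hence "(1, Suc a) = (1::nat, a)" using diag_edge_uniq[OF x w'[folded ec] , of "(1, a)" h] ab' ab(2) by simp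
      thus False by simp
    qed
    moreover have "w \<noteq> (1, Suc a)" using wn(3) by simp
    \<comment> \<open>An edge from inside the arc to the left column would cross the arc.\<close>
    moreover have e1: "e = 1"
    proof (rule ccontr)
      assume "e \<noteq> 1"
      moreover have "c < 2 * n - Suc b" "2 * n - Suc b < 2 * n - Suc (Suc a)" "2 * n - Suc (Suc a) < 2 * n - Suc a"
        using c bn ab(2) False by linarith+
      ultimately show False using pl(2) c(2) by (simp add: boundary_pos_def)
    qed
    moreover have "\<not> c < a"
    proof
      assume "c < a"
      hence "2 * n - Suc b < 2 * n - Suc (Suc a)" "2 * n - Suc (Suc a) < 2 * n - Suc a" "2 * n - Suc a < 2 * n - Suc c"
        using bn ab(2) False by linarith+
      thus False using pl(1) e1 by (simp add: boundary_pos_def)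
    qed
    moreover have "\<not> b < c"
    proof
      assume "b < c"
      hence "2 * n - Suc c < 2 * n - Suc b" "2 * n - Suc b < 2 * n - Suc (Suc a)" "2 * n - Suc (Suc a) < 2 * n - Suc a"
        using c(1) bn ab(2) False by linarith+
      thus False using pl(2) e1 by (simp add: boundary_pos_def)
    qed
    ultimately have "e = 1 \<and> Suc a < c \<and> c < b" unfolding ec by auto
    thus ?thesis using less.hyps[of c "Suc a" h'] w unfolding ec by auto
  qed
qed

text \<open>Without arcs in column \<open>c\<close> every node of that column is joined to the other
  one. Planarity makes this matching increasing, so it is the identity of heights, and the other
  column has no arcs either.\<close>

lemma through_of_no_arc:
  assumes x: "x \<in> diagrams G n" and c: "c = 0 \<or> c = 1" and no: "\<And>i j h. ({(c, i), (c, j)}, h) \<notin> x"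
  shows "\<exists>\<gamma>\<in>{..<n} \<rightarrow>\<^sub>E carrier G. x = through n \<gamma>"
proof -
  have "\<exists>j h. ({(c, i), (1 - c, j)}, h) \<in> x" if i: "i < n" for i
  proof -
    have "(c, i) \<in> nodes n" using i c by (auto simp: nodes_def)
    then obtain w h where w: "({(c, i), w}, h) \<in> x" by (rule diag_node_edge[OF x])
    have "fst w = 0 \<or> fst w = 1" using diag_edge_nodes(2)[OF x w] by (auto simp: nodes_def)
    moreover have "fst w \<noteq> c"
    proof
      assume "fst w = c"
      hence "w = (c, snd w)" by (simp add: prod_eq_iff)
      thus False using no[of i "snd w" h] w by simp
    qed
    ultimately have "w = (1 - c, snd w)" using c by (auto simp: prod_eq_iff)
    thus ?thesis using w by metis
  qed
  then obtain f \<gamma> where f: "\<And>i. i < n \<Longrightarrow> ({(c, i), (1 - c, f i)}, \<gamma> i) \<in> x" by metis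
  have fn: "f i < n" if "i < n" for i using diag_edge_nodes(2)[OF x f[OF that]] by (simp add: nodes_def)
  \<comment> \<open>Two transversal edges in reversed order interleave on the boundary. For
    \<open>c = 1\<close> both are read from their left ends, so the comparison starts from
    \<open>f j < f i\<close>.\<close>
  have mono: "f i < f j" if ij: "i < j" "j < n" for i j
  proof (rule ccontr)
    assume "\<not> f i < f j"
    moreover have "f i \<noteq> f j"
    proof
      assume e: "f i = f j"
      have "({(1 - c, f i), (c, i)}, \<gamma> i) \<in> x" "({(1 - c, f i), (c, j)}, \<gamma> j) \<in> x"
        using f[of i] f[of j] ij e by (simp_all add: insert_commute)
      from diag_edge_uniq[OF x this] show False using ij c by auto
    qed
    ultimately have lt: "f j < f i" by simp
    note fi = f[OF less_trans[OF ij]] and fj = f[OF ij(2)]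
    have n: "f i < n" "i < n" using fn[of i] ij by simp_all
    show False
    proof (cases "c = 0")
      case True
      have "j < 2 * n - Suc (f i)" "2 * n - Suc (f i) < 2 * n - Suc (f j)" using n ij lt by simp_all
      thus ?thesis using diag_planar[OF x fi fj] True ij by (simp add: boundary_pos_def)
    next
      case False
      hence c1: "c = 1" using c by simp
      have "({(0, f j), (1, j)}, \<gamma> j) \<in> x" "({(0, f i), (1, i)}, \<gamma> i) \<in> x"
        using fi fj c1 by (simp_all add: insert_commute)
      moreover have "f i < 2 * n - Suc j" "2 * n - Suc j < 2 * n - Suc i" using n ij by linarith+
      ultimately show ?thesis using diag_planar[OF x] lt by (fastforce simp: boundary_pos_def)
    qed
  qed
  have fi: "f i = i" if "i < n" for i by (rule strict_mono_bounded[OF mono fn that])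
  have e: "({(0, i), (1, i)}, \<gamma> i) \<in> x" if "i < n" for i
    using f[OF that] fi[OF that] c by (auto simp: insert_commute)
  let ?\<gamma> = "restrict \<gamma> {..<n}"
  have g: "?\<gamma> \<in> {..<n} \<rightarrow>\<^sub>E carrier G" using diag_edge_nodes(4)[OF x e] by simp
  moreover have "x = through n ?\<gamma>"
    by (rule diag_eqI[OF x through_diagram]) (use g e in \<open>auto simp: through_def\<close>)
  ultimately show ?thesis by blast
qed

text \<open>Extensional label functions are used because they form the carrier of the product group,
  which makes \<open>through n\<close> injective there.\<close>

lemma through_diagrams_eq: "through_diagrams G n = through n ` ({..<n} \<rightarrow>\<^sub>E carrier G)"
proof (intro equalityI subsetI)
  fix x assume "x \<in> through_diagrams G n"
  hence x: "x \<in> diagrams G n" and t: "\<And>p. p \<in> x \<Longrightarrow> fst ` fst p = {0, 1}" by (simp_all add: through_diagrams_def)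
  have "({(0, i), (0, j)}, h) \<notin> x" for i j h using t[of "({(0, i), (0, j)}, h)"] by auto
  from through_of_no_arc[OF x _ this] show "x \<in> through n ` ({..<n} \<rightarrow>\<^sub>E carrier G)" by blast
next
  fix x assume "x \<in> through n ` ({..<n} \<rightarrow>\<^sub>E carrier G)"
  then obtain \<gamma> where g: "\<gamma> \<in> {..<n} \<rightarrow>\<^sub>E carrier G" "x = through n \<gamma>" by blast
  have "x \<in> diagrams G n" unfolding g(2) by (rule through_diagram) (use g(1) in auto)
  moreover have "fst ` fst p = {0, 1}" if "p \<in> x" for p using that unfolding g(2) by (auto simp: through_def)
  ultimately show "x \<in> through_diagrams G n" by (simp add: through_diagrams_def)
qed

lemma arc_of_not_through:
  assumes x: "x \<in> diagrams G n" "x \<notin> through_diagrams G n" and c: "c = 0 \<or> c = 1"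
  obtains i j h where "({(c, i), (c, j)}, h) \<in> x"
proof -
  have "\<not> (\<forall>i j h. ({(c, i), (c, j)}, h) \<notin> x)"
  proof
    assume "\<forall>i j h. ({(c, i), (c, j)}, h) \<notin> x"
    hence "\<exists>\<gamma>\<in>{..<n} \<rightarrow>\<^sub>E carrier G. x = through n \<gamma>" by (intro through_of_no_arc[OF x(1) c]) blast
    thus False using x(2) unfolding through_diagrams_eq by blast
  qed
  thus thesis using that by blast
qed

lemma arc_not_through: "({(c, i), (c, j)}, h) \<in> x \<Longrightarrow> x \<notin> through_diagrams G n"
  by (force simp: through_diagrams_def)

text \<open>A diagram that is not a through diagram has arcs in both columns. Left arcs of
  \<open>x\<close> and right arcs of \<open>y\<close> survive in the composite.\<close>

lemma through_prime:
  assumes x: "x \<in> diagrams G n" and y: "y \<in> diagrams G n" and xy: "compose_diagrams G n x y \<in> through_diagrams G n"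
  shows "x \<in> through_diagrams G n \<and> y \<in> through_diagrams G n"
proof (rule ccontr)
  assume "\<not> ?thesis"
  then consider "x \<notin> through_diagrams G n" | "y \<notin> through_diagrams G n" by blast
  thus False
  proof cases
    case 1
    then obtain i j h where a: "({(0, i), (0, j)}, h) \<in> x" using arc_of_not_through[OF x, of 0] by blast
    have "({(0, i), (0, j)}, h) \<in> compose_diagrams G n x y" by (rule straight_right(1)[OF x y a]) simp
    thus False using arc_not_through xy by blast
  next
    case 2
    then obtain i j h where a: "({(1, i), (1, j)}, h) \<in> y" using arc_of_not_through[OF y, of 1] by blast
    have "({(1, i), (1, j)}, h) \<in> compose_diagrams G n x y" by (rule straight_left(1)[OF x y a]) simp
    thus False using arc_not_through xy by blast
  qed
qed

lemma short_cup_of_not_through: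
  assumes x: "x \<in> diagrams G n" "x \<notin> through_diagrams G n"
  shows "\<exists>i g. ({(1, i), (1, Suc i)}, g) \<in> x"
proof -
  obtain i j h where a: "({(1, i), (1, j)}, h) \<in> x" using arc_of_not_through[OF x, of 1] by blast
  have "i \<noteq> j" using diag_edge_nodes(3)[OF x(1) a] by simp
  then consider "i < j" | "j < i" by linarith
  thus ?thesis
  proof cases
    case 1 show ?thesis by (rule exists_short_cup[OF x(1) a 1])
  next
    case 2
    have "({(1, j), (1, i)}, h) \<in> x" using a by (simp add: insert_commute)
    thus ?thesis by (rule exists_short_cup[OF x(1) _ 2])
  qed
qed

end

section \<open>Hooks\<close>

text \<open>The three heights are consecutive with \<open>q\<close> in the middle, counted upwards
  or downwards. Both directions occur, since a cup is approached from the side on which there is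
  free space.\<close>

locale hook = labels G for G :: "('g, 's) monoid_scheme" (structure) +
  fixes n p q t :: nat and g :: 'g
  assumes pqt: "p = Suc q \<and> q = Suc t \<or> q = Suc p \<and> t = Suc q" and less: "p < n" "q < n" "t < n"
    and g: "g \<in> carrier G"
begin

definition cup :: "node set \<times> 'g" where "cup = ({(1, p), (1, q)}, g)"

text \<open>The hook pulls a strand that arrives at \<open>t\<close> around the cup on \<open>p\<close> and \<open>q\<close>; the label of the cup
  and its inverse cancel along this strand.\<close>

definition hk :: "'g diagram" where
  "hk = {cup, ({(0, q), (0, t)}, \<one>), ({(0, p), (1, t)}, inv g)} \<union> (\<lambda>i. ({(0, i), (1, i)}, \<one>)) ` ({..<n} - {p, q, t})"

lemma distinct: "p \<noteq> q" "q \<noteq> p" "p \<noteq> t" "t \<noteq> p" "q \<noteq> t" "t \<noteq> q" using pqt by auto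

lemma hk_straight: "i < n \<Longrightarrow> i \<notin> {p, q, t} \<Longrightarrow> ({(0, i), (1, i)}, \<one>) \<in> hk"
  unfolding hk_def by blast

lemma hk_planar: "planar n (fst ` hk)"
  unfolding planar_def
proof (rule notI, elim exE conjE)
  fix a b c d assume ab: "{a, b} \<in> fst ` hk" and cd: "{c, d} \<in> fst ` hk"
    and lt: "boundary_pos n a < boundary_pos n c" "boundary_pos n c < boundary_pos n b" "boundary_pos n b < boundary_pos n d"
  \<comment> \<open>The boundary positions of the right nodes at heights \<open>p\<close>,
    \<open>q\<close> and \<open>t\<close>, given by sums so that truncated subtraction does not
    interfere.\<close>
  obtain P Q T where PQT: "P + p + 1 = 2 * n" "Q + q + 1 = 2 * n" "T + t + 1 = 2 * n"
    using that[of "2 * n - 1 - p" "2 * n - 1 - q" "2 * n - 1 - t"] less by simp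
  \<comment> \<open>Every chord, read in increasing order, joins adjacent positions, or is the
    slanted strand from \<open>p\<close> to \<open>T\<close>, or is a straight strand on one side of
    all three heights. No two chords of these kinds interleave.\<close>
  have e: "boundary_pos n b = Suc (boundary_pos n a) \<or> boundary_pos n a = p \<and> boundary_pos n b = T \<or>
      (\<exists>k. k < n \<and> (k < p \<and> k < q \<and> k < t \<or> p < k \<and> q < k \<and> t < k) \<and>
        boundary_pos n a = k \<and> boundary_pos n b + k + 1 = 2 * n)"
    if ab: "{a, b} \<in> fst ` hk" and lt: "boundary_pos n a < boundary_pos n b" for a b
  proof -
    let ?A = "boundary_pos n a" and ?B = "boundary_pos n b"
    have im: "{?A, ?B} = boundary_pos n ` {a, b}" by simp
    have m: "2 * n - Suc p = P" "2 * n - Suc q = Q" "2 * n - Suc t = T" using PQT by simp_all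
    have big: "p < T" using PQT less by linarith
    consider "{a, b} = {(1, p), (1, q)}" | "{a, b} = {(0, q), (0, t)}" | "{a, b} = {(0, p), (1, t)}"
      | k where "k < n" "k \<noteq> p" "k \<noteq> q" "k \<noteq> t" "{a, b} = {(0, k), (1, k)}"
      using ab unfolding hk_def cup_def by (simp add: image_image) blast
    thus ?thesis
    proof cases
      case 1
      hence "{?A, ?B} = {P, Q}" unfolding im by (simp add: boundary_pos_def m)
      hence "?A = P \<and> ?B = Q \<or> ?A = Q \<and> ?B = P" by (simp add: doubleton_eq_iff)
      hence "?B = Suc ?A" using lt pqt PQT by auto
      thus ?thesis by blast
    next
      case 2
      hence "{?A, ?B} = {q, t}" unfolding im by (simp add: boundary_pos_def)
      hence "?A = q \<and> ?B = t \<or> ?A = t \<and> ?B = q" by (simp add: doubleton_eq_iff)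
      hence "?B = Suc ?A" using lt pqt by auto
      thus ?thesis by blast
    next
      case 3
      hence "{?A, ?B} = {p, T}" unfolding im by (auto simp: boundary_pos_def m)
      hence "?A = p \<and> ?B = T \<or> ?A = T \<and> ?B = p" by (simp add: doubleton_eq_iff)
      hence "?A = p \<and> ?B = T" using lt big by auto
      thus ?thesis by blast
    next
      case 4
      hence "{?A, ?B} = {k, 2 * n - 1 - k}" unfolding im 4(5) by (auto simp: boundary_pos_def)
      hence "?A = k \<and> ?B = 2 * n - 1 - k \<or> ?A = 2 * n - 1 - k \<and> ?B = k" by (simp add: doubleton_eq_iff)
      hence "?A = k \<and> ?B + k + 1 = 2 * n" using lt 4(1) by auto
      moreover have "k < p \<and> k < q \<and> k < t \<or> p < k \<and> q < k \<and> t < k" using 4(2-4) pqt by arith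
      ultimately show ?thesis using 4(1) by blast
    qed
  qed
  show False using e[OF ab less_trans[OF lt(1,2)]] e[OF cd less_trans[OF lt(2,3)]] lt PQT(3) less by auto
qed

lemma hk_diagram: "hk \<in> diagrams G n"
proof -
  have "\<forall>(e, h)\<in>hk. e \<subseteq> nodes n \<and> card e = 2 \<and> h \<in> carrier G"
    using less g distinct by (auto simp: hk_def cup_def nodes_def)
  moreover have "\<exists>!P. P \<in> hk \<and> v \<in> fst P" if v: "v \<in> nodes n" for v
  proof (rule ex_ex1I)
    obtain a i where ai: "v = (a, i)" by (cases v)
    have "\<exists>P\<in>hk. v \<in> fst P"
      using v less unfolding ai hk_def cup_def by (auto simp: nodes_def)
    thus "\<exists>P. P \<in> hk \<and> v \<in> fst P" by blast
    fix P Q assume "P \<in> hk \<and> v \<in> fst P" "Q \<in> hk \<and> v \<in> fst Q"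
    thus "P = Q" using distinct unfolding hk_def cup_def by auto
  qed
  ultimately show ?thesis using hk_planar by (simp add: diagrams_def)
qed

lemma cup_in_hk: "cup \<in> hk" by (simp add: hk_def)

lemma cup_compose:
  assumes x: "x \<in> diagrams G n" shows "cup \<in> compose_diagrams G n x hk"
  unfolding cup_def by (rule straight_left(1)[OF x hk_diagram cup_in_hk[unfolded cup_def]]) simp

lemma edge_preserved:
  assumes x: "x \<in> diagrams G n" and f: "(f, h) \<in> x" and av: "\<And>i. (1, i) \<in> f \<Longrightarrow> i \<notin> {p, q, t}"
  shows "(f, h) \<in> compose_diagrams G n x hk"
    and "\<exists>C\<in>comps (V3 n) (glue x hk). f \<subseteq> C \<and> \<not> C \<subseteq> M1 n"
proof -
  have s: "({(0, i), (1, i)}, \<one>) \<in> hk" if "(1, i) \<in> f" for i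
    by (rule hk_straight[OF _ av[OF that]]) (use diagramD(1)[OF x f] that in \<open>auto simp: nodes_def\<close>)
  show "(f, h) \<in> compose_diagrams G n x hk" by (rule straight_right(1)[OF x hk_diagram f]) (rule s)
  show "\<exists>C\<in>comps (V3 n) (glue x hk). f \<subseteq> C \<and> \<not> C \<subseteq> M1 n"
    by (rule straight_right(2)[OF x hk_diagram f]) (rule s)
qed

text \<open>The strand runs from \<open>u\<close> to \<open>t\<close>, along the left arc of the
  hook to \<open>q\<close>, through the cup of \<open>x\<close> to \<open>p\<close>, and along the
  slanted strand back to height \<open>t\<close>. Its label is \<open>h\<close> times
  \<open>g\<close> times the inverse of \<open>g\<close>.\<close>

lemma bent_edge:
  assumes x: "x \<in> diagrams G n" and cx: "cup \<in> x" and f: "({u, (1, t)}, h) \<in> x"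
  shows "({u, (1, t)}, h) \<in> compose_diagrams G n x hk"
    and "\<exists>C\<in>comps (V3 n) (glue x hk). {(1, p), (1, q), (1, t)} \<subseteq> C \<and> u \<in> C \<and> \<not> C \<subseteq> M1 n"
proof -
  have fe: "u \<in> nodes n" "u \<noteq> (1, t)" "h \<in> carrier G" using diagramD(1-3)[OF x f] by auto
  have ne: "({u, (1, t)}, h) \<noteq> cup" using distinct by (auto simp: cup_def doubleton_eq_iff)
  have up: "u \<noteq> (1, p)" "u \<noteq> (1, q)" using diag_uniq[OF x f cx, of u] ne by (auto simp: cup_def)
  \<comment> \<open>The other end \<open>u\<close> may lie in the right column too; its strand is
    then continued straight at that height. So this set has at most one element.\<close>
  define K where "K = {k. u = (1, k)}"
  have Kc: "K = {} \<or> (\<exists>k. K = {k})" by (cases u) (auto simp: K_def)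
  have Kn: "k < n" "k \<noteq> p" "k \<noteq> q" "k \<noteq> t" if "k \<in> K" for k
    using that fe(1,2) up by (auto simp: K_def nodes_def)
  define A where "A = ({(1::nat, q), (1, t)}, \<one>)"
  define B where "B = ({(1::nat, p), (2, t)}, inv g)"
  define R where "R = (\<lambda>k. ({(1::nat, k), (2, k)}, \<one>)) ` K"
  define P where "P = {({u, (1, t)}, h), cup}"
  define Q where "Q = insert A (insert B R)"
  define C where "C = (\<Union>p\<in>P \<union> Q. fst p)"
  have C_eq: "C = {u, (1, t), (1, p), (1, q), (2, t)} \<union> {2} \<times> K"
    unfolding C_def P_def Q_def A_def B_def R_def cup_def by (auto simp: K_def)
  have Px: "P \<subseteq> x" unfolding P_def using f cx by simp
  have Qy: "Q \<subseteq> lmap shift hk"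
  proof -
    have "A \<in> lmap shift hk" unfolding A_def
      by (rule lmap_shiftI[of "{(0, q), (0, t)}"]) (simp_all add: hk_def shift_def numeral_2_eq_2)
    moreover have "B \<in> lmap shift hk" unfolding B_def
      by (rule lmap_shiftI[of "{(0, p), (1, t)}"]) (simp_all add: hk_def shift_def numeral_2_eq_2)
    moreover have "({(1::nat, k), (2, k)}, \<one>) \<in> lmap shift hk" if "k \<in> K" for k
      by (rule lmap_shiftI[OF hk_straight[of k]]) (use Kn[OF that] in \<open>simp_all add: shift_def numeral_2_eq_2\<close>)
    ultimately show ?thesis unfolding Q_def R_def by blast
  qed
  have M: "\<not> C \<subseteq> M1 n" unfolding C_eq by auto
  have cn: "\<exists>p\<in>P. v \<in> fst p" if "v \<in> C" "v \<in> nodes n" for v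
    using that unfolding C_eq P_def cup_def by (auto simp: nodes_def)
  have cs: "\<exists>q\<in>Q. v \<in> fst q" if "v \<in> C" "v \<in> shift ` nodes n" for v
    using that fe(1) unfolding C_eq Q_def A_def B_def R_def shift_nodes by (auto simp: K_def nodes_def)
  have conn: "W = C" if W: "W \<subseteq> C" "W \<noteq> {}" and cl: "\<And>p. p \<in> P \<union> Q \<Longrightarrow> fst p \<inter> W \<noteq> {} \<Longrightarrow> fst p \<subseteq> W" for W
  proof -
    have 1: "u \<in> W \<longleftrightarrow> (1, t) \<in> W" using cl[of "({u, (1, t)}, h)"] unfolding P_def by auto
    have 2: "(1, p) \<in> W \<longleftrightarrow> (1, q) \<in> W" using cl[of cup] unfolding P_def by (auto simp: cup_def)
    have 3: "(1, q) \<in> W \<longleftrightarrow> (1, t) \<in> W" using cl[of A] unfolding Q_def by (auto simp: A_def)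
    have 4: "(1, p) \<in> W \<longleftrightarrow> (2, t) \<in> W" using cl[of B] unfolding Q_def by (auto simp: B_def)
    have 5: "(1, k) \<in> W \<longleftrightarrow> (2, k) \<in> W" if "k \<in> K" for k
      using cl[of "({(1, k), (2, k)}, \<one>)"] that unfolding Q_def R_def by auto
    have 6: "u = (1, k)" if "k \<in> K" for k using that by (simp add: K_def)
    obtain v where v: "v \<in> W" using W(2) by blast
    hence "v \<in> C" using W(1) by blast
    hence t: "(1, t) \<in> W" using v 1 2 3 4 5 6 unfolding C_eq by auto
    hence "C \<subseteq> W" using 1 2 3 4 5 6 unfolding C_eq by auto
    thus ?thesis using W(1) by blast
  qed
  have cm: "C \<in> comps (V3 n) (glue x hk)"
    "(outm ` (C - M1 n), (\<Otimes>p\<in>P. snd p) \<otimes> (\<Otimes>q\<in>Q. snd q)) \<in> compose_diagrams G n x hk"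
    by (rule comp_member[OF x hk_diagram Px Qy C_def _ _ _ M]; fact)+
  have sC: "snd cup = g" by (simp add: cup_def)
  have lP: "(\<Otimes>p\<in>P. snd p) = h \<otimes> g"
    unfolding P_def using ne fe(3) g by (simp add: sC)
  have fin: "finite R" unfolding R_def using Kc by auto
  have R1: "(\<Otimes>q\<in>R. snd q) = \<one>" by (rule finprod_one_eqI) (auto simp: R_def)
  have Rc: "snd \<in> R \<rightarrow> carrier G" by (auto simp: R_def)
  have pK: "p \<notin> K" using up(1) by (simp add: K_def)
  have nBR: "B \<notin> R"
  proof
    assume "B \<in> R"
    then obtain k where "k \<in> K" "{(1::nat, p), (2, t)} = {(1, k), (2, k)}" unfolding B_def R_def by blast
    thus False using distinct by (auto simp: doubleton_eq_iff)
  qed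
  have nAR: "A \<notin> insert B R"
  proof
    assume "A \<in> insert B R"
    then obtain k j where "{(1::nat, q), (1, t)} = {(1, k), (2, j)}" unfolding A_def B_def R_def by blast
    thus False by (auto simp: doubleton_eq_iff)
  qed
  have sA: "snd A = \<one>" "snd B = inv g" by (simp_all add: A_def B_def)
  have lQ: "(\<Otimes>q\<in>Q. snd q) = inv g"
    unfolding Q_def using fin nBR nAR Rc g R1 by (simp add: sA)
  have l: "(\<Otimes>p\<in>P. snd p) \<otimes> (\<Otimes>q\<in>Q. snd q) = h"
    unfolding lP lQ using g fe(3) by (simp add: m_assoc)
  have o: "outm ` (C - M1 n) = {u, (1, t)}"
  proof -
    obtain a k where ak: "u = (a, k)" by (cases u)
    have kn: "k < n" "a = 0 \<or> a = 1" using fe(1) unfolding ak by (auto simp: nodes_def)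
    from kn(2) show ?thesis
    proof
      assume a: "a = 0"
      have "C - M1 n = {(0, k), (2, t)}" unfolding C_eq K_def ak a using less kn by auto
      thus ?thesis unfolding ak a by (simp add: outm_def)
    next
      assume a: "a = 1"
      have "C - M1 n = {(2, k), (2, t)}" unfolding C_eq K_def ak a using less kn by auto
      thus ?thesis unfolding ak a by (simp add: outm_def)
    qed
  qed
  show "({u, (1, t)}, h) \<in> compose_diagrams G n x hk"
    by (rule subst[OF o], rule subst[OF l], rule cm(2))
  show "\<exists>C\<in>comps (V3 n) (glue x hk). {(1, p), (1, q), (1, t)} \<subseteq> C \<and> u \<in> C \<and> \<not> C \<subseteq> M1 n"
    by (rule bexI[OF _ cm(1)]) (simp add: C_eq M[unfolded C_eq])
qed

text \<open>The cup of \<open>x\<close> disappears into the strand at \<open>t\<close>, and the cup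
  of the hook takes its place. Nothing closes up, so \<open>\<delta>\<close> does not enter.\<close>

lemma absorb:
  assumes x: "x \<in> diagrams G n" and cx: "cup \<in> x"
  shows "compose_diagrams G n x hk = x" and "loops n x hk = {}"
proof -
  have "(1, t) \<in> nodes n" using less by (simp add: nodes_def)
  then obtain u h where u: "({(1, t), u}, h) \<in> x" by (rule diag_node_edge[OF x])
  have f: "({u, (1, t)}, h) \<in> x" using u by (simp add: insert_commute)
  have cases: "(e, l) = cup \<or> (e, l) = ({u, (1, t)}, h) \<or> (\<forall>i. (1, i) \<in> e \<longrightarrow> i \<notin> {p, q, t})" if e: "(e, l) \<in> x" for e l
  proof -
    have "(e, l) = cup" if "(1, p) \<in> e \<or> (1, q) \<in> e"
      using diag_uniq[OF x e cx, of "(1, p)"] diag_uniq[OF x e cx, of "(1, q)"] that by (auto simp: cup_def)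
    moreover have "(e, l) = ({u, (1, t)}, h)" if "(1, t) \<in> e"
      using diag_uniq[OF x e f, of "(1, t)"] that by auto
    ultimately show ?thesis by blast
  qed
  show "compose_diagrams G n x hk = x"
  proof (rule diag_eqI[OF compose_closed[OF x hk_diagram] x], rule subsetI)
    fix P assume P: "P \<in> x"
    obtain e l where el: "P = (e, l)" by (cases P)
    consider "(e, l) = cup" | "(e, l) = ({u, (1, t)}, h)" | "\<forall>i. (1, i) \<in> e \<longrightarrow> i \<notin> {p, q, t}"
      using cases P unfolding el by blast
    thus "P \<in> compose_diagrams G n x hk" unfolding el
    proof cases
      case 1 show "(e, l) \<in> compose_diagrams G n x hk" unfolding 1 by (rule cup_compose[OF x])
    next
      case 2 show "(e, l) \<in> compose_diagrams G n x hk" unfolding 2 by (rule bent_edge(1)[OF x cx f])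
    next
      case 3 show "(e, l) \<in> compose_diagrams G n x hk"
        by (rule edge_preserved(1)[OF x]) (use P el 3 in auto)
    qed
  qed
  show "loops n x hk = {}"
  proof (rule no_loops[OF x hk_diagram])
    fix i assume i: "i < n"
    obtain C where C: "C \<in> comps (V3 n) (glue x hk)" "{(1, p), (1, q), (1, t)} \<subseteq> C" "u \<in> C" "\<not> C \<subseteq> M1 n"
      using bent_edge(2)[OF x cx f] by blast
    show "\<exists>C\<in>comps (V3 n) (glue x hk). (1, i) \<in> C \<and> \<not> C \<subseteq> M1 n"
    proof (cases "(1, i) \<in> C")
      case True thus ?thesis using C by blast
    next
      case False
      have "(1, i) \<in> nodes n" using i by (simp add: nodes_def)
      then obtain w l where w: "({(1, i), w}, l) \<in> x" by (rule diag_node_edge[OF x])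
      have "({(1, i), w}, l) \<noteq> cup"
      proof
        assume "({(1, i), w}, l) = cup"
        hence "{(1, i), w} = {(1, p), (1, q)}" by (simp only: cup_def prod.inject)
        hence "(1, i) \<in> {(1, p), (1::nat, q)}" by blast
        thus False using False C(2) by blast
      qed
      moreover have "({(1, i), w}, l) \<noteq> ({u, (1, t)}, h)"
      proof
        assume "({(1, i), w}, l) = ({u, (1, t)}, h)"
        hence "{(1, i), w} = {u, (1, t)}" by (simp only: prod.inject)
        hence "(1, i) \<in> {u, (1::nat, t)}" by blast
        thus False using False C(2,3) by blast
      qed
      ultimately have "\<forall>i'. (1, i') \<in> {(1, i), w} \<longrightarrow> i' \<notin> {p, q, t}" using cases[OF w] by (simp only: simp_thms)
      hence av: "j \<notin> {p, q, t}" if "(1, j) \<in> {(1, i), w}" for j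
        using that by - (drule spec[where x = j], erule (1) mp)
      have "\<exists>C\<in>comps (V3 n) (glue x hk). {(1, i), w} \<subseteq> C \<and> \<not> C \<subseteq> M1 n"
        by (rule edge_preserved(2)[OF x w]) (rule av)
      thus ?thesis by blast
    qed
  qed
qed

end

section \<open>The Temperley-Lieb algebra\<close>

locale TL = labels G for G :: "('g, 's) monoid_scheme" (structure) +
  fixes k :: "('k, 'r) ring_scheme" and act :: "'g \<Rightarrow> 'k \<Rightarrow> 'k" and \<delta> :: 'k and n :: nat
  assumes G_ring: "commutative_G_ring G k act" and \<delta>: "\<delta> \<in> carrier k"
begin

abbreviation "D \<equiv> diagrams G n"
abbreviation "Gn \<equiv> group_power G n"

lemma cring_k: "cring k" using G_ring by (simp add: commutative_G_ring_def)

lemma comm_monoid_k: "comm_monoid k" by (rule cring.axioms(2)[OF cring_k])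

lemma act_closed: "(\<lambda>g. act g \<delta>) \<in> carrier G \<rightarrow> carrier k"
proof
  fix g assume "g \<in> carrier G"
  hence "act g \<in> ring_hom k k" using G_ring by (simp add: commutative_G_ring_def ring_iso_def)
  thus "act g \<delta> \<in> carrier k" by (rule ring_hom_closed) (rule \<delta>)
qed

lemma loop_factor_closed:
  assumes x: "x \<in> D" and y: "y \<in> D" shows "loop_factor G k act \<delta> n x y \<in> carrier k"
proof -
  interpret k: comm_monoid k by (rule comm_monoid_k)
  have "component_label G x y C \<in> carrier G" for C
    unfolding component_label_def using diagramD(3)[OF x] diagramD(3)[OF y]
    by (intro m_closed finprod_closed) auto
  thus ?thesis unfolding loop_factor_def by (intro k.finprod_closed Pi_I funcset_mem[OF act_closed])
qed

lemma carrier_Gn: "carrier Gn = {..<n} \<rightarrow>\<^sub>E carrier G" by (simp add: group_power_def)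

lemma group_Gn: "group Gn" unfolding group_power_def by (rule product_group) (rule is_group)

lemma through_cong: "(\<And>i. i < n \<Longrightarrow> \<gamma> i = \<gamma>' i) \<Longrightarrow> through n \<gamma> = through n \<gamma>'"
  unfolding through_def by (intro image_cong) auto

lemma TL_based_ring:
  "based_ring k D (compose_diagrams G n) (loop_factor G k act \<delta> n) (identity_diagram G n)"
proof (intro based_ring.intro based_ring_axioms.intro cring_k)
  fix x y z assume x: "x \<in> D" and y: "y \<in> D" and z: "z \<in> D"
  note w = wf_diagram[OF x] wf_diagram[OF y] wf_diagram[OF z]
  show "compose_diagrams G n (compose_diagrams G n x y) z = compose_diagrams G n x (compose_diagrams G n y z)"
    by (rule compose_assoc[OF w])
  show "loop_factor G k act \<delta> n x y \<otimes>\<^bsub>k\<^esub> loop_factor G k act \<delta> n (compose_diagrams G n x y) z =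
    loop_factor G k act \<delta> n y z \<otimes>\<^bsub>k\<^esub> loop_factor G k act \<delta> n x (compose_diagrams G n y z)"
    by (rule loop_factor_cocycle[where act = act and \<delta> = \<delta>, OF w comm_monoid_k act_closed])
next
  fix x y assume x: "x \<in> D" and y: "y \<in> D"
  show "compose_diagrams G n x y \<in> D" by (rule compose_closed[OF x y])
  show "loop_factor G k act \<delta> n x y \<in> carrier k" by (rule loop_factor_closed[OF x y])
next
  fix x assume x: "x \<in> D"
  show "compose_diagrams G n x (identity_diagram G n) = x" "compose_diagrams G n (identity_diagram G n) x = x"
    by (rule compose_identity_right[OF x], rule compose_identity_left[OF x])
  show "loop_factor G k act \<delta> n x (identity_diagram G n) = \<one>\<^bsub>k\<^esub>"
    by (rule loop_factor_one[OF comm_monoid_k compose_identity_right(2)[OF x]])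
  show "loop_factor G k act \<delta> n (identity_diagram G n) x = \<one>\<^bsub>k\<^esub>"
    by (rule loop_factor_one[OF comm_monoid_k compose_identity_left(2)[OF x]])
qed (rule identity_diag)

lemma group_based_ring:
  "based_ring k (carrier Gn) (monoid.mult Gn) (\<lambda>_ _. \<one>\<^bsub>k\<^esub>) \<one>\<^bsub>Gn\<^esub>"
proof -
  interpret k: cring k by (rule cring_k)
  interpret Gn: group Gn by (rule group_Gn)
  show ?thesis
    by (intro based_ring.intro based_ring_axioms.intro cring_k) (simp_all add: Gn.m_assoc)
qed

text \<open>Straight strands compose height by height without loops, so the through diagrams form a
  copy of the product group, and the twist is trivial on them.\<close>

sublocale Q: based_quotient k D "compose_diagrams G n" "loop_factor G k act \<delta> n" "identity_diagram G n"
  "carrier Gn" "monoid.mult Gn" "\<one>\<^bsub>Gn\<^esub>" "through n"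
proof (intro based_quotient.intro based_quotient_axioms.intro TL_based_ring group_based_ring)
  fix \<alpha> assume a: "\<alpha> \<in> carrier Gn"
  hence a': "\<alpha> \<in> {..<n} \<rightarrow> carrier G" by (simp add: carrier_Gn PiE_iff)
  show "through n \<alpha> \<in> D" by (rule through_diagram[OF a'])
  fix \<beta> assume b: "\<beta> \<in> carrier Gn"
  hence b': "\<beta> \<in> {..<n} \<rightarrow> carrier G" by (simp add: carrier_Gn PiE_iff)
  show "compose_diagrams G n (through n \<alpha>) (through n \<beta>) = through n (\<alpha> \<otimes>\<^bsub>Gn\<^esub> \<beta>)"
    unfolding compose_through(1)[OF a' b'] by (rule through_cong) (simp add: group_power_def)
  show "loop_factor G k act \<delta> n (through n \<alpha>) (through n \<beta>) = \<one>\<^bsub>k\<^esub>"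
    by (rule loop_factor_one[OF comm_monoid_k compose_through(2)[OF a' b']])
next
  show "inj_on (through n) (carrier Gn)"
  proof (rule inj_onI)
    fix \<alpha> \<beta> assume a: "\<alpha> \<in> carrier Gn" and b: "\<beta> \<in> carrier Gn" and eq: "through n \<alpha> = through n \<beta>"
    show "\<alpha> = \<beta>"
    proof (rule PiE_ext[OF a[unfolded carrier_Gn] b[unfolded carrier_Gn]])
      fix i assume "i \<in> {..<n}"
      hence "({(0, i), (1, i)}, \<alpha> i) \<in> through n \<beta>" unfolding eq[symmetric] by (auto simp: through_def)
      then obtain j where j: "({(0::nat, i), (1::nat, i)}, \<alpha> i) = ({(0, j), (1, j)}, \<beta> j)"
        unfolding through_def by (rule imageE)
      hence e: "{(0::nat, i), (1::nat, i)} = {(0, j), (1, j)}" and l: "\<alpha> i = \<beta> j" by (simp_all only: prod.inject)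
      have "(0, i) \<in> {(0::nat, j), (1::nat, j)}" unfolding e[symmetric] by simp
      thus "\<alpha> i = \<beta> i" using l by simp
    qed
  qed
  show "through n \<one>\<^bsub>Gn\<^esub> = identity_diagram G n"
    unfolding identity_through by (rule through_cong) (simp add: group_power_def)
  fix x y assume "x \<in> D" "y \<in> D" "compose_diagrams G n x y \<in> through n ` carrier Gn"
  thus "x \<in> through n ` carrier Gn \<and> y \<in> through n ` carrier Gn"
    unfolding carrier_Gn through_diagrams_eq[symmetric] by (rule through_prime)
qed

definition cups :: "(nat \<Rightarrow> 'g) \<Rightarrow> nat \<Rightarrow> node set \<times> 'g" where
  "cups \<gamma> i = ({(1, i), (1, Suc i)}, \<gamma> i)"

definition containing :: "'g diagram \<Rightarrow> 'g diagram set" where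
  "containing c = {x \<in> D. c \<subseteq> x}"

lemma containing_D: "containing c \<subseteq> D" by (auto simp: containing_def)

text \<open>The left ideal spanned by the diagrams with the given cups equals \<open>A e\<close>.
  Taking \<open>a = 1\<close> in the second condition shows that \<open>e\<close> lies in this
  ideal, so by the first it is idempotent. The weaker wording is what survives adding one
  cup.\<close>

definition good :: "(nat \<Rightarrow> 'g) \<Rightarrow> nat set \<Rightarrow> bool" where
  "good \<gamma> J \<longleftrightarrow> (\<exists>e\<in>Q.A.S D. (\<forall>a\<in>Q.A.S (containing (cups \<gamma> ` J)). a \<otimes>\<^bsub>Q.A.alg\<^esub> e = a) \<and>
     (\<forall>a\<in>Q.A.S D. a \<otimes>\<^bsub>Q.A.alg\<^esub> e \<in> Q.A.S (containing (cups \<gamma> ` J))))"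

lemma good_empty: "good \<gamma> {}"
proof -
  have c: "containing (cups \<gamma> ` {}) = D" by (simp add: containing_def)
  have "basis_vec k (identity_diagram G n) \<in> Q.A.S D" by (rule Q.A.k.basis_vec_free[OF identity_diag])
  hence "\<exists>e\<in>Q.A.S D. (\<forall>a\<in>Q.A.S D. a \<otimes>\<^bsub>Q.A.alg\<^esub> e = a) \<and> (\<forall>a\<in>Q.A.S D. a \<otimes>\<^bsub>Q.A.alg\<^esub> e \<in> Q.A.S D)"
  proof (rule bexI[rotated], intro conjI ballI)
    fix a assume a: "a \<in> Q.A.S D"
    show "a \<otimes>\<^bsub>Q.A.alg\<^esub> basis_vec k (identity_diagram G n) = a" by (rule Q.A.mult_one(1)[OF a])
    thus "a \<otimes>\<^bsub>Q.A.alg\<^esub> basis_vec k (identity_diagram G n) \<in> Q.A.S D" by (rule ssubst) (rule a)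
  qed
  thus ?thesis by (simp only: good_def c)
qed

text \<open>Right multiplication by the hook fixes the diagrams that contain its cup, and puts this cup
  into all others without disturbing the cups that avoid \<open>p\<close>, \<open>q\<close> and \<open>t\<close>.\<close>

lemma good_insert:
  assumes K: "good \<gamma> K" and h: "hook G n p q t (\<gamma> i)" and pq: "{p, q} = {i, Suc i}"
    and dis: "\<And>j. j \<in> K \<Longrightarrow> j \<notin> {p, q, t} \<and> Suc j \<notin> {p, q, t}"
  shows "good \<gamma> (insert i K)"
proof -
  interpret H: hook G n p q t "\<gamma> i" by (rule h)
  have cup: "H.cup = cups \<gamma> i"
  proof -
    have "{(1::nat, p), (1, q)} = Pair 1 ` {p, q}" by simp
    also have "\<dots> = {(1, i), (1, Suc i)}" unfolding pq by simp
    finally show ?thesis by (simp add: H.cup_def cups_def)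
  qed
  let ?K = "containing (cups \<gamma> ` K)" and ?I = "containing (cups \<gamma> ` insert i K)"
  let ?b = "basis_vec k H.hk"
  have IK: "?I \<subseteq> ?K" by (auto simp: containing_def)
  have b: "?b \<in> Q.A.S D" by (rule Q.A.k.basis_vec_free[OF H.hk_diagram])
  obtain e where e: "e \<in> Q.A.S D" "\<forall>a\<in>Q.A.S ?K. a \<otimes>\<^bsub>Q.A.alg\<^esub> e = a"
    "\<forall>a\<in>Q.A.S D. a \<otimes>\<^bsub>Q.A.alg\<^esub> e \<in> Q.A.S ?K"
    using K unfolding good_def by (elim bexE conjE)
  have e': "e \<otimes>\<^bsub>Q.A.alg\<^esub> ?b \<in> Q.A.S D" by (rule Q.A.mult_closed[OF e(1) b])
  have id: "a \<otimes>\<^bsub>Q.A.alg\<^esub> (e \<otimes>\<^bsub>Q.A.alg\<^esub> ?b) = a" if a: "a \<in> Q.A.S ?I" for a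
  proof -
    have aK: "a \<in> Q.A.S ?K" by (rule subsetD[OF Q.A.k.free_mono[OF IK] a])
    have aD: "a \<in> Q.A.S D" by (rule subsetD[OF Q.A.k.free_mono[OF containing_D] a])
    \<comment> \<open>Diagrams with the larger set of cups have the smaller one as well, so
      \<open>e\<close> fixes them and only the hook remains to be absorbed.\<close>
    have "a \<otimes>\<^bsub>Q.A.alg\<^esub> (e \<otimes>\<^bsub>Q.A.alg\<^esub> ?b) = a \<otimes>\<^bsub>Q.A.alg\<^esub> ?b"
      unfolding Q.A.mult_assoc[OF aD e(1) b, symmetric] bspec[OF e(2) aK] ..
    also have "\<dots> = a"
    proof (rule Q.A.mult_right_id[OF H.hk_diagram _ containing_D a])
      fix x assume "x \<in> ?I"
      hence x: "x \<in> D" "H.cup \<in> x" unfolding cup by (auto simp: containing_def)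
      show "compose_diagrams G n x H.hk = x \<and> loop_factor G k act \<delta> n x H.hk = \<one>\<^bsub>k\<^esub>"
        using H.absorb(1)[OF x] loop_factor_one[OF comm_monoid_k H.absorb(2)[OF x]] by blast
    qed
    finally show ?thesis .
  qed
  have cl: "a \<otimes>\<^bsub>Q.A.alg\<^esub> (e \<otimes>\<^bsub>Q.A.alg\<^esub> ?b) \<in> Q.A.S ?I" if a: "a \<in> Q.A.S D" for a
    unfolding Q.A.mult_assoc[OF a e(1) b, symmetric]
  proof (rule Q.A.mult_right_closed[OF H.hk_diagram _ containing_D bspec[OF e(3) a]])
    fix x assume "x \<in> ?K"
    hence x: "x \<in> D" "cups \<gamma> ` K \<subseteq> x" by (auto simp: containing_def)
    have "cups \<gamma> j \<in> compose_diagrams G n x H.hk" if j: "j \<in> K" for j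
      unfolding cups_def
    proof (rule H.edge_preserved(1)[OF x(1)])
      show "({(1, j), (1, Suc j)}, \<gamma> j) \<in> x" using x(2) j by (auto simp: cups_def)
      show "l \<notin> {p, q, t}" if "(1, l) \<in> {(1::nat, j), (1, Suc j)}" for l using that dis[OF j] by auto
    qed
    moreover have "cups \<gamma> i \<in> compose_diagrams G n x H.hk" using H.cup_compose[OF x(1)] unfolding cup .
    ultimately show "compose_diagrams G n x H.hk \<in> ?I"
      using compose_closed[OF x(1) H.hk_diagram] by (auto simp: containing_def)
  qed
  show ?thesis unfolding good_def by (rule bexI[OF _ e'], intro conjI ballI, erule id, erule cl)
qed

text \<open>The cups above the free node \<open>f\<close> are inserted from the top down and those below it from the
  bottom up, so that the third node \<open>t\<close> of each hook is not yet in use.\<close>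

lemma good_cups:
  assumes J: "\<And>i. i \<in> J \<Longrightarrow> Suc i < n \<and> \<gamma> i \<in> carrier G \<and> Suc i \<notin> J"
    and f: "f < n" "f \<notin> J" "f \<notin> Suc ` J"
  shows "good \<gamma> J"
proof -
  have nf: "Suc i \<noteq> f" if "i \<in> J" for i using f(3) that by blast
  have R: "f < n - d \<Longrightarrow> good \<gamma> {i\<in>J. n - d \<le> i}" for d
  proof (induction d)
    case 0
    have "{i\<in>J. n - 0 \<le> i} = {}" using J by force
    thus ?case using good_empty by metis
  next
    case (Suc d)
    define m where "m = n - Suc d"
    have m: "n - d = Suc m" "f < m" using Suc.prems by (simp_all add: m_def)
    have IH: "good \<gamma> {i\<in>J. Suc m \<le> i}" using Suc m by simp
    show ?case
    proof (cases "m \<in> J")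
      case True
      have "{i\<in>J. m \<le> i} = insert m {i\<in>J. Suc m \<le> i}" using True by (auto simp: Suc_le_eq)
      moreover have "good \<gamma> (insert m {i\<in>J. Suc m \<le> i})"
      proof (rule good_insert[OF IH])
        \<comment> \<open>The cups inserted so far lie above \<open>Suc m\<close>, so the hook bends
          towards smaller heights. Since \<open>f < m\<close>, the node \<open>m - 1\<close> exists
          and is not below \<open>f\<close>.\<close>
        show "hook G n (Suc m) m (m - 1) (\<gamma> m)"
          by (intro hook.intro hook_axioms.intro labels_axioms) (use J[OF True] m(2) in auto)
        show "{Suc m, m} = {m, Suc m}" by (rule insert_commute)
        show "j \<notin> {Suc m, m, m - 1} \<and> Suc j \<notin> {Suc m, m, m - 1}" if j: "j \<in> {i\<in>J. Suc m \<le> i}" for j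
        proof -
          have "j \<noteq> Suc m" using J[OF True] j by blast
          hence "Suc m < j" using j by simp
          thus ?thesis by auto
        qed
      qed
      ultimately show ?thesis unfolding m_def by simp
    next
      case False
      hence "{i\<in>J. m \<le> i} = {i\<in>J. Suc m \<le> i}" by (auto simp: Suc_le_eq le_less)
      thus ?thesis using IH unfolding m_def by simp
    qed
  qed
  have L: "m \<le> f \<Longrightarrow> good \<gamma> {i\<in>J. f < i \<or> i < m}" for m
  proof (induction m)
    case 0
    have "n - (n - Suc f) = Suc f" using f(1) by simp
    thus ?case using R[of "n - Suc f"] by (simp add: Suc_le_eq)
  next
    case (Suc m)
    hence IH: "good \<gamma> {i\<in>J. f < i \<or> i < m}" and mf: "m < f" by simp_all
    show ?case
    proof (cases "m \<in> J")
      case True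
      \<comment> \<open>The node \<open>Suc m\<close> belongs to the cup and so is not
        \<open>f\<close>. Hence the third node of the hook is at most \<open>f\<close> and stays
        clear of the cups above it.\<close>
      have mf': "Suc (Suc m) \<le> f" using mf nf[OF True] by simp
      have "{i\<in>J. f < i \<or> i < Suc m} = insert m {i\<in>J. f < i \<or> i < m}" using True by (auto simp: less_Suc_eq)
      moreover have "good \<gamma> (insert m {i\<in>J. f < i \<or> i < m})"
      proof (rule good_insert[OF IH])
        show "hook G n m (Suc m) (Suc (Suc m)) (\<gamma> m)"
          by (intro hook.intro hook_axioms.intro labels_axioms) (use J[OF True] mf' f(1) in simp_all)
        show "j \<notin> {m, Suc m, Suc (Suc m)} \<and> Suc j \<notin> {m, Suc m, Suc (Suc m)}"
          if j: "j \<in> {i\<in>J. f < i \<or> i < m}" for j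
        proof -
          have "Suc j \<noteq> m" using J[of j] j True by blast
          thus ?thesis using j mf' by auto
        qed
      qed simp
      ultimately show ?thesis by simp
    next
      case False
      hence "{i\<in>J. f < i \<or> i < Suc m} = {i\<in>J. f < i \<or> i < m}" by (auto simp: less_Suc_eq)
      thus ?thesis using IH by simp
    qed
  qed
  have "f < i \<or> i < f" if "i \<in> J" for i using that f(2) by (cases "i = f") auto
  hence "{i\<in>J. f < i \<or> i < f} = J" by blast
  thus ?thesis using L[OF order_refl] by simp
qed

text \<open>Disjoint cups covering every node would make \<open>n\<close> twice their
  number.\<close>

lemma exists_free_node:
  assumes "odd n" and J: "\<And>i. i \<in> J \<Longrightarrow> Suc i < n \<and> Suc i \<notin> J"
  shows "\<exists>f<n. f \<notin> J \<and> f \<notin> Suc ` J"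
proof (rule ccontr)
  assume c: "\<not> ?thesis"
  have JU: "J \<union> Suc ` J = {..<n}"
  proof
    show "J \<union> Suc ` J \<subseteq> {..<n}" using J by force
    show "{..<n} \<subseteq> J \<union> Suc ` J" using c by blast
  qed
  have "finite J" by (rule finite_subset[of _ "{..<n}"]) (use JU in auto)
  moreover have "J \<inter> Suc ` J = {}" using J by blast
  ultimately have "card (J \<union> Suc ` J) = 2 * card J" by (simp add: card_Un_disjoint card_image)
  thus False using \<open>odd n\<close> unfolding JU by simp
qed

text \<open>Heights and labels are unrestricted. A set of cups that cannot occur together in a
  diagram merely makes \<open>containing\<close> empty, and the empty left ideal is acyclic.\<close>

definition short_cups :: "'g diagram" where
  "short_cups = {({(1, i), (1, Suc i)}, g) | i g. True}"

text \<open>Cups that occur in one common diagram are disjoint and carry one label per position, so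
  they are described by a set of heights and a label function.\<close>

lemma containing_cups:
  assumes c: "c \<subseteq> short_cups" and x: "x \<in> containing c"
  shows "\<exists>J \<gamma>. c = cups \<gamma> ` J \<and> (\<forall>i\<in>J. Suc i < n \<and> \<gamma> i \<in> carrier G \<and> Suc i \<notin> J)"
proof -
  have xD: "x \<in> D" and cx: "c \<subseteq> x" using x by (simp_all add: containing_def)
  define J where "J = {i. \<exists>g. ({(1, i), (1, Suc i)}, g) \<in> c}"
  define \<gamma> where "\<gamma> i = (SOME g. ({(1, i), (1, Suc i)}, g) \<in> c)" for i
  have m: "cups \<gamma> i \<in> c" if "i \<in> J" for i
    unfolding cups_def \<gamma>_def by (rule someI_ex) (use that in \<open>simp add: J_def\<close>)
  have mx: "cups \<gamma> i \<in> x" if "i \<in> J" for i by (rule subsetD[OF cx m[OF that]])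
  have "c = cups \<gamma> ` J"
  proof (intro equalityI subsetI)
    fix p assume p: "p \<in> c"
    then obtain i g where ig: "p = ({(1, i), (1, Suc i)}, g)" using c by (auto simp: short_cups_def)
    hence i: "i \<in> J" using p by (auto simp: J_def)
    have "p = cups \<gamma> i"
      by (rule diag_uniq[OF xD subsetD[OF cx p] mx[OF i], of "(1, i)"]) (simp_all add: ig cups_def)
    thus "p \<in> cups \<gamma> ` J" using i by (rule image_eqI)
  qed (use m in blast)
  moreover have "Suc i < n \<and> \<gamma> i \<in> carrier G \<and> Suc i \<notin> J" if i: "i \<in> J" for i
  proof (intro conjI notI)
    show "Suc i < n" "\<gamma> i \<in> carrier G"
      using diag_edge_nodes[OF xD mx[OF i, unfolded cups_def]] by (simp_all add: nodes_def)
    assume "Suc i \<in> J"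
    from diag_uniq[OF xD mx[OF i] mx[OF this], of "(1, Suc i)"] show False
      by (simp add: cups_def doubleton_eq_iff)
  qed
  ultimately show ?thesis by (intro exI[of _ J] exI[of _ \<gamma>]) simp
qed

interpretation X: based_augmented k Q.A.alg "Q.A.trivial_aug (through n ` carrier Gn)" D Q.I
  by (rule Q.based)

lemma I_eq: "Q.I = D - through_diagrams G n" by (simp only: through_diagrams_eq carrier_Gn)

text \<open>Arcs in the right column of the right factor are untouched by a product; at least one
  cup is needed to stay inside \<open>I\<close>.\<close>

lemma left_ideal_containing:
  assumes c: "c \<subseteq> short_cups" "c \<noteq> {}" shows "X.left_ideal (containing c)"
  unfolding X.left_ideal_def
proof (intro conjI ballI)
  show "containing c \<subseteq> Q.I"
  proof
    fix x assume x: "x \<in> containing c"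
    obtain p where p: "p \<in> c" using c(2) by blast
    obtain i g where "p = ({(1, i), (1, Suc i)}, g)" using p c(1) by (auto simp: short_cups_def)
    hence "({(1, i), (1, Suc i)}, g) \<in> x" using x p by (auto simp: containing_def)
    thus "x \<in> Q.I" unfolding I_eq using arc_not_through x by (auto simp: containing_def)
  qed
  fix a b assume a: "a \<in> carrier Q.A.alg" and b: "b \<in> X.S (containing c)"
  show "a \<otimes>\<^bsub>Q.A.alg\<^esub> b \<in> X.S (containing c)"
  proof (rule Q.A.mult_left_closed[OF _ containing_D _ b])
    show "a \<in> X.S D" using a by simp
    fix x y assume x: "x \<in> D" and y: "y \<in> containing c"
    hence yD: "y \<in> D" and cy: "c \<subseteq> y" by (simp_all add: containing_def)
    have "p \<in> compose_diagrams G n x y" if p: "p \<in> c" for p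
    proof -
      obtain i g where ig: "p = ({(1, i), (1, Suc i)}, g)" using p c(1) by (auto simp: short_cups_def)
      show ?thesis unfolding ig
        by (rule straight_left(1)[OF x yD subsetD[OF cy p[unfolded ig]]]) simp
    qed
    thus "compose_diagrams G n x y \<in> containing c"
      using compose_closed[OF x yD] by (auto simp: containing_def)
  qed
qed

lemma acyclic_containing:
  assumes "odd n" and c: "c \<subseteq> short_cups" shows "X.acyclic (containing c)"
proof (cases "containing c = {}")
  case True thus ?thesis using X.acyclic_empty by simp
next
  case False
  then obtain x where x: "x \<in> containing c" by blast
  obtain J \<gamma> where J: "c = cups \<gamma> ` J" "\<forall>i\<in>J. Suc i < n \<and> \<gamma> i \<in> carrier G \<and> Suc i \<notin> J"
    using containing_cups[OF c x] by (elim exE conjE)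
  have "\<exists>f<n. f \<notin> J \<and> f \<notin> Suc ` J" by (rule exists_free_node[OF \<open>odd n\<close>]) (use J(2) in simp)
  then obtain f where f: "f < n" "f \<notin> J" "f \<notin> Suc ` J" by (elim exE conjE)
  have "good \<gamma> J" by (rule good_cups[OF bspec[OF J(2)] f])
  then obtain e where e: "e \<in> Q.A.S D" "\<forall>a\<in>Q.A.S (containing c). a \<otimes>\<^bsub>Q.A.alg\<^esub> e = a"
    "\<forall>a\<in>Q.A.S D. a \<otimes>\<^bsub>Q.A.alg\<^esub> e \<in> Q.A.S (containing c)"
    unfolding good_def J(1)[symmetric] by (elim bexE conjE)
  show ?thesis by (rule X.acyclic_idempotent[of e]) (use e in simp_all)
qed

lemma acyclic_I: assumes "odd n" shows "X.acyclic Q.I"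
proof -
  let ?U = "{containing c | c. c \<subseteq> short_cups \<and> c \<noteq> {}}"
  have U: "X.left_ideal V \<and> X.acyclic V" if V: "V \<in> ?U" for V
  proof -
    obtain c where "V = containing c" "c \<subseteq> short_cups" "c \<noteq> {}" using V by blast
    thus ?thesis using left_ideal_containing acyclic_containing[OF assms] by simp
  qed
  have Int: "V \<inter> W \<in> ?U" if V: "V \<in> ?U" and W: "W \<in> ?U" for V W
  proof -
    obtain c where c: "V = containing c" "c \<subseteq> short_cups" "c \<noteq> {}" using V by blast
    obtain d where d: "W = containing d" "d \<subseteq> short_cups" using W by blast
    \<comment> \<open>The union of two sets of cups may be contradictory; the intersection is then
      empty and still a member of the family.\<close>
    have "V \<inter> W = containing (c \<union> d)" unfolding c(1) d(1) by (auto simp: containing_def)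
    thus ?thesis using c d by blast
  qed
  have "\<Union>?U = Q.I"
  proof (intro equalityI subsetI)
    fix x assume "x \<in> \<Union>?U"
    then obtain V where V: "V \<in> ?U" "x \<in> V" by blast
    have "V \<subseteq> Q.I" using U[OF V(1)] unfolding X.left_ideal_def by (elim conjE)
    thus "x \<in> Q.I" using V(2) by (rule subsetD)
  next
    fix x assume "x \<in> Q.I"
    hence x: "x \<in> D" "x \<notin> through_diagrams G n" unfolding I_eq by simp_all
    obtain i g where ig: "({(1, i), (1, Suc i)}, g) \<in> x" using short_cup_of_not_through[OF x] by (elim exE)
    let ?c = "{({(1, i), (1, Suc i)}, g)}"
    have "?c \<subseteq> short_cups" unfolding short_cups_def by simp blast
    hence "containing ?c \<in> ?U" by (intro CollectI exI[of _ ?c] conjI refl) simp_all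
    moreover have "x \<in> containing ?c" using x(1) ig by (simp add: containing_def)
    ultimately show "x \<in> \<Union>?U" by (rule UnionI)
  qed
  moreover have "X.acyclic (\<Union>?U)" by (rule X.acyclic_Union) (rule U, assumption, rule Int)
  ultimately show ?thesis by (simp only:)
qed

lemma Tor_iso:
  assumes "odd n"
  shows "\<exists>\<phi>. \<phi> \<in> module_iso k
    (Tor k (TL_algebra G k act \<delta> n) (TL_trivial G k n) (TL_trivial G k n) i)
    (Tor k (group_algebra k Gn) (group_trivial k Gn) (group_trivial k Gn) i)"
  using Q.Tor_iso_of_acyclic[OF acyclic_I[OF assms], of i]
  unfolding Q.A.alg_def Q.B.alg_def TL_algebra_def TL_trivial_def group_algebra_def group_trivial_def
  unfolding through_diagrams_eq carrier_Gn .

end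

theorem corollary11p11:
  fixes G :: "('g, 's) monoid_scheme" and k :: "('k, 'r) ring_scheme"
    and act :: "'g \<Rightarrow> 'k \<Rightarrow> 'k" and \<delta> :: 'k and n :: nat
  assumes "comm_group G"
    and "commutative_G_ring G k act"
    and "\<delta> \<in> carrier k"
    and "odd n"
  shows "\<exists>\<phi>. \<forall>i. \<phi> i \<in> module_iso k
           (Tor k (TL_algebra G k act \<delta> n) (TL_trivial G k n) (TL_trivial G k n) i)
           (Tor k (group_algebra k (group_power G n))
              (group_trivial k (group_power G n)) (group_trivial k (group_power G n)) i)"
proof -
  interpret TL G k act \<delta> n
    by (intro TL.intro labels.intro TL_axioms.intro assms)
  show ?thesis by (rule choice) (rule allI, rule Tor_iso[OF assms(4)])
qed

end
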